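(* Suppose that there exists a constant $C>0$ such that $\mu_0((\kappa,+\infty))\le C/\kappa$ for all sufficiently large $\kappa>0$, and that the density $p_0$ belongs to the space $$\mathcal{S}(a,r,L)=\Big\{p_0\text{ density such that }\int_{\mathbb{R}}|p_0^\star(\xi)|^2e^{2a|\xi|^r}d\xi\le L\Big\}$$ for $a>0$, $r>0$ and $L>0$. Then, for any $\gamma>2\sqrt t$, and by choosing the bandwidth $h$ according to the equation $$\psi(h):=\exp\Big(\frac{2\gamma}{h}+\frac{2a}{h^r}\Big)h^{r-1}=O(n),$$ solved by - if $r=1$: $h=\dfrac{2(a+\gamma)}{\log n}$; - if $r<1$: $h=2\gamma\Big(\log n+(r-1)\log\log n+\sum_{i=0}^kb_i^*(\log n)^{r+i(r-1)}\Big)^{-1}$; - if $r>1$: $h^r=2a\Big(\log n+\frac{r-1}r\log\log n+\sum_{i=0}^kd_i^*(\log n)^{\frac1r-i\frac{r-1}r}\Big)^{-1}$, we have $$\mathbb{E}\Big[\|\widehat p_{0,h}-p_0\|^2\Big]=\begin{cases}O\big(n^{-\frac a{a+\gamma}}\big)&\text{if }r=1,\\[1mm] O\Big(\exp\Big\{-\frac{2a}{(2\gamma)^r}\Big[\log n+(r-1)\log\log n+\sum_{i=0}^kb_i^*(\log n)^{r+i(r-1)}\Big]^r\Big\}\Big)&\text{if }r<1,\\[1mm] O\Big(\frac1n\exp\Big\{\frac{2\gamma}{(2a)^{1/r}}\Big[\log n+\frac{r-1}r\log\log n+\sum_{i=0}^kd_i^*(\log n)^{\frac1r-i\frac{r-1}r}\Big]^{1/r}\Big\}\Big)&\text{if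 }r>1,\end{cases}$$ where (for $r\neq1$) the integer $k$ is such that $$\frac{k}{k+1}<\min\Big(r,\frac1r\Big)\le\frac{k+1}{k+2},$$ and where the constants $b_i^*$ and $d_i^*$ solve the triangular systems $$b_0^*=-\frac{2a}{(2\gamma)^r},\qquad b_i^*=-\frac{2a}{(2\gamma)^r}\sum_{j=0}^{i-1}\frac{r(r-1)\cdots(r-j)}{(j+1)!}\sum_{p_0+\cdots+p_j=i-j-1}b^*_{p_0}\cdots b^*_{p_j}\quad(i>0),$$ $$d_0^*=-\frac{2\gamma}{(2a)^{1/r}},\qquad d_i^*=-\frac{2\gamma}{(2a)^{1/r}}\sum_{j=0}^{i-1}\frac{\frac1r(\frac1r-1)\cdots(\frac1r-j)}{(j+1)!}\sum_{p_0+\cdots+p_j=i-j-1}d^*_{p_0}\cdots d^*_{p_j}\quad(i>0),$$ the inner sums being over nonnegative integers $p_0,\dots,p_j$.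
   Context: Fix $t>0$; $\|\cdot\|$ is the $L^2(\mathbb{R})$ norm, and $g^\star(\xi)=\int_{\mathbb{R}}g(x)e^{ix\xi}dx$ is the Fourier transform. $\mathbb{C}_{2\sqrt t}=\{z\in\mathbb{C}:\operatorname{Im}z>2\sqrt t\}$. Let $\mu_0$ be a probability measure on $\mathbb{R}$ with density $p_0$ with respect to Lebesgue measure. For each $n\ge1$, let $d_1^n,\dots,d_n^n$ be i.i.d. with law $\mu_0$, with order statistics $\lambda_1^n(0)<\dots<\lambda_n^n(0)$, and let $X^n(0)=\mathrm{diag}(\lambda_1^n(0),\dots,\lambda_n^n(0))$. Let $H^n$ be a Hermitian Brownian motion independent of $X^n(0)$: $H^n(s)$ is $n\times n$ Hermitian with $(H^n)_{kl}=\frac1{\sqrt{2n}}(B_{k,l}+i\tilde B_{k,l})$ for $k<l$ and $(H^n)_{kk}=\frac1{\sqrt n}B_{k,k}$, where $B_{k,l},\tilde B_{k,l}$ are i.i.d. standard real Brownian motions. Let $X^n(t)=X^n(0)+H^n(t)$, with eigenvalues $\lambda_1^n(t),\dots,\lambda_n^n(t)$, and $\widehat G_{\mu^n_t}(z)=\frac1n\sum_{j=1}^n\frac1{z-\lambda_j^n(t)}$ for $\operatorname{Im}z>0$. For $z\in\mathbb{C}_{2\sqrt t}$, $\widehat w^n_{fp}(z)$ denotes the fixed point $w$ of the equation $\frac1t(w-z)=\widehat G_{\mu^n_t}(w)$; it satisfies $\operatorname{Im}\widehat w^n_{fp}(z)>\frac12\operatorname{Im}z$. Kernel: $K$ is a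 regularizing kernel whose Fourier transform $K^\star$ is bounded by a positive constant $C_K<+\infty$ and has compact support, say $[-1,1]$ (for instance $K(x)=\sin(x)/(\pi x)$, for which $K^\star=\mathbf 1_{[-1,1]}$). For a bandwidth $h>0$, $K_h(\cdot)=\frac1hK(\cdot/h)$, so $K_h^\star(\xi)=K^\star(h\xi)$. Estimator: for $\gamma>2\sqrt t$ and $h>0$, $\widehat p_{0,h}$ is defined through its Fourier transform $$\widehat p_{0,h}^{\,\star}(\xi)=e^{\gamma|\xi|}\,K_h^\star(\xi)\,\frac1{\pi t}\,g_n^\star(\xi),\qquad g_n(x)=\gamma-\operatorname{Im}\widehat w^n_{fp}(x+i\gamma),\quad x\in\mathbb{R}.$$
   Formalization: It is additionally assumed that K* equals 1 on [-1,1] (the sinc kernel); for other kernels with K* bounded and supported in [-1,1], such as the Fejér kernel with r=1, the bias is of order h^2 and the stated rates fail. *)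

theory Defs
  imports "HOL-Probability.Probability" "HOL-Library.Landau_Symbols"
    "HOL-Library.Multiset" "Jordan_Normal_Form.Char_Poly"
begin

section \<open>Fourier transforms on the real line\<close>

definition fourier :: "(real \<Rightarrow> real) \<Rightarrow> real \<Rightarrow> complex" where
  "fourier g \<xi> = (\<integral>x. complex_of_real (g x) * iexp (x * \<xi>) \<partial>lborel)"

definition inverse_fourier :: "(real \<Rightarrow> complex) \<Rightarrow> real \<Rightarrow> complex" where
  "inverse_fourier \<phi> x = (\<integral>\<xi>. \<phi> \<xi> * iexp (- (x * \<xi>)) \<partial>lborel) / complex_of_real (2 * pi)"

text \<open>
  The Fourier transform on \<open>L\<^sup>2\<close>, as the \<open>L\<^sup>2\<close> limit of truncated Fourier integrals. It is
  needed for kernels such as \<open>sin x / (\<pi> x)\<close>, which are not Lebesgue integrable. It determines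
  \<open>F\<close> up to a null set.
\<close>
definition has_L2_fourier :: "(real \<Rightarrow> real) \<Rightarrow> (real \<Rightarrow> complex) \<Rightarrow> bool" where
  "has_L2_fourier f F \<longleftrightarrow>
     f \<in> borel_measurable borel \<and> (\<integral>\<^sup>+x. ennreal ((f x)\<^sup>2) \<partial>lborel) < \<infinity> \<and>
     F \<in> borel_measurable borel \<and>
     ((\<lambda>R. \<integral>\<^sup>+\<xi>. ennreal ((cmod (F \<xi> - fourier (\<lambda>x. indicator {-R..R} x * f x) \<xi>))\<^sup>2) \<partial>lborel)
        \<longlongrightarrow> 0) at_top"

definition L2_dist_sq :: "(real \<Rightarrow> complex) \<Rightarrow> (real \<Rightarrow> real) \<Rightarrow> ennreal" where
  "L2_dist_sq f g = (\<integral>\<^sup>+x. ennreal ((cmod (f x - complex_of_real (g x)))\<^sup>2) \<partial>lborel)"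

definition supersmooth_densities :: "real \<Rightarrow> real \<Rightarrow> real \<Rightarrow> (real \<Rightarrow> real) set" where
  "supersmooth_densities a r L =
     {p. p \<in> borel_measurable borel \<and> (\<forall>x. 0 \<le> p x) \<and> (\<integral>\<^sup>+x. ennreal (p x) \<partial>lborel) = 1 \<and>
         (\<integral>\<^sup>+\<xi>. ennreal ((cmod (fourier p \<xi>))\<^sup>2 * exp (2 * a * \<bar>\<xi>\<bar> powr r)) \<partial>lborel) \<le> ennreal L}"


section \<open>The random matrix model\<close>

text \<open>Matrix and sample indices run over \<open>{0..<n}\<close>.\<close>

definition order_statistic :: "nat \<Rightarrow> (nat \<Rightarrow> real) \<Rightarrow> nat \<Rightarrow> real" where
  "order_statistic n x k = sort (map x [0..<n]) ! k"

definition initial_matrix :: "nat \<Rightarrow> (nat \<Rightarrow> 'a \<Rightarrow> real) \<Rightarrow> 'a \<Rightarrow> complex mat" where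
  "initial_matrix n d \<omega> =
     mat_diag n (\<lambda>k. complex_of_real (order_statistic n (\<lambda>j. d j \<omega>) k))"

definition hermitian_process ::
  "nat \<Rightarrow> (nat \<Rightarrow> nat \<Rightarrow> real \<Rightarrow> 'a \<Rightarrow> real) \<Rightarrow> (nat \<Rightarrow> nat \<Rightarrow> real \<Rightarrow> 'a \<Rightarrow> real)
     \<Rightarrow> real \<Rightarrow> 'a \<Rightarrow> complex mat" where
  "hermitian_process n B B' s \<omega> = mat n n (\<lambda>(k, l).
     if k < l then Complex (B k l s \<omega>) (B' k l s \<omega>) / complex_of_real (sqrt (2 * real n))
     else if k = l then complex_of_real (B k k s \<omega> / sqrt (real n))
     else cnj (Complex (B l k s \<omega>) (B' l k s \<omega>)) / complex_of_real (sqrt (2 * real n)))"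

context prob_space
begin

definition brownian_motion :: "(real \<Rightarrow> 'a \<Rightarrow> real) \<Rightarrow> bool" where
  "brownian_motion B \<longleftrightarrow>
     (\<forall>s\<ge>0. random_variable borel (B s)) \<and>
     (AE \<omega> in M. B 0 \<omega> = 0) \<and>
     (\<forall>s u. 0 \<le> s \<and> s < u \<longrightarrow>
        distributed M lborel (\<lambda>\<omega>. B u \<omega> - B s \<omega>) (normal_density 0 (sqrt (u - s)))) \<and>
     (\<forall>(m::nat) \<tau>. 0 \<le> \<tau> 0 \<and> (\<forall>i<m. \<tau> i < \<tau> (Suc i)) \<longrightarrow>
        indep_vars (\<lambda>_. borel) (\<lambda>i \<omega>. B (\<tau> (Suc i)) \<omega> - B (\<tau> i) \<omega>) {..<m}) \<and>
     (AE \<omega> in M. continuous_on {0..} (\<lambda>s. B s \<omega>))"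

text \<open>
  \<open>B k l\<close> (\<open>k \<le> l\<close>) and \<open>B' k l\<close> (\<open>k < l\<close>) are independent, as random paths, standard Brownian
  motions; the values at other indices are irrelevant for \<open>hermitian_process\<close>.
\<close>
definition hermitian_bm_entries ::
  "nat \<Rightarrow> (nat \<Rightarrow> nat \<Rightarrow> real \<Rightarrow> 'a \<Rightarrow> real) \<Rightarrow> (nat \<Rightarrow> nat \<Rightarrow> real \<Rightarrow> 'a \<Rightarrow> real) \<Rightarrow> bool" where
  "hermitian_bm_entries n B B' \<longleftrightarrow>
     (\<forall>k l. k \<le> l \<and> l < n \<longrightarrow> brownian_motion (B k l)) \<and>
     (\<forall>k l. k < l \<and> l < n \<longrightarrow> brownian_motion (B' k l)) \<and>
     indep_vars (\<lambda>_. PiM {0..} (\<lambda>_. borel))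
       (\<lambda>i \<omega>. \<lambda>s\<in>{0..}. case i of Inl (k, l) \<Rightarrow> B k l s \<omega> | Inr (k, l) \<Rightarrow> B' k l s \<omega>)
       ({Inl (k, l) | k l. k \<le> l \<and> l < n} \<union> {Inr (k, l) | k l. k < l \<and> l < n})"

text \<open>Independence of the \<open>\<sigma>\<close>-algebras generated by \<open>X\<close> and by the whole path of \<open>H\<close>.\<close>
definition indep_matrix_process :: "nat \<Rightarrow> ('a \<Rightarrow> complex mat) \<Rightarrow> (real \<Rightarrow> 'a \<Rightarrow> complex mat) \<Rightarrow> bool" where
  "indep_matrix_process n X H \<longleftrightarrow>
     indep_set
       (sets (vimage_algebra (space M) (\<lambda>\<omega>. \<lambda>kl\<in>{..<n} \<times> {..<n}. X \<omega> $$ kl)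
          (PiM ({..<n} \<times> {..<n}) (\<lambda>_. borel))))
       (sets (vimage_algebra (space M) (\<lambda>\<omega>. \<lambda>(s, kl)\<in>{0..} \<times> {..<n} \<times> {..<n}. H s \<omega> $$ kl)
          (PiM ({0..} \<times> {..<n} \<times> {..<n}) (\<lambda>_. borel))))"

end


section \<open>The estimator\<close>

text \<open>The sum runs over the eigenvalues with algebraic multiplicity.\<close>
definition empirical_stieltjes :: "complex mat \<Rightarrow> complex \<Rightarrow> complex" where
  "empirical_stieltjes A z =
     (\<Sum>e\<in>#proots (char_poly A). 1 / (z - e)) / of_nat (dim_row A)"

text \<open>
  The equation may have further solutions elsewhere; for \<open>Im z > 2 * sqrt t\<close> the solution is unique
  in the half-plane \<open>Im w > Im z / 2\<close>, where \<open>w \<mapsto> z + t * G w\<close> is a contraction.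
\<close>
definition w_fp :: "real \<Rightarrow> (complex \<Rightarrow> complex) \<Rightarrow> complex \<Rightarrow> complex" where
  "w_fp t G z = (THE w. Im w > Im z / 2 \<and> (w - z) / complex_of_real t = G w)"

text \<open>
  \<open>Ks\<close> is the Fourier transform of the kernel \<open>K\<close>; that of \<open>K\<^sub>h x = K (x / h) / h\<close> is
  \<open>\<lambda>\<xi>. Ks (h * \<xi>)\<close>. The argument \<open>A\<close> is the observed matrix at time \<open>t\<close>.
\<close>
definition estimator_fourier ::
  "real \<Rightarrow> real \<Rightarrow> (real \<Rightarrow> complex) \<Rightarrow> real \<Rightarrow> complex mat \<Rightarrow> real \<Rightarrow> complex" where
  "estimator_fourier t \<gamma> Ks h A \<xi> =
     complex_of_real (exp (\<gamma> * \<bar>\<xi>\<bar>)) * Ks (h * \<xi>) * complex_of_real (1 / (pi * t)) *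
     fourier (\<lambda>x. \<gamma> - Im (w_fp t (empirical_stieltjes A) (Complex x \<gamma>))) \<xi>"

definition estimator ::
  "real \<Rightarrow> real \<Rightarrow> (real \<Rightarrow> complex) \<Rightarrow> real \<Rightarrow> complex mat \<Rightarrow> real \<Rightarrow> complex" where
  "estimator t \<gamma> Ks h A = inverse_fourier (estimator_fourier t \<gamma> Ks h A)"


section \<open>Bandwidth expansions\<close>

text \<open>
  The triangular system for \<open>b\<^sup>*\<close> (with \<open>c = 2a / (2\<gamma>)\<^sup>r\<close>, \<open>\<rho> = r\<close>) and for \<open>d\<^sup>*\<close>
  (with \<open>c = 2\<gamma> / (2a)\<^bsup>1/r\<^esup>\<close>, \<open>\<rho> = 1/r\<close>). The list \<open>p\<close> is \<open>(p\<^sub>0, \<dots>, p\<^sub>j)\<close>.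
\<close>
definition triangular_system :: "real \<Rightarrow> real \<Rightarrow> (nat \<Rightarrow> real) \<Rightarrow> bool" where
  "triangular_system c \<rho> b \<longleftrightarrow>
     b 0 = - c \<and>
     (\<forall>i>0. b i = - c * (\<Sum>j=0..i-1. (\<Prod>m=0..j. \<rho> - real m) / fact (j + 1) *
        (\<Sum>p | length p = j + 1 \<and> sum_list p = i - j - 1. prod_list (map b p))))"

definition expansion_lt1 :: "real \<Rightarrow> nat \<Rightarrow> (nat \<Rightarrow> real) \<Rightarrow> nat \<Rightarrow> real" where
  "expansion_lt1 r k b n =
     ln (real n) + (r - 1) * ln (ln (real n)) +
     (\<Sum>i=0..k. b i * ln (real n) powr (r + real i * (r - 1)))"

definition expansion_gt1 :: "real \<Rightarrow> nat \<Rightarrow> (nat \<Rightarrow> real) \<Rightarrow> nat \<Rightarrow> real" where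
  "expansion_gt1 r k d n =
     ln (real n) + (r - 1) / r * ln (ln (real n)) +
     (\<Sum>i=0..k. d i * ln (real n) powr (1 / r - real i * ((r - 1) / r)))"

end

theory Submission
  imports Defs
    "HOL-Computational_Algebra.Computational_Algebra"
    "HOL-Real_Asymp.Real_Asymp"
    "HOL-Analysis.Generalised_Binomial_Theorem"
begin

text \<open>
  The transform of the estimator vanishes outside \<open>\<bar>\<xi>\<bar> \<le> 1 / h\<close>, so Plancherel's inequality splits the
  squared error at this frequency. The high frequencies carry only the tail of \<open>p0\<close>, at most
  \<open>L exp (- 2a / h\<^sup>r) / (2 \<pi>)\<close>. For the low ones, let \<open>z = x + \<i> \<gamma>\<close>. The function \<open>- t Im G\<^sub>0 z\<close>, with \<open>G\<^sub>0\<close>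
  the Cauchy transform of \<open>p0\<close>, is \<open>t\<close> times the Poisson smoothing of \<open>p0\<close> at height \<open>\<gamma>\<close>, so its transform
  is \<open>\<pi> t exp (- \<gamma> \<bar>\<xi>\<bar>)\<close> times that of \<open>p0\<close>: undoing this factor costs \<open>exp (2 \<gamma> / h)\<close>, and what remains
  is the squared \<open>L\<^sup>2\<close> distance in \<open>x\<close> of the estimated fixed point \<open>w\<close> from \<open>z + t G\<^sub>0 z\<close>
  (\<open>estimator_risk_bound\<close>).

  The expectation of that distance is of order \<open>1 / n\<close>. Let \<open>G\<^sub>D\<close> be the Stieltjes transform of the
  sample at time \<open>0\<close> and \<open>G\<^sub>s\<close> that of the matrix at time \<open>s\<close>. Since \<open>w \<mapsto> z + t G\<^sub>t w\<close> is a contraction,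
  its fixed point is, up to constants, as close to \<open>z + t G\<^sub>D z\<close> as \<open>G\<^sub>t (z + t G\<^sub>D z)\<close> is to \<open>G\<^sub>D z\<close>
  (\<open>w_fp_stability\<close>). And \<open>G\<^sub>D z\<close> is an average of \<open>n\<close> independent terms with mean \<open>G\<^sub>0 z\<close>, whose variance
  is integrable in \<open>x\<close> (\<open>sample_stieltjes_mean_square_integral\<close>).

  There remains \<open>u s = G\<^sub>s (z + s G\<^sub>D z) - G\<^sub>D z\<close> at \<open>s = t\<close>. In the limit of large \<open>n\<close>, \<open>G\<close> solves the
  complex Burgers equation, which transports the initial value along the straight lines
  \<open>s \<mapsto> z + s G\<^sub>D z\<close>, and \<open>u\<close> vanishes. For finite \<open>n\<close> a step of length \<open>\<epsilon>\<close> changes \<open>u\<close> by a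
  linear term in the Gaussian increment, which has mean zero given the past, by a quadratic term with
  mean \<open>\<epsilon> G\<^sub>s \<tau>\<close>, where \<open>\<tau> = tr R\<^sup>2 / n\<close> for the resolvent \<open>R\<close>, and by \<open>- \<epsilon> (G\<^sub>D z) \<tau>\<close> because the spectral parameter moves. The
  last two add up to \<open>\<epsilon> u \<tau>\<close>, so that the second moment of \<open>u\<close> satisfies a linear recursion
  whose source is the variance of the linear term (\<open>gaussian_step\<close>, \<open>deviation_step\<close>). This
  source is, up to constants, \<open>\<epsilon> / n\<close> times an average of Poisson kernels, each of total mass \<open>\<pi>\<close>, so its integral over
  \<open>x\<close> is \<open>O (\<epsilon> / n)\<close> whatever the eigenvalues are; summing the recursion and letting the
  step tend to \<open>0\<close> gives \<open>deviation_mean_square_integral\<close>.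

  Both terms of the resulting bound
  \<open>C (exp (- 2a / h\<^sup>r) + exp (2 \<gamma> / h) / n)\<close> are then evaluated at the prescribed bandwidth. For \<open>r \<noteq> 1\<close>,
  write \<open>E\<close> for the expansion that defines \<open>h\<close>. The triangular system makes the
  unbounded terms of \<open>E + c E\<^sup>\<rho> - s ln E - ln n\<close> cancel, where \<open>\<rho>\<close> is \<open>r\<close> or \<open>1 / r\<close>
  (\<open>bandwidth_expansion_asymptotics\<close>); boundedness of this expression is the claim on \<open>\<psi> h\<close> and, since
  the sign of \<open>s\<close> is favourable both for \<open>r < 1\<close> and for \<open>r > 1\<close>, it shows that one term of the bound is at
  most of the order of the other, which is the stated rate.
\<close>

section \<open>Asymptotics of the bandwidth expansion\<close>

text \<open>
  The remainder of the binomial series after order \<open>k\<close> is \<open>v ^ Suc k\<close> times a series that is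
  dominated, for \<open>\<bar>v\<bar> \<le> 1 / 2\<close>, by its absolute values at \<open>1 / 2\<close>, inside the disc of convergence.
\<close>
lemma binomial_series_remainder:
  fixes \<rho> :: real
  obtains C where "C > 0" "\<And>v. \<bar>v\<bar> \<le> 1/2 \<Longrightarrow>
    \<bar>(1 + v) powr \<rho> - (\<Sum>j\<le>k. (\<rho> gchoose j) * v ^ j)\<bar> \<le> C * \<bar>v\<bar> ^ Suc k"
proof -
  define T where "T = (\<Sum>n. \<bar>\<rho> gchoose (n + Suc k)\<bar> * (1/2) ^ n)"
  have "summable (\<lambda>n. (\<rho> gchoose n) * (3/4) ^ n)"
    using gen_binomial_real[of "3/4" \<rho>] by (simp add: sums_iff)
  hence "summable (\<lambda>n. norm ((\<rho> gchoose n) * (1/2) ^ n))"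
    by (rule powser_insidea) simp
  hence "summable (\<lambda>n. \<bar>\<rho> gchoose n\<bar> * (1/2) ^ n)" by (simp add: abs_mult)
  hence "summable (\<lambda>n. \<bar>\<rho> gchoose (n + Suc k)\<bar> * (1/2) ^ (n + Suc k))"
    by (subst summable_iff_shift)
  hence "summable (\<lambda>n. 2 ^ Suc k * (\<bar>\<rho> gchoose (n + Suc k)\<bar> * (1/2) ^ (n + Suc k)))"
    by (rule summable_mult)
  hence sT: "summable (\<lambda>n. \<bar>\<rho> gchoose (n + Suc k)\<bar> * (1/2) ^ n)"
    by (simp add: power_add field_simps)
  have T0: "T \<ge> 0" unfolding T_def by (intro suminf_nonneg sT) auto
  have "\<bar>(1 + v) powr \<rho> - (\<Sum>j\<le>k. (\<rho> gchoose j) * v ^ j)\<bar> \<le> (T + 1) * \<bar>v\<bar> ^ Suc k"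
    if v: "\<bar>v\<bar> \<le> 1/2" for v
  proof -
    have s: "(\<lambda>n. (\<rho> gchoose n) * v ^ n) sums (1 + v) powr \<rho>"
      using v by (intro gen_binomial_real) auto
    have "(\<lambda>n. (\<rho> gchoose (n + Suc k)) * v ^ (n + Suc k)) sums
        ((1 + v) powr \<rho> - (\<Sum>j<Suc k. (\<rho> gchoose j) * v ^ j))"
      using s by (subst sums_iff_shift) simp
    hence s2: "(\<lambda>n. (\<rho> gchoose (n + Suc k)) * v ^ (n + Suc k)) sums
        ((1 + v) powr \<rho> - (\<Sum>j\<le>k. (\<rho> gchoose j) * v ^ j))"
      by (simp only: lessThan_Suc_atMost)
    have b: "norm ((\<rho> gchoose (n + Suc k)) * v ^ (n + Suc k))
        \<le> (\<bar>\<rho> gchoose (n + Suc k)\<bar> * (1/2) ^ n) * \<bar>v\<bar> ^ Suc k" for n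
    proof -
      have "norm ((\<rho> gchoose (n + Suc k)) * v ^ (n + Suc k))
          = \<bar>\<rho> gchoose (n + Suc k)\<bar> * \<bar>v\<bar> ^ n * \<bar>v\<bar> ^ Suc k"
        by (simp add: abs_mult power_abs power_add mult_ac)
      also have "\<dots> \<le> \<bar>\<rho> gchoose (n + Suc k)\<bar> * (1/2) ^ n * \<bar>v\<bar> ^ Suc k"
        using v by (intro mult_right_mono mult_left_mono power_mono) auto
      finally show ?thesis .
    qed
    have sS: "summable (\<lambda>n. (\<bar>\<rho> gchoose (n + Suc k)\<bar> * (1/2) ^ n) * \<bar>v\<bar> ^ Suc k)"
      by (rule summable_mult2[OF sT])
    have "norm (\<Sum>n. (\<rho> gchoose (n + Suc k)) * v ^ (n + Suc k))
        \<le> (\<Sum>n. (\<bar>\<rho> gchoose (n + Suc k)\<bar> * (1/2) ^ n) * \<bar>v\<bar> ^ Suc k)"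
      by (rule norm_suminf_le[OF b sS])
    also have "\<dots> = T * \<bar>v\<bar> ^ Suc k"
      unfolding T_def by (rule suminf_mult2[OF sT, symmetric])
    also have "\<dots> \<le> (T + 1) * \<bar>v\<bar> ^ Suc k" by (intro mult_right_mono) auto
    finally show ?thesis using sums_unique[OF s2] by simp
  qed
  with T0 show thesis by (intro that[of "T + 1"]) auto
qed

text \<open>
  The inner sums of the triangular system are coefficients of powers of one polynomial, which turns
  the system into a polynomial identity.
\<close>
lemma coeff_shifted_power:
  fixes b :: "nat \<Rightarrow> real"
  assumes "i \<le> k"
  defines "V \<equiv> (\<Sum>i\<le>k. monom (b i) (Suc i))"
  shows "coeff (V ^ Suc j) i = (if j < i then
     \<Sum>p | length p = j + 1 \<and> sum_list p = i - j - 1. prod_list (map b p) else 0)"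
proof -
  define W :: "real poly" where "W = (\<Sum>i\<le>k. monom (b i) i)"
  have V: "V = monom 1 1 * W"
    unfolding V_def W_def by (simp add: sum_distrib_left mult_monom)
  have cW: "coeff W i = (if i \<le> k then b i else 0)" for i
    unfolding W_def by (simp add: coeff_sum)
  have "V ^ Suc j = monom 1 (Suc j) * W ^ Suc j"
    unfolding V by (simp only: power_mult_distrib monom_power) simp
  hence eq: "coeff (V ^ Suc j) i = (if j < i then coeff (W ^ Suc j) (i - Suc j) else 0)"
    by (simp only: coeff_monom_mult) auto
  have "coeff (W ^ Suc j) (i - Suc j) = fps_nth (fps_of_poly W ^ Suc j) (i - Suc j)"
    by (simp only: fps_of_poly_power[symmetric] fps_of_poly_nth)
  also have "\<dots> = (\<Sum>v\<in>natpermute (i - Suc j) (j + 1). \<Prod>m=0..j. coeff W (v ! m))"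
    by (simp only: fps_power_nth_Suc fps_of_poly_nth)
  also have "\<dots> = (\<Sum>v\<in>natpermute (i - Suc j) (j + 1). prod_list (map b v))"
  proof (rule sum.cong[OF refl])
    fix v assume v: "v \<in> natpermute (i - Suc j) (j + 1)"
    hence l: "length v = Suc j" and s: "sum_list v = i - Suc j" by (auto simp: natpermute_def)
    have "v ! m \<le> k" if "m \<le> j" for m
      using member_le_sum_list[of "v ! m" v] l s that assms(1) by auto
    hence "(\<Prod>m=0..j. coeff W (v ! m)) = (\<Prod>m=0..j. b (v ! m))"
      by (intro prod.cong) (auto simp: cW)
    also have "\<dots> = prod_list (map b v)"
      using l by (simp add: prod.list_conv_set_nth atLeastLessThanSuc_atLeastAtMost)
    finally show "(\<Prod>m=0..j. coeff W (v ! m)) = prod_list (map b v)" .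
  qed
  finally have "coeff (W ^ Suc j) (i - Suc j) =
      (\<Sum>v\<in>natpermute (i - Suc j) (j + 1). prod_list (map b v))" .
  with eq show ?thesis by (simp add: natpermute_def)
qed

text \<open>
  In the variable \<open>y = l powr (\<rho> - 1)\<close> the expansion is \<open>l (1 + V y)\<close> up to the logarithm. The sum over
  \<open>j\<close> is the binomial polynomial of \<open>(1 + V) powr \<rho>\<close>, so divisibility says that the correction terms
  of \<open>E\<close> cancel against \<open>c E powr \<rho>\<close> in all orders up to \<open>k\<close>.
\<close>
lemma triangular_system_cancels:
  fixes k :: nat and b :: "nat \<Rightarrow> real"
  assumes sys: "triangular_system c \<rho> b"
  defines "V \<equiv> (\<Sum>i\<le>k. monom (b i) (Suc i))"
  shows "monom 1 (Suc k) dvd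
     (\<Sum>i\<le>k. monom (b i) i) + Polynomial.smult c (\<Sum>j\<le>k. Polynomial.smult (\<rho> gchoose j) (V ^ j))"
proof (unfold monom_1_dvd_iff', intro allI impI)
  fix i assume "i < Suc k"
  hence ik: "i \<le> k" by simp
  have g: "(\<Prod>m=0..j. \<rho> - real m) / fact (j + 1) = \<rho> gchoose (Suc j)" for j
    by (simp add: gbinomial_Suc)
  have c1: "coeff (V ^ Suc j) i = (if j < i then
     \<Sum>p | length p = j + 1 \<and> sum_list p = i - j - 1. prod_list (map b p) else 0)" for j
    unfolding V_def by (rule coeff_shifted_power[OF ik])
  have "coeff (\<Sum>j\<le>k. Polynomial.smult (\<rho> gchoose j) (V ^ j)) i = (\<Sum>j\<le>k. (\<rho> gchoose j) * coeff (V ^ j) i)"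
    by (simp add: coeff_sum)
  also have "\<dots> = coeff 1 i + (\<Sum>j<k. (\<rho> gchoose Suc j) * coeff (V ^ Suc j) i)"
    by (simp only: lessThan_Suc_atMost[symmetric] sum.lessThan_Suc_shift) simp
  also have "(\<Sum>j<k. (\<rho> gchoose Suc j) * coeff (V ^ Suc j) i)
      = (\<Sum>j<i. (\<rho> gchoose Suc j) * coeff (V ^ Suc j) i)"
    using ik by (intro sum.mono_neutral_right) (auto simp: c1 simp del: power_Suc split: if_splits)
  finally have cc: "coeff (\<Sum>j\<le>k. Polynomial.smult (\<rho> gchoose j) (V ^ j)) i =
      coeff 1 i + (\<Sum>j<i. (\<rho> gchoose Suc j) * coeff (V ^ Suc j) i)" .
  show "coeff ((\<Sum>i\<le>k. monom (b i) i) + Polynomial.smult c (\<Sum>j\<le>k. Polynomial.smult (\<rho> gchoose j) (V ^ j))) i = 0"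
  proof (cases "i = 0")
    case True
    with sys show ?thesis unfolding coeff_add coeff_smult cc by (simp add: coeff_sum triangular_system_def)
  next
    case False
    have "b i = - c * (\<Sum>j=0..i-1. (\<Prod>m=0..j. \<rho> - real m) / fact (j + 1) *
        (\<Sum>p | length p = j + 1 \<and> sum_list p = i - j - 1. prod_list (map b p)))"
      using sys False by (simp add: triangular_system_def)
    also have "\<dots> = - c * (\<Sum>j<i. (\<rho> gchoose Suc j) * coeff (V ^ Suc j) i)"
      using False by (simp only: g c1) (intro arg_cong[where f = "\<lambda>x. - c * x"] sum.cong, auto)
    finally show ?thesis using False ik unfolding coeff_add coeff_smult cc by (simp add: coeff_sum del: power_Suc)
  qed
qed

text \<open>
  The orders above \<open>k\<close> that survive the cancellation are at most
  \<open>l powr (\<rho> + Suc k * (\<rho> - 1))\<close>, which is bounded precisely because \<open>\<rho> \<le> (k + 1) / (k + 2)\<close>.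
\<close>
lemma bandwidth_expansion_asymptotics:
  fixes c \<rho> s :: real and b :: "nat \<Rightarrow> real" and k :: nat
  assumes \<rho>: "0 < \<rho>" "\<rho> < 1" and k: "\<rho> \<le> real (k + 1) / real (k + 2)"
    and sys: "triangular_system c \<rho> b"
  defines "E \<equiv> \<lambda>l::real. l + s * ln l + (\<Sum>i\<le>k. b i * l powr (\<rho> + real i * (\<rho> - 1)))"
  shows "((\<lambda>l. E l / l) \<longlongrightarrow> 1) at_top"
    and "(\<lambda>l. E l + c * E l powr \<rho> - s * ln (E l) - l) \<in> O[at_top](\<lambda>_. 1)"
proof -
  define V :: "real poly" where "V = (\<Sum>i\<le>k. monom (b i) (Suc i))"
  define B :: "real poly" where "B = (\<Sum>i\<le>k. monom (b i) i)"
  define P :: "real poly" where "P = B + Polynomial.smult c (\<Sum>j\<le>k. Polynomial.smult (\<rho> gchoose j) (V ^ j))"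
  have VB: "V = monom 1 1 * B"
    unfolding V_def B_def by (simp add: sum_distrib_left mult_monom)
  obtain Q where Q: "P = monom 1 (Suc k) * Q"
    using triangular_system_cancels[OF sys, of k] unfolding P_def B_def V_def by (auto elim: dvdE)
  define y where "y = (\<lambda>l::real. l powr (\<rho> - 1))"
  define v where "v = (\<lambda>l. poly V (y l))"
  define \<delta> where "\<delta> = (\<lambda>l::real. s * ln l / l)"
  have y0: "(y \<longlongrightarrow> 0) at_top" unfolding y_def using \<rho> by real_asymp
  have \<delta>0: "(\<delta> \<longlongrightarrow> 0) at_top" unfolding \<delta>_def by real_asymp
  have V0: "poly V 0 = 0" unfolding VB by (simp add: poly_monom)
  have v0: "(v \<longlongrightarrow> 0) at_top"
    using tendsto_poly[OF y0, of V] V0 unfolding v_def by simp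
  have lpow: "l powr (\<rho> + real i * (\<rho> - 1)) = l powr \<rho> * y l ^ i" if "l > 0" for l i
    using that by (simp add: y_def powr_add powr_power mult.commute)
  have lB: "(\<Sum>i\<le>k. b i * l powr (\<rho> + real i * (\<rho> - 1))) = l powr \<rho> * poly B (y l)" if "l > 0" for l
    using that by (simp add: lpow B_def poly_sum poly_monom sum_distrib_left mult_ac)
  have ly: "l * y l = l powr \<rho>" if "l > 0" for l
    using that powr_add[of l 1 "\<rho> - 1"] by (simp add: y_def)
  have E: "E l = l * (1 + v l + \<delta> l)" if "l > 0" for l
  proof -
    have "l * v l = l powr \<rho> * poly B (y l)"
      using ly[OF that] by (simp add: v_def VB poly_monom mult.assoc[symmetric])
    thus ?thesis using that unfolding E_def by (subst lB) (simp_all add: \<delta>_def algebra_simps)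
  qed
  have "((\<lambda>l. 1 + v l + \<delta> l) \<longlongrightarrow> 1 + 0 + 0) at_top" by (intro tendsto_intros v0 \<delta>0)
  hence vd: "((\<lambda>l. 1 + v l + \<delta> l) \<longlongrightarrow> 1) at_top" by simp
  show "((\<lambda>l. E l / l) \<longlongrightarrow> 1) at_top"
    by (rule Lim_transform_eventually[OF vd])
       (use eventually_gt_at_top[of 0] in eventually_elim, simp add: E)
  have small: "\<forall>\<^sub>F l in at_top. \<bar>v l\<bar> < 1/4 \<and> \<bar>\<delta> l\<bar> < 1/4 \<and> l > 1"
    using tendstoD[OF v0, of "1/4"] tendstoD[OF \<delta>0, of "1/4"] eventually_gt_at_top[of 1]
    by (auto simp: eventually_conj_iff dist_real_def)
  \<comment> \<open>The part without logarithms: by the triangular system only orders above \<open>k\<close> are left.\<close>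
  obtain C where C: "C > 0" "\<And>v. \<bar>v\<bar> \<le> 1/2 \<Longrightarrow>
    \<bar>(1 + v) powr \<rho> - (\<Sum>j\<le>k. (\<rho> gchoose j) * v ^ j)\<bar> \<le> C * \<bar>v\<bar> ^ Suc k"
    by (rule binomial_series_remainder[of \<rho> k]) blast
  have ylk: "l powr \<rho> * \<bar>y l\<bar> ^ Suc k \<le> 1" if "l > 1" for l
  proof -
    have "l powr \<rho> * \<bar>y l\<bar> ^ Suc k = l powr (\<rho> + real (Suc k) * (\<rho> - 1))"
      using that lpow[of l "Suc k"] by (simp add: y_def)
    also have "\<dots> \<le> l powr 0"
      using that k by (intro powr_mono) (auto simp: field_simps)
    finally show ?thesis using that by simp
  qed
  have O1: "(\<lambda>l. l powr \<rho> * (poly B (y l) + c * (1 + v l) powr \<rho>)) \<in> O[at_top](\<lambda>_. 1)"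
  proof -
    have "((\<lambda>l. \<bar>poly Q (y l)\<bar>) \<longlongrightarrow> \<bar>poly Q 0\<bar>) at_top" "((\<lambda>l. \<bar>poly B (y l)\<bar> ^ Suc k) \<longlongrightarrow> \<bar>poly B 0\<bar> ^ Suc k) at_top"
      by (intro tendsto_intros y0)+
    hence "\<forall>\<^sub>F l in at_top. \<bar>poly Q (y l)\<bar> < \<bar>poly Q 0\<bar> + 1"
          "\<forall>\<^sub>F l in at_top. \<bar>poly B (y l)\<bar> ^ Suc k < \<bar>poly B 0\<bar> ^ Suc k + 1"
      by (auto intro: order_tendstoD)
    with small have "\<forall>\<^sub>F l in at_top. norm (l powr \<rho> * (poly B (y l) + c * (1 + v l) powr \<rho>))
        \<le> (\<bar>poly Q 0\<bar> + 1 + \<bar>c\<bar> * C * (\<bar>poly B 0\<bar> ^ Suc k + 1)) * norm (1::real)"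
    proof eventually_elim
      case (elim l)
      define Rm where "Rm = (1 + v l) powr \<rho> - (\<Sum>j\<le>k. (\<rho> gchoose j) * v l ^ j)"
      have "v l = y l * poly B (y l)" by (simp add: v_def VB poly_monom)
      hence Rm: "\<bar>Rm\<bar> \<le> C * (\<bar>y l\<bar> ^ Suc k * \<bar>poly B (y l)\<bar> ^ Suc k)"
        using C(2)[of "v l"] elim unfolding Rm_def
        by (simp only: abs_mult power_mult_distrib) simp
      have "poly B (y l) + c * (1 + v l) powr \<rho> = poly P (y l) + c * Rm"
        by (simp add: P_def Rm_def v_def poly_sum algebra_simps)
      also have "poly P (y l) = y l ^ Suc k * poly Q (y l)" by (simp add: Q poly_monom)
      finally have "\<bar>poly B (y l) + c * (1 + v l) powr \<rho>\<bar>
          \<le> \<bar>y l\<bar> ^ Suc k * \<bar>poly Q (y l)\<bar> + \<bar>c\<bar> * \<bar>Rm\<bar>"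
        using abs_triangle_ineq[of "y l ^ Suc k * poly Q (y l)" "c * Rm"]
        by (simp only: abs_mult power_abs)
      also have "\<dots> \<le> \<bar>y l\<bar> ^ Suc k * (\<bar>poly Q 0\<bar> + 1)
          + \<bar>c\<bar> * (C * (\<bar>y l\<bar> ^ Suc k * (\<bar>poly B 0\<bar> ^ Suc k + 1)))"
        using elim C(1) by (intro add_mono mult_left_mono order_trans[OF Rm]) auto
      finally have "l powr \<rho> * \<bar>poly B (y l) + c * (1 + v l) powr \<rho>\<bar> \<le> l powr \<rho> *
         (\<bar>y l\<bar> ^ Suc k * (\<bar>poly Q 0\<bar> + 1) + \<bar>c\<bar> * (C * (\<bar>y l\<bar> ^ Suc k * (\<bar>poly B 0\<bar> ^ Suc k + 1))))"
        by (intro mult_left_mono) auto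
      also have "\<dots> = (l powr \<rho> * \<bar>y l\<bar> ^ Suc k) *
          (\<bar>poly Q 0\<bar> + 1 + \<bar>c\<bar> * C * (\<bar>poly B 0\<bar> ^ Suc k + 1))"
        by (simp only: algebra_simps)
      also have "\<dots> \<le> 1 * (\<bar>poly Q 0\<bar> + 1 + \<bar>c\<bar> * C * (\<bar>poly B 0\<bar> ^ Suc k + 1))"
        using elim C(1) by (intro mult_right_mono ylk) auto
      finally show ?case by (simp add: abs_mult)
    qed
    thus ?thesis by (rule bigoI)
  qed
  \<comment> \<open>The logarithm perturbs the power by \<open>l powr \<rho> * O (ln l / l)\<close>, which tends to \<open>0\<close> as \<open>\<rho> < 1\<close>.\<close>
  have O2: "(\<lambda>l. l powr \<rho> * ((1 + v l + \<delta> l) powr \<rho> - (1 + v l) powr \<rho>)) \<in> O[at_top](\<lambda>_. 1)"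
  proof -
    have "((\<lambda>l. l powr \<rho> * (s * ln l / l)) \<longlongrightarrow> 0) at_top" using \<rho> by real_asymp
    hence "\<forall>\<^sub>F l in at_top. \<bar>l powr \<rho> * (s * ln l / l)\<bar> < 1"
      by (drule_tac e = 1 in tendstoD) (simp_all only: dist_real_def diff_zero zero_less_one)
    with small have "\<forall>\<^sub>F l in at_top. norm (l powr \<rho> * ((1 + v l + \<delta> l) powr \<rho> - (1 + v l) powr \<rho>))
       \<le> (\<rho> * (1/2) powr (\<rho> - 1)) * norm (1::real)"
    proof eventually_elim
      case (elim l)
      have "norm ((1 + v l + \<delta> l) powr \<rho> - (1 + v l) powr \<rho>)
          \<le> (\<rho> * (1/2) powr (\<rho> - 1)) * norm ((1 + v l + \<delta> l) - (1 + v l))"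
      proof (rule field_differentiable_bound[where S = "{1/2..}" and f' = "\<lambda>x. \<rho> * x powr (\<rho> - 1)"])
        fix x :: real assume x: "x \<in> {1/2..}"
        thus "((\<lambda>x. x powr \<rho>) has_field_derivative \<rho> * x powr (\<rho> - 1)) (at x within {1/2..})"
          by (auto intro!: derivative_eq_intros)
        show "norm (\<rho> * x powr (\<rho> - 1)) \<le> \<rho> * (1/2) powr (\<rho> - 1)"
          using x \<rho> by (auto simp: abs_mult intro!: mult_left_mono powr_mono2')
      qed (use elim in \<open>auto simp: abs_less_iff\<close>)
      hence "norm (l powr \<rho> * ((1 + v l + \<delta> l) powr \<rho> - (1 + v l) powr \<rho>))
          \<le> l powr \<rho> * ((\<rho> * (1/2) powr (\<rho> - 1)) * \<bar>\<delta> l\<bar>)"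
        by (simp add: abs_mult mult_left_mono)
      also have "\<dots> = (\<rho> * (1/2) powr (\<rho> - 1)) * \<bar>l powr \<rho> * (s * ln l / l)\<bar>"
        by (simp add: \<delta>_def abs_mult)
      also have "\<dots> \<le> (\<rho> * (1/2) powr (\<rho> - 1)) * 1"
        using elim \<rho> by (intro mult_left_mono) auto
      finally show ?case by simp
    qed
    thus ?thesis by (rule bigoI)
  qed
  have "((\<lambda>l. s * ln (1 + v l + \<delta> l)) \<longlongrightarrow> s * ln 1) at_top" by (intro tendsto_intros vd) simp
  hence O3: "(\<lambda>l. s * ln (1 + v l + \<delta> l)) \<in> O[at_top](\<lambda>_. 1)"
    by (intro bigoI_tendsto[of _ _ "s * ln 1"]) auto
  have "(\<lambda>l. l powr \<rho> * (poly B (y l) + c * (1 + v l) powr \<rho>)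
     + c * (l powr \<rho> * ((1 + v l + \<delta> l) powr \<rho> - (1 + v l) powr \<rho>))
     - s * ln (1 + v l + \<delta> l)) \<in> O[at_top](\<lambda>_. 1)" (is "?F \<in> _")
    by (intro sum_in_bigo O1 O3) (use O2 in \<open>simp add: landau_o.big.cmult_in_iff\<close>)
  moreover have "\<forall>\<^sub>F l in at_top. ?F l = E l + c * E l powr \<rho> - s * ln (E l) - l"
    using small
  proof eventually_elim
    case (elim l)
    hence pos: "1 + v l + \<delta> l > 0" "1 + v l > 0" by (auto simp: abs_less_iff)
    have e1: "E l = l + s * ln l + l powr \<rho> * poly B (y l)" using elim by (simp add: E_def lB)
    have e2: "E l powr \<rho> = l powr \<rho> * (1 + v l + \<delta> l) powr \<rho>"
      using elim pos by (simp add: E powr_mult)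
    have e3: "ln (E l) = ln l + ln (1 + v l + \<delta> l)" using elim pos by (simp add: E ln_mult)
    show ?case unfolding e2 e3 unfolding e1 by (simp add: algebra_simps)
  qed
  ultimately show "(\<lambda>l. E l + c * E l powr \<rho> - s * ln (E l) - l) \<in> O[at_top](\<lambda>_. 1)"
    using landau_o.big.in_cong by fastforce
qed

section \<open>Fourier transforms\<close>

lemma cnj_measurable [measurable]:
  assumes [measurable]: "f \<in> borel_measurable M"
  shows "(\<lambda>x. cnj (f x)) \<in> borel_measurable M"
  by (rule measurable_compose[OF assms borel_measurable_continuous_onI]) (intro continuous_intros)

lemma integrable_mult_iexp:
  fixes f :: "real \<Rightarrow> complex"
  assumes f: "integrable lborel f" and [measurable]: "g \<in> borel_measurable lborel"
  shows "integrable lborel (\<lambda>x. f x * iexp (g x))"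
  using f by (rule Bochner_Integration.integrable_bound) (use f in \<open>auto simp: norm_mult\<close>)

lemma integrable_mult_bounded:
  fixes f g :: "'b \<Rightarrow> complex"
  assumes f: "integrable M f" and g[measurable]: "g \<in> borel_measurable M" and b: "\<And>x. norm (g x) \<le> C"
  shows "integrable M (\<lambda>x. f x * g x)"
proof (rule Bochner_Integration.integrable_bound)
  show "integrable M (\<lambda>x. complex_of_real C * f x)" using f by simp
  show "AE x in M. norm (f x * g x) \<le> norm (complex_of_real C * f x)"
  proof (intro always_eventually allI)
    fix x
    have "norm (f x * g x) \<le> norm (f x) * C" by (simp add: norm_mult mult_left_mono b)
    also have "\<dots> \<le> norm (complex_of_real C * f x)" by (simp add: norm_mult mult.commute mult_right_mono)
    finally show "norm (f x * g x) \<le> norm (complex_of_real C * f x)" .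
  qed
qed (use f in measurable)

text \<open>
  The transform with the sign of \<open>inverse_fourier\<close>, for complex-valued functions and without normalisation;
  both directions of the statements below reduce to it.
\<close>
abbreviation FT :: "(real \<Rightarrow> complex) \<Rightarrow> real \<Rightarrow> complex" where
  "FT f x \<equiv> (\<integral>\<xi>. f \<xi> * iexp (- (x * \<xi>)) \<partial>lborel)"

lemma FT_measurable [measurable]:
  fixes f :: "real \<Rightarrow> complex"
  assumes [measurable]: "f \<in> borel_measurable borel"
  shows "(\<lambda>x. FT f x) \<in> borel_measurable borel"
  by measurable

lemma FT_bounded:
  assumes "integrable lborel f"
  shows "norm (FT f x) \<le> (\<integral>\<xi>. norm (f \<xi>) \<partial>lborel)"
  by (rule order_trans[OF integral_norm_bound]) (simp add: norm_mult)

lemma FT_continuous: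
  assumes f: "integrable lborel f"
  shows "isCont (FT f) x"
  unfolding isCont_def tendsto_at_iff_sequentially comp_def
proof (intro allI impI)
  fix X :: "nat \<Rightarrow> real" assume X: "\<forall>i. X i \<in> UNIV - {x}" "X \<longlonglongrightarrow> x"
  from f have [measurable]: "f \<in> borel_measurable lborel" by auto
  show "(\<lambda>n. FT f (X n)) \<longlonglongrightarrow> FT f x"
  proof (rule integral_dominated_convergence[where w = "\<lambda>\<xi>. norm (f \<xi>)"])
    show "AE \<xi> in lborel. (\<lambda>n. f \<xi> * iexp (- (X n * \<xi>))) \<longlonglongrightarrow> f \<xi> * iexp (- (x * \<xi>))"
      by (intro always_eventually allI tendsto_intros X)
  qed (use f in \<open>auto simp: norm_mult\<close>)
qed

text \<open>
  Both sides are the same double integral, so Fubini's theorem applies.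
\<close>
lemma multiplication_formula:
  fixes f k :: "real \<Rightarrow> complex"
  assumes f: "integrable lborel f" and k: "integrable lborel k"
  shows "(\<integral>x. k x * FT f x \<partial>lborel) = (\<integral>\<xi>. f \<xi> * FT k \<xi> \<partial>lborel)"
proof -
  from f k have [measurable]: "f \<in> borel_measurable lborel" "k \<in> borel_measurable lborel" by auto
  have int: "integrable (lborel \<Otimes>\<^sub>M lborel) (\<lambda>(x, \<xi>). k x * (f \<xi> * iexp (- (x * \<xi>))))"
  proof (rule lborel_pair.Fubini_integrable)
    show "integrable lborel (\<lambda>x. \<integral>y. norm (case (x, y) of (x, \<xi>) \<Rightarrow> k x * (f \<xi> * iexp (- (x * \<xi>)))) \<partial>lborel)"
      using k by (simp add: norm_mult)
    show "AE x in lborel. integrable lborel (\<lambda>y. case (x, y) of (x, \<xi>) \<Rightarrow> k x * (f \<xi> * iexp (- (x * \<xi>))))"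
    proof (intro AE_I2)
      fix x :: real
      show "integrable lborel (\<lambda>y. case (x, y) of (x, \<xi>) \<Rightarrow> k x * (f \<xi> * iexp (- (x * \<xi>))))"
        using integrable_mult_iexp[OF f, of "\<lambda>y. - (x * y)"] by simp
    qed
  qed simp
  have "(\<integral>x. k x * FT f x \<partial>lborel) = (\<integral>x. (\<integral>\<xi>. k x * (f \<xi> * iexp (- (x * \<xi>))) \<partial>lborel) \<partial>lborel)"
    by simp
  also have "\<dots> = (\<integral>\<xi>. (\<integral>x. k x * (f \<xi> * iexp (- (x * \<xi>))) \<partial>lborel) \<partial>lborel)"
    by (rule lborel_pair.Fubini_integral[symmetric, OF int])
  also have "\<dots> = (\<integral>\<xi>. (\<integral>x. f \<xi> * (k x * iexp (- (\<xi> * x))) \<partial>lborel) \<partial>lborel)"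
    by (simp add: mult_ac)
  also have "\<dots> = (\<integral>\<xi>. f \<xi> * FT k \<xi> \<partial>lborel)" by simp
  finally show ?thesis .
qed

lemma FT_gaussian:
  assumes \<sigma>: "\<sigma> > 0"
  shows "integrable lborel (\<lambda>x. complex_of_real (exp (- (\<sigma> * x)\<^sup>2 / 2)))"
    and "FT (\<lambda>x. complex_of_real (exp (- (\<sigma> * x)\<^sup>2 / 2))) u = complex_of_real (2 * pi * normal_density 0 \<sigma> u)"
proof -
  have e: "exp (- (\<sigma> * x)\<^sup>2 / 2) = sqrt (2 * pi) * std_normal_density (\<sigma> * x)" for x
    by (simp add: std_normal_density_def)
  have "integrable lborel (\<lambda>x. std_normal_density (0 + \<sigma> * x))"
    by (rule lborel_integrable_real_affine) (use \<sigma> in auto)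
  thus "integrable lborel (\<lambda>x. complex_of_real (exp (- (\<sigma> * x)\<^sup>2 / 2)))"
    unfolding e by simp
  have scaled: "b = a /\<^sub>R c" if "a = c *\<^sub>R b" "c \<noteq> 0" for a b :: complex and c :: real
    using that by simp
  have ch: "(\<integral>y. std_normal_density y *\<^sub>R iexp (t * y) \<partial>lborel) = complex_of_real (exp (- (t\<^sup>2) / 2))" for t
    using fun_cong[OF char_std_normal_distribution, of t]
    by (simp add: char_def integral_density)
  have "FT (\<lambda>x. complex_of_real (exp (- (\<sigma> * x)\<^sup>2 / 2))) u
     = sqrt (2 * pi) * (\<integral>x. std_normal_density (0 + \<sigma> * x) *\<^sub>R iexp ((- u / \<sigma>) * (0 + \<sigma> * x)) \<partial>lborel)"
    unfolding e using \<sigma> by (simp add: scaleR_conv_of_real mult.assoc)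
  also have "(\<integral>x. std_normal_density (0 + \<sigma> * x) *\<^sub>R iexp ((- u / \<sigma>) * (0 + \<sigma> * x)) \<partial>lborel)
     = (\<integral>y. std_normal_density y *\<^sub>R iexp ((- u / \<sigma>) * y) \<partial>lborel) /\<^sub>R \<bar>\<sigma>\<bar>"
  proof (rule scaled)
    show "(\<integral>y. std_normal_density y *\<^sub>R iexp ((- u / \<sigma>) * y) \<partial>lborel) = \<bar>\<sigma>\<bar> *\<^sub>R
      (\<integral>x. std_normal_density (0 + \<sigma> * x) *\<^sub>R iexp ((- u / \<sigma>) * (0 + \<sigma> * x)) \<partial>lborel)"
      by (rule lborel_integral_real_affine) (use \<sigma> in simp)
  qed (use \<sigma> in simp)
  also have "\<dots> = complex_of_real (exp (- ((- u / \<sigma>)\<^sup>2) / 2)) /\<^sub>R \<bar>\<sigma>\<bar>" by (simp only: ch)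
  finally show "FT (\<lambda>x. complex_of_real (exp (- (\<sigma> * x)\<^sup>2 / 2))) u = complex_of_real (2 * pi * normal_density 0 \<sigma> u)"
    using \<sigma> by (simp add: normal_density_def real_sqrt_mult scaleR_conv_of_real field_simps power_divide
        flip: of_real_mult of_real_divide)
qed

text \<open>
  The multiplication formula turns the weighted integral on the left into the pairing of \<open>\<psi>\<close> with
  its own convolution by \<open>2 \<pi>\<close> times a Gaussian density. By \<open>2 \<bar>ab\<bar> \<le> \<bar>a\<bar>\<^sup>2 + \<bar>b\<bar>\<^sup>2\<close> this is at most \<open>2 \<pi>\<close> times
  the squared norm, uniformly in \<open>\<sigma>\<close>. The weight makes the product on the left integrable.
\<close>
lemma gaussian_weighted_plancherel:
  fixes \<psi> :: "real \<Rightarrow> complex"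
  assumes \<psi>: "integrable lborel \<psi>" and \<psi>2: "integrable lborel (\<lambda>\<xi>. (cmod (\<psi> \<xi>))\<^sup>2)" and \<sigma>: "\<sigma> > 0"
  shows "(\<integral>\<^sup>+x. ennreal (exp (- (\<sigma> * x)\<^sup>2 / 2) * (cmod (FT \<psi> x))\<^sup>2) \<partial>lborel)
     \<le> ennreal (2 * pi * (\<integral>\<xi>. (cmod (\<psi> \<xi>))\<^sup>2 \<partial>lborel))"
proof -
  define w where "w = (\<lambda>x. complex_of_real (exp (- (\<sigma> * x)\<^sup>2 / 2)))"
  have w: "integrable lborel w" and Fw: "\<And>u. FT w u = complex_of_real (2 * pi * normal_density 0 \<sigma> u)"
    unfolding w_def using FT_gaussian[OF \<sigma>] by simp_all
  from \<psi> have [measurable]: "\<psi> \<in> borel_measurable lborel" by auto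
  from w have [measurable]: "w \<in> borel_measurable lborel" by auto
  define S where "S = (\<integral>\<xi>. (cmod (\<psi> \<xi>))\<^sup>2 \<partial>lborel)"
  let ?N = "normal_density 0 \<sigma>"
  have bF: "norm (cnj (FT \<psi> x)) \<le> (\<integral>\<xi>. norm (\<psi> \<xi>) \<partial>lborel)" for x
    using FT_bounded[OF \<psi>, of x] by simp
  have k1: "integrable lborel (\<lambda>x. w x * cnj (FT \<psi> x))"
    by (rule integrable_mult_bounded[OF w _ bF]) measurable
  have intr: "integrable lborel (\<lambda>x. exp (- (\<sigma> * x)\<^sup>2 / 2) * (cmod (FT \<psi> x))\<^sup>2)"
  proof -
    have "integrable lborel (\<lambda>x. w x * cnj (FT \<psi> x) * FT \<psi> x)"
      by (rule integrable_mult_bounded[OF k1 _ FT_bounded[OF \<psi>]]) simp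
    hence "integrable lborel (\<lambda>x. complex_of_real (exp (- (\<sigma> * x)\<^sup>2 / 2) * (cmod (FT \<psi> x))\<^sup>2))"
      by (rule back_subst[where P = "integrable lborel"])
         (auto simp: fun_eq_iff w_def mult.assoc complex_norm_square mult.commute simp del: of_real_power)
    thus ?thesis by (rule complex_of_real_integrable_eq[THEN iffD1])
  qed
  \<comment> \<open>The transform of the weighted transform is a convolution with a Gaussian density.\<close>
  have inner: "FT (\<lambda>x. w x * cnj (FT \<psi> x)) \<xi> =
      (\<integral>\<eta>. cnj (\<psi> \<eta>) * complex_of_real (2 * pi * ?N (\<xi> - \<eta>)) \<partial>lborel)" for \<xi>
  proof -
    have "cnj (FT (\<lambda>x. w x * cnj (FT \<psi> x)) \<xi>) = (\<integral>x. cnj (w x * cnj (FT \<psi> x) * iexp (- (\<xi> * x))) \<partial>lborel)"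
      by (simp only: Bochner_Integration.integral_cnj)
    also have "\<dots> = (\<integral>x. (w x * iexp (\<xi> * x)) * FT \<psi> x \<partial>lborel)"
      by (intro Bochner_Integration.integral_cong refl)
         (simp add: w_def exp_cnj mult_ac)
    also have "\<dots> = (\<integral>\<eta>. \<psi> \<eta> * FT (\<lambda>x. w x * iexp (\<xi> * x)) \<eta> \<partial>lborel)"
      by (rule multiplication_formula[OF \<psi>]) (rule integrable_mult_iexp[OF w], simp)
    also have "\<dots> = (\<integral>\<eta>. \<psi> \<eta> * complex_of_real (2 * pi * ?N (\<xi> - \<eta>)) \<partial>lborel)"
    proof (intro Bochner_Integration.integral_cong refl arg_cong2[where f = "(*)"])
      fix \<eta>
      have "FT (\<lambda>x. w x * iexp (\<xi> * x)) \<eta> = FT w (\<eta> - \<xi>)"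
        by (intro Bochner_Integration.integral_cong refl)
           (simp add: mult.assoc algebra_simps flip: exp_add)
      also have "\<dots> = complex_of_real (2 * pi * ?N (\<xi> - \<eta>))"
        unfolding Fw by (simp add: normal_density_def power2_commute)
      finally show "FT (\<lambda>x. w x * iexp (\<xi> * x)) \<eta> = complex_of_real (2 * pi * ?N (\<xi> - \<eta>))" .
    qed
    finally have "cnj (cnj (FT (\<lambda>x. w x * cnj (FT \<psi> x)) \<xi>)) =
        cnj (\<integral>\<eta>. \<psi> \<eta> * complex_of_real (2 * pi * ?N (\<xi> - \<eta>)) \<partial>lborel)" by simp
    thus ?thesis by (simp add: Bochner_Integration.integral_cnj[symmetric] del: of_real_mult)
  qed
  have N1: "(\<integral>\<^sup>+\<eta>. ennreal (?N (\<xi> - \<eta>)) \<partial>lborel) = 1" for \<xi>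
  proof -
    have "(\<integral>\<^sup>+\<eta>. ennreal (?N (\<xi> - \<eta>)) \<partial>lborel) = (\<integral>\<^sup>+\<eta>. ennreal (normal_density \<xi> \<sigma> \<eta>) \<partial>lborel)"
      by (simp add: normal_density_def power2_commute)
    also have "\<dots> = 1"
      using prob_space.emeasure_space_1[OF prob_space_normal_density[OF \<sigma>, of \<xi>]]
      by (simp add: emeasure_density)
    finally show ?thesis .
  qed
  have "(\<integral>x. exp (- (\<sigma> * x)\<^sup>2 / 2) * (cmod (FT \<psi> x))\<^sup>2 \<partial>lborel)
      = Re (\<integral>x. complex_of_real (exp (- (\<sigma> * x)\<^sup>2 / 2) * (cmod (FT \<psi> x))\<^sup>2) \<partial>lborel)"
    by (simp only: integral_complex_of_real Re_complex_of_real)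
  also have "(\<integral>x. complex_of_real (exp (- (\<sigma> * x)\<^sup>2 / 2) * (cmod (FT \<psi> x))\<^sup>2) \<partial>lborel)
      = (\<integral>x. (w x * cnj (FT \<psi> x)) * FT \<psi> x \<partial>lborel)"
    by (intro Bochner_Integration.integral_cong refl)
       (simp add: w_def mult.assoc complex_norm_square mult.commute del: of_real_power)
  also have "\<dots> = (\<integral>\<xi>. \<psi> \<xi> * FT (\<lambda>x. w x * cnj (FT \<psi> x)) \<xi> \<partial>lborel)"
    by (rule multiplication_formula[OF \<psi> k1])
  also have "Re \<dots> \<le> norm \<dots>" by (rule complex_Re_le_cmod)
  finally have 1: "(\<integral>x. exp (- (\<sigma> * x)\<^sup>2 / 2) * (cmod (FT \<psi> x))\<^sup>2 \<partial>lborel)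
     \<le> norm (\<integral>\<xi>. \<psi> \<xi> * FT (\<lambda>x. w x * cnj (FT \<psi> x)) \<xi> \<partial>lborel)" .
  have "ennreal (norm (\<integral>\<xi>. \<psi> \<xi> * FT (\<lambda>x. w x * cnj (FT \<psi> x)) \<xi> \<partial>lborel))
     \<le> (\<integral>\<^sup>+\<xi>. norm (\<psi> \<xi> * FT (\<lambda>x. w x * cnj (FT \<psi> x)) \<xi>) \<partial>lborel)"
  proof (intro integral_norm_bound_ennreal integrable_mult_bounded[OF \<psi> _ FT_bounded[OF k1]])
    show "FT (\<lambda>x. w x * cnj (FT \<psi> x)) \<in> borel_measurable lborel" by measurable
  qed
  also have "\<dots> \<le> (\<integral>\<^sup>+\<xi>. (\<integral>\<^sup>+\<eta>. ennreal (pi * (cmod (\<psi> \<xi>))\<^sup>2) * ennreal (?N (\<xi> - \<eta>))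
       + ennreal (pi * (cmod (\<psi> \<eta>))\<^sup>2) * ennreal (?N (\<xi> - \<eta>)) \<partial>lborel) \<partial>lborel)"
  proof (rule nn_integral_mono)
    fix \<xi> :: real
    have i: "integrable lborel (\<lambda>\<eta>. cnj (\<psi> \<eta>) * complex_of_real (2 * pi * ?N (\<xi> - \<eta>)))"
    proof (rule integrable_mult_bounded[where C = "2 * pi * (1 / sqrt (2 * pi * \<sigma>\<^sup>2))"])
      show "norm (complex_of_real (2 * pi * ?N (\<xi> - x))) \<le> 2 * pi * (1 / sqrt (2 * pi * \<sigma>\<^sup>2))" for x
      proof -
        have "?N (\<xi> - x) \<le> 1 / sqrt (2 * pi * \<sigma>\<^sup>2) * 1"
          unfolding normal_density_def by (intro mult_left_mono) auto
        hence "(2 * pi) * ?N (\<xi> - x) \<le> (2 * pi) * (1 / sqrt (2 * pi * \<sigma>\<^sup>2))"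
          by (intro mult_left_mono) auto
        moreover have "\<bar>(2 * pi) * ?N (\<xi> - x)\<bar> = (2 * pi) * ?N (\<xi> - x)"
          by (intro abs_of_nonneg mult_nonneg_nonneg) auto
        ultimately show ?thesis by (simp only: norm_of_real)
      qed
      show "integrable lborel (\<lambda>\<eta>. cnj (\<psi> \<eta>))" using \<psi> by (simp only: complex_integrable_cnj)
      show "(\<lambda>\<eta>. complex_of_real (2 * pi * ?N (\<xi> - \<eta>))) \<in> borel_measurable lborel" by measurable
    qed
    have "ennreal (norm (\<psi> \<xi> * FT (\<lambda>x. w x * cnj (FT \<psi> x)) \<xi>))
       = ennreal (norm (\<psi> \<xi>)) * ennreal (norm (\<integral>\<eta>. cnj (\<psi> \<eta>) * complex_of_real (2 * pi * ?N (\<xi> - \<eta>)) \<partial>lborel))"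
      by (simp only: inner norm_mult ennreal_mult'' norm_ge_zero)
    also have "\<dots> \<le> ennreal (norm (\<psi> \<xi>)) * (\<integral>\<^sup>+\<eta>. norm (cnj (\<psi> \<eta>) * complex_of_real (2 * pi * ?N (\<xi> - \<eta>))) \<partial>lborel)"
      by (intro mult_left_mono integral_norm_bound_ennreal i) auto
    also have "\<dots> = (\<integral>\<^sup>+\<eta>. ennreal (norm (\<psi> \<xi>)) * ennreal (norm (\<psi> \<eta>) * (2 * pi * ?N (\<xi> - \<eta>))) \<partial>lborel)"
      by (subst nn_integral_cmult[symmetric]) (simp_all add: norm_mult)
    also have "\<dots> \<le> (\<integral>\<^sup>+\<eta>. ennreal (pi * (cmod (\<psi> \<xi>))\<^sup>2) * ennreal (?N (\<xi> - \<eta>))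
       + ennreal (pi * (cmod (\<psi> \<eta>))\<^sup>2) * ennreal (?N (\<xi> - \<eta>)) \<partial>lborel)"
    proof (rule nn_integral_mono)
      fix \<eta> :: real
      have "2 * (norm (\<psi> \<xi>) * norm (\<psi> \<eta>)) \<le> (cmod (\<psi> \<xi>))\<^sup>2 + (cmod (\<psi> \<eta>))\<^sup>2"
        using sum_squares_bound[of "norm (\<psi> \<xi>)" "norm (\<psi> \<eta>)"] by simp
      hence "(2 * (norm (\<psi> \<xi>) * norm (\<psi> \<eta>))) * (pi * ?N (\<xi> - \<eta>))
          \<le> ((cmod (\<psi> \<xi>))\<^sup>2 + (cmod (\<psi> \<eta>))\<^sup>2) * (pi * ?N (\<xi> - \<eta>))"
        by (intro mult_right_mono) auto
      thus "ennreal (norm (\<psi> \<xi>)) * ennreal (norm (\<psi> \<eta>) * (2 * pi * ?N (\<xi> - \<eta>)))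
        \<le> ennreal (pi * (cmod (\<psi> \<xi>))\<^sup>2) * ennreal (?N (\<xi> - \<eta>)) + ennreal (pi * (cmod (\<psi> \<eta>))\<^sup>2) * ennreal (?N (\<xi> - \<eta>))"
        by (simp add: ennreal_mult[symmetric] ennreal_plus[symmetric] algebra_simps del: ennreal_plus)
    qed
    finally show "ennreal (norm (\<psi> \<xi> * FT (\<lambda>x. w x * cnj (FT \<psi> x)) \<xi>)) \<le> \<dots>" .
  qed
  also have "\<dots> = (\<integral>\<^sup>+\<xi>. (\<integral>\<^sup>+\<eta>. ennreal (pi * (cmod (\<psi> \<xi>))\<^sup>2) * ennreal (?N (\<xi> - \<eta>)) \<partial>lborel) \<partial>lborel)
     + (\<integral>\<^sup>+\<xi>. (\<integral>\<^sup>+\<eta>. ennreal (pi * (cmod (\<psi> \<eta>))\<^sup>2) * ennreal (?N (\<xi> - \<eta>)) \<partial>lborel) \<partial>lborel)"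
    by (subst nn_integral_add[symmetric]) (auto intro!: nn_integral_cong nn_integral_add)
  also have "(\<integral>\<^sup>+\<xi>. (\<integral>\<^sup>+\<eta>. ennreal (pi * (cmod (\<psi> \<xi>))\<^sup>2) * ennreal (?N (\<xi> - \<eta>)) \<partial>lborel) \<partial>lborel) = ennreal (pi * S)"
    using \<psi>2 by (simp add: nn_integral_cmult N1 S_def nn_integral_eq_integral)
  also have "(\<integral>\<^sup>+\<xi>. (\<integral>\<^sup>+\<eta>. ennreal (pi * (cmod (\<psi> \<eta>))\<^sup>2) * ennreal (?N (\<xi> - \<eta>)) \<partial>lborel) \<partial>lborel)
     = (\<integral>\<^sup>+\<eta>. (\<integral>\<^sup>+\<xi>. ennreal (pi * (cmod (\<psi> \<eta>))\<^sup>2) * ennreal (?N (\<xi> - \<eta>)) \<partial>lborel) \<partial>lborel)"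
    by (rule lborel_pair.Fubini') simp
  also have "\<dots> = (\<integral>\<^sup>+\<eta>. (\<integral>\<^sup>+\<xi>. ennreal (pi * (cmod (\<psi> \<eta>))\<^sup>2) * ennreal (?N (\<eta> - \<xi>)) \<partial>lborel) \<partial>lborel)"
    by (simp add: normal_density_def power2_commute)
  also have "\<dots> = ennreal (pi * S)"
    using \<psi>2 by (simp add: nn_integral_cmult N1 S_def nn_integral_eq_integral)
  also have "ennreal (pi * S) + ennreal (pi * S) = ennreal (2 * pi * S)"
    by (subst ennreal_plus[symmetric]) (auto simp: S_def)
  finally have "ennreal (norm (\<integral>\<xi>. \<psi> \<xi> * FT (\<lambda>x. w x * cnj (FT \<psi> x)) \<xi> \<partial>lborel)) \<le> ennreal (2 * pi * S)" .
  with 1 have "ennreal (\<integral>x. exp (- (\<sigma> * x)\<^sup>2 / 2) * (cmod (FT \<psi> x))\<^sup>2 \<partial>lborel) \<le> ennreal (2 * pi * S)"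
    using ennreal_leI order_trans by blast
  thus ?thesis using intr by (subst nn_integral_eq_integral) (auto simp: S_def)
qed

text \<open>
  Plancherel's theorem as an inequality between possibly infinite quantities: Fatou's lemma applied to
  the weighted version as the weight tends to \<open>1\<close>.
\<close>
lemma plancherel_le:
  fixes \<psi> :: "real \<Rightarrow> complex"
  assumes \<psi>: "integrable lborel \<psi>"
  shows "(\<integral>\<^sup>+x. ennreal ((cmod (FT \<psi> x))\<^sup>2) \<partial>lborel) \<le> ennreal (2 * pi) * (\<integral>\<^sup>+\<xi>. ennreal ((cmod (\<psi> \<xi>))\<^sup>2) \<partial>lborel)"
proof (cases "(\<integral>\<^sup>+\<xi>. ennreal ((cmod (\<psi> \<xi>))\<^sup>2) \<partial>lborel) = \<infinity>")
  case True
  thus ?thesis by (simp add: ennreal_mult_top)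
next
  case False
  from \<psi> have [measurable]: "\<psi> \<in> borel_measurable lborel" by auto
  have \<psi>2: "integrable lborel (\<lambda>\<xi>. (cmod (\<psi> \<xi>))\<^sup>2)"
    using False by (intro integrableI_bounded) (auto simp: less_top)
  define W where "W = (\<lambda>n x. exp (- (inverse (real (Suc n)) * x)\<^sup>2 / 2) * (cmod (FT \<psi> x))\<^sup>2)"
  have "(\<lambda>n. W n x) \<longlonglongrightarrow> exp (- (0 * x)\<^sup>2 / 2) * (cmod (FT \<psi> x))\<^sup>2" for x
    unfolding W_def by (intro tendsto_intros LIMSEQ_inverse_real_of_nat) auto
  hence lim: "(\<lambda>n. ennreal (W n x)) \<longlonglongrightarrow> ennreal ((cmod (FT \<psi> x))\<^sup>2)" for x
    by (intro tendsto_ennrealI) simp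
  have "(\<integral>\<^sup>+x. ennreal ((cmod (FT \<psi> x))\<^sup>2) \<partial>lborel) = (\<integral>\<^sup>+x. liminf (\<lambda>n. ennreal (W n x)) \<partial>lborel)"
    by (intro nn_integral_cong) (simp add: lim_imp_Liminf[OF _ lim])
  also have "\<dots> \<le> liminf (\<lambda>n. \<integral>\<^sup>+x. ennreal (W n x) \<partial>lborel)"
    by (rule nn_integral_liminf) (simp add: W_def)
  also have "\<dots> \<le> liminf (\<lambda>n::nat. ennreal (2 * pi * (\<integral>\<xi>. (cmod (\<psi> \<xi>))\<^sup>2 \<partial>lborel)))"
    unfolding W_def by (intro Liminf_mono always_eventually allI gaussian_weighted_plancherel \<psi> \<psi>2) simp
  also have "\<dots> = ennreal (2 * pi) * (\<integral>\<^sup>+\<xi>. ennreal ((cmod (\<psi> \<xi>))\<^sup>2) \<partial>lborel)"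
    using \<psi>2 by (simp add: Liminf_const nn_integral_eq_integral ennreal_mult)
  finally show ?thesis .
qed

lemma fourier_eq_cnj_FT: "fourier g \<xi> = cnj (FT (\<lambda>x. complex_of_real (g x)) \<xi>)"
proof -
  have "cnj (FT (\<lambda>x. complex_of_real (g x)) \<xi>) = (\<integral>x. cnj (complex_of_real (g x) * iexp (- (\<xi> * x))) \<partial>lborel)"
    by (simp only: Bochner_Integration.integral_cnj)
  also have "\<dots> = fourier g \<xi>"
    unfolding fourier_def by (intro Bochner_Integration.integral_cong refl) (simp add: exp_cnj mult_ac)
  finally show ?thesis by simp
qed

lemma fourier_plancherel_le:
  assumes "integrable lborel g"
  shows "(\<integral>\<^sup>+\<xi>. ennreal ((cmod (fourier g \<xi>))\<^sup>2) \<partial>lborel) \<le> ennreal (2 * pi) * (\<integral>\<^sup>+x. ennreal ((g x)\<^sup>2) \<partial>lborel)"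
  using plancherel_le[of "\<lambda>x. complex_of_real (g x)"] assms by (simp add: fourier_eq_cnj_FT)

lemma continuous_nonneg_if_interval_integrals_nonneg:
  fixes f :: "real \<Rightarrow> real"
  assumes cont: "\<And>x. isCont f x" and nn: "\<And>a b. a < b \<Longrightarrow> 0 \<le> (LINT x:{a<..b}|lborel. f x)"
  shows "0 \<le> f x"
proof (rule ccontr)
  assume "\<not> 0 \<le> f x"
  hence neg: "f x < 0" by simp
  then obtain d where d: "d > 0" "\<And>y. dist y x < d \<Longrightarrow> dist (f y) (f x) < - f x / 2"
    using cont[of x] unfolding continuous_at_eps_delta by (metis half_gt_zero neg_0_less_iff_less)
  define b where "b = x + d / 2"
  have fy: "f y \<le> f x / 2" if "y \<in> {x<..b}" for y
    using d(2)[of y] that d(1) by (auto simp: dist_real_def b_def abs_less_iff)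
  have int: "set_integrable lborel {x<..b} f"
    by (rule set_integrable_subset[OF borel_integrable_atLeastAtMost', of x b])
       (use cont in \<open>auto intro: continuous_at_imp_continuous_on\<close>)
  have "(LINT y:{x<..b}|lborel. f y) \<le> (LINT y:{x<..b}|lborel. f x / 2)"
    proof (rule set_integral_mono[OF int])
    have "integrable lborel (indicator {x<..b} :: real \<Rightarrow> real)"
      by (rule integrable_real_indicator) (use d(1) in \<open>auto simp: b_def\<close>)
    thus "set_integrable lborel {x<..b} (\<lambda>y. f x / 2)"
      unfolding set_integrable_def by simp
  qed (use fy in auto)
  also have "\<dots> = (b - x) * (f x / 2)"
    using d(1) by (simp add: set_lebesgue_integral_def b_def)
  also have "\<dots> < 0" using d(1) neg by (simp add: b_def mult_pos_neg)
  finally show False using nn[of x b] d(1) by (simp add: b_def)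
qed

text \<open>
  Levy's inversion formula gives the mass of an interval as a limit of truncated integrals. When the
  characteristic function is integrable the limit is an absolutely convergent integral against the
  transform of the indicator of the interval, and the multiplication formula moves the transform to the other factor.
\<close>
lemma density_interval_from_fourier:
  fixes p :: "real \<Rightarrow> real"
  assumes [measurable]: "p \<in> borel_measurable borel" and p0: "\<And>x. 0 \<le> p x"
    and p1: "(\<integral>\<^sup>+x. ennreal (p x) \<partial>lborel) = 1"
    and \<phi>: "integrable lborel (fourier p)" and ab: "a < b"
  shows "complex_of_real (measure (density lborel p) {a<..b})
     = (CLINT x:{a<..b}|lborel. inverse_fourier (fourier p) x)"
proof -
  let ?\<mu> = "density lborel (\<lambda>x. ennreal (p x))"
  have \<mu>1: "emeasure ?\<mu> (space ?\<mu>) = 1" using p1 by (simp add: emeasure_density)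
  interpret prob_space ?\<mu> by (rule prob_spaceI[OF \<mu>1])
  interpret real_distribution ?\<mu> by standard auto
  from \<phi> have [measurable]: "fourier p \<in> borel_measurable borel" by auto
  have ch: "char ?\<mu> t = fourier p t" for t
    unfolding char_def fourier_def
    by (simp add: integral_density p0 scaleR_conv_of_real mult.commute)
  have atom: "measure ?\<mu> {x} = 0" for x
  proof -
    have "emeasure ?\<mu> {x} = 0"
      by (subst emeasure_density) (auto intro!: nn_integral_0_iff_AE[THEN iffD2] AE_I[of _ _ "{x}"] split: split_indicator)
    thus ?thesis by (simp add: measure_def)
  qed
  define F where "F = (\<lambda>t. (iexp (-(t * a)) - iexp (-(t * b))) / (\<i> * t))"
  have Fm [measurable]: "F \<in> borel_measurable lborel" unfolding F_def by measurable
  have Fb: "norm (F t) \<le> b - a" for t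
  proof (cases "t = 0")
    case False
    thus ?thesis using Levy_Inversion_aux2[of "-b" "-a" t] ab by (simp add: F_def)
  qed (use ab in \<open>simp add: F_def\<close>)
  have F\<phi>: "integrable lborel (\<lambda>t. fourier p t * F t)"
    by (rule integrable_mult_bounded[OF \<phi> Fm Fb])
  have "(\<lambda>n. 1 / (2 * pi) * (CLBINT t=- real n..real n. F t * char ?\<mu> t)) \<longlonglongrightarrow> measure ?\<mu> {a<..b}"
    unfolding F_def using Levy_Inversion[of a b] ab atom by simp
  moreover have "(\<lambda>n. 1 / (2 * pi) * (CLBINT t=- real n..real n. F t * char ?\<mu> t))
      \<longlonglongrightarrow> 1 / (2 * pi) * (\<integral>t. fourier p t * F t \<partial>lborel)"
  proof (intro tendsto_intros)
    have "(\<lambda>n. \<integral>t. indicator {- real n..real n} t *\<^sub>R (fourier p t * F t) \<partial>lborel) \<longlonglongrightarrow> (\<integral>t. fourier p t * F t \<partial>lborel)"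
    proof (rule integral_dominated_convergence[where w = "\<lambda>t. norm (fourier p t * F t)"])
      show "AE t in lborel. (\<lambda>n. indicator {- real n..real n} t *\<^sub>R (fourier p t * F t)) \<longlonglongrightarrow> fourier p t * F t"
      proof (intro AE_I2 tendsto_eventually)
        fix t :: real
        obtain N :: nat where "\<bar>t\<bar> \<le> real N" using real_arch_simple by blast
        thus "\<forall>\<^sub>F n in sequentially. indicator {- real n..real n} t *\<^sub>R (fourier p t * F t) = fourier p t * F t"
          by (intro eventually_sequentiallyI[of N]) (auto simp: indicator_def)
      qed
    qed (use F\<phi> in \<open>auto simp: indicator_def\<close>)
    also have "(\<lambda>n. \<integral>t. indicator {- real n..real n} t *\<^sub>R (fourier p t * F t) \<partial>lborel)
       = (\<lambda>n. CLBINT t=- real n..real n. F t * char ?\<mu> t)"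
      by (simp add: interval_integral_Icc set_lebesgue_integral_def ch mult.commute)
    finally show "(\<lambda>n. CLBINT t=- real n..real n. F t * char ?\<mu> t) \<longlonglongrightarrow> (\<integral>t. fourier p t * F t \<partial>lborel)" .
  qed
  ultimately have 1: "complex_of_real (measure ?\<mu> {a<..b}) = 1 / (2 * pi) * (\<integral>t. fourier p t * F t \<partial>lborel)"
    by (rule LIMSEQ_unique)
  \<comment> \<open>\<open>F\<close> is the transform of the indicator of the interval, except possibly at \<open>0\<close>.\<close>
  let ?I = "\<lambda>x. complex_of_real (indicator {a<..b} x)"
  have I: "integrable lborel ?I" using ab by simp
  have FI: "FT ?I t = F t" if "t \<noteq> 0" for t
  proof -
    have "FT ?I t = (CLBINT x=a..b. iexp (- (t * x)))"
      using ab by (subst interval_integral_Ioc) (auto simp: set_lebesgue_integral_def scaleR_conv_of_real)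
    also have "\<dots> = iexp (- (t * b)) / (- \<i> * t) - iexp (- (t * a)) / (- \<i> * t)"
    proof (rule interval_integral_FTC_finite)
      show "continuous_on {min a b..max a b} (\<lambda>x. iexp (- (t * x)))" by (intro continuous_intros)
      fix x
      have "((\<lambda>z. exp (\<i> * - (complex_of_real t * z)) / (- \<i> * t)) has_field_derivative
          exp (\<i> * - (complex_of_real t * complex_of_real x))) (at (complex_of_real x))"
        using that by (auto intro!: derivative_eq_intros simp: mult_ac)
      from has_vector_derivative_real_field[OF this]
      show "((\<lambda>x. iexp (- (t * x)) / (- \<i> * t)) has_vector_derivative iexp (- (t * x))) (at x within {min a b..max a b})"
        by simp
    qed
    also have "\<dots> = F t" unfolding F_def using that by (simp add: field_simps)
    finally show ?thesis .
  qed
  have "(\<integral>t. fourier p t * F t \<partial>lborel) = (\<integral>t. fourier p t * FT ?I t \<partial>lborel)"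
  proof (rule integral_cong_AE)
    show "AE t in lborel. fourier p t * F t = fourier p t * FT ?I t"
      using AE_lborel_singleton[of 0] by eventually_elim (subst FI, assumption, rule refl)
    show "(\<lambda>t. fourier p t * FT ?I t) \<in> borel_measurable lborel"
      by (intro borel_measurable_times) (auto intro: FT_measurable)
  qed simp
  also have "\<dots> = (\<integral>x. ?I x * FT (fourier p) x \<partial>lborel)"
    by (rule multiplication_formula[OF I \<phi>])
  finally show ?thesis
    by (subst 1) (simp add: inverse_fourier_def set_lebesgue_integral_def scaleR_conv_of_real)
qed

text \<open>
  The inverse transform is continuous and has the right integral over every interval. Hence it is
  real and nonnegative, and the measure with this density coincides with the one with density \<open>p\<close>.
\<close>
lemma fourier_inversion_density:
  fixes p :: "real \<Rightarrow> real"
  assumes pm [measurable]: "p \<in> borel_measurable borel" and p0: "\<And>x. 0 \<le> p x"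
    and p1: "(\<integral>\<^sup>+x. ennreal (p x) \<partial>lborel) = 1"
    and \<phi>: "integrable lborel (fourier p)"
  shows "AE x in lborel. inverse_fourier (fourier p) x = complex_of_real (p x)"
proof -
  let ?\<mu> = "density lborel (\<lambda>x. ennreal (p x))"
  define q where "q = inverse_fourier (fourier p)"
  have qc: "isCont q x" for x
    unfolding q_def inverse_fourier_def using FT_continuous[OF \<phi>] by (intro continuous_intros) auto
  have [measurable]: "q \<in> borel_measurable borel"
    by (intro borel_measurable_continuous_onI continuous_at_imp_continuous_on) (auto intro: qc)
  have int: "set_integrable lborel {a<..b} q" if "a < b" for a b
    by (rule set_integrable_subset[OF borel_integrable_atLeastAtMost', of a b])
       (use qc in \<open>auto intro: continuous_at_imp_continuous_on\<close>)
  have qi: "(CLINT x:{a<..b}|lborel. q x) = complex_of_real (measure ?\<mu> {a<..b})" if "a < b" for a b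
    unfolding q_def by (rule density_interval_from_fourier[OF pm p0 p1 \<phi> that, symmetric])
  have Rei: "(LINT x:{a<..b}|lborel. Re (q x)) = measure ?\<mu> {a<..b}"
    and Imi: "(LINT x:{a<..b}|lborel. Im (q x)) = 0" if "a < b" for a b
    using arg_cong[OF qi[OF that], of Re] arg_cong[OF qi[OF that], of Im] int[OF that]
    unfolding set_lebesgue_integral_def set_integrable_def
    by (simp_all flip: integral_Re integral_Im)
  have q0: "0 \<le> Re (q x)" for x
    by (rule continuous_nonneg_if_interval_integrals_nonneg[of "\<lambda>x. Re (q x)"])
       (auto simp: Rei intro!: continuous_Re[OF qc])
  have Im1: "0 \<le> Im (q x)" for x
    by (rule continuous_nonneg_if_interval_integrals_nonneg[of "\<lambda>x. Im (q x)"])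
       (auto simp: Imi intro!: continuous_Im[OF qc])
  have "0 \<le> - Im (q x)" for x
  proof (rule continuous_nonneg_if_interval_integrals_nonneg[of "\<lambda>x. - Im (q x)"])
    show "isCont (\<lambda>x. - Im (q x)) x" for x by (rule continuous_minus[OF continuous_Im[OF qc]])
    show "0 \<le> (LINT x:{a<..b}|lborel. - Im (q x))" if "a < b" for a b
      using Imi[OF that] by (simp add: set_lebesgue_integral_def)
  qed
  with Im1 have Imq: "Im (q x) = 0" for x by (metis neg_0_le_iff_le order_antisym)
  let ?\<nu> = "density lborel (\<lambda>x. ennreal (Re (q x)))"
  have \<mu>1: "emeasure ?\<mu> (space ?\<mu>) = 1" using p1 by (simp add: emeasure_density)
  interpret prob_space ?\<mu> by (rule prob_spaceI[OF \<mu>1])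
  have Ioc: "emeasure ?\<nu> {a<..b} = emeasure ?\<mu> {a<..b}" if "a < b" for a b
  proof -
    have "emeasure ?\<nu> {a<..b} = (\<integral>\<^sup>+x. ennreal (indicator {a<..b} x *\<^sub>R Re (q x)) \<partial>lborel)"
      by (subst emeasure_density) (auto intro!: nn_integral_cong split: split_indicator)
    also have "\<dots> = ennreal (LINT x:{a<..b}|lborel. Re (q x))"
      unfolding set_lebesgue_integral_def
      using int[OF that] unfolding set_integrable_def
      by (intro nn_integral_eq_integral) (auto simp: q0 dest: integrable_Re)
    finally show ?thesis by (simp add: Rei[OF that] emeasure_eq_measure)
  qed
  have Ioi: "emeasure ?\<nu> {x<..} = emeasure ?\<mu> {x<..}" for x
  proof -
    have U: "{x<..} = (\<Union>n. {x<..x + real (Suc n)})"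
    proof (intro equalityI subsetI)
      fix y assume "y \<in> {x<..}"
      moreover obtain n :: nat where "y - x \<le> real n" using real_arch_simple by blast
      ultimately show "y \<in> (\<Union>n. {x<..x + real (Suc n)})" by (auto intro!: exI[of _ n])
    qed auto
    have inc: "incseq (\<lambda>n. {x<..x + real (Suc n)})" by (auto simp: incseq_def)
    have "(\<lambda>n. emeasure ?\<nu> {x<..x + real (Suc n)}) \<longlonglongrightarrow> emeasure ?\<nu> {x<..}"
      "(\<lambda>n. emeasure ?\<mu> {x<..x + real (Suc n)}) \<longlonglongrightarrow> emeasure ?\<mu> {x<..}"
      unfolding U by (rule Lim_emeasure_incseq[OF _ inc]; auto)+
    moreover have "emeasure ?\<nu> {x<..x + real (Suc n)} = emeasure ?\<mu> {x<..x + real (Suc n)}" for n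
      by (rule Ioc) simp
    ultimately show ?thesis by (simp only: LIMSEQ_unique)
  qed
  have "?\<nu> = ?\<mu>"
    by (rule measure_eqI_lessThan) (auto simp: Ioi less_top[symmetric])
  hence "AE x in lborel. ennreal (Re (q x)) = ennreal (p x)"
    by (subst (asm) sigma_finite_measure.density_unique_iff[OF sigma_finite_lborel]) auto
  thus ?thesis
    by eventually_elim (use Imq q0 p0 in \<open>auto simp: q_def[symmetric] complex_eq_iff\<close>)
qed

text \<open>
  This reduces the loss of an estimator defined by its transform to the error of that transform.
\<close>
lemma inverse_fourier_L2_bound:
  fixes p :: "real \<Rightarrow> real" and \<psi> :: "real \<Rightarrow> complex"
  assumes pm [measurable]: "p \<in> borel_measurable borel" and p0: "\<And>x. 0 \<le> p x"
    and p1: "(\<integral>\<^sup>+x. ennreal (p x) \<partial>lborel) = 1"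
    and \<phi>: "integrable lborel (fourier p)" and \<psi>: "integrable lborel \<psi>"
  shows "L2_dist_sq (inverse_fourier \<psi>) p
    \<le> (\<integral>\<^sup>+\<xi>. ennreal ((cmod (\<psi> \<xi> - fourier p \<xi>))\<^sup>2) \<partial>lborel) / ennreal (2 * pi)"
proof -
  let ?d = "\<lambda>\<xi>. \<psi> \<xi> - fourier p \<xi>"
  have d: "integrable lborel ?d" using \<phi> \<psi> by simp
  from \<phi> \<psi> d have [measurable]: "fourier p \<in> borel_measurable borel" "\<psi> \<in> borel_measurable borel" by auto
  have lin: "inverse_fourier \<psi> x - inverse_fourier (fourier p) x = FT ?d x / complex_of_real (2 * pi)" for x
  proof -
    have "FT ?d x = FT \<psi> x - FT (fourier p) x"
      unfolding left_diff_distrib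
      by (rule Bochner_Integration.integral_diff) (intro integrable_mult_iexp \<phi> \<psi>; simp)+
    thus ?thesis by (simp add: inverse_fourier_def diff_divide_distrib)
  qed
  have "L2_dist_sq (inverse_fourier \<psi>) p = (\<integral>\<^sup>+x. ennreal (1 / (2 * pi)\<^sup>2) * ennreal ((cmod (FT ?d x))\<^sup>2) \<partial>lborel)"
    unfolding L2_dist_sq_def
  proof (rule nn_integral_cong_AE)
    show "AE x in lborel. ennreal ((cmod (inverse_fourier \<psi> x - complex_of_real (p x)))\<^sup>2)
       = ennreal (1 / (2 * pi)\<^sup>2) * ennreal ((cmod (FT ?d x))\<^sup>2)"
      using fourier_inversion_density[OF pm p0 p1 \<phi>]
    proof eventually_elim
      case (elim x)
      show ?case
        by (subst elim[symmetric], subst lin)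
           (simp add: norm_divide norm_mult power_divide ennreal_mult[symmetric])
    qed
  qed
  also have "\<dots> = ennreal (1 / (2 * pi)\<^sup>2) * (\<integral>\<^sup>+x. ennreal ((cmod (FT ?d x))\<^sup>2) \<partial>lborel)"
    by (rule nn_integral_cmult) (use FT_measurable[of ?d] in measurable)
  also have "\<dots> \<le> ennreal (1 / (2 * pi)\<^sup>2) * (ennreal (2 * pi) * (\<integral>\<^sup>+\<xi>. ennreal ((cmod (?d \<xi>))\<^sup>2) \<partial>lborel))"
    by (intro mult_left_mono plancherel_le d) auto
  also have "\<dots> = ennreal (1 / (2 * pi)) * (\<integral>\<^sup>+\<xi>. ennreal ((cmod (?d \<xi>))\<^sup>2) \<partial>lborel)"
    by (subst mult.assoc[symmetric], subst ennreal_mult[symmetric]) (auto simp: power2_eq_square field_simps)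
  also have "\<dots> = (\<integral>\<^sup>+\<xi>. ennreal ((cmod (?d \<xi>))\<^sup>2) \<partial>lborel) / ennreal (2 * pi)"
    using divide_ennreal[of 1 "2 * pi"] ennreal_times_divide[of _ 1 "ennreal (2 * pi)"]
    by (simp only: mult.commute[of "ennreal (1 / (2 * pi))"]) simp
  finally show ?thesis .
qed

lemma cauchy_kernel_integrable:
  fixes \<gamma> :: real
  assumes \<gamma>: "\<gamma> > 0"
  shows "integrable lborel (\<lambda>x. \<gamma> / ((x - y)\<^sup>2 + \<gamma>\<^sup>2))"
    and "(\<integral>x. \<gamma> / ((x - y)\<^sup>2 + \<gamma>\<^sup>2) \<partial>lborel) = pi"
proof -
  have i1: "integrable lborel (\<lambda>x::real. inverse (1 + x\<^sup>2))"
    using integrable_inverse_1_plus_square by (simp add: set_integrable_def)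
  have v1: "(\<integral>x. inverse (1 + (x::real)\<^sup>2) \<partial>lborel) = pi"
    using LBINT_inverse_1_plus_square
    by (simp add: interval_lebesgue_integral_def set_lebesgue_integral_def)
  have e: "\<gamma> / ((x - y)\<^sup>2 + \<gamma>\<^sup>2) = inverse (1 + (- y / \<gamma> + (1 / \<gamma>) * x)\<^sup>2) / \<gamma>" for x
  proof -
    have "- y / \<gamma> + (1 / \<gamma>) * x = (x - y) / \<gamma>" using \<gamma> by (simp add: field_simps)
    moreover have "1 + ((x - y) / \<gamma>)\<^sup>2 = ((x - y)\<^sup>2 + \<gamma>\<^sup>2) / \<gamma>\<^sup>2"
      using \<gamma> by (simp only: power_divide) (simp add: add_divide_distrib)
    ultimately show ?thesis using \<gamma> by (simp only: inverse_divide) (simp add: power2_eq_square)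
  qed
  have i2: "integrable lborel (\<lambda>x. inverse (1 + (- y / \<gamma> + (1 / \<gamma>) * x)\<^sup>2))"
    using lborel_integrable_real_affine[OF i1, of "1 / \<gamma>" "- y / \<gamma>"] \<gamma> by simp
  thus "integrable lborel (\<lambda>x. \<gamma> / ((x - y)\<^sup>2 + \<gamma>\<^sup>2))" unfolding e by simp
  have "pi = \<bar>1 / \<gamma>\<bar> *\<^sub>R (\<integral>x. inverse (1 + (- y / \<gamma> + (1 / \<gamma>) * x)\<^sup>2) \<partial>lborel)"
    using lborel_integral_real_affine[of "1 / \<gamma>" "\<lambda>x. inverse (1 + x\<^sup>2)" "- y / \<gamma>"] \<gamma> v1 by simp
  thus "(\<integral>x. \<gamma> / ((x - y)\<^sup>2 + \<gamma>\<^sup>2) \<partial>lborel) = pi" unfolding e using \<gamma> by simp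
qed

text \<open>
  The two-sided exponential density is assembled from two such integrals.
\<close>
lemma exponential_half_line_transform:
  fixes \<gamma> :: real
  assumes \<gamma>: "\<gamma> > 0"
  shows "set_integrable lborel {0<..} (\<lambda>x. exp (- \<gamma> * x) *\<^sub>R iexp (x * \<xi>))"
    and "(CLINT x:{0<..}|lborel. exp (- \<gamma> * x) *\<^sub>R iexp (x * \<xi>)) = 1 / Complex \<gamma> (- \<xi>)"
proof -
  have m: "set_integrable lborel {0<..} (\<lambda>x. exp (- \<gamma> * x))"
  proof -
    have "set_integrable lborel (einterval 0 \<infinity>) (\<lambda>x. exp (- \<gamma> * x))"
    proof (rule interval_integral_FTC_nonneg[where F = "\<lambda>x. - exp (- \<gamma> * x) / \<gamma>" and A = "- 1 / \<gamma>" and B = 0])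
      show "(((\<lambda>x. - exp (- \<gamma> * x) / \<gamma>) \<circ> real_of_ereal) \<longlongrightarrow> - 1 / \<gamma>) (at_right 0)"
        unfolding zero_ereal_def ereal_tendsto_simps1
        by (rule tendsto_eq_intros refl | simp add: \<gamma>[THEN less_imp_neq, symmetric])+
      have "((\<lambda>x. exp (- \<gamma> * x)) \<longlongrightarrow> 0) at_top"
        by (rule filterlim_compose[OF exp_at_bot])
           (use \<gamma> in \<open>auto simp: filterlim_uminus_at_bot intro!: filterlim_tendsto_pos_mult_at_top[OF tendsto_const _ filterlim_ident]\<close>)
      from tendsto_divide[OF tendsto_minus[OF this] tendsto_const[of \<gamma>]]
      show "(((\<lambda>x. - exp (- \<gamma> * x) / \<gamma>) \<circ> real_of_ereal) \<longlongrightarrow> 0) (at_left \<infinity>)"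
        unfolding ereal_tendsto_simps1 using \<gamma> by simp
    qed (use \<gamma> in \<open>auto intro!: derivative_eq_intros\<close>)
    thus ?thesis by (simp add: zero_ereal_def)
  qed
  show i: "set_integrable lborel {0<..} (\<lambda>x. exp (- \<gamma> * x) *\<^sub>R iexp (x * \<xi>))"
    unfolding set_integrable_def
    by (rule Bochner_Integration.integrable_bound[OF m[unfolded set_integrable_def]])
       (auto simp: indicator_def)
  define c where "c = Complex (- \<gamma>) \<xi>"
  have c0: "c \<noteq> 0" using \<gamma> by (simp add: c_def complex_eq_iff)
  have ec: "exp (- \<gamma> * x) *\<^sub>R iexp (x * \<xi>) = exp (c * complex_of_real x)" for x
  proof -
    have "c * complex_of_real x = complex_of_real (- \<gamma> * x) + \<i> * complex_of_real (x * \<xi>)"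
      by (simp add: c_def Complex_eq algebra_simps)
    thus ?thesis by (simp only: exp_add exp_of_real scaleR_conv_of_real)
  qed
  have "(LBINT x=0..\<infinity>. exp (- \<gamma> * x) *\<^sub>R iexp (x * \<xi>)) = 0 - 1 / c"
  proof (rule interval_integral_FTC_integrable[where F = "\<lambda>x. exp (c * complex_of_real x) / c"])
    show "set_integrable lborel (einterval 0 \<infinity>) (\<lambda>x. exp (- \<gamma> * x) *\<^sub>R iexp (x * \<xi>))"
      using i by (simp add: zero_ereal_def)
    fix x :: real
    have "((\<lambda>z. exp (c * z) / c) has_field_derivative exp (c * complex_of_real x)) (at (complex_of_real x))"
      using c0 by (auto intro!: derivative_eq_intros)
    from has_vector_derivative_real_field[OF this, of UNIV]
    show "((\<lambda>x. exp (c * complex_of_real x) / c) has_vector_derivative exp (- \<gamma> * x) *\<^sub>R iexp (x * \<xi>)) (at x)"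
      by (simp only: ec)
    show "isCont (\<lambda>x. exp (- \<gamma> * x) *\<^sub>R iexp (x * \<xi>)) x" by (intro continuous_intros)
  next
    have "((\<lambda>x. exp (c * complex_of_real x) / c) \<longlongrightarrow> exp (c * complex_of_real 0) / c) (at_right 0)"
      by (intro tendsto_intros c0)
    thus "(((\<lambda>x. exp (c * complex_of_real x) / c) \<circ> real_of_ereal) \<longlongrightarrow> 1 / c) (at_right 0)"
      unfolding zero_ereal_def ereal_tendsto_simps1 by simp
    have "((\<lambda>x. exp (- \<gamma> * x)) \<longlongrightarrow> 0) at_top"
      by (rule filterlim_compose[OF exp_at_bot])
         (use \<gamma> in \<open>auto simp: filterlim_uminus_at_bot intro!: filterlim_tendsto_pos_mult_at_top[OF tendsto_const _ filterlim_ident]\<close>)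
    moreover have "norm (exp (c * complex_of_real x)) = exp (- \<gamma> * x)" for x
      by (simp add: c_def)
    ultimately have "((\<lambda>x. exp (c * complex_of_real x)) \<longlongrightarrow> 0) at_top"
      by (rule_tac tendsto_norm_zero_cancel) simp
    from tendsto_divide[OF this tendsto_const[of c] c0]
    show "(((\<lambda>x. exp (c * complex_of_real x) / c) \<circ> real_of_ereal) \<longlongrightarrow> 0) (at_left \<infinity>)"
      unfolding ereal_tendsto_simps1 by simp
  qed auto
  moreover have "- 1 / c = 1 / Complex \<gamma> (- \<xi>)"
    unfolding c_def by (simp add: complex_eq_iff Re_divide Im_divide)
  ultimately show "(CLINT x:{0<..}|lborel. exp (- \<gamma> * x) *\<^sub>R iexp (x * \<xi>)) = 1 / Complex \<gamma> (- \<xi>)"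
    by (simp add: interval_lebesgue_integral_def zero_ereal_def)
qed

text \<open>
  The transform of the Laplace density is, up to scaling, the Cauchy kernel. Inverting it yields
  the transform of the Cauchy kernel.
\<close>
lemma fourier_laplace_density:
  fixes \<gamma> :: real
  assumes \<gamma>: "\<gamma> > 0"
  shows "integrable lborel (\<lambda>x. \<gamma> / 2 * exp (- \<gamma> * \<bar>x\<bar>))"
    and "fourier (\<lambda>x. \<gamma> / 2 * exp (- \<gamma> * \<bar>x\<bar>)) \<xi> = complex_of_real (\<gamma>\<^sup>2 / (\<xi>\<^sup>2 + \<gamma>\<^sup>2))"
proof -
  let ?h = "\<lambda>\<xi> x. indicator {0<..} x *\<^sub>R (exp (- \<gamma> * x) *\<^sub>R iexp (x * \<xi>))"
  have h: "integrable lborel (?h \<xi>)" for \<xi>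
    using exponential_half_line_transform(1)[OF \<gamma>, of \<xi>] by (simp add: set_integrable_def)
  have h': "integrable lborel (\<lambda>x. ?h \<xi> (0 + (-1) * x))" for \<xi>
    by (rule lborel_integrable_real_affine[OF h]) simp
  have split: "complex_of_real (\<gamma> / 2 * exp (- \<gamma> * \<bar>x\<bar>)) * iexp (x * \<xi>)
      = complex_of_real (\<gamma> / 2) * (?h \<xi> x + ?h (- \<xi>) (0 + (-1) * x))" if "x \<noteq> 0" for x \<xi>
    using that by (auto simp: indicator_def scaleR_conv_of_real mult.assoc exp_of_real[symmetric])
  have H: "(\<integral>x. ?h \<xi> x \<partial>lborel) = 1 / Complex \<gamma> (- \<xi>)" for \<xi>
    using exponential_half_line_transform(2)[OF \<gamma>, of \<xi>] by (simp add: set_lebesgue_integral_def)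
  have H': "(\<integral>x. ?h (- \<xi>) (0 + (-1) * x) \<partial>lborel) = 1 / Complex \<gamma> \<xi>" for \<xi>
    using lborel_integral_real_affine[of "-1" "?h (- \<xi>)" 0] H[of "- \<xi>"] by simp
  have int: "integrable lborel (\<lambda>x. complex_of_real (\<gamma> / 2 * exp (- \<gamma> * \<bar>x\<bar>)) * iexp (x * \<xi>))" for \<xi>
  proof (rule Bochner_Integration.integrable_cong_AE[THEN iffD2])
    show "AE x in lborel. complex_of_real (\<gamma> / 2 * exp (- \<gamma> * \<bar>x\<bar>)) * iexp (x * \<xi>)
      = complex_of_real (\<gamma> / 2) * (?h \<xi> x + ?h (- \<xi>) (0 + (-1) * x))"
      by (rule AE_I[of _ _ "{0}"]) (use split in auto)
    show "integrable lborel (\<lambda>x. complex_of_real (\<gamma> / 2) * (?h \<xi> x + ?h (- \<xi>) (0 + (-1) * x)))"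
      by (intro integrable_mult_right Bochner_Integration.integrable_add h h')
  qed measurable
  have "integrable lborel (\<lambda>x. complex_of_real (\<gamma> / 2 * exp (- \<gamma> * \<bar>x\<bar>)))"
    using int[of 0] by simp
  thus "integrable lborel (\<lambda>x. \<gamma> / 2 * exp (- \<gamma> * \<bar>x\<bar>))"
    by (rule complex_of_real_integrable_eq[THEN iffD1])
  have "fourier (\<lambda>x. \<gamma> / 2 * exp (- \<gamma> * \<bar>x\<bar>)) \<xi>
     = (\<integral>x. complex_of_real (\<gamma> / 2) * (?h \<xi> x + ?h (- \<xi>) (0 + (-1) * x)) \<partial>lborel)"
    unfolding fourier_def
  proof (rule integral_cong_AE)
    show "AE x in lborel. complex_of_real (\<gamma> / 2 * exp (- \<gamma> * \<bar>x\<bar>)) * iexp (x * \<xi>)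
      = complex_of_real (\<gamma> / 2) * (?h \<xi> x + ?h (- \<xi>) (0 + (-1) * x))"
      by (rule AE_I[of _ _ "{0}"]) (use split in auto)
  qed measurable
  also have "\<dots> = complex_of_real (\<gamma> / 2) * (1 / Complex \<gamma> (- \<xi>) + 1 / Complex \<gamma> \<xi>)"
    by (subst Bochner_Integration.integral_mult_right[OF Bochner_Integration.integrable_add[OF h h']],
        subst Bochner_Integration.integral_add[OF h h']) (simp only: H H')
  also have "\<dots> = complex_of_real (\<gamma>\<^sup>2 / (\<xi>\<^sup>2 + \<gamma>\<^sup>2))"
  proof -
    have u: "Complex \<gamma> (- \<xi>) * Complex \<gamma> \<xi> = complex_of_real (\<xi>\<^sup>2 + \<gamma>\<^sup>2)"
      "Complex \<gamma> (- \<xi>) + Complex \<gamma> \<xi> = complex_of_real (2 * \<gamma>)"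
      by (simp_all add: complex_eq_iff power2_eq_square)
    have n: "Complex \<gamma> (- \<xi>) \<noteq> 0" "Complex \<gamma> \<xi> \<noteq> 0" using \<gamma> by (simp_all add: complex_eq_iff)
    have "1 / Complex \<gamma> (- \<xi>) + 1 / Complex \<gamma> \<xi>
        = (Complex \<gamma> (- \<xi>) + Complex \<gamma> \<xi>) / (Complex \<gamma> (- \<xi>) * Complex \<gamma> \<xi>)"
      using n by (simp add: add_divide_distrib)
    thus ?thesis
      by (simp only: u of_real_mult[symmetric] of_real_divide[symmetric]) (simp add: power2_eq_square)
  qed
  finally show "fourier (\<lambda>x. \<gamma> / 2 * exp (- \<gamma> * \<bar>x\<bar>)) \<xi> = complex_of_real (\<gamma>\<^sup>2 / (\<xi>\<^sup>2 + \<gamma>\<^sup>2))" .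
qed

lemma fourier_cauchy_kernel:
  fixes \<gamma> :: real
  assumes \<gamma>: "\<gamma> > 0"
  shows "AE \<xi> in lborel. fourier (\<lambda>x. \<gamma> / (x\<^sup>2 + \<gamma>\<^sup>2)) \<xi> = complex_of_real (pi * exp (- \<gamma> * \<bar>\<xi>\<bar>))"
proof -
  let ?p = "\<lambda>x. \<gamma> / 2 * exp (- \<gamma> * \<bar>x\<bar>)"
  have F: "fourier ?p = (\<lambda>\<xi>. complex_of_real (\<gamma>\<^sup>2 / (\<xi>\<^sup>2 + \<gamma>\<^sup>2)))"
    by (rule ext) (rule fourier_laplace_density(2)[OF \<gamma>])
  have "fourier ?p 0 = complex_of_real (integral\<^sup>L lborel ?p)"
    unfolding fourier_def
    by (simp only: mult_zero_right of_real_0 exp_zero mult_1_right integral_complex_of_real)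
  moreover have "fourier ?p 0 = 1" using \<gamma> by (subst fourier_laplace_density(2)[OF \<gamma>]) simp
  ultimately have "integral\<^sup>L lborel ?p = 1" by (metis of_real_eq_1_iff)
  hence p1: "(\<integral>\<^sup>+x. ennreal (?p x) \<partial>lborel) = 1"
    using \<gamma> fourier_laplace_density(1)[OF \<gamma>] by (subst nn_integral_eq_integral) auto
  have "integrable lborel (\<lambda>x. \<gamma> * (\<gamma> / ((x - 0)\<^sup>2 + \<gamma>\<^sup>2)))"
    by (rule integrable_mult_right) (rule cauchy_kernel_integrable(1)[OF \<gamma>])
  hence Fi: "integrable lborel (fourier ?p)"
    unfolding F by (intro integrable_of_real) (simp add: power2_eq_square)
  have "AE \<xi> in lborel. inverse_fourier (fourier ?p) \<xi> = complex_of_real (?p \<xi>)"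
    by (rule fourier_inversion_density[OF _ _ p1 Fi]) (use \<gamma> in auto)
  thus ?thesis
  proof eventually_elim
    case (elim \<xi>)
    have "fourier (\<lambda>x. \<gamma> / (x\<^sup>2 + \<gamma>\<^sup>2)) \<xi> = cnj (FT (\<lambda>x. complex_of_real (\<gamma> / (x\<^sup>2 + \<gamma>\<^sup>2))) \<xi>)"
      by (rule fourier_eq_cnj_FT)
    also have "FT (\<lambda>x. complex_of_real (\<gamma> / (x\<^sup>2 + \<gamma>\<^sup>2))) \<xi> = FT (fourier ?p) \<xi> / complex_of_real \<gamma>"
      unfolding F by (subst integral_divide_zero[symmetric], intro Bochner_Integration.integral_cong refl)
        (use \<gamma> in \<open>simp add: power2_eq_square\<close>)
    also have "FT (fourier ?p) \<xi> = complex_of_real (2 * pi) * complex_of_real (?p \<xi>)"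
      using elim by (simp add: inverse_fourier_def field_simps)
    finally show ?case using \<gamma> by simp
  qed
qed

text \<open>
  Poisson smoothing at height \<open>\<gamma>\<close> is convolution with the Cauchy kernel, and so multiplies the
  transform by \<open>\<pi> exp (- \<gamma> \<bar>\<xi>\<bar>)\<close>. The estimator inverts this factor.
\<close>
lemma fourier_poisson_smoothing:
  fixes \<gamma> :: real and p :: "real \<Rightarrow> real"
  assumes \<gamma>: "\<gamma> > 0" and p: "integrable lborel p"
  defines "g \<equiv> \<lambda>x. \<integral>y. p y * (\<gamma> / ((x - y)\<^sup>2 + \<gamma>\<^sup>2)) \<partial>lborel"
  shows "integrable lborel g"
    and "AE \<xi> in lborel. fourier g \<xi> = complex_of_real (pi * exp (- \<gamma> * \<bar>\<xi>\<bar>)) * fourier p \<xi>"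
proof -
  from p have [measurable]: "p \<in> borel_measurable lborel" by auto
  let ?k = "\<lambda>x y. \<gamma> / ((x - y)\<^sup>2 + \<gamma>\<^sup>2)"
  have k0: "?k x y \<ge> 0" for x y using \<gamma> by simp
  have intr: "integrable (lborel \<Otimes>\<^sub>M lborel) (\<lambda>(y, x). p y * ?k x y)"
  proof (rule lborel_pair.Fubini_integrable)
    have "(\<integral>x. norm (p y * ?k x y) \<partial>lborel) = \<bar>p y\<bar> * pi" for y
    proof -
      have "norm (p y * ?k x y) = \<bar>p y\<bar> * ?k x y" for x
        using k0 by (simp only: real_norm_def abs_mult abs_of_nonneg)
      thus ?thesis
        by (simp only: Bochner_Integration.integral_mult_right_zero cauchy_kernel_integrable(2)[OF \<gamma>])
    qed
    thus "integrable lborel (\<lambda>y. \<integral>x. norm (case (y, x) of (y, x) \<Rightarrow> p y * ?k x y) \<partial>lborel)"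
      using p by simp
    show "AE y in lborel. integrable lborel (\<lambda>x. case (y, x) of (y, x) \<Rightarrow> p y * ?k x y)"
      unfolding case_prod_conv
      by (intro AE_I2 Bochner_Integration.integrable_mult_right cauchy_kernel_integrable(1)[OF \<gamma>])
  qed measurable
  have swp: "integrable (lborel \<Otimes>\<^sub>M lborel) (\<lambda>(x, y). p y * ?k x y)"
    using lborel_pair.integrable_product_swap[OF intr] by simp
  show "integrable lborel g"
    unfolding g_def using lborel_pair.integrable_fst'[OF swp] by simp
  have conv: "fourier g \<xi> = fourier (\<lambda>x. \<gamma> / (x\<^sup>2 + \<gamma>\<^sup>2)) \<xi> * fourier p \<xi>" for \<xi>
  proof -
    have int: "integrable (lborel \<Otimes>\<^sub>M lborel) (\<lambda>(x, y). complex_of_real (p y * ?k x y) * iexp (x * \<xi>))"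
    proof -
      have "integrable (lborel \<Otimes>\<^sub>M lborel) (\<lambda>z. complex_of_real (case z of (x, y) \<Rightarrow> p y * ?k x y) * iexp (fst z * \<xi>))"
        using swp by (intro integrable_mult_bounded[where C = 1] integrable_of_real) (simp_all, measurable)
      thus ?thesis by (simp only: split_beta')
    qed
    have "fourier g \<xi> = (\<integral>x. (\<integral>y. complex_of_real (p y * ?k x y) * iexp (x * \<xi>) \<partial>lborel) \<partial>lborel)"
      unfolding fourier_def g_def
      by (simp only: Bochner_Integration.integral_mult_left_zero integral_complex_of_real)
    also have "\<dots> = (\<integral>y. (\<integral>x. complex_of_real (p y * ?k x y) * iexp (x * \<xi>) \<partial>lborel) \<partial>lborel)"
      by (rule lborel_pair.Fubini_integral[symmetric, OF int])
    also have "\<dots> = (\<integral>y. fourier (\<lambda>x. \<gamma> / (x\<^sup>2 + \<gamma>\<^sup>2)) \<xi> * (complex_of_real (p y) * iexp (y * \<xi>)) \<partial>lborel)"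
    proof (intro Bochner_Integration.integral_cong refl)
      fix y :: real
      have "(\<integral>x. complex_of_real (p y * ?k x y) * iexp (x * \<xi>) \<partial>lborel)
          = (\<integral>x. complex_of_real (p y * ?k (y + 1 * x) y) * iexp ((y + 1 * x) * \<xi>) \<partial>lborel)"
        by (subst lborel_integral_real_affine[of 1 _ y]) simp_all
      also have "\<dots> = (\<integral>x. (complex_of_real (p y) * iexp (y * \<xi>)) *
           (complex_of_real (\<gamma> / (x\<^sup>2 + \<gamma>\<^sup>2)) * iexp (x * \<xi>)) \<partial>lborel)"
        by (intro Bochner_Integration.integral_cong refl) (simp add: algebra_simps exp_add)
      also have "\<dots> = fourier (\<lambda>x. \<gamma> / (x\<^sup>2 + \<gamma>\<^sup>2)) \<xi> * (complex_of_real (p y) * iexp (y * \<xi>))"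
        unfolding fourier_def by (subst integral_mult_right_zero) (rule mult.commute)
      finally show "(\<integral>x. complex_of_real (p y * ?k x y) * iexp (x * \<xi>) \<partial>lborel)
        = fourier (\<lambda>x. \<gamma> / (x\<^sup>2 + \<gamma>\<^sup>2)) \<xi> * (complex_of_real (p y) * iexp (y * \<xi>))" .
    qed
    also have "\<dots> = fourier (\<lambda>x. \<gamma> / (x\<^sup>2 + \<gamma>\<^sup>2)) \<xi> * fourier p \<xi>"
      unfolding fourier_def by (rule integral_mult_right_zero)
    finally show ?thesis .
  qed
  show "AE \<xi> in lborel. fourier g \<xi> = complex_of_real (pi * exp (- \<gamma> * \<bar>\<xi>\<bar>)) * fourier p \<xi>"
    using fourier_cauchy_kernel[OF \<gamma>] by eventually_elim (simp only: conv)
qed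

section \<open>Stieltjes transforms and the fixed point equation\<close>

definition stieltjes :: "nat \<Rightarrow> (nat \<Rightarrow> real) \<Rightarrow> complex \<Rightarrow> complex" where
  "stieltjes n lam w = (\<Sum>j<n. 1 / (w - complex_of_real (lam j))) / of_nat n"

lemma Im_le_dist_real: "\<bar>Im w\<bar> \<le> cmod (w - complex_of_real x)"
  using abs_Im_le_cmod[of "w - complex_of_real x"] by simp

lemma norm_average_le:
  fixes f :: "nat \<Rightarrow> complex"
  assumes "\<And>j. j < n \<Longrightarrow> cmod (f j) \<le> c" and "0 \<le> c"
  shows "cmod ((\<Sum>j<n. f j) / of_nat n) \<le> c"
proof (cases "n = 0")
  case False
  have "cmod (\<Sum>j<n. f j) \<le> real (card {..<n}) * c"
    by (rule sum_norm_bound) (use assms in auto)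
  thus ?thesis using False by (simp add: norm_divide field_simps)
qed (use assms in auto)

lemma cmod_stieltjes_le:
  assumes "0 < Im w"
  shows "cmod (stieltjes n lam w) \<le> 1 / Im w"
  unfolding stieltjes_def
proof (rule norm_average_le)
  fix j
  have "Im w \<le> cmod (w - complex_of_real (lam j))" using Im_le_dist_real[of w "lam j"] by simp
  thus "cmod (1 / (w - complex_of_real (lam j))) \<le> 1 / Im w"
    using assms by (simp add: norm_divide frac_le)
qed (use assms in auto)

lemma stieltjes_lipschitz:
  assumes w: "0 < Im w" and w': "0 < Im w'"
  shows "cmod (stieltjes n lam w - stieltjes n lam w') \<le> cmod (w - w') / (Im w * Im w')"
proof -
  have "stieltjes n lam w - stieltjes n lam w'
     = (\<Sum>j<n. 1 / (w - complex_of_real (lam j)) - 1 / (w' - complex_of_real (lam j))) / of_nat n"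
    by (simp add: stieltjes_def sum_subtractf diff_divide_distrib)
  also have "cmod \<dots> \<le> cmod (w - w') / (Im w * Im w')"
  proof (rule norm_average_le)
    fix j
    let ?l = "complex_of_real (lam j)"
    have b: "Im w \<le> cmod (w - ?l)" "Im w' \<le> cmod (w' - ?l)"
      using Im_le_dist_real[of w "lam j"] Im_le_dist_real[of w' "lam j"] by auto
    hence "w - ?l \<noteq> 0" "w' - ?l \<noteq> 0" using w w' by auto
    hence "1 / (w - ?l) - 1 / (w' - ?l) = (w' - w) / ((w - ?l) * (w' - ?l))"
      by (simp add: field_simps)
    hence "cmod (1 / (w - ?l) - 1 / (w' - ?l)) = cmod (w - w') / (cmod (w - ?l) * cmod (w' - ?l))"
      by (simp add: norm_divide norm_mult norm_minus_commute)
    also have "\<dots> \<le> cmod (w - w') / (Im w * Im w')"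
      using b w w' by (intro divide_left_mono mult_mono mult_pos_pos) auto
    finally show "cmod (1 / (w - ?l) - 1 / (w' - ?l)) \<le> cmod (w - w') / (Im w * Im w')" .
  qed (use w w' in auto)
  finally show ?thesis .
qed

lemma Im_stieltjes:
  "- Im (stieltjes n lam w) = (\<Sum>j<n. Im w / (cmod (w - complex_of_real (lam j)))\<^sup>2) / real n"
proof (cases "n = 0")
  case False
  have "Im (stieltjes n lam w) = (\<Sum>j<n. - (Im w / (cmod (w - complex_of_real (lam j)))\<^sup>2)) / real n"
    unfolding stieltjes_def Im_divide_of_nat by (simp add: Im_divide cmod_power2)
  thus ?thesis by (simp add: sum_negf)
qed (simp add: stieltjes_def)

text \<open>
  The two bounds of a Stieltjes transform of a probability measure on which the fixed point argument rests.
\<close>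
definition stieltjes_like :: "(complex \<Rightarrow> complex) \<Rightarrow> bool" where
  "stieltjes_like G \<longleftrightarrow> (\<forall>w. 0 < Im w \<longrightarrow> cmod (G w) \<le> 1 / Im w) \<and>
     (\<forall>w w'. 0 < Im w \<longrightarrow> 0 < Im w' \<longrightarrow> cmod (G w - G w') \<le> cmod (w - w') / (Im w * Im w'))"

lemma stieltjes_like_stieltjes: "stieltjes_like (stieltjes n lam)"
  by (simp add: stieltjes_like_def cmod_stieltjes_le stieltjes_lipschitz)

context
  fixes t \<gamma> :: real and G :: "complex \<Rightarrow> complex"
  assumes t: "0 < t" and \<gamma>: "2 * sqrt t < \<gamma>" and G: "stieltjes_like G"
begin

lemma gamma_facts: "0 < \<gamma>" "4 * t < \<gamma>\<^sup>2" "4 * t / \<gamma>\<^sup>2 < 1"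
proof -
  have s: "0 < sqrt t" using t by simp
  show g: "0 < \<gamma>" using s \<gamma> by linarith
  have "(2 * sqrt t)\<^sup>2 < \<gamma>\<^sup>2" using \<gamma> s by (intro power_strict_mono) auto
  thus "4 * t < \<gamma>\<^sup>2" using t by (simp add: power_mult_distrib)
  thus "4 * t / \<gamma>\<^sup>2 < 1" using g by simp
qed

text \<open>
  In the half-plane \<open>Im w \<ge> \<gamma> / 2\<close> the Lipschitz constant is \<open>t * (2 / \<gamma>)\<^sup>2\<close>, which is below \<open>1\<close> exactly when
  \<open>\<gamma> > 2 * sqrt t\<close>.
\<close>
lemma half_plane_contraction:
  assumes "\<gamma> / 2 \<le> Im v" "\<gamma> / 2 \<le> Im w"
  shows "t * cmod (G v - G w) \<le> 4 * t / \<gamma>\<^sup>2 * cmod (v - w)"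
proof -
  have g: "0 < \<gamma>" by (rule gamma_facts)
  have "cmod (G v - G w) \<le> cmod (v - w) / (Im v * Im w)"
    using G assms g by (auto simp: stieltjes_like_def)
  also have "\<dots> \<le> cmod (v - w) / (\<gamma> / 2 * (\<gamma> / 2))"
    using assms g by (intro divide_left_mono mult_mono mult_pos_pos) auto
  finally have "t * cmod (G v - G w) \<le> t * (cmod (v - w) / (\<gamma> / 2 * (\<gamma> / 2)))"
    using t by (intro mult_left_mono) auto
  thus ?thesis by (simp add: power2_eq_square mult_ac)
qed

lemma half_plane_invariant:
  assumes z: "Im z = \<gamma>" and w: "\<gamma> / 2 \<le> Im w"
  shows "\<gamma> / 2 < Im (z + t * G w)"
proof -
  have g: "0 < \<gamma>" by (rule gamma_facts)
  have "cmod (G w) \<le> 1 / Im w" using G w g by (auto simp: stieltjes_like_def)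
  also have "\<dots> \<le> 1 / (\<gamma> / 2)" using w g by (intro divide_left_mono) auto
  finally have "\<bar>Im (G w)\<bar> \<le> 2 / \<gamma>" using abs_Im_le_cmod[of "G w"] by simp
  hence "t * \<bar>Im (G w)\<bar> \<le> t * (2 / \<gamma>)" using t by (intro mult_left_mono) auto
  moreover have "t * (2 / \<gamma>) < \<gamma> / 2" using gamma_facts by (simp add: field_simps power2_eq_square)
  moreover have "\<bar>t * Im (G w)\<bar> = t * \<bar>Im (G w)\<bar>" using t by (simp add: abs_mult)
  ultimately show ?thesis using z by (auto simp: abs_le_iff)
qed

lemma fixed_point_unique_exists:
  assumes z: "Im z = \<gamma>"
  shows "\<exists>!w. Im w > Im z / 2 \<and> (w - z) / complex_of_real t = G w"
proof -
  have eqv: "(w - z) / complex_of_real t = G w \<longleftrightarrow> z + t * G w = w" for w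
    using t by (auto simp: field_simps)
  let ?S = "{w. \<gamma> / 2 \<le> Im w}"
  have ex: "\<exists>!w\<in>?S. z + t * G w = w"
  proof (rule Banach_fix[where c = "4 * t / \<gamma>\<^sup>2"])
    show "Topological_Spaces.complete ?S"
      by (intro complete_eq_closed[THEN iffD2] closed_Collect_le continuous_intros)
    show "?S \<noteq> {}" by (auto intro!: exI[of _ "Complex 0 (\<gamma>/2)"])
    show "0 \<le> 4 * t / \<gamma>\<^sup>2" using t by simp
    show "4 * t / \<gamma>\<^sup>2 < 1" by (rule gamma_facts)
    show "(\<lambda>w. z + t * G w) ` ?S \<subseteq> ?S" using half_plane_invariant[OF z] by (auto intro: less_imp_le)
    show "dist (z + t * G v) (z + t * G w) \<le> 4 * t / \<gamma>\<^sup>2 * dist v w" if "v \<in> ?S" "w \<in> ?S" for v w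
    proof -
      have "dist (z + t * G v) (z + t * G w) = t * cmod (G v - G w)"
        using t by (simp add: dist_norm norm_mult flip: right_diff_distrib)
      thus ?thesis using half_plane_contraction[of v w] that by (simp add: dist_norm)
    qed
  qed
  have "Im w > Im z / 2 \<and> (w - z) / complex_of_real t = G w \<longleftrightarrow> w \<in> ?S \<and> z + t * G w = w" for w
    unfolding eqv mem_Collect_eq z using half_plane_invariant[OF z, of w] by (metis less_imp_le)
  thus ?thesis using ex by simp
qed

lemma w_fp_properties:
  assumes z: "Im z = \<gamma>"
  shows "\<gamma> / 2 < Im (w_fp t G z)" "w_fp t G z = z + t * G (w_fp t G z)"
  using theI'[OF fixed_point_unique_exists[OF z]] z t
  unfolding w_fp_def[symmetric] by (auto simp: field_simps)

text \<open>
  The usual a posteriori estimate for a contraction: a point that almost solves the equation is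
  close to the solution.
\<close>
lemma w_fp_stability:
  assumes z: "Im z = \<gamma>" and v: "\<gamma> / 2 \<le> Im v"
  shows "cmod (w_fp t G z - v) \<le> cmod (z + t * G v - v) / (1 - 4 * t / \<gamma>\<^sup>2)"
proof -
  let ?w = "w_fp t G z"
  have "?w - v = t * (G ?w - G v) + (z + t * G v - v)"
    using w_fp_properties(2)[OF z] by (simp add: algebra_simps)
  hence "cmod (?w - v) \<le> t * cmod (G ?w - G v) + cmod (z + t * G v - v)"
    using norm_triangle_ineq[of "t * (G ?w - G v)" "z + t * G v - v"] t
    by (simp only: norm_mult norm_of_real abs_of_pos)
  also have "t * cmod (G ?w - G v) \<le> 4 * t / \<gamma>\<^sup>2 * cmod (?w - v)"
    using half_plane_contraction[of ?w v] w_fp_properties(1)[OF z] v by simp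
  finally have "(1 - 4 * t / \<gamma>\<^sup>2) * cmod (?w - v) \<le> cmod (z + t * G v - v)"
    by (simp add: algebra_simps)
  thus ?thesis using gamma_facts(3) by (simp add: pos_le_divide_eq mult.commute)
qed

lemma w_fp_lipschitz:
  assumes z: "Im z = \<gamma>" and z': "Im z' = \<gamma>"
  shows "cmod (w_fp t G z - w_fp t G z') \<le> cmod (z - z') / (1 - 4 * t / \<gamma>\<^sup>2)"
proof -
  have "cmod (w_fp t G z - w_fp t G z')
      \<le> cmod (z + t * G (w_fp t G z') - w_fp t G z') / (1 - 4 * t / \<gamma>\<^sup>2)"
    using w_fp_properties(1)[OF z'] by (intro w_fp_stability z) simp
  also have "z + t * G (w_fp t G z') - w_fp t G z' = z - z'"
    using w_fp_properties(2)[OF z'] by (simp add: algebra_simps)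
  finally show ?thesis .
qed

text \<open>
  Continuity in \<open>x\<close> provides the measurability of the function whose transform the estimator uses.
\<close>
lemma w_fp_continuous: "continuous_on UNIV (\<lambda>x. w_fp t G (Complex x \<gamma>))"
proof (rule lipschitz_on_continuous_on)
  show "(1 / (1 - 4 * t / \<gamma>\<^sup>2))-lipschitz_on UNIV (\<lambda>x. w_fp t G (Complex x \<gamma>))"
  proof (rule lipschitz_onI)
    fix x y :: real
    have "Complex x \<gamma> - Complex y \<gamma> = complex_of_real (x - y)" by (simp add: complex_eq_iff)
    thus "dist (w_fp t G (Complex x \<gamma>)) (w_fp t G (Complex y \<gamma>)) \<le> 1 / (1 - 4 * t / \<gamma>\<^sup>2) * dist x y"
      using w_fp_lipschitz[of "Complex x \<gamma>" "Complex y \<gamma>"]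
      by (simp only: dist_norm norm_of_real) simp
  qed (use gamma_facts(3) in auto)
qed

end

lemma dist_shift_le:
  assumes "cmod (w - z) \<le> c * Im w" "0 < Im w"
  shows "cmod (z - complex_of_real x) \<le> (1 + c) * cmod (w - complex_of_real x)"
proof -
  have c: "0 \<le> c" using assms norm_ge_zero[of "w - z"] by (metis mult_less_0_iff not_le order_trans zero_less_mult_pos2 mult_neg_pos)
  have "cmod (z - complex_of_real x) \<le> cmod (w - complex_of_real x) + cmod (w - z)"
    using norm_triangle_ineq4[of "w - complex_of_real x" "w - z"] by simp
  also have "cmod (w - z) \<le> c * cmod (w - complex_of_real x)"
    using assms Im_le_dist_real[of w x] c by (intro order_trans[OF assms(1)] mult_left_mono) auto
  finally show ?thesis by (simp add: algebra_simps)
qed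

text \<open>
  The Poisson kernels that arise at a random point \<open>w\<close> near \<open>z\<close> are dominated by those at \<open>z\<close>, whose
  integral over a horizontal line is known.
\<close>
lemma inverse_square_shift_le:
  assumes "cmod (w - z) \<le> c * Im w" "0 < Im w" "0 < Im z"
  shows "1 / (cmod (w - complex_of_real x))\<^sup>2 \<le> (1 + c)\<^sup>2 / (cmod (z - complex_of_real x))\<^sup>2"
proof -
  let ?u = "cmod (w - complex_of_real x)" and ?v = "cmod (z - complex_of_real x)"
  have u: "0 < ?u" and v: "0 < ?v"
    using Im_le_dist_real[of w x] Im_le_dist_real[of z x] assms by linarith+
  have "?v\<^sup>2 \<le> ((1 + c) * ?u)\<^sup>2"
    using dist_shift_le[OF assms(1,2), of x] by (intro power_mono) auto
  thus ?thesis using u v by (simp only: power_mult_distrib) (simp add: field_simps)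
qed

section \<open>Resolvents of Hermitian matrices\<close>

text \<open>
  Matrices are functions of two indices of which only those below \<open>n\<close> matter. Sums, products and
  measurability are then pointwise, while determinants and characteristic polynomials are taken
  after conversion to the type \<open>mat\<close>.
\<close>
definition mm :: "nat \<Rightarrow> (nat \<Rightarrow> nat \<Rightarrow> complex) \<Rightarrow> (nat \<Rightarrow> nat \<Rightarrow> complex) \<Rightarrow> nat \<Rightarrow> nat \<Rightarrow> complex" where
  "mm n X Y i j = (\<Sum>k<n. X i k * Y k j)"

definition tr :: "nat \<Rightarrow> (nat \<Rightarrow> nat \<Rightarrow> complex) \<Rightarrow> complex" where
  "tr n X = (\<Sum>i<n. X i i)"

text \<open>
  The Frobenius norm.
\<close>
definition fro :: "nat \<Rightarrow> (nat \<Rightarrow> nat \<Rightarrow> complex) \<Rightarrow> real" where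
  "fro n X = L2_set (\<lambda>(i, j). cmod (X i j)) ({..<n} \<times> {..<n})"

lemma mm_assoc: "mm n (mm n X Y) Z = mm n X (mm n Y Z)"
proof (intro ext)
  fix i j
  have "mm n (mm n X Y) Z i j = (\<Sum>k<n. \<Sum>l<n. X i l * Y l k * Z k j)"
    by (simp add: mm_def sum_distrib_right)
  also have "\<dots> = (\<Sum>l<n. \<Sum>k<n. X i l * Y l k * Z k j)" by (rule sum.swap)
  also have "\<dots> = mm n X (mm n Y Z) i j" by (simp add: mm_def sum_distrib_left mult.assoc)
  finally show "mm n (mm n X Y) Z i j = mm n X (mm n Y Z) i j" .
qed

lemma mm_add_right: "mm n X (\<lambda>i j. Y i j + Z i j) = (\<lambda>i j. mm n X Y i j + mm n X Z i j)"
  by (intro ext) (simp add: mm_def distrib_left sum.distrib)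

lemma mm_add_left: "mm n (\<lambda>i j. Y i j + Z i j) X = (\<lambda>i j. mm n Y X i j + mm n Z X i j)"
  by (intro ext) (simp add: mm_def distrib_right sum.distrib)

lemma tr_add: "tr n (\<lambda>i j. X i j + Y i j) = tr n X + tr n Y"
  by (simp add: tr_def sum.distrib)

lemma tr_cmult: "tr n (\<lambda>i j. c * X i j) = c * tr n X"
  by (simp add: tr_def sum_distrib_left)

lemma tr_mm_commute: "tr n (mm n X Y) = tr n (mm n Y X)"
  unfolding tr_def mm_def by (subst sum.swap) (simp add: mult.commute)

lemma fro_nonneg: "0 \<le> fro n X"
  by (simp add: fro_def L2_set_nonneg)

lemma fro_power2: "(fro n X)\<^sup>2 = (\<Sum>i<n. \<Sum>j<n. (cmod (X i j))\<^sup>2)"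
  unfolding fro_def L2_set_def
  by (subst real_sqrt_pow2) (auto simp: sum.cartesian_product case_prod_beta intro!: sum_nonneg)

lemma cmod_sum_mult_le:
  fixes f g :: "nat \<Rightarrow> complex"
  shows "(cmod (\<Sum>k<n. f k * g k))\<^sup>2 \<le> (\<Sum>k<n. (cmod (f k))\<^sup>2) * (\<Sum>k<n. (cmod (g k))\<^sup>2)"
proof -
  have "cmod (\<Sum>k<n. f k * g k) \<le> (\<Sum>k<n. cmod (f k) * cmod (g k))"
    by (rule order_trans[OF norm_sum]) (simp add: norm_mult)
  hence "(cmod (\<Sum>k<n. f k * g k))\<^sup>2 \<le> (\<Sum>k<n. cmod (f k) * cmod (g k))\<^sup>2"
    by (intro power_mono) auto
  also have "\<dots> \<le> (\<Sum>k<n. (cmod (f k))\<^sup>2) * (\<Sum>k<n. (cmod (g k))\<^sup>2)"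
    by (rule Cauchy_Schwarz_ineq_sum)
  finally show ?thesis .
qed

lemma fro_mm: "fro n (mm n X Y) \<le> fro n X * fro n Y"
proof (rule power2_le_imp_le)
  have "(fro n (mm n X Y))\<^sup>2 \<le> (\<Sum>i<n. \<Sum>j<n. (\<Sum>k<n. (cmod (X i k))\<^sup>2) * (\<Sum>k<n. (cmod (Y k j))\<^sup>2))"
    unfolding fro_power2 mm_def by (intro sum_mono cmod_sum_mult_le)
  also have "\<dots> = (\<Sum>i<n. \<Sum>k<n. (cmod (X i k))\<^sup>2) * (\<Sum>j<n. \<Sum>k<n. (cmod (Y k j))\<^sup>2)"
    by (simp add: sum_product)
  also have "(\<Sum>j<n. \<Sum>k<n. (cmod (Y k j))\<^sup>2) = (\<Sum>k<n. \<Sum>j<n. (cmod (Y k j))\<^sup>2)" by (rule sum.swap)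
  finally show "(fro n (mm n X Y))\<^sup>2 \<le> (fro n X * fro n Y)\<^sup>2"
    by (simp add: fro_power2 power_mult_distrib)
qed (simp add: fro_nonneg)

lemma cmod_tr_mm_le: "cmod (tr n (mm n X Y)) \<le> fro n X * fro n Y"
proof -
  have "tr n (mm n X Y) = (\<Sum>z\<in>{..<n} \<times> {..<n}. X (fst z) (snd z) * Y (snd z) (fst z))"
    by (simp add: tr_def mm_def sum.cartesian_product case_prod_beta)
  also have "cmod \<dots> \<le> (\<Sum>z\<in>{..<n} \<times> {..<n}. \<bar>cmod (X (fst z) (snd z))\<bar> * \<bar>cmod (Y (snd z) (fst z))\<bar>)"
    by (rule order_trans[OF norm_sum]) (simp add: norm_mult)
  also have "\<dots> \<le> L2_set (\<lambda>z. cmod (X (fst z) (snd z))) ({..<n} \<times> {..<n})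
      * L2_set (\<lambda>z. cmod (Y (snd z) (fst z))) ({..<n} \<times> {..<n})"
    by (rule L2_set_mult_ineq)
  also have "L2_set (\<lambda>z. cmod (X (fst z) (snd z))) ({..<n} \<times> {..<n}) = fro n X"
    by (simp add: fro_def case_prod_beta')
  also have "L2_set (\<lambda>z. cmod (Y (snd z) (fst z))) ({..<n} \<times> {..<n}) = fro n Y"
  proof -
    have "(\<Sum>z\<in>{..<n} \<times> {..<n}. (cmod (Y (snd z) (fst z)))\<^sup>2) = (\<Sum>i<n. \<Sum>j<n. (cmod (Y j i))\<^sup>2)"
      by (simp add: sum.cartesian_product case_prod_beta)
    also have "\<dots> = (\<Sum>j<n. \<Sum>i<n. (cmod (Y j i))\<^sup>2)" by (rule sum.swap)
    also have "\<dots> = (fro n Y)\<^sup>2" by (simp add: fro_power2)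
    finally show ?thesis unfolding L2_set_def by (simp add: fro_nonneg)
  qed
  finally show ?thesis .
qed

definition hermitian :: "nat \<Rightarrow> (nat \<Rightarrow> nat \<Rightarrow> complex) \<Rightarrow> bool" where
  "hermitian n a \<longleftrightarrow> (\<forall>i<n. \<forall>j<n. a j i = cnj (a i j))"

lemma hermitianD: "hermitian n a \<Longrightarrow> i < n \<Longrightarrow> j < n \<Longrightarrow> cnj (a i j) = a j i"
  by (metis hermitian_def)

definition shifted :: "nat \<Rightarrow> (nat \<Rightarrow> nat \<Rightarrow> complex) \<Rightarrow> complex \<Rightarrow> complex mat" where
  "shifted n a w = mat n n (\<lambda>(i, j). (if i = j then w else 0) - a i j)"

text \<open>
  The inverse of \<open>w - a\<close>, given by the adjugate so that measurability in \<open>a\<close> and \<open>w\<close> is evident.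
  The value \<open>0\<close> outside the index range makes identities between resolvents hold for all indices.
\<close>
definition resolvent :: "nat \<Rightarrow> (nat \<Rightarrow> nat \<Rightarrow> complex) \<Rightarrow> complex \<Rightarrow> nat \<Rightarrow> nat \<Rightarrow> complex" where
  "resolvent n a w i j =
     (if i < n \<and> j < n then adj_mat (shifted n a w) $$ (i, j) / Determinant.det (shifted n a w) else 0)"

lemma shifted_carrier [simp]: "shifted n a w \<in> carrier_mat n n"
  by (simp add: shifted_def)

text \<open>
  A vector in the kernel would satisfy \<open>a v = w v\<close>, but the quadratic form of \<open>a\<close> at \<open>v\<close> is real.
\<close>
lemma det_shifted_nonzero:
  assumes a: "hermitian n a" and w: "Im w \<noteq> 0"
  shows "Determinant.det (shifted n a w) \<noteq> 0"
proof
  assume "Determinant.det (shifted n a w) = 0"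
  then obtain v where v: "v \<in> carrier_vec n" "v \<noteq> 0\<^sub>v n" "shifted n a w *\<^sub>v v = 0\<^sub>v n"
    using det_0_iff_vec_prod_zero[OF shifted_carrier] by blast
  have eq: "w * v $ i = (\<Sum>j<n. a i j * v $ j)" if i: "i < n" for i
  proof -
    have "0 = (shifted n a w *\<^sub>v v) $ i" using v(3) i by simp
    also have "\<dots> = (\<Sum>j<n. ((if i = j then w else 0) - a i j) * v $ j)"
      using i v(1) by (simp add: shifted_def mult_mat_vec_def scalar_prod_def atLeast0LessThan)
    also have "\<dots> = (\<Sum>j<n. (if i = j then w * v $ j else 0)) - (\<Sum>j<n. a i j * v $ j)"
      by (subst sum_subtractf[symmetric]) (intro sum.cong refl, auto simp: algebra_simps)
    finally show ?thesis using i by simp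
  qed
  define s where "s = (\<Sum>i<n. cnj (v $ i) * (\<Sum>j<n. a i j * v $ j))"
  have "cnj s = (\<Sum>i<n. \<Sum>j<n. v $ i * (cnj (a i j) * cnj (v $ j)))"
    by (simp add: s_def sum_distrib_left)
  also have "\<dots> = (\<Sum>i<n. \<Sum>j<n. v $ i * (a j i * cnj (v $ j)))"
    by (intro sum.cong refl) (simp add: hermitianD[OF a])
  also have "\<dots> = (\<Sum>j<n. \<Sum>i<n. v $ i * (a j i * cnj (v $ j)))" by (rule sum.swap)
  also have "\<dots> = s" by (simp add: s_def sum_distrib_left mult_ac)
  finally have Ims: "Im s = 0" by (metis Reals_cnj_iff complex_is_Real_iff)
  have "s = (\<Sum>i<n. cnj (v $ i) * (w * v $ i))" by (simp add: s_def eq)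
  also have "\<dots> = w * complex_of_real (\<Sum>i<n. (cmod (v $ i))\<^sup>2)"
    unfolding of_real_sum sum_distrib_left
    by (intro sum.cong refl) (simp only: complex_norm_square mult_ac)
  finally have "Im w * (\<Sum>i<n. (cmod (v $ i))\<^sup>2) = 0" using Ims by simp
  hence "(\<Sum>i<n. (cmod (v $ i))\<^sup>2) = 0" using w by simp
  hence "\<forall>i<n. v $ i = 0" by (subst (asm) sum_nonneg_eq_0_iff) auto
  hence "v = 0\<^sub>v n" using v(1) by (intro eq_vecI) auto
  with v(2) show False by simp
qed

lemma resolvent_inverse:
  assumes d: "Determinant.det (shifted n a w) \<noteq> 0" and ij: "i < n" "j < n"
  shows "(\<Sum>k<n. ((if i = k then w else 0) - a i k) * resolvent n a w k j) = (if i = j then 1 else 0)"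
    and "(\<Sum>k<n. resolvent n a w i k * ((if k = j then w else 0) - a k j)) = (if i = j then 1 else 0)"
proof -
  let ?P = "shifted n a w" and ?d = "Determinant.det (shifted n a w)"
  have c: "adj_mat ?P \<in> carrier_mat n n" by (rule adj_mat(1)) simp
  have "(?P * adj_mat ?P) $$ (i, j) = (?d \<cdot>\<^sub>m 1\<^sub>m n) $$ (i, j)" by (simp add: adj_mat(2)[OF shifted_carrier])
  moreover have "(?P * adj_mat ?P) $$ (i, j) = (\<Sum>k<n. ((if i = k then w else 0) - a i k) * adj_mat ?P $$ (k, j))"
    using ij c carrier_matD[OF c] by (simp add: shifted_def scalar_prod_def atLeast0LessThan)
  ultimately have "(\<Sum>k<n. ((if i = k then w else 0) - a i k) * adj_mat ?P $$ (k, j)) = (if i = j then ?d else 0)"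
    using ij by simp
  hence "(\<Sum>k<n. ((if i = k then w else 0) - a i k) * adj_mat ?P $$ (k, j)) / ?d = (if i = j then 1 else 0)"
    using d by simp
  thus "(\<Sum>k<n. ((if i = k then w else 0) - a i k) * resolvent n a w k j) = (if i = j then 1 else 0)"
    using ij by (simp add: resolvent_def sum_divide_distrib)
  have "(adj_mat ?P * ?P) $$ (i, j) = (?d \<cdot>\<^sub>m 1\<^sub>m n) $$ (i, j)" by (simp add: adj_mat(3)[OF shifted_carrier])
  moreover have "(adj_mat ?P * ?P) $$ (i, j) = (\<Sum>k<n. adj_mat ?P $$ (i, k) * ((if k = j then w else 0) - a k j))"
    using ij c carrier_matD[OF c] by (simp add: shifted_def scalar_prod_def atLeast0LessThan)
  ultimately have "(\<Sum>k<n. adj_mat ?P $$ (i, k) * ((if k = j then w else 0) - a k j)) = (if i = j then ?d else 0)"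
    using ij by simp
  hence "(\<Sum>k<n. adj_mat ?P $$ (i, k) * ((if k = j then w else 0) - a k j)) / ?d = (if i = j then 1 else 0)"
    using d by simp
  thus "(\<Sum>k<n. resolvent n a w i k * ((if k = j then w else 0) - a k j)) = (if i = j then 1 else 0)"
    using ij by (simp add: resolvent_def sum_divide_distrib)
qed

text \<open>
  From \<open>X P = 1\<close> and \<open>Q Y = 1\<close> follows \<open>Y - X = X (P - Q) Y\<close>. The resolvent identities are special cases, and
  so is Ward's identity, with \<open>Y\<close> the adjoint of \<open>X\<close>.
\<close>
lemma inverse_difference:
  fixes X Y P Q :: "nat \<Rightarrow> nat \<Rightarrow> complex"
  assumes XP: "\<And>i j. i < n \<Longrightarrow> j < n \<Longrightarrow> mm n X P i j = (if i = j then 1 else 0)"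
    and QY: "\<And>i j. i < n \<Longrightarrow> j < n \<Longrightarrow> mm n Q Y i j = (if i = j then 1 else 0)"
    and X0: "\<And>i j. \<not> (i < n \<and> j < n) \<Longrightarrow> X i j = 0"
    and Y0: "\<And>i j. \<not> (i < n \<and> j < n) \<Longrightarrow> Y i j = 0"
  shows "Y i j - X i j = mm n X (mm n (\<lambda>i j. P i j - Q i j) Y) i j"
proof (cases "i < n \<and> j < n")
  case True
  have "mm n X (mm n (\<lambda>i j. P i j - Q i j) Y) i j
      = mm n X (mm n P Y) i j - mm n X (mm n Q Y) i j"
    by (simp add: mm_def left_diff_distrib right_diff_distrib sum_subtractf sum_distrib_left)
  also have "mm n X (mm n P Y) i j = mm n (mm n X P) Y i j" by (simp add: mm_assoc)
  also have "\<dots> = (\<Sum>k<n. (if i = k then 1 else 0) * Y k j)"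
    unfolding mm_def[of n "mm n X P"] using True by (intro sum.cong) (auto simp: XP)
  also have "\<dots> = Y i j" using True by (simp add: if_distrib[of "\<lambda>x. x * _"] cong: if_cong)
  also have "mm n X (mm n Q Y) i j = (\<Sum>k<n. X i k * (if k = j then 1 else 0))"
    unfolding mm_def[of n X] using True by (intro sum.cong) (auto simp: QY)
  also have "\<dots> = X i j" using True by (simp add: if_distrib[of "\<lambda>x. _ * x"] cong: if_cong)
  finally show ?thesis by simp
next
  case False
  have "mm n X Z i j = 0" if "\<And>k. \<not> (j < n) \<Longrightarrow> Z k j = 0" for Z
    unfolding mm_def using False that by (intro sum.neutral) (auto simp: X0)
  moreover have "mm n (\<lambda>i j. P i j - Q i j) Y k j = 0" if "\<not> j < n" for k
    unfolding mm_def using that by (simp add: Y0)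
  ultimately show ?thesis using False by (simp add: X0 Y0)
qed

lemma resolvent_out [simp]: "\<not> (i < n \<and> j < n) \<Longrightarrow> resolvent n a w i j = 0"
  by (auto simp: resolvent_def)

lemma resolvent_identity:
  assumes a: "hermitian n a" and b: "hermitian n b" and w: "Im w \<noteq> 0" and w': "Im w' \<noteq> 0"
  shows "resolvent n b w' i j - resolvent n a w i j =
     mm n (resolvent n a w) (mm n (\<lambda>i j. (b i j - a i j) - (if i = j then w' - w else 0)) (resolvent n b w')) i j"
proof -
  have e: "(\<lambda>i j. (b i j - a i j) - (if i = j then w' - w else 0))
      = (\<lambda>i j. ((if i = j then w else 0) - a i j) - ((if i = j then w' else 0) - b i j))"
    by (intro ext) simp
  show ?thesis unfolding e
    by (rule inverse_difference)
       (use resolvent_inverse[OF det_shifted_nonzero[OF a w]] resolvent_inverse[OF det_shifted_nonzero[OF b w']]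
         in \<open>auto simp: mm_def\<close>)
qed

lemma resolvent_perturbation:
  assumes a: "hermitian n a" and b: "hermitian n b" and w: "Im w \<noteq> 0"
  shows "resolvent n b w = (\<lambda>i j. resolvent n a w i j +
     mm n (resolvent n a w) (mm n (\<lambda>i j. b i j - a i j) (resolvent n b w)) i j)"
proof -
  have "(\<lambda>i j. (b i j - a i j) - (if i = j then w - w else 0)) = (\<lambda>i j. b i j - a i j)"
    by (intro ext) simp
  note id = resolvent_identity[OF a b w w, unfolded this]
  have move: "x = y + z" if "x - y = z" for x y z :: complex using that by auto
  show ?thesis by (intro ext move id)
qed

lemma resolvent_shift:
  assumes a: "hermitian n a" and w: "Im w \<noteq> 0" and w': "Im w' \<noteq> 0"
  shows "resolvent n a w' = (\<lambda>i j. resolvent n a w i j +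
     (- (w' - w)) * mm n (resolvent n a w) (resolvent n a w') i j)"
proof (intro ext)
  fix i j
  have "mm n (\<lambda>i j. (a i j - a i j) - (if i = j then w' - w else 0)) (resolvent n a w') k j
      = - (w' - w) * resolvent n a w' k j" for k
  proof (cases "k < n")
    case True
    have "mm n (\<lambda>i j. (a i j - a i j) - (if i = j then w' - w else 0)) (resolvent n a w') k j
       = (\<Sum>l<n. if k = l then - (w' - w) * resolvent n a w' l j else 0)"
      unfolding mm_def by (intro sum.cong refl) (simp add: left_diff_distrib)
    also have "\<dots> = - (w' - w) * resolvent n a w' k j" using True by (subst sum.delta') simp_all
    finally show ?thesis .
  next
    case False
    have "(\<Sum>l<n. ((a k l - a k l) - (if k = l then w' - w else 0)) * resolvent n a w' l j) = 0"
      using False by (intro sum.neutral) auto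
    thus ?thesis using False by (simp add: mm_def)
  qed
  hence "mm n (resolvent n a w) (mm n (\<lambda>i j. (a i j - a i j) - (if i = j then w' - w else 0)) (resolvent n a w')) i j
     = (\<Sum>k<n. resolvent n a w i k * (- (w' - w) * resolvent n a w' k j))"
    unfolding mm_def[of n "resolvent n a w"] by (simp only:)
  also have "\<dots> = (- (w' - w)) * mm n (resolvent n a w) (resolvent n a w') i j"
    unfolding mm_def sum_distrib_left by (intro sum.cong refl) (simp only: mult_ac)
  finally have "resolvent n a w' i j - resolvent n a w i j = (- (w' - w)) * mm n (resolvent n a w) (resolvent n a w') i j"
    by (simp only: resolvent_identity[OF a a w w', of i j])
  thus "resolvent n a w' i j = resolvent n a w i j +
     (- (w' - w)) * mm n (resolvent n a w) (resolvent n a w') i j"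
    by (subst (asm) diff_eq_eq) (simp only: add.commute)
qed

text \<open>
  Ward's identity: \<open>R\<^sup>* - R = (w - cnj w) R R\<^sup>*\<close>, and the trace of \<open>R R\<^sup>*\<close> is the squared Frobenius norm.
\<close>
lemma resolvent_ward:
  assumes a: "hermitian n a" and w: "Im w \<noteq> 0"
  shows "(fro n (resolvent n a w))\<^sup>2 = - Im (tr n (resolvent n a w)) / Im w"
proof -
  let ?R = "resolvent n a w"
  let ?S = "\<lambda>i j. cnj (?R j i)"
  note inv = resolvent_inverse[OF det_shifted_nonzero[OF a w]]
  have QY: "mm n (\<lambda>i j. cnj ((if j = i then w else 0) - a j i)) ?S i j = (if i = j then 1 else 0)"
    if "i < n" "j < n" for i j
  proof -
    have "mm n (\<lambda>i j. cnj ((if j = i then w else 0) - a j i)) ?S i j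
       = cnj (\<Sum>k<n. ?R j k * ((if k = i then w else 0) - a k i))"
      unfolding mm_def cnj_sum by (intro sum.cong refl) (simp only: complex_cnj_mult mult.commute)
    also have "\<dots> = (if i = j then 1 else 0)" by (subst inv(2)[OF that(2,1)]) auto
    finally show ?thesis .
  qed
  have diff: "?S i j - ?R i j = mm n ?R (mm n (\<lambda>i j. ((if i = j then w else 0) - a i j) - cnj ((if j = i then w else 0) - a j i)) ?S) i j" for i j
  proof (rule inverse_difference[OF _ QY])
    show "mm n ?R (\<lambda>i j. (if i = j then w else 0) - a i j) i j = (if i = j then 1 else 0)"
      if "i < n" "j < n" for i j
      unfolding mm_def by (rule inv(2)[OF that])
  qed auto
  have inner: "mm n (\<lambda>i j. ((if i = j then w else 0) - a i j) - cnj ((if j = i then w else 0) - a j i)) ?S k j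
     = (w - cnj w) * ?S k j" if "k < n" for k j
  proof -
    have "mm n (\<lambda>i j. ((if i = j then w else 0) - a i j) - cnj ((if j = i then w else 0) - a j i)) ?S k j
       = (\<Sum>l<n. if k = l then (w - cnj w) * ?S l j else 0)"
      unfolding mm_def using that by (intro sum.cong refl) (auto simp: hermitianD[OF a])
    thus ?thesis using that by simp
  qed
  have "?S i i - ?R i i = (w - cnj w) * complex_of_real (\<Sum>k<n. (cmod (?R i k))\<^sup>2)" for i
  proof -
    have "?S i i - ?R i i = (\<Sum>k<n. ?R i k * ((w - cnj w) * ?S k i))"
      unfolding diff mm_def[of n ?R] by (intro sum.cong refl) (simp only: inner lessThan_iff)
    also have "\<dots> = (w - cnj w) * complex_of_real (\<Sum>k<n. (cmod (?R i k))\<^sup>2)"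
      unfolding of_real_sum sum_distrib_left
      by (intro sum.cong refl) (simp only: complex_norm_square mult_ac)
    finally show ?thesis .
  qed
  hence "(\<Sum>i<n. ?S i i - ?R i i) = (w - cnj w) * complex_of_real ((fro n ?R)\<^sup>2)"
    by (simp only: fro_power2 of_real_sum sum_distrib_left)
  hence "Im (\<Sum>i<n. ?S i i - ?R i i) = Im ((w - cnj w) * complex_of_real ((fro n ?R)\<^sup>2))" by (rule arg_cong)
  hence "- 2 * Im (tr n ?R) = 2 * Im w * (fro n ?R)\<^sup>2"
    by (simp add: tr_def sum_subtractf sum_negf del: of_real_power)
  hence "(fro n ?R)\<^sup>2 * Im w = - Im (tr n ?R)" by (simp only: mult.commute[of _ "Im w"])
  thus ?thesis by (subst nonzero_eq_divide_eq[OF w])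
qed

lemma poly_pderiv_linear_factors:
  fixes es :: "complex list"
  assumes "w \<notin> set es"
  shows "poly (pderiv (\<Prod>e\<leftarrow>es. [:- e, 1:])) w = (\<Sum>e\<leftarrow>es. 1 / (w - e)) * poly (\<Prod>e\<leftarrow>es. [:- e, 1:]) w"
  using assms
proof (induction es)
  case (Cons e es)
  hence "w - e \<noteq> 0" by auto
  define p where "p = (\<Prod>e\<leftarrow>es. [:- e, 1:])"
  have IH: "poly (pderiv p) w = (\<Sum>e\<leftarrow>es. 1 / (w - e)) * poly p w"
    using Cons unfolding p_def by simp
  have "poly (pderiv ([:- e, 1:] * p)) w = (w - e) * poly (pderiv p) w + poly p w"
    unfolding pderiv_mult by (simp add: pderiv_pCons algebra_simps)
  also have "\<dots> = (1 / (w - e) + (\<Sum>e\<leftarrow>es. 1 / (w - e))) * ((w - e) * poly p w)"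
    using \<open>w - e \<noteq> 0\<close> unfolding IH by (simp add: distrib_right)
  finally show ?case by (simp add: p_def[symmetric] algebra_simps)
qed simp

lemma det_shifted_eq_char_poly:
  "Determinant.det (shifted n a w) = poly (char_poly (mat n n (\<lambda>(i, j). a i j))) w"
proof -
  let ?A = "mat n n (\<lambda>(i, j). a i j)"
  have "- (char_matrix ?A w) = shifted n a w"
    by (rule eq_matI) (auto simp: char_matrix_def shifted_def)
  thus ?thesis by (simp add: char_poly_matrix[of ?A n])
qed

lemma tr_resolvent_eq_log_derivative:
  assumes d: "Determinant.det (shifted n a w) \<noteq> 0"
  shows "tr n (resolvent n a w) =
    poly (pderiv (char_poly (mat n n (\<lambda>(i, j). a i j)))) w / poly (char_poly (mat n n (\<lambda>(i, j). a i j))) w"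
proof -
  let ?A = "mat n n (\<lambda>(i, j). a i j)" and ?P = "shifted n a w"
  have "tr n (resolvent n a w) = (\<Sum>i<n. cofactor ?P i i) / Determinant.det ?P"
    unfolding tr_def sum_divide_distrib
    by (intro sum.cong refl) (simp add: resolvent_def adj_mat_def shifted_def)
  also have "(\<Sum>i<n. cofactor ?P i i) = (\<Sum>i<n. poly (char_poly (mat_delete ?A i i)) w)"
  proof (intro sum.cong refl)
    fix i assume "i \<in> {..<n}"
    have c: "mat_delete ?A i i \<in> carrier_mat (n - 1) (n - 1)" by (rule mat_delete_carrier) simp
    have "mat_delete ?P i i = - char_matrix (mat_delete ?A i i) w"
      by (rule eq_matI) (auto simp: mat_delete_def char_matrix_def shifted_def)
    thus "cofactor ?P i i = poly (char_poly (mat_delete ?A i i)) w"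
      by (simp add: cofactor_def char_poly_matrix[OF c] flip: power_add power_mult mult_2)
  qed
  also have "\<dots> = poly (pderiv (char_poly ?A)) w"
    by (simp add: pderiv_char_poly[of ?A n] poly_sum)
  finally show ?thesis by (simp add: det_shifted_eq_char_poly)
qed

text \<open>
  The trace of the resolvent is the logarithmic derivative of the characteristic polynomial, hence a
  sum over its roots, and the roots are real. This identifies the normalised trace
  with the empirical Stieltjes transform.
\<close>
lemma hermitian_eigenvalues:
  assumes a: "hermitian n a"
  obtains lam where
    "\<And>w. empirical_stieltjes (mat n n (\<lambda>(i, j). a i j)) w = stieltjes n lam w"
    "\<And>w. Im w \<noteq> 0 \<Longrightarrow> tr n (resolvent n a w) / of_nat n = stieltjes n lam w"
proof -
  let ?A = "mat n n (\<lambda>(i, j). a i j)"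
  obtain es where es: "char_poly ?A = (\<Prod>e\<leftarrow>es. [:- e, 1:])" "length es = n"
    using char_poly_factorized[of ?A n] by auto
  have real: "complex_of_real (Re e) = e" if "e \<in> set es" for e
  proof -
    have "poly (char_poly ?A) e = 0" using that by (simp add: es(1) poly_prod_list_zero_iff)
    hence "Im e = 0" by (metis det_shifted_eq_char_poly det_shifted_nonzero[OF a])
    thus ?thesis by (simp add: complex_eq_iff)
  qed
  define lam where "lam = (\<lambda>j. Re (es ! j))"
  have sum: "(\<Sum>e\<leftarrow>es. 1 / (w - e)) / of_nat n = stieltjes n lam w" for w
  proof -
    have "(\<Sum>e\<leftarrow>es. 1 / (w - e)) = (\<Sum>j<n. 1 / (w - es ! j))"
      by (simp add: sum_list_sum_nth es(2) atLeast0LessThan)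
    also have "\<dots> = (\<Sum>j<n. 1 / (w - complex_of_real (lam j)))"
      using real es(2) by (intro sum.cong refl) (simp add: lam_def)
    finally show ?thesis by (simp add: stieltjes_def)
  qed
  have "proots (char_poly ?A) = mset es"
  proof -
    have z: "0 \<notin> set (map (\<lambda>e. [:- e, 1:]) es)" by auto
    have "proots (char_poly ?A) = (\<Sum>p\<leftarrow>map (\<lambda>e. [:- e, 1:]) es. proots p)"
      unfolding es(1) using proots_prod_list[OF z] by (simp only: list.map_ident)
    also have "\<dots> = mset es" by (induction es) auto
    finally show ?thesis .
  qed
  hence 1: "empirical_stieltjes ?A w = stieltjes n lam w" for w
    unfolding empirical_stieltjes_def sum[symmetric]
    by (simp add: sum_mset_sum_list flip: mset_map)
  have 2: "tr n (resolvent n a w) / of_nat n = stieltjes n lam w" if w: "Im w \<noteq> 0" for w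
  proof -
    have d: "Determinant.det (shifted n a w) \<noteq> 0" by (rule det_shifted_nonzero[OF a w])
    have "w \<notin> set es"
      using real[of w] w by (metis Im_complex_of_real)
    hence "tr n (resolvent n a w) = (\<Sum>e\<leftarrow>es. 1 / (w - e))"
      using d by (simp add: tr_resolvent_eq_log_derivative[OF d] det_shifted_eq_char_poly es(1) poly_pderiv_linear_factors)
    thus ?thesis by (simp add: sum)
  qed
  show thesis by (rule that[OF 1 2])
qed

lemma fro_mm_le: "fro n X \<le> x \<Longrightarrow> fro n Y \<le> y \<Longrightarrow> fro n (mm n X Y) \<le> x * y"
  by (rule order_trans[OF fro_mm]) (meson fro_nonneg mult_mono order_trans)

lemma cmod_tr_le: "fro n X \<le> x \<Longrightarrow> fro n Y \<le> y \<Longrightarrow> cmod (tr n (mm n X Y)) \<le> x * y"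
  by (rule order_trans[OF cmod_tr_mm_le]) (meson fro_nonneg mult_mono order_trans)

text \<open>
  The second-order expansion of \<open>\<bar>u\<bar>\<^sup>2\<close> when the matrix changes by \<open>e\<close> and the spectral parameter by \<open>\<delta>\<close>. The
  terms that are kept are those of size \<open>m\<close>, \<open>m\<^sup>2\<close> and \<open>\<delta>\<close>. With \<open>m\<close> of order \<open>sqrt \<delta>\<close>, as for Gaussian increments, all
  others are at most of order \<open>\<delta>\<close> to the power \<open>3 / 2\<close>; the constant \<open>K\<close> may depend on \<open>n\<close>, as the time step tends to \<open>0\<close> with \<open>n\<close> fixed.
\<close>
lemma resolvent_step:
  fixes a b :: "nat \<Rightarrow> nat \<Rightarrow> complex" and w \<delta> g :: complex and K :: real
  assumes a: "hermitian n a" and b: "hermitian n b" and n: "1 \<le> n"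
    and w: "0 < Im w" and w': "0 < Im (w + \<delta>)" and K: "1 \<le> K"
    and RK: "fro n (resolvent n a w) \<le> K" "fro n (resolvent n b w) \<le> K" "fro n (resolvent n b (w + \<delta>)) \<le> K"
  defines "R \<equiv> resolvent n a w" and "e \<equiv> \<lambda>i j. b i j - a i j"
  defines "u \<equiv> tr n R / of_nat n - g" and "u' \<equiv> tr n (resolvent n b (w + \<delta>)) / of_nat n - g"
    and "q1 \<equiv> tr n (mm n e (mm n R R)) / of_nat n"
    and "q2 \<equiv> tr n (mm n e (mm n R (mm n e (mm n R R)))) / of_nat n"
    and "\<tau> \<equiv> tr n (mm n R R) / of_nat n" and "m \<equiv> fro n e" and "\<epsilon> \<equiv> cmod \<delta>"
  assumes uK: "cmod u \<le> K"
  shows "(cmod u')\<^sup>2 \<le> (cmod u)\<^sup>2 + 2 * Re (cnj u * q1) + 2 * Re (cnj u * (q2 - \<delta> * \<tau>)) + (cmod q1)\<^sup>2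
     + K ^ 5 * (4 * m ^ 3 + \<epsilon> * m\<^sup>2 + 6 * \<epsilon> * m + 3 * \<epsilon>\<^sup>2)"
proof -
  define R1 where "R1 = resolvent n b w"
  define R' where "R' = resolvent n b (w + \<delta>)"
  have RK: "fro n R \<le> K" "fro n R1 \<le> K" "fro n R' \<le> K" using RK by (simp_all add: R_def R1_def R'_def)
  have eK: "fro n e \<le> m" by (simp add: m_def)
  have m0: "0 \<le> m" and \<epsilon>0: "0 \<le> \<epsilon>" by (simp_all add: m_def \<epsilon>_def fro_nonneg)
  have id1: "R1 = (\<lambda>i j. R i j + mm n R (mm n e R1) i j)"
    unfolding R1_def R_def e_def by (rule resolvent_perturbation[OF a b]) (use w in simp)
  have id2: "R' = (\<lambda>i j. R1 i j + (- \<delta>) * mm n R1 R' i j)"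
    using resolvent_shift[OF b, of w "w + \<delta>"] w w' unfolding R1_def R'_def by simp
  \<comment> \<open>Three applications of the resolvent identity in the matrix, two of the one in the spectral parameter.\<close>
  have t1: "tr n R1 = tr n R + tr n (mm n R (mm n e R1))"
    by (subst id1) (rule tr_add)
  have exp: "tr n (mm n X (mm n e R1)) = tr n (mm n X (mm n e R)) + tr n (mm n X (mm n e (mm n R (mm n e R1))))" for X
    by (subst id1) (simp only: mm_add_right tr_add)
  have t2: "tr n (mm n R (mm n e R1)) = tr n (mm n R (mm n e R)) + tr n (mm n R (mm n e (mm n R (mm n e R1))))"
    by (rule exp)
  have t3: "tr n (mm n R (mm n e (mm n R (mm n e R1)))) = tr n (mm n R (mm n e (mm n R (mm n e R))))
     + tr n (mm n R (mm n e (mm n R (mm n e (mm n R (mm n e R1))))))"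
    using exp[of "mm n (mm n R e) R"] by (simp only: mm_assoc)
  have c1: "tr n (mm n R (mm n e R)) = of_nat n * q1"
    using n unfolding q1_def by (subst tr_mm_commute) (simp add: mm_assoc)
  have c2: "tr n (mm n R (mm n e (mm n R (mm n e R)))) = of_nat n * q2"
    using n unfolding q2_def by (subst tr_mm_commute) (simp add: mm_assoc)
  define T3 where "T3 = tr n (mm n R (mm n e (mm n R (mm n e (mm n R (mm n e R1))))))"
  have s1: "tr n R' = tr n R1 + (- \<delta>) * tr n (mm n R1 R')"
    by (subst id2) (simp only: tr_add tr_cmult)
  have RR': "mm n R R' = (\<lambda>i j. mm n R R i j + (mm n R (mm n R (mm n e R1)) i j + mm n R (\<lambda>i j. (- \<delta>) * mm n R1 R' i j) i j))"
    by (subst id2, subst id1) (simp only: mm_add_right add.assoc)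
  have cm: "mm n R (\<lambda>i j. (- \<delta>) * mm n R1 R' i j) = (\<lambda>i j. (- \<delta>) * mm n R (mm n R1 R') i j)"
    unfolding mm_def by (intro ext) (simp add: sum_distrib_left mult_ac)
  have "mm n R1 R' = (\<lambda>i j. mm n R R' i j + mm n (mm n R (mm n e R1)) R' i j)"
    by (subst id1) (simp only: mm_add_left)
  hence "tr n (mm n R1 R') = tr n (mm n R R') + tr n (mm n (mm n R (mm n e R1)) R')"
    by (metis tr_add)
  moreover have "tr n (mm n R R') = tr n (mm n R R) + (tr n (mm n R (mm n R (mm n e R1)))
      + (- \<delta>) * tr n (mm n R (mm n R1 R')))"
    by (subst RR') (simp only: cm tr_add tr_cmult)
  moreover have "tr n (mm n R R) = of_nat n * \<tau>" using n by (simp add: \<tau>_def)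
  ultimately have s2: "tr n (mm n R1 R') = of_nat n * \<tau> + (tr n (mm n R (mm n R (mm n e R1)))
      + (- \<delta>) * tr n (mm n R (mm n R1 R'))) + tr n (mm n (mm n R (mm n e R1)) R')"
    by (simp only:)
  define S where "S = tr n (mm n R (mm n R (mm n e R1))) + (- \<delta>) * tr n (mm n R (mm n R1 R'))
      + tr n (mm n (mm n R (mm n e R1)) R')"
  define \<rho> where "\<rho> = (T3 - \<delta> * S) / of_nat n"
  have n0: "of_nat n \<noteq> (0::complex)" "1 \<le> real n" using n by auto
  have d: "u' - u = q1 + q2 - \<delta> * \<tau> + \<rho>"
  proof -
    have "tr n R' - tr n R = of_nat n * q1 + of_nat n * q2 + T3 - \<delta> * (of_nat n * \<tau> + S)"
      unfolding s1 t1 t2 t3 c1 c2 s2 T3_def[symmetric] S_def by (simp add: algebra_simps)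
    hence "(tr n R' - tr n R) / of_nat n = q1 + q2 - \<delta> * \<tau> + \<rho>"
      using n0 by (simp add: \<rho>_def field_simps)
    thus ?thesis by (simp add: u'_def u_def R'_def R_def diff_divide_distrib)
  qed
  \<comment> \<open>Remainders are bounded by products of Frobenius norms.\<close>
  have div: "cmod (x / of_nat n) \<le> y" if "cmod x \<le> y" for x y
  proof -
    have "cmod (x / of_nat n) \<le> cmod x / 1"
      using n0 by (simp only: norm_divide norm_of_nat) (intro divide_left_mono, auto)
    thus ?thesis using that by simp
  qed
  have bT3: "cmod T3 \<le> K ^ 4 * m ^ 3"
    using cmod_tr_le[OF RK(1) fro_mm_le[OF eK fro_mm_le[OF RK(1) fro_mm_le[OF eK fro_mm_le[OF RK(1) fro_mm_le[OF eK RK(2)]]]]]]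
    by (simp add: T3_def eval_nat_numeral mult_ac)
  have b1: "cmod (tr n (mm n R (mm n R (mm n e R1)))) \<le> K ^ 3 * m"
    using cmod_tr_le[OF RK(1) fro_mm_le[OF RK(1) fro_mm_le[OF eK RK(2)]]]
    by (simp add: eval_nat_numeral mult_ac)
  have b2: "cmod (tr n (mm n (mm n R (mm n e R1)) R')) \<le> K ^ 3 * m"
    using cmod_tr_le[OF fro_mm_le[OF RK(1) fro_mm_le[OF eK RK(2)]] RK(3)]
    by (simp add: eval_nat_numeral mult_ac)
  have b3: "cmod (tr n (mm n R (mm n R1 R'))) \<le> K ^ 3"
    using cmod_tr_le[OF RK(1) fro_mm_le[OF RK(2) RK(3)]]
    by (simp add: eval_nat_numeral mult_ac)
  have bS: "cmod S \<le> K ^ 3 * m + \<epsilon> * K ^ 3 + K ^ 3 * m"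
    unfolding S_def
    by (rule order_trans[OF norm_triangle_ineq] order_trans[OF add_mono] add_mono b1 b2)+
       (use b1 b2 b3 \<epsilon>0 in \<open>auto simp: norm_mult \<epsilon>_def intro!: mult_left_mono\<close>)
  have K4: "K ^ 3 \<le> K ^ 4" "K ^ 2 \<le> K ^ 4" "K ^ 2 \<le> K ^ 3" using K by (auto intro!: power_increasing)
  have b\<rho>: "cmod \<rho> \<le> K ^ 4 * (m ^ 3 + 2 * \<epsilon> * m + \<epsilon>\<^sup>2)"
  proof -
    have "cmod (T3 - \<delta> * S) \<le> cmod T3 + \<epsilon> * cmod S"
      using norm_triangle_ineq4[of T3 "\<delta> * S"] by (simp add: norm_mult \<epsilon>_def)
    also have "\<dots> \<le> K ^ 4 * m ^ 3 + \<epsilon> * (K ^ 3 * m + \<epsilon> * K ^ 3 + K ^ 3 * m)"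
      by (intro add_mono bT3 mult_left_mono bS \<epsilon>0)
    also have "\<dots> = K ^ 4 * m ^ 3 + K ^ 3 * (2 * \<epsilon> * m + \<epsilon>\<^sup>2)"
      by (simp add: algebra_simps power2_eq_square)
    also have "\<dots> \<le> K ^ 4 * m ^ 3 + K ^ 4 * (2 * \<epsilon> * m + \<epsilon>\<^sup>2)"
      using m0 \<epsilon>0 K4 by (intro add_left_mono mult_right_mono) auto
    finally show ?thesis unfolding \<rho>_def by (intro div) (simp add: algebra_simps)
  qed
  have bq1: "cmod q1 \<le> K\<^sup>2 * m"
    unfolding q1_def using cmod_tr_le[OF eK fro_mm_le[OF RK(1) RK(1)]]
    by (intro div) (simp add: power2_eq_square mult_ac)
  have "tr n R' - tr n R = tr n (mm n R (mm n e R1)) + (- \<delta>) * tr n (mm n R1 R')"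
    unfolding s1 t1 by simp
  hence dd: "u' - u = (tr n (mm n R (mm n e R1)) + (- \<delta>) * tr n (mm n R1 R')) / of_nat n"
    by (simp add: u'_def u_def R'_def R_def diff_divide_distrib[symmetric])
  have bR1R': "cmod ((- \<delta>) * tr n (mm n R1 R')) \<le> \<epsilon> * K\<^sup>2"
    using cmod_tr_le[OF RK(2) RK(3)] \<epsilon>0 by (simp add: norm_mult \<epsilon>_def power2_eq_square mult_left_mono)
  have bd: "cmod (u' - u) \<le> K\<^sup>2 * (m + \<epsilon>)"
    unfolding dd
  proof (intro div order_trans[OF norm_triangle_ineq])
    have "cmod (tr n (mm n R (mm n e R1))) \<le> K\<^sup>2 * m"
      using cmod_tr_le[OF RK(1) fro_mm_le[OF eK RK(2)]] by (simp add: power2_eq_square mult_ac)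
    thus "cmod (tr n (mm n R (mm n e R1))) + cmod ((- \<delta>) * tr n (mm n R1 R')) \<le> K\<^sup>2 * (m + \<epsilon>)"
      using bR1R' by (simp add: algebra_simps)
  qed
  have bdq: "cmod (u' - u - q1) \<le> K ^ 3 * (m\<^sup>2 + \<epsilon>)"
  proof -
    have "u' - u - q1 = (tr n (mm n R (mm n e (mm n R (mm n e R1)))) + (- \<delta>) * tr n (mm n R1 R')) / of_nat n"
      unfolding dd t2 c1 using n0 by (simp add: field_simps)
    also have "cmod \<dots> \<le> K ^ 3 * (m\<^sup>2 + \<epsilon>)"
    proof (intro div order_trans[OF norm_triangle_ineq])
      have "cmod (tr n (mm n R (mm n e (mm n R (mm n e R1))))) \<le> K ^ 3 * m\<^sup>2"
        using cmod_tr_le[OF RK(1) fro_mm_le[OF eK fro_mm_le[OF RK(1) fro_mm_le[OF eK RK(2)]]]]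
        by (simp add: eval_nat_numeral mult_ac)
      moreover have "\<epsilon> * K\<^sup>2 \<le> \<epsilon> * K ^ 3" using \<epsilon>0 K4 by (intro mult_left_mono) auto
      ultimately show "cmod (tr n (mm n R (mm n e (mm n R (mm n e R1))))) + cmod ((- \<delta>) * tr n (mm n R1 R')) \<le> K ^ 3 * (m\<^sup>2 + \<epsilon>)"
        using bR1R' by (simp add: algebra_simps)
    qed
    finally show ?thesis .
  qed
  have e1: "(cmod u')\<^sup>2 = (cmod u)\<^sup>2 + 2 * Re (cnj u * (u' - u)) + (cmod (u' - u))\<^sup>2"
    by (simp only: cmod_power2) (simp add: algebra_simps power2_eq_square)
  have e2: "2 * Re (cnj u * (u' - u)) \<le> 2 * Re (cnj u * q1) + 2 * Re (cnj u * (q2 - \<delta> * \<tau>)) + 2 * (K * cmod \<rho>)"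
  proof -
    have "cnj u * (u' - u) = cnj u * q1 + cnj u * (q2 - \<delta> * \<tau>) + cnj u * \<rho>"
      unfolding d by (simp add: algebra_simps)
    moreover have "Re (cnj u * \<rho>) \<le> K * cmod \<rho>"
      using complex_Re_le_cmod[of "cnj u * \<rho>"] mult_right_mono[OF uK norm_ge_zero[of \<rho>]]
      by (simp only: norm_mult complex_mod_cnj)
    ultimately show ?thesis by simp
  qed
  have e3: "(cmod (u' - u))\<^sup>2 \<le> (cmod q1)\<^sup>2 + K ^ 5 * ((m\<^sup>2 + \<epsilon>) * (2 * m + \<epsilon>))"
  proof -
    have "(cmod (u' - u))\<^sup>2 - (cmod q1)\<^sup>2 = (cmod (u' - u) - cmod q1) * (cmod (u' - u) + cmod q1)"
      by (simp add: power2_eq_square algebra_simps)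
    also have "\<dots> \<le> cmod (u' - u - q1) * (cmod (u' - u) + cmod q1)"
      using norm_triangle_ineq2[of "u' - u" q1] by (intro mult_right_mono) auto
    also have "\<dots> \<le> (K ^ 3 * (m\<^sup>2 + \<epsilon>)) * (K\<^sup>2 * (m + \<epsilon>) + K\<^sup>2 * m)"
      using bdq bd bq1 K m0 \<epsilon>0 by (intro mult_mono add_mono) auto
    also have "\<dots> = K ^ 5 * ((m\<^sup>2 + \<epsilon>) * (2 * m + \<epsilon>))"
      by (simp add: algebra_simps eval_nat_numeral)
    finally show ?thesis by simp
  qed
  have "K * cmod \<rho> \<le> K ^ 5 * (m ^ 3 + 2 * \<epsilon> * m + \<epsilon>\<^sup>2)"
    using mult_left_mono[OF b\<rho>, of K] K by (simp add: eval_nat_numeral mult.assoc)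
  with e1 e2 e3 have "(cmod u')\<^sup>2 \<le> (cmod u)\<^sup>2 + 2 * Re (cnj u * q1) + 2 * Re (cnj u * (q2 - \<delta> * \<tau>)) + (cmod q1)\<^sup>2
     + (2 * (K ^ 5 * (m ^ 3 + 2 * \<epsilon> * m + \<epsilon>\<^sup>2)) + K ^ 5 * ((m\<^sup>2 + \<epsilon>) * (2 * m + \<epsilon>)))"
    by linarith
  also have "2 * (K ^ 5 * (m ^ 3 + 2 * \<epsilon> * m + \<epsilon>\<^sup>2)) + K ^ 5 * ((m\<^sup>2 + \<epsilon>) * (2 * m + \<epsilon>))
     = K ^ 5 * (4 * m ^ 3 + \<epsilon> * m\<^sup>2 + 6 * \<epsilon> * m + 3 * \<epsilon>\<^sup>2)"
    by (simp add: algebra_simps power2_eq_square power3_eq_cube)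
  finally show ?thesis .
qed

text \<open>
  Leibniz' formula makes the determinant a polynomial in the entries.
\<close>
lemma det_mat_measurable:
  fixes f :: "nat \<Rightarrow> nat \<Rightarrow> 'b \<Rightarrow> complex"
  assumes "\<And>i j. i < m \<Longrightarrow> j < m \<Longrightarrow> f i j \<in> borel_measurable N"
  shows "(\<lambda>\<omega>. Determinant.det (mat m m (\<lambda>(i, j). f i j \<omega>))) \<in> borel_measurable N"
proof -
  have "(\<lambda>\<omega>. \<Sum>p\<in>{p. p permutes {0..<m}}. signof p * (\<Prod>i = 0..<m. f i (p i) \<omega>)) \<in> borel_measurable N"
  proof (intro borel_measurable_sum borel_measurable_times borel_measurable_const borel_measurable_prod)
    fix p i assume "p \<in> {p. p permutes {0..<m}}" "i \<in> {0..<m}"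
    thus "f i (p i) \<in> borel_measurable N"
      using permutes_in_image[of p "{0..<m}" i] by (intro assms) auto
  qed
  moreover have "Determinant.det (mat m m (\<lambda>(i, j). f i j \<omega>))
      = (\<Sum>p\<in>{p. p permutes {0..<m}}. signof p * (\<Prod>i = 0..<m. f i (p i) \<omega>))" for \<omega>
  proof -
    have "(\<Prod>i = 0..<m. mat m m (\<lambda>(i, j). f i j \<omega>) $$ (i, p i)) = (\<Prod>i = 0..<m. f i (p i) \<omega>)"
      if "p permutes {0..<m}" for p
      using permutes_in_image[OF that] by (intro prod.cong refl) auto
    thus ?thesis by (subst det_def'[of _ m]) auto
  qed
  ultimately show ?thesis by simp
qed

text \<open>
  The entries of the adjugate are minors of the shifted matrix.
\<close>
lemma resolvent_measurable:
  fixes a :: "nat \<Rightarrow> nat \<Rightarrow> 'b \<Rightarrow> complex"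
  assumes a: "\<And>i j. i < n \<Longrightarrow> j < n \<Longrightarrow> a i j \<in> borel_measurable N" and w: "w \<in> borel_measurable N"
  shows "(\<lambda>\<omega>. resolvent n (\<lambda>i j. a i j \<omega>) (w \<omega>) i j) \<in> borel_measurable N"
proof (cases "i < n \<and> j < n")
  case True
  let ?s = "\<lambda>i j \<omega>. (if i = j then w \<omega> else 0) - a i j \<omega>"
  have s: "?s i j \<in> borel_measurable N" if "i < n" "j < n" for i j
    using a[OF that] w by simp
  have d: "(\<lambda>\<omega>. Determinant.det (shifted n (\<lambda>i j. a i j \<omega>) (w \<omega>))) \<in> borel_measurable N"
    unfolding shifted_def by (rule det_mat_measurable) (rule s)
  let ?r = "\<lambda>i'. if i' < j then i' else Suc i'" and ?c = "\<lambda>j'. if j' < i then j' else Suc j'"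
  have del: "mat_delete (shifted n (\<lambda>i j. a i j \<omega>) (w \<omega>)) j i
      = mat (n - 1) (n - 1) (\<lambda>(i', j'). ?s (?r i') (?c j') \<omega>)" for \<omega>
    using True unfolding mat_delete_def shifted_def by (intro eq_matI) auto
  have "(\<lambda>\<omega>. Determinant.det (mat (n - 1) (n - 1) (\<lambda>(i', j'). ?s (?r i') (?c j') \<omega>))) \<in> borel_measurable N"
    by (rule det_mat_measurable) (rule s; auto)
  hence "(\<lambda>\<omega>. cofactor (shifted n (\<lambda>i j. a i j \<omega>) (w \<omega>)) j i) \<in> borel_measurable N"
    unfolding cofactor_def del by (rule borel_measurable_times[OF borel_measurable_const])
  moreover have "resolvent n (\<lambda>i j. a i j \<omega>) (w \<omega>) i j
     = cofactor (shifted n (\<lambda>i j. a i j \<omega>) (w \<omega>)) j i / Determinant.det (shifted n (\<lambda>i j. a i j \<omega>) (w \<omega>))" for \<omega>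
    using True by (simp add: resolvent_def adj_mat_def shifted_def)
  ultimately show ?thesis using d by simp
qed (simp add: resolvent_out)

lemma tr_measurable:
  assumes "\<And>i j. i < n \<Longrightarrow> j < n \<Longrightarrow> (\<lambda>\<omega>. X \<omega> i j) \<in> borel_measurable N"
  shows "(\<lambda>\<omega>. tr n (X \<omega>)) \<in> borel_measurable N"
  unfolding tr_def using assms by (intro borel_measurable_sum) auto

lemma mm_measurable:
  assumes "\<And>i j. i < n \<Longrightarrow> j < n \<Longrightarrow> (\<lambda>\<omega>. X \<omega> i j) \<in> borel_measurable N"
    and "\<And>i j. i < n \<Longrightarrow> j < n \<Longrightarrow> (\<lambda>\<omega>. Y \<omega> i j) \<in> borel_measurable N" and "i < n" "j < n"
  shows "(\<lambda>\<omega>. mm n (X \<omega>) (Y \<omega>) i j) \<in> borel_measurable N"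
  unfolding mm_def using assms by (intro borel_measurable_sum borel_measurable_times) auto

lemma fro_measurable:
  assumes "\<And>i j. i < n \<Longrightarrow> j < n \<Longrightarrow> (\<lambda>\<omega>. X \<omega> i j) \<in> borel_measurable N"
  shows "(\<lambda>\<omega>. fro n (X \<omega>)) \<in> borel_measurable N"
proof -
  have "(\<lambda>\<omega>. \<Sum>i<n. \<Sum>j<n. (cmod (X \<omega> i j))\<^sup>2) \<in> borel_measurable N"
    using assms by (intro borel_measurable_sum borel_measurable_power borel_measurable_norm) auto
  from measurable_compose[OF this borel_measurable_sqrt]
  have "(\<lambda>\<omega>. sqrt (\<Sum>i<n. \<Sum>j<n. (cmod (X \<omega> i j))\<^sup>2)) \<in> borel_measurable N" .
  moreover have "fro n (X \<omega>) = sqrt (\<Sum>i<n. \<Sum>j<n. (cmod (X \<omega> i j))\<^sup>2)" for \<omega>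
    by (metis fro_power2 fro_nonneg real_sqrt_unique)
  ultimately show ?thesis by simp
qed

lemma resolvent_bounds:
  assumes a: "hermitian n a" and n: "1 \<le> n" and \<eta>: "0 < \<eta>" and w: "\<eta> \<le> Im w"
  shows "cmod (tr n (resolvent n a w) / of_nat n) \<le> 1 / \<eta>"
    and "(fro n (resolvent n a w))\<^sup>2 \<le> real n / \<eta>\<^sup>2"
    and "fro n (resolvent n a w) \<le> sqrt (real n) / \<eta>"
    and "cmod (tr n (mm n (resolvent n a w) (resolvent n a w)) / of_nat n) \<le> 1 / \<eta>\<^sup>2"
proof -
  obtain lam where lam: "\<And>w. Im w \<noteq> 0 \<Longrightarrow> tr n (resolvent n a w) / of_nat n = stieltjes n lam w"
    using hermitian_eigenvalues[OF a] by metis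
  have w0: "0 < Im w" using \<eta> w by simp
  have "cmod (tr n (resolvent n a w) / of_nat n) \<le> 1 / Im w"
    using lam[of w] w0 cmod_stieltjes_le[OF w0, of n lam] by simp
  also have "\<dots> \<le> 1 / \<eta>" using \<eta> w by (intro divide_left_mono) auto
  finally show G: "cmod (tr n (resolvent n a w) / of_nat n) \<le> 1 / \<eta>" .
  have "(fro n (resolvent n a w))\<^sup>2 = - Im (tr n (resolvent n a w)) / Im w"
    using resolvent_ward[OF a] w0 by simp
  also have "\<dots> = real n * (- Im (tr n (resolvent n a w) / of_nat n) / Im w)"
    using n by simp
  also have "\<dots> \<le> real n * ((1 / \<eta>) / \<eta>)"
  proof (intro mult_left_mono frac_le)
    show "- Im (tr n (resolvent n a w) / of_nat n) \<le> 1 / \<eta>"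
      using G abs_Im_le_cmod[of "tr n (resolvent n a w) / of_nat n"] by linarith
  qed (use \<eta> w in auto)
  finally show F: "(fro n (resolvent n a w))\<^sup>2 \<le> real n / \<eta>\<^sup>2" by (simp add: power2_eq_square)
  have "fro n (resolvent n a w) \<le> sqrt (real n / \<eta>\<^sup>2)" using F by (rule real_le_rsqrt)
  thus "fro n (resolvent n a w) \<le> sqrt (real n) / \<eta>" using \<eta> by (simp add: real_sqrt_divide)
  have "cmod (tr n (mm n (resolvent n a w) (resolvent n a w))) \<le> (fro n (resolvent n a w))\<^sup>2"
    using cmod_tr_mm_le by (simp add: power2_eq_square)
  also have "\<dots> \<le> real n / \<eta>\<^sup>2" by (rule F)
  finally show "cmod (tr n (mm n (resolvent n a w) (resolvent n a w)) / of_nat n) \<le> 1 / \<eta>\<^sup>2"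
    using n by (simp add: norm_divide field_simps)
qed

section \<open>Gaussian Hermitian increments\<close>

definition herm_entry :: "nat \<Rightarrow> (nat \<Rightarrow> nat \<Rightarrow> real) \<Rightarrow> (nat \<Rightarrow> nat \<Rightarrow> real) \<Rightarrow> nat \<Rightarrow> nat \<Rightarrow> complex" where
  "herm_entry n b b' k l =
     (if k < l then Complex (b k l) (b' k l) / complex_of_real (sqrt (2 * real n))
      else if k = l then complex_of_real (b k k / sqrt (real n))
      else cnj (Complex (b l k) (b' l k)) / complex_of_real (sqrt (2 * real n)))"

text \<open>
  One index for each independent real coordinate: real parts on and above the diagonal, imaginary
  parts above it.
\<close>
definition entry_index :: "nat \<Rightarrow> (nat \<times> nat + nat \<times> nat) set" where
  "entry_index n = {Inl (k, l) | k l. k \<le> l \<and> l < n} \<union> {Inr (k, l) | k l. k < l \<and> l < n}"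

lemma hermitian_herm_entry: "hermitian n (herm_entry n b b')"
  by (auto simp: hermitian_def herm_entry_def)

lemma finite_entry_index: "finite (entry_index n)"
proof -
  have "entry_index n \<subseteq> Inl ` ({..<n} \<times> {..<n}) \<union> Inr ` ({..<n} \<times> {..<n})"
    by (auto simp: entry_index_def)
  thus ?thesis by (rule finite_subset) auto
qed

text \<open>
  A formula without case distinction on the position relative to the diagonal, from which
  covariances can be read off: \<open>\<sigma>\<close> is the only factor that is not symmetric in \<open>k\<close> and \<open>l\<close>.
\<close>
lemma herm_entry_decomposition:
  fixes y :: "nat \<times> nat + nat \<times> nat \<Rightarrow> real" and n :: nat
  defines "S \<equiv> \<lambda>k l. y (Inl (min k l, max k l))"
    and "T \<equiv> \<lambda>k l. if k = l then 0 else y (Inr (min k l, max k l))"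
    and "c \<equiv> \<lambda>k l::nat. if k = l then 1 / sqrt (real n) else 1 / sqrt (2 * real n)"
    and "\<sigma> \<equiv> \<lambda>k l::nat. if k < l then \<i> else - \<i>"
  shows "herm_entry n (\<lambda>k l. y (Inl (k, l))) (\<lambda>k l. y (Inr (k, l))) k l
    = complex_of_real (c k l) * (complex_of_real (S k l) + \<sigma> k l * complex_of_real (T k l))"
  by (auto simp: herm_entry_def S_def T_def c_def \<sigma>_def complex_eq_iff min_def max_def)

context prob_space
begin

lemma indep_sigma_algebras_expectation:
  fixes F X :: "'a \<Rightarrow> complex"
  assumes ind: "indep_set (sets N1) (sets N2)"
    and sp: "space N1 = space M" "space N2 = space M"
    and F: "F \<in> borel_measurable N1" "integrable M F" and X: "X \<in> borel_measurable N2" "integrable M X"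
  shows "integrable M (\<lambda>\<omega>. F \<omega> * X \<omega>)" and "expectation (\<lambda>\<omega>. F \<omega> * X \<omega>) = expectation F * expectation X"
proof -
  have "indep_var borel F borel X"
    unfolding indep_var_eq
  proof (intro conjI)
    have "{F -` A \<inter> space M |A. A \<in> sets borel} \<subseteq> sets N1"
      using measurable_sets[OF F(1)] sp by auto
    hence 1: "sigma_sets (space M) {F -` A \<inter> space M |A. A \<in> sets borel} \<subseteq> sets N1"
      using sets.sigma_sets_subset[of _ N1] sp by simp
    have "{X -` A \<inter> space M |A. A \<in> sets borel} \<subseteq> sets N2"
      using measurable_sets[OF X(1)] sp by auto
    hence 2: "sigma_sets (space M) {X -` A \<inter> space M |A. A \<in> sets borel} \<subseteq> sets N2"
      using sets.sigma_sets_subset[of _ N2] sp by simp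
    show "indep_set (sigma_sets (space M) {F -` A \<inter> space M |A. A \<in> sets borel})
        (sigma_sets (space M) {X -` A \<inter> space M |A. A \<in> sets borel})"
      using ind 1 2 unfolding indep_sets2_eq by blast
  qed (use F(2) X(2) in auto)
  from indep_var_lebesgue_integral[OF this F(2) X(2)] indep_var_integrable[OF this F(2) X(2)]
  show "integrable M (\<lambda>\<omega>. F \<omega> * X \<omega>)" "expectation (\<lambda>\<omega>. F \<omega> * X \<omega>) = expectation F * expectation X"
    by auto
qed

lemma normal_moments:
  assumes D: "distributed M lborel Y (normal_density 0 (sqrt \<epsilon>))" and \<epsilon>: "0 < \<epsilon>"
  shows "integrable M Y" "expectation Y = 0"
    "integrable M (\<lambda>\<omega>. (Y \<omega>)\<^sup>2)" "expectation (\<lambda>\<omega>. (Y \<omega>)\<^sup>2) = \<epsilon>"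
    "integrable M (\<lambda>\<omega>. (Y \<omega>) ^ 4)" "expectation (\<lambda>\<omega>. (Y \<omega>) ^ 4) = 3 * \<epsilon>\<^sup>2"
proof -
  have s: "0 < sqrt \<epsilon>" using \<epsilon> by simp
  have i: "integrable M (\<lambda>\<omega>. (Y \<omega>) ^ k)" for k
    using distributed_integrable[OF D, of "\<lambda>x. x ^ k"] integrable_normal_moment[OF s, of 0 k] by simp
  have e: "expectation (\<lambda>\<omega>. (Y \<omega>) ^ k) = (\<integral>x. normal_density 0 (sqrt \<epsilon>) x * x ^ k \<partial>lborel)" for k
    using distributed_integral[OF D, of "\<lambda>x. x ^ k"] by simp
  show "integrable M Y" "integrable M (\<lambda>\<omega>. (Y \<omega>)\<^sup>2)" "integrable M (\<lambda>\<omega>. (Y \<omega>) ^ 4)"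
    using i[of 1] i[of 2] i[of 4] by simp_all
  show "expectation Y = 0" using e[of 1] integral_normal_moment_odd[OF s, of 0 0] by simp
  show "expectation (\<lambda>\<omega>. (Y \<omega>)\<^sup>2) = \<epsilon>"
    using e[of 2] integral_normal_moment_even[OF s, of 0 1] \<epsilon> by (simp add: fact_numeral)
  show "expectation (\<lambda>\<omega>. (Y \<omega>) ^ 4) = 3 * \<epsilon>\<^sup>2"
    using e[of 4] integral_normal_moment_even[OF s, of 0 2] \<epsilon>
    by (simp add: fact_numeral power2_eq_square field_simps)
qed

lemma gaussian_array_covariance:
  assumes ind: "indep_vars (\<lambda>_. borel) Y I"
    and D: "\<And>i. i \<in> I \<Longrightarrow> distributed M lborel (Y i) (normal_density 0 (sqrt \<epsilon>))" and \<epsilon>: "0 < \<epsilon>"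
    and xy: "x \<in> I" "y \<in> I"
  shows "integrable M (\<lambda>\<omega>. Y x \<omega> * Y y \<omega>)" "expectation (\<lambda>\<omega>. Y x \<omega> * Y y \<omega>) = (if x = y then \<epsilon> else 0)"
proof -
  note m = normal_moments[OF D \<epsilon>]
  have "integrable M (\<lambda>\<omega>. Y x \<omega> * Y y \<omega>) \<and> expectation (\<lambda>\<omega>. Y x \<omega> * Y y \<omega>) = (if x = y then \<epsilon> else 0)"
  proof (cases "x = y")
    case True
    thus ?thesis using m(3,4)[OF xy(1)] by (simp add: power2_eq_square)
  next
    case False
    have v: "indep_vars (\<lambda>_. borel) Y {x, y}" by (rule indep_vars_subset[OF ind]) (use xy in auto)
    have ii: "\<And>i. i \<in> {x, y} \<Longrightarrow> integrable M (Y i)" using m(1) xy by auto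
    from indep_vars_lebesgue_integral[OF _ v ii] indep_vars_integrable[OF _ v ii] False m(2)[OF xy(1)]
    show ?thesis by simp
  qed
  thus "integrable M (\<lambda>\<omega>. Y x \<omega> * Y y \<omega>)" "expectation (\<lambda>\<omega>. Y x \<omega> * Y y \<omega>) = (if x = y then \<epsilon> else 0)" by auto
qed

text \<open>
  Products of two entries have mean zero unless the entries are conjugate to each other: the
  contributions of real and imaginary parts cancel for an entry with itself and add up for an entry with its conjugate. Fourth
  moments are needed only up to a constant, for the remainder of the expansion.
\<close>
lemma hermitian_gaussian_moments:
  assumes ind: "indep_vars (\<lambda>_. borel) Y (entry_index n)"
    and D: "\<And>i. i \<in> entry_index n \<Longrightarrow> distributed M lborel (Y i) (normal_density 0 (sqrt \<epsilon>))"
    and \<epsilon>: "0 < \<epsilon>" and n: "1 \<le> n" and kl: "k < n" "l < n"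
  defines "e \<equiv> \<lambda>k l \<omega>. herm_entry n (\<lambda>k l. Y (Inl (k, l)) \<omega>) (\<lambda>k l. Y (Inr (k, l)) \<omega>) k l"
  shows "integrable M (e k l)" "expectation (e k l) = 0"
    and "p < n \<Longrightarrow> q < n \<Longrightarrow> integrable M (\<lambda>\<omega>. e k l \<omega> * e p q \<omega>)"
    and "p < n \<Longrightarrow> q < n \<Longrightarrow> expectation (\<lambda>\<omega>. e k l \<omega> * e p q \<omega>) = (if k = q \<and> l = p then complex_of_real (\<epsilon> / real n) else 0)"
    and "integrable M (\<lambda>\<omega>. (cmod (e k l \<omega>)) ^ 4)"
    and "expectation (\<lambda>\<omega>. (cmod (e k l \<omega>)) ^ 4) \<le> 3 * \<epsilon>\<^sup>2 / (real n)\<^sup>2"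
proof -
  define S where "S = (\<lambda>k l. Y (Inl (min k l, max k l)))"
  define T where "T = (\<lambda>k l \<omega>. if k = l then 0 else Y (Inr (min k l, max k l)) \<omega>)"
  define c where "c = (\<lambda>k l::nat. if k = l then 1 / sqrt (real n) else 1 / sqrt (2 * real n))"
  define \<sigma> where "\<sigma> = (\<lambda>k l::nat. if k < l then \<i> else - \<i>)"
  have e: "e k l \<omega> = complex_of_real (c k l) * (complex_of_real (S k l \<omega>) + \<sigma> k l * complex_of_real (T k l \<omega>))" for k l \<omega>
    unfolding e_def using herm_entry_decomposition[of n "\<lambda>x. Y x \<omega>" k l]
    by (simp add: S_def T_def c_def \<sigma>_def)
  have inI: "Inl (min k l, max k l) \<in> entry_index n" if "k < n" "l < n" for k l
    using that by (auto simp: entry_index_def)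
  have inI': "Inr (min k l, max k l) \<in> entry_index n" if "k < n" "l < n" "k \<noteq> l" for k l
    using that by (auto simp: entry_index_def)
  note m = normal_moments[OF D \<epsilon>]
  have cov: "integrable M (\<lambda>\<omega>. Y x \<omega> * Y y \<omega>)" "expectation (\<lambda>\<omega>. Y x \<omega> * Y y \<omega>) = (if x = y then \<epsilon> else 0)"
    if "x \<in> entry_index n" "y \<in> entry_index n" for x y
    by (rule gaussian_array_covariance[OF ind D \<epsilon> that]; assumption)+
  have S: "integrable M (S k l)" "expectation (S k l) = 0" "integrable M (\<lambda>\<omega>. (S k l \<omega>) ^ 4)" "expectation (\<lambda>\<omega>. (S k l \<omega>) ^ 4) = 3 * \<epsilon>\<^sup>2"
    if "k < n" "l < n" for k l
    unfolding S_def using m[OF inI[OF that]] by auto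
  have T: "integrable M (T k l)" "expectation (T k l) = 0" "integrable M (\<lambda>\<omega>. (T k l \<omega>) ^ 4)" "expectation (\<lambda>\<omega>. (T k l \<omega>) ^ 4) \<le> (if k = l then 0 else 3 * \<epsilon>\<^sup>2)"
    if "k < n" "l < n" for k l
    unfolding T_def using m[OF inI'[OF that]] by (cases "k = l"; auto)+
  have SS: "integrable M (\<lambda>\<omega>. S k l \<omega> * S p q \<omega>)"
      "expectation (\<lambda>\<omega>. S k l \<omega> * S p q \<omega>) = (if min k l = min p q \<and> max k l = max p q then \<epsilon> else 0)"
    if "k < n" "l < n" "p < n" "q < n" for k l p q
    unfolding S_def using cov[OF inI[OF that(1,2)] inI[OF that(3,4)]] by auto
  have ST: "integrable M (\<lambda>\<omega>. S k l \<omega> * T p q \<omega>)" "expectation (\<lambda>\<omega>. S k l \<omega> * T p q \<omega>) = 0"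
    if "k < n" "l < n" "p < n" "q < n" for k l p q
    unfolding S_def T_def using cov[OF inI[OF that(1,2)] inI'[OF that(3,4)]] by (cases "p = q"; auto)+
  have TS: "integrable M (\<lambda>\<omega>. T k l \<omega> * S p q \<omega>)" "expectation (\<lambda>\<omega>. T k l \<omega> * S p q \<omega>) = 0"
    if "k < n" "l < n" "p < n" "q < n" for k l p q
    using ST[OF that(3,4,1,2)] by (simp_all add: mult.commute)
  have TT: "integrable M (\<lambda>\<omega>. T k l \<omega> * T p q \<omega>)"
      "expectation (\<lambda>\<omega>. T k l \<omega> * T p q \<omega>) = (if min k l = min p q \<and> max k l = max p q \<and> k \<noteq> l then \<epsilon> else 0)"
    if "k < n" "l < n" "p < n" "q < n" for k l p q
  proof -
    have "integrable M (\<lambda>\<omega>. T k l \<omega> * T p q \<omega>) \<and> expectation (\<lambda>\<omega>. T k l \<omega> * T p q \<omega>) = (if min k l = min p q \<and> max k l = max p q \<and> k \<noteq> l then \<epsilon> else 0)"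
    proof (cases "k = l \<or> p = q")
      case True
      hence "\<not> (min k l = min p q \<and> max k l = max p q \<and> k \<noteq> l)" by (auto simp: min_def max_def split: if_splits)
      thus ?thesis using True by (auto simp: T_def)
    next
      case False
      thus ?thesis unfolding T_def using cov[OF inI'[OF that(1,2)] inI'[OF that(3,4)]] by auto
    qed
    thus "integrable M (\<lambda>\<omega>. T k l \<omega> * T p q \<omega>)"
      "expectation (\<lambda>\<omega>. T k l \<omega> * T p q \<omega>) = (if min k l = min p q \<and> max k l = max p q \<and> k \<noteq> l then \<epsilon> else 0)" by auto
  qed
  show "integrable M (e k l)" unfolding e using S(1)[OF kl] T(1)[OF kl] by simp
  show "expectation (e k l) = 0" unfolding e using S(1,2)[OF kl] T(1,2)[OF kl] by simp
  have prod: "e k l \<omega> * e p q \<omega> = complex_of_real (c k l * c p q) * (complex_of_real (S k l \<omega> * S p q \<omega>)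
       + \<sigma> p q * complex_of_real (S k l \<omega> * T p q \<omega>) + \<sigma> k l * complex_of_real (T k l \<omega> * S p q \<omega>)
       + (\<sigma> k l * \<sigma> p q) * complex_of_real (T k l \<omega> * T p q \<omega>))" for p q \<omega>
    unfolding e by (simp add: algebra_simps)
  show "integrable M (\<lambda>\<omega>. e k l \<omega> * e p q \<omega>)" if pq: "p < n" "q < n" for p q
    unfolding prod
    by (intro Bochner_Integration.integrable_mult_right Bochner_Integration.integrable_add integrable_of_real SS ST TS TT kl pq)
  show "expectation (\<lambda>\<omega>. e k l \<omega> * e p q \<omega>) = (if k = q \<and> l = p then complex_of_real (\<epsilon> / real n) else 0)"
    if pq: "p < n" "q < n" for p q
  proof -
    note i = SS(1)[OF kl pq] ST(1)[OF kl pq] TS(1)[OF kl pq] TT(1)[OF kl pq]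
    have "expectation (\<lambda>\<omega>. e k l \<omega> * e p q \<omega>) = complex_of_real (c k l * c p q) *
        (complex_of_real (expectation (\<lambda>\<omega>. S k l \<omega> * S p q \<omega>))
       + \<sigma> p q * complex_of_real (expectation (\<lambda>\<omega>. S k l \<omega> * T p q \<omega>)) + \<sigma> k l * complex_of_real (expectation (\<lambda>\<omega>. T k l \<omega> * S p q \<omega>))
       + (\<sigma> k l * \<sigma> p q) * complex_of_real (expectation (\<lambda>\<omega>. T k l \<omega> * T p q \<omega>)))"
      unfolding prod
      by (subst Bochner_Integration.integral_mult_right_zero,
          (subst Bochner_Integration.integral_add, (intro Bochner_Integration.integrable_mult_right Bochner_Integration.integrable_add integrable_of_real i)+)+,
          simp only: Bochner_Integration.integral_mult_right_zero integral_complex_of_real)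
    also have "\<dots> = (if k = q \<and> l = p then complex_of_real (\<epsilon> / real n) else 0)"
      unfolding SS(2)[OF kl pq] ST(2)[OF kl pq] TS(2)[OF kl pq] TT(2)[OF kl pq]
      using n by (auto simp: c_def \<sigma>_def min_def max_def simp flip: of_real_mult split: if_splits) (simp add: field_simps)
    finally show ?thesis .
  qed
  have c2: "(c k l)\<^sup>2 = (if k = l then 1 / real n else 1 / (2 * real n))"
    using n by (simp add: c_def power_divide)
  have eb: "(cmod (e k l \<omega>)) ^ 4 \<le> (c k l) ^ 4 * (2 * (S k l \<omega>) ^ 4 + 2 * (T k l \<omega>) ^ 4)" for \<omega>
  proof -
    have "(cmod (complex_of_real (S k l \<omega>) + \<sigma> k l * complex_of_real (T k l \<omega>)))\<^sup>2 = (S k l \<omega>)\<^sup>2 + (T k l \<omega>)\<^sup>2"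
      by (simp add: cmod_power2 \<sigma>_def)
    hence "(cmod (e k l \<omega>))\<^sup>2 = (c k l)\<^sup>2 * ((S k l \<omega>)\<^sup>2 + (T k l \<omega>)\<^sup>2)"
      unfolding e by (simp add: norm_mult power_mult_distrib)
    hence "((cmod (e k l \<omega>))\<^sup>2)\<^sup>2 = ((c k l)\<^sup>2)\<^sup>2 * ((S k l \<omega>)\<^sup>2 + (T k l \<omega>)\<^sup>2)\<^sup>2" by (simp add: power_mult_distrib)
    also have "\<dots> \<le> ((c k l)\<^sup>2)\<^sup>2 * (2 * ((S k l \<omega>)\<^sup>2)\<^sup>2 + 2 * ((T k l \<omega>)\<^sup>2)\<^sup>2)"
      using sum_squares_bound[of "(S k l \<omega>)\<^sup>2" "(T k l \<omega>)\<^sup>2"]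
      by (intro mult_left_mono) (simp_all add: power2_sum)
    finally show ?thesis by (simp add: power_mult[symmetric])
  qed
  have ib: "integrable M (\<lambda>\<omega>. (c k l) ^ 4 * (2 * (S k l \<omega>) ^ 4 + 2 * (T k l \<omega>) ^ 4))"
    using S(3)[OF kl] T(3)[OF kl] by simp
  show i4: "integrable M (\<lambda>\<omega>. (cmod (e k l \<omega>)) ^ 4)"
  proof (rule Bochner_Integration.integrable_bound[OF ib])
    have [measurable]: "e k l \<in> borel_measurable M"
      unfolding e using S(1)[OF kl] T(1)[OF kl] by simp
    show "(\<lambda>\<omega>. (cmod (e k l \<omega>)) ^ 4) \<in> borel_measurable M" by measurable
    show "AE \<omega> in M. norm ((cmod (e k l \<omega>)) ^ 4) \<le> norm ((c k l) ^ 4 * (2 * (S k l \<omega>) ^ 4 + 2 * (T k l \<omega>) ^ 4))"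
      using eb by (intro AE_I2) (auto intro: order_trans[OF _ abs_ge_self])
  qed
  show "expectation (\<lambda>\<omega>. (cmod (e k l \<omega>)) ^ 4) \<le> 3 * \<epsilon>\<^sup>2 / (real n)\<^sup>2"
  proof (cases "k = l")
    case False
    have "expectation (\<lambda>\<omega>. (cmod (e k l \<omega>)) ^ 4) \<le> expectation (\<lambda>\<omega>. (c k l) ^ 4 * (2 * (S k l \<omega>) ^ 4 + 2 * (T k l \<omega>) ^ 4))"
      by (rule integral_mono[OF i4 ib eb])
    also have "\<dots> = (c k l) ^ 4 * (2 * expectation (\<lambda>\<omega>. (S k l \<omega>) ^ 4) + 2 * expectation (\<lambda>\<omega>. (T k l \<omega>) ^ 4))"
      using S(3)[OF kl] T(3)[OF kl] by simp
    also have "\<dots> \<le> (c k l) ^ 4 * (2 * (3 * \<epsilon>\<^sup>2) + 2 * (3 * \<epsilon>\<^sup>2))"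
      using S(4)[OF kl] T(4)[OF kl] False by (intro mult_left_mono) auto
    also have "(c k l) ^ 4 = 1 / (4 * (real n)\<^sup>2)"
    proof -
      have "(c k l) ^ 4 = ((c k l)\<^sup>2)\<^sup>2" by (simp flip: power_mult)
      thus ?thesis unfolding c2 using False by (simp add: power2_eq_square)
    qed
    finally show ?thesis by simp
  next
    case True
    have "(c k l) ^ 4 = ((c k l)\<^sup>2)\<^sup>2" by (simp flip: power_mult)
    hence c4: "(c k l) ^ 4 = 1 / (real n)\<^sup>2" unfolding c2 using True by (simp add: power2_eq_square)
    have "(cmod (e k l \<omega>)) ^ 4 = (c k l) ^ 4 * (S k l \<omega>) ^ 4" for \<omega>
      unfolding e using True by (simp add: T_def norm_mult power_mult_distrib power_even_abs)
    thus ?thesis using S(4)[OF kl] c4 by simp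
  qed
qed

end

lemma hermitian_add:
  assumes "hermitian n a" "hermitian n b"
  shows "hermitian n (\<lambda>i j. a i j + b i j)"
  unfolding hermitian_def using hermitianD[OF assms(1)] hermitianD[OF assms(2)] by simp

lemma cmod_le_fro:
  assumes "i < n" "j < n"
  shows "cmod (X i j) \<le> fro n X"
proof -
  have "(case (i, j) of (i, j) \<Rightarrow> cmod (X i j)) \<le> fro n X"
    unfolding fro_def by (rule member_le_L2_set) (use assms in auto)
  thus ?thesis by simp
qed

text \<open>
  Expresses lower powers of the size \<open>m\<close> of an increment by its fourth power, at the scale \<open>s\<close> of the
  square root of the time step, so that only the fourth moment has to be computed.
\<close>
lemma power_le_interpolation:
  fixes m s :: real
  assumes m: "0 \<le> m" and s: "0 < s" and j: "j \<le> 4"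
  shows "m ^ j \<le> s ^ j + m ^ 4 / s ^ (4 - j)"
proof (cases "m \<le> s")
  case True
  hence "m ^ j \<le> s ^ j" using m by (intro power_mono)
  moreover have "0 \<le> m ^ 4 / s ^ (4 - j)" using m s by simp
  ultimately show ?thesis by linarith
next
  case False
  have "m ^ j * s ^ (4 - j) \<le> m ^ j * m ^ (4 - j)"
    using False m s by (intro mult_left_mono power_mono) auto
  also have "\<dots> = m ^ 4" using j by (simp flip: power_add)
  finally have "m ^ j \<le> m ^ 4 / s ^ (4 - j)" using s by (simp add: field_simps)
  moreover have "0 \<le> s ^ j" using s by simp
  ultimately show ?thesis by linarith
qed

lemma fro_power4_le: "(fro n X) ^ 4 \<le> (real n)\<^sup>2 * (\<Sum>i<n. \<Sum>j<n. (cmod (X i j)) ^ 4)"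
proof -
  have "(fro n X) ^ 4 = ((fro n X)\<^sup>2)\<^sup>2" by (simp flip: power_mult)
  also have "(fro n X)\<^sup>2 = (\<Sum>z\<in>{..<n} \<times> {..<n}. (cmod (X (fst z) (snd z)))\<^sup>2)"
    by (simp add: fro_power2 sum.cartesian_product case_prod_beta)
  also have "(\<Sum>z\<in>{..<n} \<times> {..<n}. (cmod (X (fst z) (snd z)))\<^sup>2)\<^sup>2
      \<le> (\<Sum>z\<in>{..<n} \<times> {..<n}. ((cmod (X (fst z) (snd z)))\<^sup>2)\<^sup>2) * card ({..<n} \<times> {..<n})"
    by (rule sum_squared_le_sum_of_squares)
  also have "\<dots> = (real n)\<^sup>2 * (\<Sum>i<n. \<Sum>j<n. (cmod (X i j)) ^ 4)"
    by (simp add: sum.cartesian_product case_prod_beta power2_eq_square flip: power_mult)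
       (simp add: power_mult[symmetric] power2_eq_square[symmetric])
  finally show ?thesis .
qed

lemma step_error_le:
  fixes m s c \<epsilon>' :: real
  assumes m: "0 \<le> m" and s: "0 < s" and e: "0 \<le> \<epsilon>'" "\<epsilon>' \<le> c * s\<^sup>2" and c: "0 \<le> c"
  shows "4 * m ^ 3 + \<epsilon>' * m\<^sup>2 + 6 * \<epsilon>' * m + 3 * \<epsilon>'\<^sup>2
     \<le> (4 * s ^ 3 + c * s ^ 4 + 6 * c * s ^ 3 + 3 * c\<^sup>2 * s ^ 4) + (4 / s + c + 6 * c / s) * m ^ 4"
proof -
  have 3: "m ^ 3 \<le> s ^ 3 + m ^ 4 / s" and 2: "m\<^sup>2 \<le> s\<^sup>2 + m ^ 4 / s\<^sup>2" and 1: "m \<le> s + m ^ 4 / s ^ 3"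
    using power_le_interpolation[OF m s, of 3] power_le_interpolation[OF m s, of 2] power_le_interpolation[OF m s, of 1]
    by simp_all
  have "\<epsilon>' * m\<^sup>2 \<le> (c * s\<^sup>2) * (s\<^sup>2 + m ^ 4 / s\<^sup>2)" using e 2 c by (intro mult_mono) auto
  also have "\<dots> = c * s ^ 4 + c * m ^ 4" using s by (simp add: field_simps power_add[symmetric] eval_nat_numeral)
  finally have b: "\<epsilon>' * m\<^sup>2 \<le> c * s ^ 4 + c * m ^ 4" .
  have "\<epsilon>' * m \<le> (c * s\<^sup>2) * (s + m ^ 4 / s ^ 3)" using e 1 c m s by (intro mult_mono) auto
  also have "\<dots> = c * s ^ 3 + c / s * m ^ 4" using s by (simp add: field_simps eval_nat_numeral)
  finally have d: "\<epsilon>' * m \<le> c * s ^ 3 + c / s * m ^ 4" .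
  have "\<epsilon>'\<^sup>2 \<le> (c * s\<^sup>2)\<^sup>2" using e by (intro power_mono) auto
  also have "\<dots> = c\<^sup>2 * s ^ 4" by (simp add: power_mult_distrib flip: power_mult)
  finally have f: "\<epsilon>'\<^sup>2 \<le> c\<^sup>2 * s ^ 4" .
  have "4 * m ^ 3 + \<epsilon>' * m\<^sup>2 + 6 * \<epsilon>' * m + 3 * \<epsilon>'\<^sup>2
     \<le> 4 * (s ^ 3 + m ^ 4 / s) + (c * s ^ 4 + c * m ^ 4) + 6 * (c * s ^ 3 + c / s * m ^ 4) + 3 * (c\<^sup>2 * s ^ 4)"
    unfolding mult.assoc[of 6]
    by (intro add_mono mult_left_mono 3 b d f) auto
  also have "\<dots> = (4 * s ^ 3 + c * s ^ 4 + 6 * c * s ^ 3 + 3 * c\<^sup>2 * s ^ 4) + (4 / s + c + 6 * c / s) * m ^ 4"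
    by (simp add: algebra_simps)
  finally show ?thesis .
qed

text \<open>
  One time step, with \<open>N1\<close> the past and \<open>e\<close> an independent increment; independence enters through the
  first two moments of \<open>e\<close> against bounded past factors. The mean of the linear term vanishes. Contracting the
  quadratic term gives \<open>\<epsilon> G \<tau>\<close>, and subtracting \<open>\<epsilon> g \<tau>\<close> from the motion of the spectral
  parameter leaves \<open>\<epsilon> u \<tau>\<close> with \<open>\<bar>\<tau>\<bar> \<le> 1 / \<eta>\<^sup>2\<close>. This accounts for the factor in front of the old second
  moment. The squared linear term contributes \<open>\<epsilon> / n\<close> times \<open>\<parallel>R\<^sup>2\<parallel>\<^sup>2 / n\<^sup>2\<close>, and \<open>\<parallel>R\<^sup>2\<parallel>\<^sup>2 \<le> \<parallel>R\<parallel>\<^sup>4 \<le> (n / \<eta>\<^sup>2) \<parallel>R\<parallel>\<^sup>2\<close>.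
\<close>
lemma (in prob_space) gaussian_step:
  fixes a e :: "nat \<Rightarrow> nat \<Rightarrow> 'a \<Rightarrow> complex" and w g :: "'a \<Rightarrow> complex" and c \<epsilon> \<eta> :: real
  assumes n: "1 \<le> n" and \<epsilon>: "0 < \<epsilon>" "\<epsilon> \<le> 1" and sub: "subalgebra M N1"
    and a: "\<And>i j. i < n \<Longrightarrow> j < n \<Longrightarrow> a i j \<in> borel_measurable N1"
    and w: "w \<in> borel_measurable N1" and g: "g \<in> borel_measurable N1"
    and ah: "\<And>\<omega>. hermitian n (\<lambda>i j. a i j \<omega>)" and eh: "\<And>\<omega>. hermitian n (\<lambda>i j. e i j \<omega>)"
    and em: "\<And>i j. i < n \<Longrightarrow> j < n \<Longrightarrow> e i j \<in> borel_measurable M"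
    and e1: "\<And>F C k l. F \<in> borel_measurable N1 \<Longrightarrow> (\<And>\<omega>. cmod (F \<omega>) \<le> C) \<Longrightarrow> k < n \<Longrightarrow> l < n \<Longrightarrow>
       integrable M (\<lambda>\<omega>. F \<omega> * e k l \<omega>) \<and> expectation (\<lambda>\<omega>. F \<omega> * e k l \<omega>) = 0"
    and e2: "\<And>F C k l p q. F \<in> borel_measurable N1 \<Longrightarrow> (\<And>\<omega>. cmod (F \<omega>) \<le> C) \<Longrightarrow> k < n \<Longrightarrow> l < n \<Longrightarrow> p < n \<Longrightarrow> q < n \<Longrightarrow>
       integrable M (\<lambda>\<omega>. F \<omega> * (e k l \<omega> * e p q \<omega>)) \<and>
       expectation (\<lambda>\<omega>. F \<omega> * (e k l \<omega> * e p q \<omega>)) = (if k = q \<and> l = p then complex_of_real (\<epsilon> / real n) else 0) * expectation F"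
    and e4: "\<And>k l. k < n \<Longrightarrow> l < n \<Longrightarrow> integrable M (\<lambda>\<omega>. (cmod (e k l \<omega>)) ^ 4) \<and>
       expectation (\<lambda>\<omega>. (cmod (e k l \<omega>)) ^ 4) \<le> 3 * \<epsilon>\<^sup>2 / (real n)\<^sup>2"
    and \<eta>: "0 < \<eta>" "\<And>\<omega>. \<eta> \<le> Im (w \<omega>)" "\<And>\<omega>. \<eta> \<le> Im (w \<omega> + \<epsilon> * g \<omega>)"
    and c: "\<And>\<omega>. cmod (g \<omega>) \<le> c"
  defines "R \<equiv> \<lambda>\<omega>. resolvent n (\<lambda>i j. a i j \<omega>) (w \<omega>)"
  defines "u \<equiv> \<lambda>\<omega>. tr n (R \<omega>) / of_nat n - g \<omega>"
    and "u' \<equiv> \<lambda>\<omega>. tr n (resolvent n (\<lambda>i j. a i j \<omega> + e i j \<omega>) (w \<omega> + \<epsilon> * g \<omega>)) / of_nat n - g \<omega>"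
    and "K \<equiv> max 1 (max (sqrt (real n) / \<eta>) (1 / \<eta> + c))"
  shows "expectation (\<lambda>\<omega>. (cmod (u' \<omega>))\<^sup>2) \<le> (1 + 2 * \<epsilon> / \<eta>\<^sup>2) * expectation (\<lambda>\<omega>. (cmod (u \<omega>))\<^sup>2)
     + \<epsilon> / (real n * \<eta>\<^sup>2) * expectation (\<lambda>\<omega>. (fro n (R \<omega>))\<^sup>2 / real n)
     + sqrt \<epsilon> ^ 3 * (K ^ 5 * (1 + 3 * (real n)\<^sup>2) * (4 + 7 * c + 3 * c\<^sup>2))"
proof -
  \<comment> \<open>\<open>K\<close> bounds the Frobenius norms of the resolvents as well as \<open>u\<close>.\<close>
  have c0: "0 \<le> c" using c[of undefined] norm_ge_zero order_trans by blast
  have K: "1 \<le> K" "sqrt (real n) / \<eta> \<le> K" "1 / \<eta> + c \<le> K" by (auto simp: K_def)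
  have n0: "(of_nat n :: complex) \<noteq> 0" "0 < real n" using n by auto
  have toM: "f \<in> borel_measurable N1 \<Longrightarrow> f \<in> borel_measurable M" for f :: "'a \<Rightarrow> complex"
    by (rule measurable_from_subalg[OF sub])
  have bh: "hermitian n (\<lambda>i j. a i j \<omega> + e i j \<omega>)" for \<omega>
    by (rule hermitian_add[OF ah eh])
  have B: "cmod (tr n (R \<omega>) / of_nat n) \<le> 1 / \<eta>" "(fro n (R \<omega>))\<^sup>2 \<le> real n / \<eta>\<^sup>2"
    "fro n (R \<omega>) \<le> sqrt (real n) / \<eta>" "cmod (tr n (mm n (R \<omega>) (R \<omega>)) / of_nat n) \<le> 1 / \<eta>\<^sup>2" for \<omega>
    unfolding R_def by (rule resolvent_bounds[OF ah n \<eta>(1) \<eta>(2)])+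
  define P where "P = (\<lambda>\<omega>. mm n (R \<omega>) (R \<omega>))"
  have Rm: "(\<lambda>\<omega>. R \<omega> i j) \<in> borel_measurable N1" for i j
    unfolding R_def by (rule resolvent_measurable[OF a w])
  have Pm: "(\<lambda>\<omega>. P \<omega> i j) \<in> borel_measurable N1" if "i < n" "j < n" for i j
    unfolding P_def by (rule mm_measurable[OF Rm Rm that])
  have fR: "fro n (R \<omega>) \<le> K" for \<omega> using B(3)[of \<omega>] K(2) by simp
  have fP: "fro n (P \<omega>) \<le> K * K" for \<omega> unfolding P_def by (rule fro_mm_le[OF fR fR])
  have bR: "cmod (R \<omega> i j) \<le> K" if "i < n" "j < n" for \<omega> i j
    using cmod_le_fro[OF that, of "R \<omega>"] fR[of \<omega>] by linarith
  have bP: "cmod (P \<omega> i j) \<le> K * K" if "i < n" "j < n" for \<omega> i j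
    using cmod_le_fro[OF that, of "P \<omega>"] fP[of \<omega>] by linarith
  have um: "u \<in> borel_measurable N1"
    unfolding u_def using g by (intro borel_measurable_diff borel_measurable_divide tr_measurable Rm) auto
  have bu: "cmod (u \<omega>) \<le> K" for \<omega>
  proof -
    have "cmod (u \<omega>) \<le> 1 / \<eta> + c"
      unfolding u_def by (rule order_trans[OF norm_triangle_ineq4 add_mono[OF B(1) c]])
    thus ?thesis using K(3) by simp
  qed
  define G where "G = (\<lambda>\<omega>. tr n (R \<omega>) / of_nat n)"
  define \<tau> where "\<tau> = (\<lambda>\<omega>. tr n (P \<omega>) / of_nat n)"
  have Gm: "G \<in> borel_measurable N1"
    unfolding G_def by (intro borel_measurable_divide tr_measurable Rm) auto
  have \<tau>m: "\<tau> \<in> borel_measurable N1"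
    unfolding \<tau>_def by (intro borel_measurable_divide tr_measurable Pm) auto
  have b\<tau>: "cmod (\<tau> \<omega>) \<le> 1 / \<eta>\<^sup>2" for \<omega> using B(4) by (simp add: \<tau>_def P_def)
  have bG: "cmod (G \<omega>) \<le> 1 / \<eta>" for \<omega> using B(1) by (simp add: G_def)
  have bint: "integrable M f" if "f \<in> borel_measurable N1" "\<And>\<omega>. cmod (f \<omega>) \<le> C" for f C
    by (rule integrable_const_bound[OF AE_I2 toM[OF that(1)]]) (rule that(2))
  define q1 where "q1 = (\<lambda>\<omega>. tr n (mm n (\<lambda>i j. e i j \<omega>) (P \<omega>)) / of_nat n)"
  define q2 where "q2 = (\<lambda>\<omega>. tr n (mm n (\<lambda>i j. e i j \<omega>) (mm n (R \<omega>) (mm n (\<lambda>i j. e i j \<omega>) (P \<omega>)))) / of_nat n)"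
  define m where "m = (\<lambda>\<omega>. fro n (\<lambda>i j. e i j \<omega>))"
  define s where "s = sqrt \<epsilon>"
  have s: "0 < s" "s \<le> 1" "s\<^sup>2 = \<epsilon>" using \<epsilon> by (auto simp: s_def)
  \<comment> \<open>The linear term is centred given the past.\<close>
  define F1 where "F1 = (\<lambda>k l \<omega>. cnj (u \<omega>) * P \<omega> l k / of_nat n)"
  have F1: "F1 k l \<in> borel_measurable N1" "cmod (F1 k l \<omega>) \<le> K * (K * K) / real n" if "k < n" "l < n" for k l \<omega>
  proof -
    show "F1 k l \<in> borel_measurable N1"
      unfolding F1_def using um Pm[OF that(2,1)] by (intro borel_measurable_divide borel_measurable_times cnj_measurable) auto
    show "cmod (F1 k l \<omega>) \<le> K * (K * K) / real n"
      unfolding F1_def norm_divide norm_mult norm_of_nat complex_mod_cnj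
      using bu bP[OF that(2,1)] K by (intro divide_right_mono mult_mono) auto
  qed
  have x1: "cnj (u \<omega>) * q1 \<omega> = (\<Sum>k<n. \<Sum>l<n. F1 k l \<omega> * e k l \<omega>)" for \<omega>
    by (simp add: q1_def F1_def tr_def mm_def sum_distrib_left sum_divide_distrib mult_ac)
  have E1: "integrable M (\<lambda>\<omega>. cnj (u \<omega>) * q1 \<omega>)" "expectation (\<lambda>\<omega>. cnj (u \<omega>) * q1 \<omega>) = 0"
  proof -
    have t: "integrable M (\<lambda>\<omega>. F1 k l \<omega> * e k l \<omega>)" "expectation (\<lambda>\<omega>. F1 k l \<omega> * e k l \<omega>) = 0"
      if "k < n" "l < n" for k l
      using e1[OF F1(1)[OF that] F1(2)[OF that] that] by blast+
    have t2: "integrable M (\<lambda>\<omega>. \<Sum>l<n. F1 k l \<omega> * e k l \<omega>)" if "k < n" for k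
      using t(1)[OF that] by (intro Bochner_Integration.integrable_sum) simp
    show "integrable M (\<lambda>\<omega>. cnj (u \<omega>) * q1 \<omega>)"
      unfolding x1 by (rule Bochner_Integration.integrable_sum) (simp add: t2)
    have "expectation (\<lambda>\<omega>. cnj (u \<omega>) * q1 \<omega>) = (\<Sum>k<n. \<Sum>l<n. expectation (\<lambda>\<omega>. F1 k l \<omega> * e k l \<omega>))"
    proof -
      have "expectation (\<lambda>\<omega>. cnj (u \<omega>) * q1 \<omega>) = (\<Sum>k<n. expectation (\<lambda>\<omega>. \<Sum>l<n. F1 k l \<omega> * e k l \<omega>))"
        unfolding x1 by (rule Bochner_Integration.integral_sum) (simp add: t2)
      also have "\<dots> = (\<Sum>k<n. \<Sum>l<n. expectation (\<lambda>\<omega>. F1 k l \<omega> * e k l \<omega>))"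
        by (intro sum.cong refl Bochner_Integration.integral_sum) (simp add: t(1))
      finally show ?thesis .
    qed
    also have "\<dots> = 0" using t(2) by simp
    finally show "expectation (\<lambda>\<omega>. cnj (u \<omega>) * q1 \<omega>) = 0" .
  qed
  \<comment> \<open>Quadratic expressions in the increment with past coefficients: only conjugate pairs of entries survive.\<close>
  have contraction: "integrable M (\<lambda>\<omega>. \<Sum>k<n. \<Sum>l<n. \<Sum>p<n. \<Sum>q<n. F k l p q \<omega> * (e k l \<omega> * e p q \<omega>)) \<and>
     expectation (\<lambda>\<omega>. \<Sum>k<n. \<Sum>l<n. \<Sum>p<n. \<Sum>q<n. F k l p q \<omega> * (e k l \<omega> * e p q \<omega>))
       = complex_of_real (\<epsilon> / real n) * expectation (\<lambda>\<omega>. \<Sum>k<n. \<Sum>l<n. F k l l k \<omega>)"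
    if F: "\<And>k l p q. k < n \<Longrightarrow> l < n \<Longrightarrow> p < n \<Longrightarrow> q < n \<Longrightarrow> F k l p q \<in> borel_measurable N1"
      "\<And>k l p q \<omega>. k < n \<Longrightarrow> l < n \<Longrightarrow> p < n \<Longrightarrow> q < n \<Longrightarrow> cmod (F k l p q \<omega>) \<le> C" for F C
  proof (intro conjI)
    have i4: "integrable M (\<lambda>\<omega>. F k l p q \<omega> * (e k l \<omega> * e p q \<omega>))"
      if "k < n" "l < n" "p < n" "q < n" for k l p q
      using e2[OF F(1)[OF that] F(2)[OF that] that] by blast
    have v4: "expectation (\<lambda>\<omega>. F k l p q \<omega> * (e k l \<omega> * e p q \<omega>))
        = (if k = q then (if l = p then complex_of_real (\<epsilon> / real n) * expectation (F k l p q) else 0) else 0)"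
      if "k < n" "l < n" "p < n" "q < n" for k l p q
      using e2[OF F(1)[OF that] F(2)[OF that] that] by simp
    have i3: "integrable M (\<lambda>\<omega>. \<Sum>q<n. F k l p q \<omega> * (e k l \<omega> * e p q \<omega>))" if "k < n" "l < n" "p < n" for k l p
      by (rule Bochner_Integration.integrable_sum) (simp add: i4 that)
    have i2: "integrable M (\<lambda>\<omega>. \<Sum>p<n. \<Sum>q<n. F k l p q \<omega> * (e k l \<omega> * e p q \<omega>))" if "k < n" "l < n" for k l
      by (rule Bochner_Integration.integrable_sum) (simp add: i3 that)
    have i1: "integrable M (\<lambda>\<omega>. \<Sum>l<n. \<Sum>p<n. \<Sum>q<n. F k l p q \<omega> * (e k l \<omega> * e p q \<omega>))" if "k < n" for k
      by (rule Bochner_Integration.integrable_sum) (simp add: i2 that)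
    show "integrable M (\<lambda>\<omega>. \<Sum>k<n. \<Sum>l<n. \<Sum>p<n. \<Sum>q<n. F k l p q \<omega> * (e k l \<omega> * e p q \<omega>))"
      by (rule Bochner_Integration.integrable_sum) (simp add: i1)
    have iF: "integrable M (F k l p q)" if "k < n" "l < n" "p < n" "q < n" for k l p q
      by (rule bint[OF F(1)[OF that] F(2)[OF that]])
    have "expectation (\<lambda>\<omega>. \<Sum>k<n. \<Sum>l<n. \<Sum>p<n. \<Sum>q<n. F k l p q \<omega> * (e k l \<omega> * e p q \<omega>))
       = (\<Sum>k<n. \<Sum>l<n. \<Sum>p<n. \<Sum>q<n. expectation (\<lambda>\<omega>. F k l p q \<omega> * (e k l \<omega> * e p q \<omega>)))"
      using i1 i2 i3 i4 by (simp add: Bochner_Integration.integral_sum)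
    also have "\<dots> = (\<Sum>k<n. \<Sum>l<n. \<Sum>p<n. \<Sum>q<n. if k = q then (if l = p then complex_of_real (\<epsilon> / real n) * expectation (F k l p q) else 0) else 0)"
      using v4 by (intro sum.cong refl) simp
    also have "\<dots> = (\<Sum>k<n. \<Sum>l<n. complex_of_real (\<epsilon> / real n) * expectation (F k l l k))"
      by (intro sum.cong refl) simp
    also have "\<dots> = complex_of_real (\<epsilon> / real n) * (\<Sum>k<n. \<Sum>l<n. expectation (F k l l k))"
      by (simp only: sum_distrib_left)
    also have "(\<Sum>k<n. \<Sum>l<n. expectation (F k l l k)) = expectation (\<lambda>\<omega>. \<Sum>k<n. \<Sum>l<n. F k l l k \<omega>)"
    proof -
      have j2: "integrable M (\<lambda>\<omega>. \<Sum>l<n. F k l l k \<omega>)" if "k < n" for k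
        by (rule Bochner_Integration.integrable_sum) (simp add: iF that)
      have "expectation (\<lambda>\<omega>. \<Sum>k<n. \<Sum>l<n. F k l l k \<omega>) = (\<Sum>k<n. expectation (\<lambda>\<omega>. \<Sum>l<n. F k l l k \<omega>))"
        by (rule Bochner_Integration.integral_sum) (simp add: j2)
      also have "\<dots> = (\<Sum>k<n. \<Sum>l<n. expectation (F k l l k))"
        by (intro sum.cong refl Bochner_Integration.integral_sum) (simp add: iF)
      finally show ?thesis by (rule sym)
    qed
    finally show "expectation (\<lambda>\<omega>. \<Sum>k<n. \<Sum>l<n. \<Sum>p<n. \<Sum>q<n. F k l p q \<omega> * (e k l \<omega> * e p q \<omega>))
       = complex_of_real (\<epsilon> / real n) * expectation (\<lambda>\<omega>. \<Sum>k<n. \<Sum>l<n. F k l l k \<omega>)" .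
  qed
  define F2 where "F2 = (\<lambda>k l p q \<omega>. cnj (u \<omega>) * (R \<omega> l p * P \<omega> q k) / of_nat n)"
  have F2: "F2 k l p q \<in> borel_measurable N1" "cmod (F2 k l p q \<omega>) \<le> K * (K * (K * K)) / real n"
    if "k < n" "l < n" "p < n" "q < n" for k l p q \<omega>
  proof -
    show "F2 k l p q \<in> borel_measurable N1"
      unfolding F2_def using um Pm[OF that(4,1)] Rm
      by (intro borel_measurable_divide borel_measurable_times cnj_measurable) auto
    show "cmod (F2 k l p q \<omega>) \<le> K * (K * (K * K)) / real n"
      unfolding F2_def norm_divide norm_mult norm_of_nat complex_mod_cnj
      using bu bP[OF that(4,1)] bR[OF that(2,3)] K by (intro divide_right_mono mult_mono) auto
  qed
  have x2: "cnj (u \<omega>) * q2 \<omega> = (\<Sum>k<n. \<Sum>l<n. \<Sum>p<n. \<Sum>q<n. F2 k l p q \<omega> * (e k l \<omega> * e p q \<omega>))" for \<omega>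
    by (simp add: q2_def F2_def tr_def mm_def sum_distrib_left sum_divide_distrib mult_ac)
  have y2: "(\<Sum>k<n. \<Sum>l<n. F2 k l l k \<omega>) = of_nat n * (cnj (u \<omega>) * (G \<omega> * \<tau> \<omega>))" for \<omega>
  proof -
    have "(\<Sum>k<n. \<Sum>l<n. F2 k l l k \<omega>) = cnj (u \<omega>) * ((\<Sum>l<n. R \<omega> l l) * (\<Sum>k<n. P \<omega> k k)) / of_nat n"
      unfolding sum_product F2_def
      by (subst sum.swap) (simp add: sum_distrib_left sum_divide_distrib)
    thus ?thesis using n0 by (simp add: G_def \<tau>_def tr_def field_simps)
  qed
  have E2: "integrable M (\<lambda>\<omega>. cnj (u \<omega>) * q2 \<omega>)"
     "expectation (\<lambda>\<omega>. cnj (u \<omega>) * q2 \<omega>) = \<epsilon> * expectation (\<lambda>\<omega>. cnj (u \<omega>) * (G \<omega> * \<tau> \<omega>))"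
  proof -
    have con: "integrable M (\<lambda>\<omega>. cnj (u \<omega>) * q2 \<omega>) \<and> expectation (\<lambda>\<omega>. cnj (u \<omega>) * q2 \<omega>)
        = complex_of_real (\<epsilon> / real n) * expectation (\<lambda>\<omega>. \<Sum>k<n. \<Sum>l<n. F2 k l l k \<omega>)"
      unfolding x2 by (rule contraction[of F2 "K * (K * (K * K)) / real n"]; rule F2; assumption)
    thus "integrable M (\<lambda>\<omega>. cnj (u \<omega>) * q2 \<omega>)" by (rule conjunct1)
    have "expectation (\<lambda>\<omega>. \<Sum>k<n. \<Sum>l<n. F2 k l l k \<omega>) = of_nat n * expectation (\<lambda>\<omega>. cnj (u \<omega>) * (G \<omega> * \<tau> \<omega>))"
      unfolding y2 by (rule Bochner_Integration.integral_mult_right_zero)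
    with con n0 show "expectation (\<lambda>\<omega>. cnj (u \<omega>) * q2 \<omega>) = \<epsilon> * expectation (\<lambda>\<omega>. cnj (u \<omega>) * (G \<omega> * \<tau> \<omega>))"
      by (simp add: of_real_divide)
  qed
  \<comment> \<open>The squared linear term is again a quadratic expression, as \<open>cnj (e p q) = e q p\<close>.\<close>
  define F3 where "F3 = (\<lambda>k l p q \<omega>. P \<omega> l k * cnj (P \<omega> p q) / (of_nat n)\<^sup>2)"
  have F3: "F3 k l p q \<in> borel_measurable N1" "cmod (F3 k l p q \<omega>) \<le> (K * K) * (K * K) / (real n)\<^sup>2"
    if "k < n" "l < n" "p < n" "q < n" for k l p q \<omega>
  proof -
    show "F3 k l p q \<in> borel_measurable N1"
      unfolding F3_def using Pm[OF that(2,1)] Pm[OF that(3,4)]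
      by (intro borel_measurable_divide borel_measurable_times cnj_measurable) auto
    show "cmod (F3 k l p q \<omega>) \<le> (K * K) * (K * K) / (real n)\<^sup>2"
      unfolding F3_def norm_divide norm_mult norm_power norm_of_nat complex_mod_cnj
      using bP[OF that(2,1)] bP[OF that(3,4)] K by (intro divide_right_mono mult_mono) auto
  qed
  have x3: "complex_of_real ((cmod (q1 \<omega>))\<^sup>2) = (\<Sum>k<n. \<Sum>l<n. \<Sum>p<n. \<Sum>q<n. F3 k l p q \<omega> * (e k l \<omega> * e p q \<omega>))" for \<omega>
  proof -
    have q: "q1 \<omega> = (\<Sum>k<n. \<Sum>l<n. e k l \<omega> * P \<omega> l k) / of_nat n"
      by (simp add: q1_def tr_def mm_def)
    have "cnj (q1 \<omega>) = (\<Sum>q<n. \<Sum>p<n. e p q \<omega> * cnj (P \<omega> p q)) / of_nat n"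
      unfolding q using hermitianD[OF eh] by (simp add: cnj_sum)
    also have "\<dots> = (\<Sum>p<n. \<Sum>q<n. e p q \<omega> * cnj (P \<omega> p q)) / of_nat n"
      by (subst sum.swap) (rule refl)
    finally have cq: "cnj (q1 \<omega>) = (\<Sum>p<n. \<Sum>q<n. e p q \<omega> * cnj (P \<omega> p q)) / of_nat n" .
    have "complex_of_real ((cmod (q1 \<omega>))\<^sup>2) = q1 \<omega> * cnj (q1 \<omega>)" by (rule complex_norm_square)
    also have "\<dots> = (\<Sum>k<n. \<Sum>l<n. \<Sum>p<n. \<Sum>q<n. (e k l \<omega> * P \<omega> l k) * (e p q \<omega> * cnj (P \<omega> p q))) / (of_nat n)\<^sup>2"
    proof -
      define Q where "Q = (\<Sum>p<n. \<Sum>q<n. e p q \<omega> * cnj (P \<omega> p q))"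
      have "q1 \<omega> * cnj (q1 \<omega>) = ((\<Sum>k<n. \<Sum>l<n. e k l \<omega> * P \<omega> l k) / of_nat n) * (Q / of_nat n)"
        unfolding Q_def by (rule arg_cong2[OF q cq])
      also have "\<dots> = (\<Sum>k<n. \<Sum>l<n. (e k l \<omega> * P \<omega> l k) * Q) / (of_nat n)\<^sup>2"
        by (simp add: sum_distrib_right power2_eq_square)
      also have "\<dots> = (\<Sum>k<n. \<Sum>l<n. \<Sum>p<n. \<Sum>q<n. (e k l \<omega> * P \<omega> l k) * (e p q \<omega> * cnj (P \<omega> p q))) / (of_nat n)\<^sup>2"
        unfolding Q_def sum_distrib_left by (rule refl)
      finally show ?thesis .
    qed
    also have "\<dots> = (\<Sum>k<n. \<Sum>l<n. \<Sum>p<n. \<Sum>q<n. F3 k l p q \<omega> * (e k l \<omega> * e p q \<omega>))"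
      by (simp add: F3_def sum_divide_distrib mult_ac)
    finally show ?thesis .
  qed
  have y3: "(\<Sum>k<n. \<Sum>l<n. F3 k l l k \<omega>) = complex_of_real ((fro n (P \<omega>))\<^sup>2 / (real n)\<^sup>2)" for \<omega>
  proof -
    have "(\<Sum>k<n. \<Sum>l<n. F3 k l l k \<omega>) = (\<Sum>l<n. \<Sum>k<n. complex_of_real ((cmod (P \<omega> l k))\<^sup>2)) / (of_nat n)\<^sup>2"
      by (subst sum.swap) (simp only: F3_def sum_divide_distrib complex_norm_square)
    thus ?thesis by (simp add: fro_power2)
  qed
  have fPm: "(\<lambda>\<omega>. fro n (P \<omega>)) \<in> borel_measurable N1" by (rule fro_measurable[OF Pm])
  have fRm: "(\<lambda>\<omega>. fro n (R \<omega>)) \<in> borel_measurable N1" by (rule fro_measurable[OF Rm])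
  have toMr: "f \<in> borel_measurable N1 \<Longrightarrow> f \<in> borel_measurable M" for f :: "'a \<Rightarrow> real"
    by (rule measurable_from_subalg[OF sub])
  note [measurable] = toMr[OF fPm] toMr[OF fRm] toM[OF um] toM[OF Gm] toM[OF \<tau>m] toM[OF g] toM[OF w]
  have ifR: "integrable M (\<lambda>\<omega>. (fro n (R \<omega>))\<^sup>2 / real n)"
    by (rule integrable_const_bound[of _ "K\<^sup>2 / real n"])
       (use fR in \<open>auto intro!: AE_I2 divide_right_mono power_mono simp: fro_nonneg\<close>)
  have iu: "integrable M (\<lambda>\<omega>. (cmod (u \<omega>))\<^sup>2)"
    by (rule integrable_const_bound[of _ "K\<^sup>2"]) (use bu in \<open>auto intro!: AE_I2 power_mono\<close>)
  have E3: "integrable M (\<lambda>\<omega>. (cmod (q1 \<omega>))\<^sup>2)"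
     "expectation (\<lambda>\<omega>. (cmod (q1 \<omega>))\<^sup>2) \<le> \<epsilon> / (real n * \<eta>\<^sup>2) * expectation (\<lambda>\<omega>. (fro n (R \<omega>))\<^sup>2 / real n)"
  proof -
    have con: "integrable M (\<lambda>\<omega>. complex_of_real ((cmod (q1 \<omega>))\<^sup>2))"
      "expectation (\<lambda>\<omega>. complex_of_real ((cmod (q1 \<omega>))\<^sup>2)) = complex_of_real (\<epsilon> / real n) * expectation (\<lambda>\<omega>. complex_of_real ((fro n (P \<omega>))\<^sup>2 / (real n)\<^sup>2))"
    proof -
      have "integrable M (\<lambda>\<omega>. complex_of_real ((cmod (q1 \<omega>))\<^sup>2)) \<and> expectation (\<lambda>\<omega>. complex_of_real ((cmod (q1 \<omega>))\<^sup>2))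
        = complex_of_real (\<epsilon> / real n) * expectation (\<lambda>\<omega>. \<Sum>k<n. \<Sum>l<n. F3 k l l k \<omega>)"
        unfolding x3 by (rule contraction[of F3 "(K * K) * (K * K) / (real n)\<^sup>2"]; rule F3; assumption)
      thus "integrable M (\<lambda>\<omega>. complex_of_real ((cmod (q1 \<omega>))\<^sup>2))"
      "expectation (\<lambda>\<omega>. complex_of_real ((cmod (q1 \<omega>))\<^sup>2)) = complex_of_real (\<epsilon> / real n) * expectation (\<lambda>\<omega>. complex_of_real ((fro n (P \<omega>))\<^sup>2 / (real n)\<^sup>2))"
        unfolding y3 by blast+
    qed
    show i: "integrable M (\<lambda>\<omega>. (cmod (q1 \<omega>))\<^sup>2)" using con(1) by (rule complex_of_real_integrable_eq[THEN iffD1])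
    have "complex_of_real (expectation (\<lambda>\<omega>. (cmod (q1 \<omega>))\<^sup>2)) = complex_of_real (\<epsilon> / real n * expectation (\<lambda>\<omega>. (fro n (P \<omega>))\<^sup>2 / (real n)\<^sup>2))"
      using con(2) by (simp only: integral_complex_of_real of_real_mult)
    hence "expectation (\<lambda>\<omega>. (cmod (q1 \<omega>))\<^sup>2) = \<epsilon> / real n * expectation (\<lambda>\<omega>. (fro n (P \<omega>))\<^sup>2 / (real n)\<^sup>2)"
      by (simp only: of_real_eq_iff)
    also have "\<dots> \<le> \<epsilon> / real n * expectation (\<lambda>\<omega>. 1 / \<eta>\<^sup>2 * ((fro n (R \<omega>))\<^sup>2 / real n))"
    proof (intro mult_left_mono integral_mono)
      fix \<omega>
      have "(fro n (P \<omega>))\<^sup>2 \<le> (fro n (R \<omega>) * fro n (R \<omega>))\<^sup>2"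
        unfolding P_def by (intro power_mono fro_mm fro_nonneg)
      also have "\<dots> = (fro n (R \<omega>))\<^sup>2 * (fro n (R \<omega>))\<^sup>2" by (simp add: power_mult_distrib)
      also have "\<dots> \<le> (real n / \<eta>\<^sup>2) * (fro n (R \<omega>))\<^sup>2"
        using B(2) by (intro mult_right_mono) auto
      finally have "(fro n (P \<omega>))\<^sup>2 / (real n)\<^sup>2 \<le> (real n / \<eta>\<^sup>2) * (fro n (R \<omega>))\<^sup>2 / (real n)\<^sup>2"
        by (intro divide_right_mono) auto
      thus "(fro n (P \<omega>))\<^sup>2 / (real n)\<^sup>2 \<le> 1 / \<eta>\<^sup>2 * ((fro n (R \<omega>))\<^sup>2 / real n)"
        using n0 by (simp add: power2_eq_square)
    next
      show "integrable M (\<lambda>\<omega>. (fro n (P \<omega>))\<^sup>2 / (real n)\<^sup>2)"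
        by (rule integrable_const_bound[of _ "(K * K)\<^sup>2 / (real n)\<^sup>2"])
           (use fP in \<open>auto intro!: AE_I2 divide_right_mono power_mono simp: fro_nonneg\<close>)
      show "integrable M (\<lambda>\<omega>. 1 / \<eta>\<^sup>2 * ((fro n (R \<omega>))\<^sup>2 / real n))"
        by (rule Bochner_Integration.integrable_mult_right[OF ifR])
    qed (use \<epsilon> in auto)
    also have "\<dots> = \<epsilon> / (real n * \<eta>\<^sup>2) * expectation (\<lambda>\<omega>. (fro n (R \<omega>))\<^sup>2 / real n)"
      by simp
    finally show "expectation (\<lambda>\<omega>. (cmod (q1 \<omega>))\<^sup>2) \<le> \<epsilon> / (real n * \<eta>\<^sup>2) * expectation (\<lambda>\<omega>. (fro n (R \<omega>))\<^sup>2 / real n)" .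
  qed
  have E4: "integrable M (\<lambda>\<omega>. (m \<omega>) ^ 4)" "expectation (\<lambda>\<omega>. (m \<omega>) ^ 4) \<le> 3 * (real n)\<^sup>2 * \<epsilon>\<^sup>2"
  proof -
    have ib: "integrable M (\<lambda>\<omega>. (real n)\<^sup>2 * (\<Sum>i<n. \<Sum>j<n. (cmod (e i j \<omega>)) ^ 4))"
      using e4 by (intro Bochner_Integration.integrable_mult_right Bochner_Integration.integrable_sum) blast
    have [measurable]: "m \<in> borel_measurable M" unfolding m_def by (rule fro_measurable[OF em])
    have le: "(m \<omega>) ^ 4 \<le> (real n)\<^sup>2 * (\<Sum>i<n. \<Sum>j<n. (cmod (e i j \<omega>)) ^ 4)" for \<omega>
      unfolding m_def by (rule fro_power4_le)
    show i: "integrable M (\<lambda>\<omega>. (m \<omega>) ^ 4)"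
      by (rule Bochner_Integration.integrable_bound[OF ib]) (use le in \<open>auto intro!: AE_I2 order_trans[OF le abs_ge_self]\<close>)
    have "expectation (\<lambda>\<omega>. (m \<omega>) ^ 4) \<le> expectation (\<lambda>\<omega>. (real n)\<^sup>2 * (\<Sum>i<n. \<Sum>j<n. (cmod (e i j \<omega>)) ^ 4))"
      by (rule integral_mono[OF i ib le])
    also have "\<dots> = (real n)\<^sup>2 * (\<Sum>i<n. \<Sum>j<n. expectation (\<lambda>\<omega>. (cmod (e i j \<omega>)) ^ 4))"
    proof -
      have j4: "integrable M (\<lambda>\<omega>. (cmod (e i j \<omega>)) ^ 4)" if "i < n" "j < n" for i j
        using e4[OF that] by blast
      have j3: "integrable M (\<lambda>\<omega>. \<Sum>j<n. (cmod (e i j \<omega>)) ^ 4)" if "i < n" for i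
        by (rule Bochner_Integration.integrable_sum) (simp add: j4 that)
      have "expectation (\<lambda>\<omega>. \<Sum>i<n. \<Sum>j<n. (cmod (e i j \<omega>)) ^ 4) = (\<Sum>i<n. expectation (\<lambda>\<omega>. \<Sum>j<n. (cmod (e i j \<omega>)) ^ 4))"
        by (rule Bochner_Integration.integral_sum) (simp add: j3)
      also have "\<dots> = (\<Sum>i<n. \<Sum>j<n. expectation (\<lambda>\<omega>. (cmod (e i j \<omega>)) ^ 4))"
        by (intro sum.cong refl Bochner_Integration.integral_sum) (simp add: j4)
      finally show ?thesis by simp
    qed
    also have "\<dots> \<le> (real n)\<^sup>2 * (\<Sum>i<n. \<Sum>j<n. 3 * \<epsilon>\<^sup>2 / (real n)\<^sup>2)"
      using e4 by (intro mult_left_mono sum_mono) auto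
    also have "\<dots> = 3 * (real n)\<^sup>2 * \<epsilon>\<^sup>2" using n0 by (simp add: power2_eq_square)
    finally show "expectation (\<lambda>\<omega>. (m \<omega>) ^ 4) \<le> 3 * (real n)\<^sup>2 * \<epsilon>\<^sup>2" .
  qed
  define A where "A = 4 * s ^ 3 + c * s ^ 4 + 6 * c * s ^ 3 + 3 * c\<^sup>2 * s ^ 4"
  define D where "D = 4 / s + c + 6 * c / s"
  have i5: "integrable M (\<lambda>\<omega>. cnj (u \<omega>) * (G \<omega> * \<tau> \<omega>))" "integrable M (\<lambda>\<omega>. cnj (u \<omega>) * (g \<omega> * \<tau> \<omega>))"
  proof -
    have "cmod (cnj (u \<omega>) * (G \<omega> * \<tau> \<omega>)) \<le> K * (1 / \<eta> * (1 / \<eta>\<^sup>2))" for \<omega>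
      unfolding norm_mult complex_mod_cnj using bu bG b\<tau> K \<eta> by (intro mult_mono) auto
    thus "integrable M (\<lambda>\<omega>. cnj (u \<omega>) * (G \<omega> * \<tau> \<omega>))"
      by (intro integrable_const_bound[of _ "K * (1 / \<eta> * (1 / \<eta>\<^sup>2))"] AE_I2) auto
    have "cmod (cnj (u \<omega>) * (g \<omega> * \<tau> \<omega>)) \<le> K * (c * (1 / \<eta>\<^sup>2))" for \<omega>
      unfolding norm_mult complex_mod_cnj using bu c b\<tau> K \<eta> c0 by (intro mult_mono) auto
    thus "integrable M (\<lambda>\<omega>. cnj (u \<omega>) * (g \<omega> * \<tau> \<omega>))"
      by (intro integrable_const_bound[of _ "K * (c * (1 / \<eta>\<^sup>2))"] AE_I2) auto
  qed
  have step: "(cmod (u' \<omega>))\<^sup>2 \<le> (cmod (u \<omega>))\<^sup>2 + 2 * Re (cnj (u \<omega>) * q1 \<omega>)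
     + 2 * Re (cnj (u \<omega>) * q2 \<omega> - \<epsilon> * (cnj (u \<omega>) * (g \<omega> * \<tau> \<omega>))) + (cmod (q1 \<omega>))\<^sup>2 + K ^ 5 * (A + D * (m \<omega>) ^ 4)" for \<omega>
  proof -
    let ?\<delta> = "complex_of_real \<epsilon> * g \<omega>"
    have b: "fro n (resolvent n (\<lambda>i j. a i j \<omega> + e i j \<omega>) (w \<omega>)) \<le> K"
      "fro n (resolvent n (\<lambda>i j. a i j \<omega> + e i j \<omega>) (w \<omega> + ?\<delta>)) \<le> K"
      using resolvent_bounds(3)[OF bh n \<eta>(1) \<eta>(2)] resolvent_bounds(3)[OF bh n \<eta>(1) \<eta>(3)] K(2)
      by (meson order_trans)+
    have "(cmod (u' \<omega>))\<^sup>2 \<le> (cmod (u \<omega>))\<^sup>2 + 2 * Re (cnj (u \<omega>) * q1 \<omega>)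
     + 2 * Re (cnj (u \<omega>) * (q2 \<omega> - ?\<delta> * \<tau> \<omega>)) + (cmod (q1 \<omega>))\<^sup>2
     + K ^ 5 * (4 * m \<omega> ^ 3 + cmod ?\<delta> * (m \<omega>)\<^sup>2 + 6 * cmod ?\<delta> * m \<omega> + 3 * (cmod ?\<delta>)\<^sup>2)"
      using resolvent_step[where a = "\<lambda>i j. a i j \<omega>" and b = "\<lambda>i j. a i j \<omega> + e i j \<omega>" and w = "w \<omega>"
        and \<delta> = "?\<delta>" and g = "g \<omega>", OF ah bh n _ _ K(1) fR[unfolded R_def] b] \<eta>(1) \<eta>(2)[of \<omega>] \<eta>(3)[of \<omega>] bu[of \<omega>]
      by (simp add: u'_def u_def R_def q1_def q2_def \<tau>_def P_def m_def)
    also have "4 * m \<omega> ^ 3 + cmod ?\<delta> * (m \<omega>)\<^sup>2 + 6 * cmod ?\<delta> * m \<omega> + 3 * (cmod ?\<delta>)\<^sup>2 \<le> A + D * (m \<omega>) ^ 4"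
      unfolding A_def D_def
    proof (rule step_error_le)
      show "cmod ?\<delta> \<le> c * s\<^sup>2" using c[of \<omega>] \<epsilon> by (simp add: s norm_mult mult.commute)
    qed (use s c0 in \<open>auto simp: m_def fro_nonneg\<close>)
    finally show ?thesis using K(1) by (simp add: algebra_simps)
  qed
  have u'm: "u' \<in> borel_measurable M"
  proof -
    have wM: "(\<lambda>\<omega>. w \<omega> + complex_of_real \<epsilon> * g \<omega>) \<in> borel_measurable M" by measurable
    have "(\<lambda>\<omega>. resolvent n (\<lambda>i j. a i j \<omega> + e i j \<omega>) (w \<omega> + complex_of_real \<epsilon> * g \<omega>) i j) \<in> borel_measurable M" for i j
      by (rule resolvent_measurable[OF borel_measurable_add[OF toM[OF a] em] wM])
    from tr_measurable[OF this] show ?thesis unfolding u'_def by measurable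
  qed
  have iu': "integrable M (\<lambda>\<omega>. (cmod (u' \<omega>))\<^sup>2)"
  proof (rule integrable_const_bound[of _ "K\<^sup>2"])
    have "cmod (u' \<omega>) \<le> K" for \<omega>
      unfolding u'_def
      by (rule order_trans[OF norm_triangle_ineq4 order_trans[OF add_mono[OF resolvent_bounds(1)[OF bh n \<eta>(1) \<eta>(3)] c] K(3)]])
    thus "AE \<omega> in M. norm ((cmod (u' \<omega>))\<^sup>2) \<le> K\<^sup>2" by (auto intro!: AE_I2 power_mono)
  qed (use u'm in measurable)
  have iZ: "integrable M (\<lambda>\<omega>. cnj (u \<omega>) * q2 \<omega> - \<epsilon> * (cnj (u \<omega>) * (g \<omega> * \<tau> \<omega>)))"
    by (intro Bochner_Integration.integrable_diff E2(1) Bochner_Integration.integrable_mult_right i5)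
  have linear: "integrable M (\<lambda>\<omega>. f1 \<omega> + 2 * f2 \<omega> + 2 * f3 \<omega> + f4 \<omega> + k * (A + D * f5 \<omega>)) \<and>
      expectation (\<lambda>\<omega>. f1 \<omega> + 2 * f2 \<omega> + 2 * f3 \<omega> + f4 \<omega> + k * (A + D * f5 \<omega>))
      = expectation f1 + 2 * expectation f2 + 2 * expectation f3 + expectation f4 + k * (A + D * expectation f5)"
    if "integrable M f1" "integrable M f2" "integrable M f3" "integrable M f4" "integrable M f5"
    for f1 f2 f3 f4 f5 :: "'a \<Rightarrow> real" and k
    using that by (simp add: prob_space)
  note lin = linear[OF iu integrable_Re[OF E1(1)] integrable_Re[OF iZ] E3(1) E4(1), of "K ^ 5"]
  have "expectation (\<lambda>\<omega>. (cmod (u' \<omega>))\<^sup>2) \<le> expectation (\<lambda>\<omega>. (cmod (u \<omega>))\<^sup>2 + 2 * Re (cnj (u \<omega>) * q1 \<omega>)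
     + 2 * Re (cnj (u \<omega>) * q2 \<omega> - \<epsilon> * (cnj (u \<omega>) * (g \<omega> * \<tau> \<omega>))) + (cmod (q1 \<omega>))\<^sup>2 + K ^ 5 * (A + D * (m \<omega>) ^ 4))"
    by (rule integral_mono[OF iu' conjunct1[OF lin] step])
  also have "\<dots> = expectation (\<lambda>\<omega>. (cmod (u \<omega>))\<^sup>2) + 2 * Re (expectation (\<lambda>\<omega>. cnj (u \<omega>) * q1 \<omega>))
     + 2 * Re (expectation (\<lambda>\<omega>. cnj (u \<omega>) * q2 \<omega> - \<epsilon> * (cnj (u \<omega>) * (g \<omega> * \<tau> \<omega>))))
     + expectation (\<lambda>\<omega>. (cmod (q1 \<omega>))\<^sup>2) + K ^ 5 * (A + D * expectation (\<lambda>\<omega>. (m \<omega>) ^ 4))"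
    unfolding conjunct2[OF lin] integral_Re[OF E1(1)] integral_Re[OF iZ] by (rule refl)
  also have "expectation (\<lambda>\<omega>. cnj (u \<omega>) * q2 \<omega> - \<epsilon> * (cnj (u \<omega>) * (g \<omega> * \<tau> \<omega>)))
      = expectation (\<lambda>\<omega>. \<epsilon> * (complex_of_real ((cmod (u \<omega>))\<^sup>2) * \<tau> \<omega>))"
  proof -
    have "expectation (\<lambda>\<omega>. cnj (u \<omega>) * q2 \<omega> - \<epsilon> * (cnj (u \<omega>) * (g \<omega> * \<tau> \<omega>)))
      = \<epsilon> * expectation (\<lambda>\<omega>. cnj (u \<omega>) * (G \<omega> * \<tau> \<omega>)) - \<epsilon> * expectation (\<lambda>\<omega>. cnj (u \<omega>) * (g \<omega> * \<tau> \<omega>))"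
      using E2 i5 by simp
    also have "\<dots> = \<epsilon> * expectation (\<lambda>\<omega>. cnj (u \<omega>) * (G \<omega> * \<tau> \<omega>) - cnj (u \<omega>) * (g \<omega> * \<tau> \<omega>))"
      using i5 by (simp add: right_diff_distrib)
    also have "\<dots> = \<epsilon> * expectation (\<lambda>\<omega>. complex_of_real ((cmod (u \<omega>))\<^sup>2) * \<tau> \<omega>)"
    proof (intro arg_cong[where f = "\<lambda>x. complex_of_real \<epsilon> * x"] Bochner_Integration.integral_cong refl)
      fix \<omega>
      have "cnj (u \<omega>) * (G \<omega> * \<tau> \<omega>) - cnj (u \<omega>) * (g \<omega> * \<tau> \<omega>) = (u \<omega> * cnj (u \<omega>)) * \<tau> \<omega>"
        by (simp add: u_def G_def algebra_simps)
      thus "cnj (u \<omega>) * (G \<omega> * \<tau> \<omega>) - cnj (u \<omega>) * (g \<omega> * \<tau> \<omega>) = complex_of_real ((cmod (u \<omega>))\<^sup>2) * \<tau> \<omega>"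
        by (simp only: complex_norm_square)
    qed
    finally show ?thesis by simp
  qed
  also have "Re (expectation (\<lambda>\<omega>. \<epsilon> * (complex_of_real ((cmod (u \<omega>))\<^sup>2) * \<tau> \<omega>))) \<le> \<epsilon> / \<eta>\<^sup>2 * expectation (\<lambda>\<omega>. (cmod (u \<omega>))\<^sup>2)"
  proof -
    have "Re (expectation (\<lambda>\<omega>. \<epsilon> * (complex_of_real ((cmod (u \<omega>))\<^sup>2) * \<tau> \<omega>))) \<le> norm (expectation (\<lambda>\<omega>. \<epsilon> * (complex_of_real ((cmod (u \<omega>))\<^sup>2) * \<tau> \<omega>)))"
      by (rule complex_Re_le_cmod)
    also have "\<dots> \<le> expectation (\<lambda>\<omega>. norm (\<epsilon> * (complex_of_real ((cmod (u \<omega>))\<^sup>2) * \<tau> \<omega>)))"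
      by (rule integral_norm_bound)
    also have "\<dots> \<le> expectation (\<lambda>\<omega>. \<epsilon> / \<eta>\<^sup>2 * (cmod (u \<omega>))\<^sup>2)"
    proof (rule integral_mono')
      fix \<omega>
      have "norm (\<epsilon> * (complex_of_real ((cmod (u \<omega>))\<^sup>2) * \<tau> \<omega>)) = \<epsilon> * ((cmod (u \<omega>))\<^sup>2 * cmod (\<tau> \<omega>))"
        using \<epsilon> by (simp add: norm_mult norm_power)
      also have "\<dots> \<le> \<epsilon> * ((cmod (u \<omega>))\<^sup>2 * (1 / \<eta>\<^sup>2))"
        using \<epsilon> b\<tau> by (intro mult_left_mono) auto
      finally show "norm (\<epsilon> * (complex_of_real ((cmod (u \<omega>))\<^sup>2) * \<tau> \<omega>)) \<le> \<epsilon> / \<eta>\<^sup>2 * (cmod (u \<omega>))\<^sup>2" by simp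
    qed (use iu \<epsilon> in auto)
    finally show ?thesis by simp
  qed
  also have "expectation (\<lambda>\<omega>. cnj (u \<omega>) * q1 \<omega>) = 0" by (rule E1)
  also have "expectation (\<lambda>\<omega>. (cmod (q1 \<omega>))\<^sup>2) \<le> \<epsilon> / (real n * \<eta>\<^sup>2) * expectation (\<lambda>\<omega>. (fro n (R \<omega>))\<^sup>2 / real n)" by (rule E3)
  also have "K ^ 5 * (A + D * expectation (\<lambda>\<omega>. (m \<omega>) ^ 4)) \<le> K ^ 5 * (s ^ 3 * ((1 + 3 * (real n)\<^sup>2) * (4 + 7 * c + 3 * c\<^sup>2)))"
  proof (rule mult_left_mono)
    have D0: "0 \<le> D" using s c0 by (simp add: D_def)
    have "D * expectation (\<lambda>\<omega>. (m \<omega>) ^ 4) \<le> D * (3 * (real n)\<^sup>2 * \<epsilon>\<^sup>2)" by (intro mult_left_mono E4 D0)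
    also have "\<epsilon>\<^sup>2 = s ^ 4" by (simp flip: s(3) power_mult)
    also have "D * (3 * (real n)\<^sup>2 * s ^ 4) = 3 * (real n)\<^sup>2 * (s ^ 3 * (4 + c * s + 6 * c))"
      using s(1) by (simp add: D_def field_simps eval_nat_numeral)
    also have "\<dots> \<le> 3 * (real n)\<^sup>2 * (s ^ 3 * (4 + 7 * c + 3 * c\<^sup>2))"
    proof (intro mult_left_mono)
      have "c * s \<le> c * 1" using s c0 by (intro mult_left_mono) auto
      thus "4 + c * s + 6 * c \<le> 4 + 7 * c + 3 * c\<^sup>2" using zero_le_power2[of c] by linarith
    qed (use s in auto)
    finally have d: "D * expectation (\<lambda>\<omega>. (m \<omega>) ^ 4) \<le> 3 * (real n)\<^sup>2 * (s ^ 3 * (4 + 7 * c + 3 * c\<^sup>2))" .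
    have s4: "s ^ 4 \<le> s ^ 3" using s by (intro power_decreasing) auto
    have "c * s ^ 4 \<le> c * s ^ 3" "c\<^sup>2 * s ^ 4 \<le> c\<^sup>2 * s ^ 3"
      using s4 c0 by (auto intro: mult_left_mono)
    hence "A \<le> s ^ 3 * (4 + 7 * c + 3 * c\<^sup>2)" unfolding A_def by (simp add: algebra_simps)
    with d show "A + D * expectation (\<lambda>\<omega>. (m \<omega>) ^ 4) \<le> s ^ 3 * ((1 + 3 * (real n)\<^sup>2) * (4 + 7 * c + 3 * c\<^sup>2))"
      by (simp add: algebra_simps)
  qed (use K in simp)
  finally show ?thesis by (simp add: s_def[symmetric] algebra_simps)
qed

section \<open>Independence of Brownian increments from the past\<close>

locale deformed_ensemble = prob_space M for M :: "'a measure" +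
  fixes n :: nat and D :: "nat \<Rightarrow> 'a \<Rightarrow> real"
    and B B' :: "nat \<Rightarrow> nat \<Rightarrow> real \<Rightarrow> 'a \<Rightarrow> real"
  assumes n1: "1 \<le> n"
    and bm_entries: "hermitian_bm_entries n B B'"
    and indep_init: "indep_matrix_process n (\<lambda>\<omega>. mat_diag n (\<lambda>k. complex_of_real (D k \<omega>))) (hermitian_process n B B')"
begin

definition entry_path :: "nat \<times> nat + nat \<times> nat \<Rightarrow> real \<Rightarrow> 'a \<Rightarrow> real" where
  "entry_path x s \<omega> = (case x of Inl (k, l) \<Rightarrow> B k l s \<omega> | Inr (k, l) \<Rightarrow> B' k l s \<omega>)"

text \<open>
  This and \<open>noise_algebra\<close> are the two \<open>\<sigma>\<close>-algebras in the definition of \<open>indep_matrix_process\<close>.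
\<close>
definition init_algebra :: "'a measure" where
  "init_algebra = vimage_algebra (space M)
     (\<lambda>\<omega>. \<lambda>kl\<in>{..<n} \<times> {..<n}. mat_diag n (\<lambda>k. complex_of_real (D k \<omega>)) $$ kl) (PiM ({..<n} \<times> {..<n}) (\<lambda>_. borel))"

definition noise_algebra :: "'a measure" where
  "noise_algebra = vimage_algebra (space M)
     (\<lambda>\<omega>. \<lambda>(s, kl)\<in>{0..} \<times> {..<n} \<times> {..<n}. hermitian_process n B B' s \<omega> $$ kl)
     (PiM ({0..} \<times> {..<n} \<times> {..<n}) (\<lambda>_. borel))"

lemma indep_init_noise: "indep_set (sets init_algebra) (sets noise_algebra)"
  using indep_init by (simp add: indep_matrix_process_def init_algebra_def noise_algebra_def)

lemma space_algebras [simp]: "space init_algebra = space M" "space noise_algebra = space M"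
  by (simp_all add: init_algebra_def noise_algebra_def)

lemma sets_algebras: "sets init_algebra \<subseteq> events" "sets noise_algebra \<subseteq> events"
  using indep_init_noise by (simp_all add: indep_sets2_eq)

lemma entry_path_simps: "entry_path (Inl (k, l)) = B k l" "entry_path (Inr (k, l)) = B' k l"
  by (simp_all add: fun_eq_iff entry_path_def)

lemma entry_path_brownian: "x \<in> entry_index n \<Longrightarrow> brownian_motion (entry_path x)"
  using bm_entries
  by (auto simp: hermitian_bm_entries_def entry_index_def entry_path_simps)

lemma paths_indep:
  "indep_vars (\<lambda>_. PiM {0..} (\<lambda>_. borel)) (\<lambda>x \<omega>. \<lambda>s\<in>{0..}. entry_path x s \<omega>) (entry_index n)"
  using bm_entries by (simp add: hermitian_bm_entries_def entry_index_def entry_path_def)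

lemma D_measurable_init:
  assumes "k < n"
  shows "D k \<in> borel_measurable init_algebra"
proof -
  let ?f = "\<lambda>\<omega>. \<lambda>kl\<in>{..<n} \<times> {..<n}. mat_diag n (\<lambda>k. complex_of_real (D k \<omega>)) $$ kl"
  have f: "?f \<in> init_algebra \<rightarrow>\<^sub>M PiM ({..<n} \<times> {..<n}) (\<lambda>_. borel)"
    unfolding init_algebra_def by (rule measurable_vimage_algebra1) (auto simp: space_PiM)
  have "(\<lambda>\<omega>. ?f \<omega> (k, k)) \<in> borel_measurable init_algebra"
    by (rule measurable_compose[OF f measurable_component_singleton]) (use assms in auto)
  hence "(\<lambda>\<omega>. complex_of_real (D k \<omega>)) \<in> borel_measurable init_algebra"
    using assms by (simp add: mat_diag_def)
  from measurable_compose[OF this borel_measurable_Re] show ?thesis by simp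
qed

text \<open>
  The real paths can be recovered from the entries of the matrix process, so they inherit its
  independence of the initial matrix.
\<close>
lemma entry_path_measurable_noise:
  assumes x: "x \<in> entry_index n" and s: "0 \<le> s"
  shows "entry_path x s \<in> borel_measurable noise_algebra"
proof -
  let ?f = "\<lambda>\<omega>. \<lambda>(s, kl)\<in>{0..} \<times> {..<n} \<times> {..<n}. hermitian_process n B B' s \<omega> $$ kl"
  have f: "?f \<in> noise_algebra \<rightarrow>\<^sub>M PiM ({0..} \<times> {..<n} \<times> {..<n}) (\<lambda>_. borel)"
    unfolding noise_algebra_def by (rule measurable_vimage_algebra1) (auto simp: space_PiM)
  have h: "(\<lambda>\<omega>. hermitian_process n B B' s \<omega> $$ (k, l)) \<in> borel_measurable noise_algebra" if "k < n" "l < n" for k l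
  proof -
    have "(\<lambda>\<omega>. ?f \<omega> (s, (k, l))) \<in> borel_measurable noise_algebra"
      by (rule measurable_compose[OF f measurable_component_singleton]) (use that s in auto)
    thus ?thesis using that s by simp
  qed
  note reh = measurable_compose[OF h borel_measurable_Re] and imh = measurable_compose[OF h borel_measurable_Im]
  have n0: "0 < n" using n1 by simp
  from x consider (diag) k where "x = Inl (k, k)" "k < n" | (re) k l where "x = Inl (k, l)" "k < l" "l < n"
    | (im) k l where "x = Inr (k, l)" "k < l" "l < n"
    unfolding entry_index_def by (auto simp: le_less)
  thus ?thesis
  proof cases
    case diag
    have "(\<lambda>\<omega>. sqrt (real n) * Re (hermitian_process n B B' s \<omega> $$ (k, k))) \<in> borel_measurable noise_algebra"
      by (intro borel_measurable_times reh diag) auto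
    also have "(\<lambda>\<omega>. sqrt (real n) * Re (hermitian_process n B B' s \<omega> $$ (k, k))) = entry_path x s"
      using diag n0 by (auto simp: fun_eq_iff hermitian_process_def entry_path_def)
    finally show ?thesis .
  next
    case re
    have "(\<lambda>\<omega>. sqrt (2 * real n) * Re (hermitian_process n B B' s \<omega> $$ (k, l))) \<in> borel_measurable noise_algebra"
      by (intro borel_measurable_times reh) (use re in auto)
    also have "(\<lambda>\<omega>. sqrt (2 * real n) * Re (hermitian_process n B B' s \<omega> $$ (k, l))) = entry_path x s"
      using re n0 by (auto simp: fun_eq_iff hermitian_process_def entry_path_def)
    finally show ?thesis .
  next
    case im
    have "(\<lambda>\<omega>. sqrt (2 * real n) * Im (hermitian_process n B B' s \<omega> $$ (k, l))) \<in> borel_measurable noise_algebra"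
      by (intro borel_measurable_times imh) (use im in auto)
    also have "(\<lambda>\<omega>. sqrt (2 * real n) * Im (hermitian_process n B B' s \<omega> $$ (k, l))) = entry_path x s"
      using im n0 by (auto simp: fun_eq_iff hermitian_process_def entry_path_def)
    finally show ?thesis .
  qed
qed

definition incr :: "real \<Rightarrow> nat \<times> nat + nat \<times> nat \<Rightarrow> nat \<Rightarrow> 'a \<Rightarrow> real" where
  "incr \<epsilon> x i \<omega> = entry_path x (real (Suc i) * \<epsilon>) \<omega> - entry_path x (real i * \<epsilon>) \<omega>"

text \<open>
  The generating families of independent events: \<open>None\<close> stands for the initial matrix, \<open>Some (x, i)\<close> for the
  \<open>i\<close>-th increment of the path \<open>x\<close>. Past and present are generated by disjoint groups of them.
\<close>
definition blocks :: "real \<Rightarrow> ((nat \<times> nat + nat \<times> nat) \<times> nat) option \<Rightarrow> 'a set set" where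
  "blocks \<epsilon> z = (case z of None \<Rightarrow> sets init_algebra
     | Some (x, i) \<Rightarrow> {incr \<epsilon> x i -` A \<inter> space M | A. A \<in> sets borel})"

lemma incr_measurable_noise:
  "x \<in> entry_index n \<Longrightarrow> 0 \<le> \<epsilon> \<Longrightarrow> incr \<epsilon> x i \<in> borel_measurable noise_algebra"
  unfolding incr_def by (intro borel_measurable_diff entry_path_measurable_noise) auto

lemma incr_block_indep:
  assumes x: "x \<in> entry_index n" and \<epsilon>: "0 < \<epsilon>" and m: "0 < m"
    and A: "\<And>i. i < m \<Longrightarrow> A i \<in> {incr \<epsilon> x i -` S \<inter> space M | S. S \<in> sets borel}"
  shows "prob (\<Inter>i<m. A i) = (\<Prod>i<m. prob (A i))"
proof -
  have bm: "brownian_motion (entry_path x)" by (rule entry_path_brownian[OF x])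
  have "\<forall>(m::nat) \<tau>. 0 \<le> \<tau> 0 \<and> (\<forall>i<m. \<tau> i < \<tau> (Suc i)) \<longrightarrow>
        indep_vars (\<lambda>_. borel) (\<lambda>i \<omega>. entry_path x (\<tau> (Suc i)) \<omega> - entry_path x (\<tau> i) \<omega>) {..<m}"
    using bm unfolding brownian_motion_def by blast
  from this[rule_format, of "\<lambda>i. real i * \<epsilon>" m]
  have "indep_vars (\<lambda>_. borel) (incr \<epsilon> x) {..<m}"
    using \<epsilon> by (simp add: incr_def[abs_def])
  hence ind: "indep_sets (\<lambda>i. {incr \<epsilon> x i -` S \<inter> space M | S. S \<in> sets borel}) {..<m}"
    by (simp add: indep_vars_def2)
  show ?thesis by (rule indep_setsD[OF ind]) (use A m in auto)
qed

text \<open>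
  Joint independence is obtained in three layers: the initial matrix against all paths, the
  paths against each other, and the increments of each path among themselves.
\<close>
lemma blocks_indep:
  assumes \<epsilon>: "0 < \<epsilon>" and m: "0 < m"
  shows "indep_sets (blocks \<epsilon>) (insert None (Some ` (entry_index n \<times> {..<m})))"
proof -
  let ?I = "entry_index n"
  let ?K = "insert None (Some ` (?I \<times> {..<m}))"
  have fin: "finite ?I" by (rule finite_entry_index)
  have I0: "?I \<noteq> {}" using n1 by (auto simp: entry_index_def intro!: exI[of _ 0])
  have E_noise: "blocks \<epsilon> (Some (x, i)) \<subseteq> sets noise_algebra" if "x \<in> ?I" for x i
    using measurable_sets[OF incr_measurable_noise[OF that less_imp_le[OF \<epsilon>]]]
    by (auto simp: blocks_def)
  show ?thesis
  proof (subst indep_sets_finite)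
    show "?K \<noteq> {}" "finite ?K" using fin by auto
    show "blocks \<epsilon> z \<subseteq> events" if zK: "z \<in> ?K" for z
    proof (cases z)
      case None
      thus ?thesis using sets_algebras(1) by (simp add: blocks_def)
    next
      case (Some p)
      then obtain x i where "z = Some (x, i)" "x \<in> ?I" using zK by auto
      thus ?thesis using E_noise[of x i] sets_algebras(2) by blast
    qed
    show "space M \<in> blocks \<epsilon> z" if "z \<in> ?K" for z
      using that sets.top[of init_algebra] by (auto simp: blocks_def intro!: exI[of _ UNIV])
    show "\<forall>A\<in>Pi ?K (blocks \<epsilon>). prob (\<Inter>z\<in>?K. A z) = (\<Prod>z\<in>?K. prob (A z))"
    proof
      fix A assume A: "A \<in> Pi ?K (blocks \<epsilon>)"
      let ?A = "\<lambda>x i. A (Some (x, i))"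
      have A0: "A None \<in> sets init_algebra" using A by (auto simp: blocks_def Pi_iff)
      have Ax: "?A x i \<in> blocks \<epsilon> (Some (x, i))" if "x \<in> ?I" "i < m" for x i
        using A that by (auto simp: Pi_iff)
      define C where "C = (\<Inter>x\<in>?I. \<Inter>i<m. ?A x i)"
      have C: "C \<in> sets noise_algebra"
      proof -
        have "?A x i \<in> sets noise_algebra" if "x \<in> ?I" "i < m" for x i
          using Ax[OF that] E_noise[OF that(1), of i] by blast
        thus ?thesis unfolding C_def using fin I0 m by (intro sets.finite_INT) auto
      qed
      have split: "(\<Inter>z\<in>?K. A z) = A None \<inter> C"
        unfolding C_def by auto
      have "prob (A None \<inter> C) = prob (A None) * prob C"
        using indep_init_noise A0 C by (simp add: indep_sets2_eq)
      also have "prob C = (\<Prod>x\<in>?I. prob (\<Inter>i<m. ?A x i))"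
      proof -
        let ?P = "PiM {0..} (\<lambda>_. borel) :: (real \<Rightarrow> real) measure"
        let ?f = "\<lambda>x \<omega>. \<lambda>s\<in>{0..}. entry_path x s \<omega>"
        have ind: "indep_sets (\<lambda>x. {?f x -` S \<inter> space M | S. S \<in> sets ?P}) ?I"
          using paths_indep by (simp add: indep_vars_def2)
        show ?thesis unfolding C_def
        proof (rule indep_setsD[OF ind])
          show "\<forall>x\<in>?I. (\<Inter>i<m. ?A x i) \<in> {?f x -` S \<inter> space M | S. S \<in> sets ?P}"
          proof
            fix x assume x: "x \<in> ?I"
            have fP: "?f x \<in> space M \<rightarrow> space ?P" by (auto simp: space_PiM)
            let ?V = "vimage_algebra (space M) (?f x) ?P"
            have fm: "?f x \<in> ?V \<rightarrow>\<^sub>M ?P" by (rule measurable_vimage_algebra1[OF fP])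
            have pm: "entry_path x s \<in> borel_measurable ?V" if "0 \<le> s" for s
            proof -
              have "(\<lambda>\<omega>. ?f x \<omega> s) \<in> borel_measurable ?V"
                by (rule measurable_compose[OF fm measurable_component_singleton]) (use that in auto)
              thus ?thesis using that by simp
            qed
            have "incr \<epsilon> x i \<in> borel_measurable ?V" for i
              unfolding incr_def using \<epsilon> by (intro borel_measurable_diff pm) auto
            hence "?A x i \<in> sets ?V" if "i < m" for i
              using Ax[OF x that] measurable_sets[of "incr \<epsilon> x i" ?V borel] by (auto simp: blocks_def)
            hence "(\<Inter>i<m. ?A x i) \<in> sets ?V" using m by (intro sets.finite_INT) auto
            thus "(\<Inter>i<m. ?A x i) \<in> {?f x -` S \<inter> space M | S. S \<in> sets ?P}"
              by (simp add: sets_vimage_algebra2[OF fP])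
          qed
        qed (use fin I0 in auto)
      qed
      also have "\<dots> = (\<Prod>x\<in>?I. \<Prod>i<m. prob (?A x i))"
      proof (intro prod.cong refl)
        fix x assume x: "x \<in> ?I"
        show "prob (\<Inter>i<m. ?A x i) = (\<Prod>i<m. prob (?A x i))"
          by (rule incr_block_indep[OF x \<epsilon> m]) (use Ax[OF x] in \<open>auto simp: blocks_def\<close>)
      qed
      also have "\<dots> = (\<Prod>z\<in>?I \<times> {..<m}. prob (A (Some z)))"
        by (simp add: prod.cartesian_product)
      also have "prob (A None) * \<dots> = (\<Prod>z\<in>?K. prob (A z))"
        using fin by (subst prod.insert) (auto simp: prod.reindex)
      finally show "prob (\<Inter>z\<in>?K. A z) = (\<Prod>z\<in>?K. prob (A z))" unfolding split .
    qed
  qed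
qed

definition past :: "real \<Rightarrow> nat \<Rightarrow> 'a measure" where
  "past \<epsilon> j = sigma (space M) (\<Union>z\<in>insert None (Some ` (entry_index n \<times> {..<j})). blocks \<epsilon> z)"

definition present :: "real \<Rightarrow> nat \<Rightarrow> 'a measure" where
  "present \<epsilon> j = sigma (space M) (\<Union>z\<in>Some ` (entry_index n \<times> {j}). blocks \<epsilon> z)"

lemma blocks_space: "blocks \<epsilon> z \<subseteq> Pow (space M)"
  using sets.sets_into_space[of _ init_algebra] by (cases z) (auto simp: blocks_def)

lemma sets_past: "sets (past \<epsilon> j) = sigma_sets (space M) (\<Union>z\<in>insert None (Some ` (entry_index n \<times> {..<j})). blocks \<epsilon> z)"
  unfolding past_def using blocks_space by (intro sets_measure_of) blast

lemma sets_present: "sets (present \<epsilon> j) = sigma_sets (space M) (\<Union>z\<in>Some ` (entry_index n \<times> {j}). blocks \<epsilon> z)"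
  unfolding present_def using blocks_space by (intro sets_measure_of) blast

lemma space_past_present [simp]: "space (past \<epsilon> j) = space M" "space (present \<epsilon> j) = space M"
  unfolding past_def present_def using blocks_space by (intro space_measure_of; blast)+

lemma past_present_indep:
  assumes \<epsilon>: "0 < \<epsilon>"
  shows "indep_set (sets (past \<epsilon> j)) (sets (present \<epsilon> j))"
proof -
  let ?I = "\<lambda>b. if b then insert None (Some ` (entry_index n \<times> {..<j})) else Some ` (entry_index n \<times> {j})"
  have "indep_sets (\<lambda>b. sigma_sets (space M) (\<Union>z\<in>?I b. blocks \<epsilon> z)) UNIV"
  proof (rule indep_sets_collect_sigma)
    have "(\<Union>b\<in>UNIV. ?I b) = insert None (Some ` (entry_index n \<times> {..<Suc j}))"
      by (auto simp: UNIV_bool less_Suc_eq)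
    thus "indep_sets (blocks \<epsilon>) (\<Union>b\<in>UNIV. ?I b)" using blocks_indep[OF \<epsilon>, of "Suc j"] by simp
    show "Int_stable (blocks \<epsilon> z)" for z
    proof (cases z)
      case None
      thus ?thesis by (auto simp: blocks_def Int_stable_def)
    next
      case (Some p)
      obtain x i where p: "p = (x, i)" by (cases p)
      show ?thesis
      proof (rule Int_stableI)
        fix a b assume "a \<in> blocks \<epsilon> z" "b \<in> blocks \<epsilon> z"
        then obtain S T where "S \<in> sets borel" "T \<in> sets borel"
          and ab: "a = incr \<epsilon> x i -` S \<inter> space M" "b = incr \<epsilon> x i -` T \<inter> space M"
          by (auto simp: Some p blocks_def)
        hence "a \<inter> b = incr \<epsilon> x i -` (S \<inter> T) \<inter> space M" "S \<inter> T \<in> sets borel" by auto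
        thus "a \<inter> b \<in> blocks \<epsilon> z" unfolding Some p blocks_def by (simp only: option.case prod.case mem_Collect_eq) blast
      qed
    qed
    show "disjoint_family_on ?I UNIV" by (auto simp: disjoint_family_on_def)
  qed
  hence "indep_sets (case_bool (sets (past \<epsilon> j)) (sets (present \<epsilon> j))) UNIV"
    by (rule indep_sets_cong[THEN iffD1, rotated -1]) (auto simp: sets_past sets_present split: bool.split)
  thus ?thesis by (simp add: indep_set_def)
qed

lemma subalgebra_past: "0 < \<epsilon> \<Longrightarrow> subalgebra M (past \<epsilon> j)"
  using past_present_indep[of \<epsilon> j] by (simp add: subalgebra_def indep_sets2_eq)

lemma D_measurable_past:
  assumes "k < n"
  shows "D k \<in> borel_measurable (past \<epsilon> j)"
proof (rule measurableI)
  fix A :: "real set" assume "A \<in> sets borel"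
  hence "D k -` A \<inter> space M \<in> blocks \<epsilon> None"
    using measurable_sets[OF D_measurable_init[OF assms]] by (simp add: blocks_def)
  thus "D k -` A \<inter> space (past \<epsilon> j) \<in> sets (past \<epsilon> j)" by (auto simp: sets_past)
qed simp

lemma incr_measurable_past:
  assumes "x \<in> entry_index n" "i < j"
  shows "incr \<epsilon> x i \<in> borel_measurable (past \<epsilon> j)"
proof (rule measurableI)
  fix A :: "real set" assume "A \<in> sets borel"
  hence "incr \<epsilon> x i -` A \<inter> space M \<in> blocks \<epsilon> (Some (x, i))" by (auto simp: blocks_def)
  thus "incr \<epsilon> x i -` A \<inter> space (past \<epsilon> j) \<in> sets (past \<epsilon> j)"
    using assms by (auto simp: sets_past)
qed simp

lemma incr_measurable_present:
  assumes "x \<in> entry_index n"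
  shows "incr \<epsilon> x j \<in> borel_measurable (present \<epsilon> j)"
proof (rule measurableI)
  fix A :: "real set" assume "A \<in> sets borel"
  hence "incr \<epsilon> x j -` A \<inter> space M \<in> blocks \<epsilon> (Some (x, j))" by (auto simp: blocks_def)
  thus "incr \<epsilon> x j -` A \<inter> space (present \<epsilon> j) \<in> sets (present \<epsilon> j)"
    using assms by (auto simp: sets_present)
qed simp

lemma incr_distributed:
  assumes x: "x \<in> entry_index n" and \<epsilon>: "0 < \<epsilon>"
  shows "distributed M lborel (incr \<epsilon> x j) (normal_density 0 (sqrt \<epsilon>))"
proof -
  have "\<forall>s u. 0 \<le> s \<and> s < u \<longrightarrow>
        distributed M lborel (\<lambda>\<omega>. entry_path x u \<omega> - entry_path x s \<omega>) (normal_density 0 (sqrt (u - s)))"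
    using entry_path_brownian[OF x] unfolding brownian_motion_def by blast
  from this[rule_format, of "real j * \<epsilon>" "real (Suc j) * \<epsilon>"] show ?thesis
    using \<epsilon> by (simp add: incr_def[abs_def] algebra_simps)
qed

lemma incr_indep:
  assumes \<epsilon>: "0 < \<epsilon>"
  shows "indep_vars (\<lambda>_. borel) (\<lambda>x. incr \<epsilon> x j) (entry_index n)"
proof -
  have "indep_vars (\<lambda>_. borel) (\<lambda>x \<omega>. (\<lambda>s\<in>{0..}. entry_path x s \<omega>) (real (Suc j) * \<epsilon>) - (\<lambda>s\<in>{0..}. entry_path x s \<omega>) (real j * \<epsilon>)) (entry_index n)"
  proof (rule indep_vars_compose2[OF paths_indep, where Y = "\<lambda>_ p. p (real (Suc j) * \<epsilon>) - p (real j * \<epsilon>)"])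
    show "(\<lambda>p. p (real (Suc j) * \<epsilon>) - p (real j * \<epsilon>)) \<in> borel_measurable (PiM {0..} (\<lambda>_. borel :: real measure))"
      using \<epsilon> by (intro borel_measurable_diff measurable_component_singleton) auto
  qed
  thus ?thesis using \<epsilon> by (simp add: incr_def[abs_def])
qed

end

section \<open>Deviation from the initial Stieltjes transform\<close>

text \<open>
  A discrete Gronwall inequality.
\<close>
lemma linear_recursion_bound:
  fixes \<alpha> \<phi> :: "nat \<Rightarrow> real"
  assumes "\<alpha> 0 = 0" and b: "0 \<le> b" and e: "0 \<le> e" and \<phi>: "\<And>j. 0 \<le> \<phi> j"
    and step: "\<And>j. j < m \<Longrightarrow> \<alpha> (Suc j) \<le> (1 + b) * \<alpha> j + \<phi> j + e"
  shows "\<alpha> m \<le> (1 + b) ^ m * ((\<Sum>j<m. \<phi> j) + real m * e)"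
proof -
  have "i \<le> m \<Longrightarrow> \<alpha> i \<le> (1 + b) ^ i * ((\<Sum>j<i. \<phi> j) + real i * e)" for i
  proof (induction i)
    case (Suc i)
    have one: "1 \<le> (1 + b) ^ Suc i" using b by (intro one_le_power) auto
    have "\<alpha> (Suc i) \<le> (1 + b) * \<alpha> i + \<phi> i + e" using step Suc by simp
    also have "\<dots> \<le> (1 + b) * ((1 + b) ^ i * ((\<Sum>j<i. \<phi> j) + real i * e)) + (\<phi> i + e)"
      using Suc b by (simp add: mult_left_mono)
    also have "\<dots> \<le> (1 + b) ^ Suc i * ((\<Sum>j<i. \<phi> j) + real i * e) + (1 + b) ^ Suc i * (\<phi> i + e)"
      using mult_right_mono[OF one, of "\<phi> i + e"] \<phi>[of i] e by simp
    also have "\<dots> = (1 + b) ^ Suc i * ((\<Sum>j<Suc i. \<phi> j) + real (Suc i) * e)"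
      by (simp add: algebra_simps)
    finally show ?case .
  qed (use assms in auto)
  thus ?thesis by simp
qed

lemma herm_entry_add:
  "herm_entry n (\<lambda>k l. b k l + c k l) (\<lambda>k l. b' k l + c' k l) k l = herm_entry n b b' k l + herm_entry n c c' k l"
  by (simp add: herm_entry_def complex_eq_iff add_divide_distrib diff_divide_distrib)

lemma herm_entry_measurable:
  assumes y: "\<And>x. x \<in> entry_index n \<Longrightarrow> y x \<in> borel_measurable N" and kl: "k < n" "l < n"
  shows "(\<lambda>\<omega>. herm_entry n (\<lambda>k l. y (Inl (k, l)) \<omega>) (\<lambda>k l. y (Inr (k, l)) \<omega>) k l) \<in> borel_measurable N"
proof -
  have S: "y (Inl (min k l, max k l)) \<in> borel_measurable N"
    by (rule y) (use kl in \<open>auto simp: entry_index_def\<close>)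
  have T: "(\<lambda>\<omega>. if k = l then 0 else y (Inr (min k l, max k l)) \<omega>) \<in> borel_measurable N"
  proof (cases "k = l")
    case False
    have "y (Inr (min k l, max k l)) \<in> borel_measurable N"
      by (rule y) (use kl False in \<open>auto simp: entry_index_def\<close>)
    thus ?thesis using False by simp
  qed simp
  show ?thesis
    unfolding herm_entry_decomposition[of n "\<lambda>x. y x _"]
    using S T by measurable
qed

text \<open>
  By Ward's identity the squared Frobenius norm is a sum of Poisson kernels at the eigenvalues.
\<close>
lemma fro_resolvent_spectral:
  assumes a: "hermitian n a"
  obtains lam where "\<And>w. 0 < Im w \<Longrightarrow> (fro n (resolvent n a w))\<^sup>2 / real n
     = (\<Sum>k<n. 1 / (cmod (w - complex_of_real (lam k)))\<^sup>2) / real n"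
proof -
  obtain lam where lam: "\<And>w. Im w \<noteq> 0 \<Longrightarrow> tr n (resolvent n a w) / of_nat n = stieltjes n lam w"
    using hermitian_eigenvalues[OF a] by metis
  have "(fro n (resolvent n a w))\<^sup>2 / real n = (\<Sum>k<n. 1 / (cmod (w - complex_of_real (lam k)))\<^sup>2) / real n"
    if w: "0 < Im w" for w
  proof -
    have "(fro n (resolvent n a w))\<^sup>2 / real n = - Im (tr n (resolvent n a w) / of_nat n) / Im w"
      using resolvent_ward[OF a, of w] w by simp
    also have "\<dots> = ((\<Sum>k<n. Im w / (cmod (w - complex_of_real (lam k)))\<^sup>2) / real n) / Im w"
      using lam[of w] w by (simp add: Im_stieltjes[symmetric])
    also have "\<dots> = (\<Sum>k<n. 1 / (cmod (w - complex_of_real (lam k)))\<^sup>2) / real n"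
      using w by (simp add: sum_divide_distrib)
    finally show ?thesis .
  qed
  thus thesis by (rule that)
qed

lemma cmod_Complex_diff: "(cmod (Complex x \<gamma> - complex_of_real y))\<^sup>2 = (x - y)\<^sup>2 + \<gamma>\<^sup>2"
  by (simp add: cmod_power2)

text \<open>
  The value does not depend on the points \<open>lam k\<close>. It is applied to eigenvalues, about which nothing is known.
\<close>
lemma nn_integral_inverse_square_average:
  fixes lam :: "nat \<Rightarrow> real"
  assumes \<gamma>: "0 < \<gamma>" and n: "1 \<le> n" and c: "0 \<le> c"
  shows "(\<integral>\<^sup>+x. ennreal (c * ((\<Sum>k<n. 1 / (cmod (Complex x \<gamma> - complex_of_real (lam k)))\<^sup>2) / real n)) \<partial>lborel) = ennreal (c * (pi / \<gamma>))"
proof -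
  have i: "integrable lborel (\<lambda>x. 1 / (cmod (Complex x \<gamma> - complex_of_real y))\<^sup>2)"
    and v: "(\<integral>x. 1 / (cmod (Complex x \<gamma> - complex_of_real y))\<^sup>2 \<partial>lborel) = pi / \<gamma>" for y
  proof -
    have e: "1 / (cmod (Complex x \<gamma> - complex_of_real y))\<^sup>2 = (\<gamma> / ((x - y)\<^sup>2 + \<gamma>\<^sup>2)) / \<gamma>" for x
      unfolding cmod_Complex_diff using \<gamma> by simp
    show "integrable lborel (\<lambda>x. 1 / (cmod (Complex x \<gamma> - complex_of_real y))\<^sup>2)"
      unfolding e by (rule integrable_divide[OF cauchy_kernel_integrable(1)[OF \<gamma>]])
    show "(\<integral>x. 1 / (cmod (Complex x \<gamma> - complex_of_real y))\<^sup>2 \<partial>lborel) = pi / \<gamma>"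
      unfolding e Bochner_Integration.integral_divide_zero cauchy_kernel_integrable(2)[OF \<gamma>] by (rule refl)
  qed
  have int: "integrable lborel (\<lambda>x. c * ((\<Sum>k<n. 1 / (cmod (Complex x \<gamma> - complex_of_real (lam k)))\<^sup>2) / real n))"
    by (intro Bochner_Integration.integrable_mult_right integrable_divide Bochner_Integration.integrable_sum i)
  have "(\<integral>x. c * ((\<Sum>k<n. 1 / (cmod (Complex x \<gamma> - complex_of_real (lam k)))\<^sup>2) / real n) \<partial>lborel)
      = c * ((\<Sum>k<n. pi / \<gamma>) / real n)"
    unfolding Bochner_Integration.integral_mult_right_zero Bochner_Integration.integral_divide_zero
    by (subst Bochner_Integration.integral_sum[OF i]) (simp only: v)
  also have "\<dots> = c * (pi / \<gamma>)" using n by simp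
  finally show ?thesis
    using c by (subst nn_integral_eq_integral[OF int]) (auto intro!: AE_I2 mult_nonneg_nonneg divide_nonneg_nonneg sum_nonneg)
qed

lemma Complex_measurable [measurable]:
  assumes [measurable]: "f \<in> borel_measurable N"
  shows "(\<lambda>\<omega>. Complex (f \<omega>) \<gamma>) \<in> borel_measurable N"
proof -
  have "(\<lambda>\<omega>. complex_of_real (f \<omega>) + \<i> * complex_of_real \<gamma>) \<in> borel_measurable N" by measurable
  also have "(\<lambda>\<omega>. complex_of_real (f \<omega>) + \<i> * complex_of_real \<gamma>) = (\<lambda>\<omega>. Complex (f \<omega>) \<gamma>)"
    by (simp add: fun_eq_iff complex_eq_iff)
  finally show ?thesis .
qed

lemma stieltjes_measurable:
  assumes D: "\<And>k. k < n \<Longrightarrow> D k \<in> borel_measurable N" and z: "z \<in> borel_measurable N"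
  shows "(\<lambda>\<omega>. stieltjes n (\<lambda>k. D k \<omega>) (z \<omega>)) \<in> borel_measurable N"
proof -
  have "(\<lambda>\<omega>. 1 / (z \<omega> - complex_of_real (D k \<omega>))) \<in> borel_measurable N" if "k < n" for k
    using D[OF that] z by measurable
  hence "(\<lambda>\<omega>. \<Sum>k<n. 1 / (z \<omega> - complex_of_real (D k \<omega>))) \<in> borel_measurable N"
    by (intro borel_measurable_sum) simp
  thus ?thesis unfolding stieltjes_def by measurable
qed

text \<open>
  Exponential factor from the recursion, variance of the linear term, and mass of the Poisson kernels.
  The height \<open>3 \<gamma> / 4\<close> bounds the imaginary part along the characteristic from below.
\<close>
definition deviation_const :: "real \<Rightarrow> real \<Rightarrow> real" where
  "deviation_const t \<gamma> = exp (2 * t / (3 * \<gamma> / 4)\<^sup>2) * (t / (3 * \<gamma> / 4)\<^sup>2) * (16 / 9 * (pi / \<gamma>))"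

context deformed_ensemble
begin

text \<open>
  The increments are taken from time \<open>0\<close> because Brownian motion starts at \<open>0\<close> only almost surely; in this
  form the matrix at a grid point is everywhere a sum of increments.
\<close>
definition deformed :: "real \<Rightarrow> nat \<Rightarrow> nat \<Rightarrow> 'a \<Rightarrow> complex" where
  "deformed s k l \<omega> = (if k = l then complex_of_real (D k \<omega>) else 0) +
     herm_entry n (\<lambda>k l. entry_path (Inl (k, l)) s \<omega> - entry_path (Inl (k, l)) 0 \<omega>)
       (\<lambda>k l. entry_path (Inr (k, l)) s \<omega> - entry_path (Inr (k, l)) 0 \<omega>) k l"

definition initial_stieltjes :: "complex \<Rightarrow> 'a \<Rightarrow> complex" where
  "initial_stieltjes z \<omega> = stieltjes n (\<lambda>k. D k \<omega>) z"

text \<open>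
  The line along which the limiting Burgers equation keeps the Stieltjes transform constant, with the slope
  given by the sample at time \<open>0\<close>.
\<close>
definition characteristic :: "real \<Rightarrow> complex \<Rightarrow> 'a \<Rightarrow> complex" where
  "characteristic s z \<omega> = z + complex_of_real s * initial_stieltjes z \<omega>"

definition char_resolvent :: "real \<Rightarrow> complex \<Rightarrow> 'a \<Rightarrow> nat \<Rightarrow> nat \<Rightarrow> complex" where
  "char_resolvent s z \<omega> = resolvent n (\<lambda>k l. deformed s k l \<omega>) (characteristic s z \<omega>)"

definition deviation :: "real \<Rightarrow> complex \<Rightarrow> 'a \<Rightarrow> complex" where
  "deviation s z \<omega> = tr n (char_resolvent s z \<omega>) / of_nat n - initial_stieltjes z \<omega>"

lemma hermitian_deformed: "hermitian n (\<lambda>k l. deformed s k l \<omega>)"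
proof -
  have "hermitian n (\<lambda>k l. if k = l then complex_of_real (D k \<omega>) else 0)" by (auto simp: hermitian_def)
  from hermitian_add[OF this hermitian_herm_entry] show ?thesis unfolding deformed_def .
qed

lemma entry_path_minus_eq_sum:
  "entry_path x (real j * \<epsilon>) \<omega> - entry_path x 0 \<omega> = (\<Sum>i<j. incr \<epsilon> x i \<omega>)"
proof (induction j)
  case (Suc j)
  have "entry_path x (real (Suc j) * \<epsilon>) \<omega> - entry_path x 0 \<omega>
      = (entry_path x (real j * \<epsilon>) \<omega> - entry_path x 0 \<omega>) + incr \<epsilon> x j \<omega>"
    unfolding incr_def by linarith
  thus ?case unfolding Suc.IH by (simp only: sum.lessThan_Suc)
qed simp

lemma deformed_measurable_past:
  assumes kl: "k < n" "l < n"
  shows "deformed (real j * \<epsilon>) k l \<in> borel_measurable (past \<epsilon> j)"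
proof -
  have "(\<lambda>\<omega>. herm_entry n (\<lambda>k l. (\<lambda>x \<omega>. \<Sum>i<j. incr \<epsilon> x i \<omega>) (Inl (k, l)) \<omega>) (\<lambda>k l. (\<lambda>x \<omega>. \<Sum>i<j. incr \<epsilon> x i \<omega>) (Inr (k, l)) \<omega>) k l) \<in> borel_measurable (past \<epsilon> j)"
    by (rule herm_entry_measurable[OF _ kl]) (intro borel_measurable_sum incr_measurable_past, auto)
  moreover have "(\<lambda>\<omega>. if k = l then complex_of_real (D k \<omega>) else 0) \<in> borel_measurable (past \<epsilon> j)"
    using D_measurable_past[OF kl(1)] by simp
  ultimately show ?thesis
    unfolding deformed_def entry_path_minus_eq_sum by (rule borel_measurable_add[rotated])
qed

text \<open>
  The slope is at most \<open>1 / \<gamma>\<close> and \<open>t / \<gamma> < \<gamma> / 4\<close>.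
\<close>
lemma characteristic_bounds:
  assumes t: "0 < t" and \<gamma>: "2 * sqrt t < \<gamma>" and z: "Im z = \<gamma>" and s: "0 \<le> s" "s \<le> t"
  shows "cmod (initial_stieltjes z \<omega>) \<le> 1 / \<gamma>" "3 * \<gamma> / 4 \<le> Im (characteristic s z \<omega>)"
    "cmod (characteristic s z \<omega> - z) \<le> 1 / 3 * Im (characteristic s z \<omega>)"
proof -
  note g = gamma_facts[OF t \<gamma> stieltjes_like_stieltjes]
  show b: "cmod (initial_stieltjes z \<omega>) \<le> 1 / \<gamma>"
    unfolding initial_stieltjes_def using cmod_stieltjes_le[of z n "\<lambda>k. D k \<omega>"] z g(1) by simp
  have d: "cmod (characteristic s z \<omega> - z) \<le> \<gamma> / 4"
  proof -
    have "cmod (characteristic s z \<omega> - z) = s * cmod (initial_stieltjes z \<omega>)" using s by (simp add: characteristic_def norm_mult)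
    also have "\<dots> \<le> t * (1 / \<gamma>)" using s b by (intro mult_mono) auto
    also have "\<dots> \<le> \<gamma> / 4" using g by (simp add: field_simps power2_eq_square)
    finally show ?thesis .
  qed
  have "\<bar>Im (characteristic s z \<omega>) - \<gamma>\<bar> \<le> \<gamma> / 4"
    using order_trans[OF abs_Im_le_cmod d] z by simp
  thus i: "3 * \<gamma> / 4 \<le> Im (characteristic s z \<omega>)" by linarith
  show "cmod (characteristic s z \<omega> - z) \<le> 1 / 3 * Im (characteristic s z \<omega>)" using d i by linarith
qed

lemma deviation_zero:
  assumes z: "0 < Im z"
  shows "deviation 0 z \<omega> = 0"
proof -
  let ?a = "\<lambda>k l. if k = l then complex_of_real (D k \<omega>) else 0"
  have a: "(\<lambda>k l. deformed 0 k l \<omega>) = ?a"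
    by (intro ext) (simp add: deformed_def herm_entry_def complex_eq_iff)
  have h: "hermitian n ?a" using hermitian_deformed[of 0 \<omega>] unfolding a .
  have c: "characteristic 0 z \<omega> = z" by (simp add: characteristic_def)
  have "resolvent n ?a z i i = 1 / (z - complex_of_real (D i \<omega>))" if i: "i < n" for i
  proof -
    have "(\<Sum>k<n. ((if i = k then z else 0) - ?a i k) * resolvent n ?a z k i) = 1"
      using resolvent_inverse(1)[OF det_shifted_nonzero[OF h] i i, of z] z by simp
    moreover have "(\<Sum>k<n. ((if i = k then z else 0) - ?a i k) * resolvent n ?a z k i)
        = (\<Sum>k<n. if i = k then (z - complex_of_real (D i \<omega>)) * resolvent n ?a z k i else 0)"
      by (intro sum.cong refl) auto
    ultimately have eq: "(z - complex_of_real (D i \<omega>)) * resolvent n ?a z i i = 1" using i by simp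
    have nz: "z - complex_of_real (D i \<omega>) \<noteq> 0"
    proof
      assume "z - complex_of_real (D i \<omega>) = 0"
      with eq show False by (simp only: mult_zero_left zero_neq_one)
    qed
    show ?thesis using eq by (subst nonzero_eq_divide_eq[OF nz]) (simp only: mult.commute)
  qed
  thus ?thesis unfolding deviation_def char_resolvent_def a c initial_stieltjes_def stieltjes_def tr_def by simp
qed

text \<open>
  The factor of the remainder in \<open>gaussian_step\<close> for the bounds at height \<open>3 \<gamma> / 4\<close>. Its growth in \<open>n\<close> is
  harmless, as it is multiplied by a power of the time step.
\<close>
definition step_const :: "real \<Rightarrow> real" where
  "step_const \<gamma> = (max 1 (max (sqrt (real n) / (3 * \<gamma> / 4)) (1 / (3 * \<gamma> / 4) + 1 / \<gamma>))) ^ 5 * (1 + 3 * (real n)\<^sup>2) * (4 + 7 * (1 / \<gamma>) + 3 * (1 / \<gamma>)\<^sup>2)"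

lemma deviation_step:
  assumes t: "0 < t" and \<gamma>: "2 * sqrt t < \<gamma>" and z: "Im z = \<gamma>"
    and \<epsilon>: "0 < \<epsilon>" "\<epsilon> \<le> 1" and j: "real (Suc j) * \<epsilon> \<le> t"
  defines "\<eta> \<equiv> 3 * \<gamma> / 4"
  shows "expectation (\<lambda>\<omega>. (cmod (deviation (real (Suc j) * \<epsilon>) z \<omega>))\<^sup>2)
    \<le> (1 + 2 * \<epsilon> / \<eta>\<^sup>2) * expectation (\<lambda>\<omega>. (cmod (deviation (real j * \<epsilon>) z \<omega>))\<^sup>2)
      + \<epsilon> / (real n * \<eta>\<^sup>2) * expectation (\<lambda>\<omega>. (fro n (char_resolvent (real j * \<epsilon>) z \<omega>))\<^sup>2 / real n)
      + sqrt \<epsilon> ^ 3 * step_const \<gamma>"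
proof -
  note g = gamma_facts[OF t \<gamma> stieltjes_like_stieltjes]
  define e where "e = (\<lambda>k l \<omega>. herm_entry n (\<lambda>k l. incr \<epsilon> (Inl (k, l)) j \<omega>) (\<lambda>k l. incr \<epsilon> (Inr (k, l)) j \<omega>) k l)"
  let ?N1 = "past \<epsilon> j" and ?N2 = "present \<epsilon> j"
  let ?s = "real j * \<epsilon>"
  have s: "0 \<le> ?s" "?s \<le> t" using \<epsilon> j by (auto simp: algebra_simps)
  have s': "0 \<le> real (Suc j) * \<epsilon>" using \<epsilon> by simp
  have sub: "subalgebra M ?N1" by (rule subalgebra_past[OF \<epsilon>(1)])
  have eN2: "e k l \<in> borel_measurable ?N2" if "k < n" "l < n" for k l
    unfolding e_def by (rule herm_entry_measurable[OF incr_measurable_present that])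
  have subN2: "subalgebra M ?N2"
    using past_present_indep[OF \<epsilon>(1), of j] by (simp add: subalgebra_def indep_sets2_eq)
  have mom: "integrable M (e k l)" "expectation (e k l) = 0" "integrable M (\<lambda>\<omega>. (cmod (e k l \<omega>)) ^ 4)"
    "expectation (\<lambda>\<omega>. (cmod (e k l \<omega>)) ^ 4) \<le> 3 * \<epsilon>\<^sup>2 / (real n)\<^sup>2" if "k < n" "l < n" for k l
    unfolding e_def
    by (rule hermitian_gaussian_moments[OF incr_indep[OF \<epsilon>(1)] _ \<epsilon>(1) n1 that], erule incr_distributed[OF _ \<epsilon>(1)])+
  have mom2: "integrable M (\<lambda>\<omega>. e k l \<omega> * e p q \<omega>)"
    "expectation (\<lambda>\<omega>. e k l \<omega> * e p q \<omega>) = (if k = q \<and> l = p then complex_of_real (\<epsilon> / real n) else 0)"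
    if "k < n" "l < n" "p < n" "q < n" for k l p q
    unfolding e_def
    by (rule hermitian_gaussian_moments[OF incr_indep[OF \<epsilon>(1)] _ \<epsilon>(1) n1 that(1,2)],
        erule incr_distributed[OF _ \<epsilon>(1)], rule that(3), rule that(4))+
  have st: "initial_stieltjes z \<in> borel_measurable ?N1"
    unfolding initial_stieltjes_def by (rule stieltjes_measurable[OF D_measurable_past]) auto
  have ch: "characteristic ?s z \<in> borel_measurable ?N1"
    unfolding characteristic_def using st by (intro borel_measurable_add borel_measurable_times) auto
  have deform: "deformed (real (Suc j) * \<epsilon>) k l \<omega> = deformed ?s k l \<omega> + e k l \<omega>" for k l \<omega>
    unfolding deformed_def e_def entry_path_minus_eq_sum
    by (simp add: herm_entry_add)
  have charac': "characteristic (real (Suc j) * \<epsilon>) z \<omega> = characteristic ?s z \<omega> + \<epsilon> * initial_stieltjes z \<omega>" for \<omega>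
    by (simp add: characteristic_def algebra_simps)
  have Fint: "integrable M F" if "F \<in> borel_measurable ?N1" "\<And>\<omega>. cmod (F \<omega>) \<le> C" for F :: "'a \<Rightarrow> complex" and C
    by (rule integrable_const_bound[OF AE_I2 measurable_from_subalg[OF sub that(1)]]) (rule that(2))
  show ?thesis
    unfolding deviation_def char_resolvent_def deform charac' step_const_def \<eta>_def[symmetric]
  proof (rule gaussian_step[OF n1 \<epsilon> sub])
    show "deformed ?s k l \<in> borel_measurable ?N1" if "k < n" "l < n" for k l
      by (rule deformed_measurable_past[OF that])
    show "characteristic ?s z \<in> borel_measurable ?N1" by (rule ch)
    show "initial_stieltjes z \<in> borel_measurable ?N1" by (rule st)
    show "hermitian n (\<lambda>i j. deformed ?s i j \<omega>)" for \<omega> by (rule hermitian_deformed)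
    show "hermitian n (\<lambda>i j. e i j \<omega>)" for \<omega> unfolding e_def by (rule hermitian_herm_entry)
    show "e k l \<in> borel_measurable M" if "k < n" "l < n" for k l
      by (rule measurable_from_subalg[OF subN2 eN2[OF that]])
    show "integrable M (\<lambda>\<omega>. F \<omega> * e k l \<omega>) \<and> expectation (\<lambda>\<omega>. F \<omega> * e k l \<omega>) = 0"
      if "F \<in> borel_measurable ?N1" "\<And>\<omega>. cmod (F \<omega>) \<le> C" "k < n" "l < n" for F C k l
      using indep_sigma_algebras_expectation[OF past_present_indep[OF \<epsilon>(1)] _ _ that(1) Fint[OF that(1,2)] eN2[OF that(3,4)] mom(1)[OF that(3,4)]]
        mom(2)[OF that(3,4)] by simp
    show "integrable M (\<lambda>\<omega>. F \<omega> * (e k l \<omega> * e p q \<omega>)) \<and>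
       expectation (\<lambda>\<omega>. F \<omega> * (e k l \<omega> * e p q \<omega>)) = (if k = q \<and> l = p then complex_of_real (\<epsilon> / real n) else 0) * expectation F"
      if "F \<in> borel_measurable ?N1" "\<And>\<omega>. cmod (F \<omega>) \<le> C" "k < n" "l < n" "p < n" "q < n" for F C k l p q
      using indep_sigma_algebras_expectation[OF past_present_indep[OF \<epsilon>(1)] _ _ that(1) Fint[OF that(1,2)]
          borel_measurable_times[OF eN2[OF that(3,4)] eN2[OF that(5,6)]] mom2(1)[OF that(3,4,5,6)]]
        mom2(2)[OF that(3,4,5,6)] by (simp add: mult.commute)
    show "integrable M (\<lambda>\<omega>. (cmod (e k l \<omega>)) ^ 4) \<and> expectation (\<lambda>\<omega>. (cmod (e k l \<omega>)) ^ 4) \<le> 3 * \<epsilon>\<^sup>2 / (real n)\<^sup>2"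
      if "k < n" "l < n" for k l
      using mom(3,4)[OF that] by blast
    show "0 < \<eta>" using g by (simp add: \<eta>_def)
    show "\<eta> \<le> Im (characteristic ?s z \<omega>)" for \<omega> unfolding \<eta>_def by (rule characteristic_bounds[OF t \<gamma> z s])
    show "\<eta> \<le> Im (characteristic ?s z \<omega> + complex_of_real \<epsilon> * initial_stieltjes z \<omega>)" for \<omega>
      unfolding \<eta>_def charac'[symmetric] by (rule characteristic_bounds[OF t \<gamma> z s' j])
    show "cmod (initial_stieltjes z \<omega>) \<le> 1 / \<gamma>" for \<omega> by (rule characteristic_bounds[OF t \<gamma> z s])
  qed
qed

lemma entry_path_measurable: "x \<in> entry_index n \<Longrightarrow> 0 \<le> s \<Longrightarrow> entry_path x s \<in> borel_measurable M"
  using entry_path_brownian[of x] unfolding brownian_motion_def by blast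

lemma D_measurable: "k < n \<Longrightarrow> D k \<in> borel_measurable M"
  by (rule measurable_from_subalg[OF _ D_measurable_init]) (use sets_algebras in \<open>auto simp: subalgebra_def\<close>)

lemma deformed_measurable:
  assumes kl: "k < n" "l < n" and s: "0 \<le> s"
  shows "deformed s k l \<in> borel_measurable M"
proof -
  have "(\<lambda>\<omega>. herm_entry n (\<lambda>k l. (\<lambda>x \<omega>. entry_path x s \<omega> - entry_path x 0 \<omega>) (Inl (k, l)) \<omega>) (\<lambda>k l. (\<lambda>x \<omega>. entry_path x s \<omega> - entry_path x 0 \<omega>) (Inr (k, l)) \<omega>) k l) \<in> borel_measurable M"
    by (rule herm_entry_measurable[OF _ kl]) (intro borel_measurable_diff entry_path_measurable s order_refl)
  moreover have "(\<lambda>\<omega>. if k = l then complex_of_real (D k \<omega>) else 0) \<in> borel_measurable M"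
    using D_measurable[OF kl(1)] by simp
  ultimately show ?thesis
    unfolding deformed_def by (rule borel_measurable_add[rotated])
qed

text \<open>
  Joint measurability in the point \<open>x\<close> and the randomness, for Tonelli's theorem.
\<close>
lemma joint_measurable:
  assumes s: "0 \<le> s"
  shows "(\<lambda>p. initial_stieltjes (Complex (fst p) \<gamma>) (snd p)) \<in> borel_measurable (lborel \<Otimes>\<^sub>M M)"
    and "(\<lambda>p. char_resolvent s (Complex (fst p) \<gamma>) (snd p) i j) \<in> borel_measurable (lborel \<Otimes>\<^sub>M M)"
    and "(\<lambda>p. deviation s (Complex (fst p) \<gamma>) (snd p)) \<in> borel_measurable (lborel \<Otimes>\<^sub>M M)"
    and "(\<lambda>p. fro n (char_resolvent s (Complex (fst p) \<gamma>) (snd p))) \<in> borel_measurable (lborel \<Otimes>\<^sub>M M)"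
proof -
  let ?N = "lborel \<Otimes>\<^sub>M M :: (real \<times> 'a) measure"
  have z: "(\<lambda>p. Complex (fst p) \<gamma>) \<in> borel_measurable ?N" by measurable
  have D: "(\<lambda>p. D k (snd p)) \<in> borel_measurable ?N" if "k < n" for k
    by (rule measurable_compose[OF measurable_snd D_measurable[OF that]])
  show st: "(\<lambda>p. initial_stieltjes (Complex (fst p) \<gamma>) (snd p)) \<in> borel_measurable ?N"
    unfolding initial_stieltjes_def by (rule stieltjes_measurable[OF D z])
  have ch: "(\<lambda>p. characteristic s (Complex (fst p) \<gamma>) (snd p)) \<in> borel_measurable ?N"
    unfolding characteristic_def using st z by measurable
  have df: "(\<lambda>p. deformed s k l (snd p)) \<in> borel_measurable ?N" if "k < n" "l < n" for k l
    by (rule measurable_compose[OF measurable_snd deformed_measurable[OF that s]])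
  have r: "(\<lambda>p. char_resolvent s (Complex (fst p) \<gamma>) (snd p) i j) \<in> borel_measurable ?N" for i j
    unfolding char_resolvent_def by (rule resolvent_measurable[OF df ch])
  show "(\<lambda>p. char_resolvent s (Complex (fst p) \<gamma>) (snd p) i j) \<in> borel_measurable ?N" by (rule r)
  show "(\<lambda>p. deviation s (Complex (fst p) \<gamma>) (snd p)) \<in> borel_measurable ?N"
    unfolding deviation_def using tr_measurable[OF r] st by measurable
  show "(\<lambda>p. fro n (char_resolvent s (Complex (fst p) \<gamma>) (snd p))) \<in> borel_measurable ?N"
    by (rule fro_measurable[OF r])
qed

lemma section_measurable:
  assumes s: "0 \<le> s"
  shows "(\<lambda>\<omega>. deviation s (Complex x \<gamma>) \<omega>) \<in> borel_measurable M"
    and "(\<lambda>\<omega>. fro n (char_resolvent s (Complex x \<gamma>) \<omega>)) \<in> borel_measurable M"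
  using measurable_compose[OF measurable_Pair1'[of x lborel M] joint_measurable(3)[OF s, of \<gamma>]]
    measurable_compose[OF measurable_Pair1'[of x lborel M] joint_measurable(4)[OF s, of \<gamma>]] by simp_all

text \<open>
  Moving from the characteristic back to \<open>z\<close> costs the factor \<open>(1 + 1 / 3)\<^sup>2 = 16 / 9\<close>.
\<close>
lemma frobenius_average_le:
  assumes t: "0 < t" and \<gamma>: "2 * sqrt t < \<gamma>" and s: "0 \<le> s" "s \<le> t"
  shows "(\<integral>\<^sup>+x. ennreal ((fro n (char_resolvent s (Complex x \<gamma>) \<omega>))\<^sup>2 / real n) \<partial>lborel) \<le> ennreal (16 / 9 * (pi / \<gamma>))"
proof -
  note g = gamma_facts[OF t \<gamma> stieltjes_like_stieltjes]
  obtain lam where lam: "\<And>w. 0 < Im w \<Longrightarrow> (fro n (resolvent n (\<lambda>k l. deformed s k l \<omega>) w))\<^sup>2 / real n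
     = (\<Sum>k<n. 1 / (cmod (w - complex_of_real (lam k)))\<^sup>2) / real n"
    by (rule fro_resolvent_spectral[OF hermitian_deformed[of s \<omega>]]) blast
  have "(fro n (char_resolvent s (Complex x \<gamma>) \<omega>))\<^sup>2 / real n
      \<le> 16 / 9 * ((\<Sum>k<n. 1 / (cmod (Complex x \<gamma> - complex_of_real (lam k)))\<^sup>2) / real n)" for x
  proof -
    let ?z = "Complex x \<gamma>" and ?w = "characteristic s (Complex x \<gamma>) \<omega>"
    have z: "Im ?z = \<gamma>" by simp
    note cb = characteristic_bounds[OF t \<gamma> z s, of \<omega>]
    have w: "0 < Im ?w" using cb(2) g(1) by linarith
    have le: "1 / (cmod (?w - complex_of_real (lam k)))\<^sup>2 \<le> 16 / 9 * (1 / (cmod (?z - complex_of_real (lam k)))\<^sup>2)" for k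
    proof -
      have "(1 + 1 / 3)\<^sup>2 = (16 / 9 :: real)" by (simp add: power2_eq_square)
      moreover have "1 / (cmod (?w - complex_of_real (lam k)))\<^sup>2 \<le> (1 + 1 / 3)\<^sup>2 / (cmod (?z - complex_of_real (lam k)))\<^sup>2"
        by (rule inverse_square_shift_le[OF cb(3) w]) (use g(1) in simp)
      ultimately show ?thesis by (simp only: times_divide_eq_right mult_1_right)
    qed
    have "(fro n (char_resolvent s ?z \<omega>))\<^sup>2 / real n = (\<Sum>k<n. 1 / (cmod (?w - complex_of_real (lam k)))\<^sup>2) / real n"
      unfolding char_resolvent_def by (rule lam[OF w])
    also have "\<dots> \<le> (\<Sum>k<n. 16 / 9 * (1 / (cmod (?z - complex_of_real (lam k)))\<^sup>2)) / real n"
      by (intro divide_right_mono sum_mono le) simp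
    finally show ?thesis by (simp only: sum_distrib_left times_divide_eq_right)
  qed
  hence "(\<integral>\<^sup>+x. ennreal ((fro n (char_resolvent s (Complex x \<gamma>) \<omega>))\<^sup>2 / real n) \<partial>lborel)
     \<le> (\<integral>\<^sup>+x. ennreal (16 / 9 * ((\<Sum>k<n. 1 / (cmod (Complex x \<gamma> - complex_of_real (lam k)))\<^sup>2) / real n)) \<partial>lborel)"
    by (intro nn_integral_mono ennreal_leI)
  also have "\<dots> = ennreal (16 / 9 * (pi / \<gamma>))"
    by (rule nn_integral_inverse_square_average[OF g(1) n1]) simp
  finally show ?thesis .
qed

lemma deviation_bounded:
  assumes t: "0 < t" and \<gamma>: "2 * sqrt t < \<gamma>" and z: "Im z = \<gamma>" and s: "0 \<le> s" "s \<le> t"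
  shows "cmod (deviation s z \<omega>) \<le> 1 / (3 * \<gamma> / 4) + 1 / \<gamma>" "(fro n (char_resolvent s z \<omega>))\<^sup>2 / real n \<le> 1 / (3 * \<gamma> / 4)\<^sup>2"
proof -
  note g = gamma_facts[OF t \<gamma> stieltjes_like_stieltjes]
  have \<eta>: "0 < 3 * \<gamma> / 4" using g by simp
  note b = resolvent_bounds[OF hermitian_deformed n1 \<eta> characteristic_bounds(2)[OF t \<gamma> z s]]
  show "cmod (deviation s z \<omega>) \<le> 1 / (3 * \<gamma> / 4) + 1 / \<gamma>"
    unfolding deviation_def char_resolvent_def
    by (rule order_trans[OF norm_triangle_ineq4 add_mono[OF b(1) characteristic_bounds(1)[OF t \<gamma> z s]]])
  have "(fro n (char_resolvent s z \<omega>))\<^sup>2 \<le> real n / (3 * \<gamma> / 4)\<^sup>2" unfolding char_resolvent_def by (rule b(2))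
  hence "(fro n (char_resolvent s z \<omega>))\<^sup>2 / real n \<le> (real n / (3 * \<gamma> / 4)\<^sup>2) / real n" by (rule divide_right_mono) simp
  thus "(fro n (char_resolvent s z \<omega>))\<^sup>2 / real n \<le> 1 / (3 * \<gamma> / 4)\<^sup>2" using n1 by simp
qed

text \<open>
  The recursion on a grid of \<open>m\<close> steps, started at \<open>deviation 0 z \<omega> = 0\<close>. The remainders of the single steps
  add up to a multiple of \<open>sqrt \<epsilon>\<close>.
\<close>
lemma deviation_second_moment_grid:
  assumes t: "0 < t" and \<gamma>: "2 * sqrt t < \<gamma>" and z: "Im z = \<gamma>"
    and m: "0 < m" "t / real m \<le> 1"
  defines "\<eta> \<equiv> 3 * \<gamma> / 4" and "\<epsilon> \<equiv> t / real m"
  shows "expectation (\<lambda>\<omega>. (cmod (deviation t z \<omega>))\<^sup>2)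
    \<le> exp (2 * t / \<eta>\<^sup>2) * ((\<Sum>j<m. \<epsilon> / (real n * \<eta>\<^sup>2) * expectation (\<lambda>\<omega>. (fro n (char_resolvent (real j * \<epsilon>) z \<omega>))\<^sup>2 / real n))
        + t * sqrt \<epsilon> * step_const \<gamma>)"
proof -
  note g = gamma_facts[OF t \<gamma> stieltjes_like_stieltjes]
  have \<epsilon>: "0 < \<epsilon>" "\<epsilon> \<le> 1" and m\<epsilon>: "real m * \<epsilon> = t" using t m by (auto simp: \<epsilon>_def)
  define \<alpha> where "\<alpha> = (\<lambda>j. expectation (\<lambda>\<omega>. (cmod (deviation (real j * \<epsilon>) z \<omega>))\<^sup>2))"
  define \<phi> where "\<phi> = (\<lambda>j. \<epsilon> / (real n * \<eta>\<^sup>2) * expectation (\<lambda>\<omega>. (fro n (char_resolvent (real j * \<epsilon>) z \<omega>))\<^sup>2 / real n))"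
  have K0: "0 \<le> step_const \<gamma>" using g by (auto simp: step_const_def)
  have \<phi>0: "0 \<le> \<phi> j" for j
    unfolding \<phi>_def using \<epsilon> by (intro mult_nonneg_nonneg Bochner_Integration.integral_nonneg divide_nonneg_nonneg) auto
  have "\<alpha> m \<le> (1 + 2 * \<epsilon> / \<eta>\<^sup>2) ^ m * ((\<Sum>j<m. \<phi> j) + real m * (sqrt \<epsilon> ^ 3 * step_const \<gamma>))"
  proof (rule linear_recursion_bound)
    show "\<alpha> 0 = 0" using g z by (simp add: \<alpha>_def deviation_zero)
    show "0 \<le> sqrt \<epsilon> ^ 3 * step_const \<gamma>" using \<epsilon> K0 by simp
    fix j assume j: "j < m"
    have "real (Suc j) * \<epsilon> \<le> real m * \<epsilon>" using j \<epsilon> by (intro mult_right_mono) auto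
    hence "real (Suc j) * \<epsilon> \<le> t" by (simp add: m\<epsilon>)
    from deviation_step[OF t \<gamma> z \<epsilon> this] show "\<alpha> (Suc j) \<le> (1 + 2 * \<epsilon> / \<eta>\<^sup>2) * \<alpha> j + \<phi> j + sqrt \<epsilon> ^ 3 * step_const \<gamma>"
      by (simp only: \<alpha>_def \<phi>_def \<eta>_def)
  qed (use \<epsilon> \<phi>0 in auto)
  also have "\<dots> \<le> exp (2 * t / \<eta>\<^sup>2) * ((\<Sum>j<m. \<phi> j) + real m * (sqrt \<epsilon> ^ 3 * step_const \<gamma>))"
  proof (rule mult_right_mono)
    have "(1 + 2 * \<epsilon> / \<eta>\<^sup>2) ^ m \<le> exp (2 * \<epsilon> / \<eta>\<^sup>2) ^ m"
      using exp_ge_add_one_self[of "2 * \<epsilon> / \<eta>\<^sup>2"] \<epsilon> by (intro power_mono) auto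
    also have "\<dots> = exp (real m * (2 * \<epsilon> / \<eta>\<^sup>2))" by (rule exp_of_nat_mult[symmetric])
    also have "real m * (2 * \<epsilon> / \<eta>\<^sup>2) = 2 * (real m * \<epsilon>) / \<eta>\<^sup>2" by simp
    finally show "(1 + 2 * \<epsilon> / \<eta>\<^sup>2) ^ m \<le> exp (2 * t / \<eta>\<^sup>2)" by (simp only: m\<epsilon>)
    show "0 \<le> (\<Sum>j<m. \<phi> j) + real m * (sqrt \<epsilon> ^ 3 * step_const \<gamma>)"
      using \<phi>0 \<epsilon> K0 by (intro add_nonneg_nonneg sum_nonneg mult_nonneg_nonneg) auto
  qed
  also have "real m * (sqrt \<epsilon> ^ 3 * step_const \<gamma>) = t * sqrt \<epsilon> * step_const \<gamma>"
  proof -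
    have "sqrt \<epsilon> ^ 3 = \<epsilon> * sqrt \<epsilon>" using \<epsilon> by (simp add: power3_eq_cube)
    hence "real m * (sqrt \<epsilon> ^ 3 * step_const \<gamma>) = (real m * \<epsilon>) * sqrt \<epsilon> * step_const \<gamma>" by simp
    thus ?thesis by (simp only: m\<epsilon>)
  qed
  finally show ?thesis by (simp only: \<alpha>_def \<phi>_def m\<epsilon>)
qed

text \<open>
  Integrating the grid estimate over all \<open>x\<close> is possible only after subtraction of the remainder \<open>\<rho> i\<close>, a
  constant in \<open>x\<close>. It is therefore moved to the left-hand side; Fatou's lemma removes it as the grid is refined.
\<close>
lemma deviation_mean_square_integral:
  assumes t: "0 < t" and \<gamma>: "2 * sqrt t < \<gamma>"
  shows "(\<integral>\<^sup>+x. (\<integral>\<^sup>+\<omega>. ennreal ((cmod (deviation t (Complex x \<gamma>) \<omega>))\<^sup>2) \<partial>M) \<partial>lborel) \<le> ennreal (deviation_const t \<gamma> / real n)"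
proof -
  note g = gamma_facts[OF t \<gamma> stieltjes_like_stieltjes]
  define \<eta> where "\<eta> = 3 * \<gamma> / 4"
  have \<eta>: "0 < \<eta>" using g by (simp add: \<eta>_def)
  interpret L: pair_sigma_finite lborel M ..
  define \<alpha> where "\<alpha> = (\<lambda>x. expectation (\<lambda>\<omega>. (cmod (deviation t (Complex x \<gamma>) \<omega>))\<^sup>2))"
  \<comment> \<open>Grids of at least \<open>max t 1\<close> steps, as the one-step estimate requires steps of length at most \<open>1\<close>.\<close>
  obtain m0 :: nat where m0: "max t 1 \<le> real m0" using real_arch_simple by blast
  define N where "N = (\<lambda>i. m0 + i)"
  have N: "0 < N i" "t / real (N i) \<le> 1" for i using m0 t by (auto simp: N_def field_simps)
  define \<epsilon> where "\<epsilon> = (\<lambda>i. t / real (N i))"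
  define F where "F = (\<lambda>i j x. expectation (\<lambda>\<omega>. (fro n (char_resolvent (real j * \<epsilon> i) (Complex x \<gamma>) \<omega>))\<^sup>2 / real n))"
  define c where "c = exp (2 * t / \<eta>\<^sup>2)"
  define \<rho> where "\<rho> = (\<lambda>i. c * (t * sqrt (\<epsilon> i) * step_const \<gamma>))"
  have \<epsilon>0: "0 < \<epsilon> i" for i using N t by (simp add: \<epsilon>_def)
  have grid: "0 \<le> real j * \<epsilon> i" "real j * \<epsilon> i \<le> t" if "j < N i" for i j
  proof -
    show "0 \<le> real j * \<epsilon> i" using \<epsilon>0[of i] by simp
    have "real j * \<epsilon> i \<le> real (N i) * \<epsilon> i" using that \<epsilon>0[of i] by (intro mult_right_mono) auto
    also have "\<dots> = t" using N by (simp add: \<epsilon>_def)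
    finally show "real j * \<epsilon> i \<le> t" .
  qed
  have \<rho>0: "\<rho> \<longlonglongrightarrow> 0"
  proof -
    have "\<epsilon> \<longlonglongrightarrow> 0" unfolding \<epsilon>_def N_def by real_asymp
    hence "\<rho> \<longlonglongrightarrow> c * (t * sqrt 0 * step_const \<gamma>)" unfolding \<rho>_def by (intro tendsto_intros)
    thus ?thesis by simp
  qed
  have bound: "\<alpha> x - \<rho> i \<le> (\<Sum>j<N i. c * (\<epsilon> i / (real n * \<eta>\<^sup>2)) * F i j x)" for x i
    using deviation_second_moment_grid[OF t \<gamma> _ N(1,2)[of i], of "Complex x \<gamma>"]
    by (simp add: \<alpha>_def \<rho>_def c_def F_def \<epsilon>_def \<eta>_def distrib_left sum_distrib_left mult.assoc)
  have fint: "integrable M (\<lambda>\<omega>. (fro n (char_resolvent s (Complex x \<gamma>) \<omega>))\<^sup>2 / real n)" if "0 \<le> s" "s \<le> t" for s x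
    by (rule integrable_const_bound[of _ "1 / (3 * \<gamma> / 4)\<^sup>2"])
       (use deviation_bounded(2)[OF t \<gamma> _ that] section_measurable(2)[OF that(1)] in \<open>auto intro!: AE_I2\<close>)
  have dint: "integrable M (\<lambda>\<omega>. (cmod (deviation t (Complex x \<gamma>) \<omega>))\<^sup>2)" for x
  proof (rule integrable_const_bound[of _ "(1 / (3 * \<gamma> / 4) + 1 / \<gamma>)\<^sup>2"])
    show "AE \<omega> in M. norm ((cmod (deviation t (Complex x \<gamma>) \<omega>))\<^sup>2) \<le> (1 / (3 * \<gamma> / 4) + 1 / \<gamma>)\<^sup>2"
      using deviation_bounded(1)[OF t \<gamma>, of "Complex x \<gamma>" t] t
      by (intro AE_I2) (simp add: power_mono del: divide_divide_eq_right)
    show "(\<lambda>\<omega>. (cmod (deviation t (Complex x \<gamma>) \<omega>))\<^sup>2) \<in> borel_measurable M"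
      using section_measurable(1)[OF less_imp_le[OF t], of x \<gamma>] by measurable
  qed
  have Fm: "F i j \<in> borel_measurable lborel" if "j < N i" for i j
  proof -
    have "(\<lambda>p. (fro n (char_resolvent (real j * \<epsilon> i) (Complex (fst p) \<gamma>) (snd p)))\<^sup>2 / real n) \<in> borel_measurable (lborel \<Otimes>\<^sub>M M)"
      using joint_measurable(4)[OF grid(1)[OF that], of \<gamma>] by measurable
    thus ?thesis unfolding F_def by (intro borel_measurable_lebesgue_integral) (simp add: case_prod_beta')
  qed
  have Fi: "(\<integral>\<^sup>+x. ennreal (F i j x) \<partial>lborel) \<le> ennreal (16 / 9 * (pi / \<gamma>))" if j: "j < N i" for i j
  proof -
    let ?f = "\<lambda>x \<omega>. ennreal ((fro n (char_resolvent (real j * \<epsilon> i) (Complex x \<gamma>) \<omega>))\<^sup>2 / real n)"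
    have "(\<integral>\<^sup>+x. ennreal (F i j x) \<partial>lborel) = (\<integral>\<^sup>+x. (\<integral>\<^sup>+\<omega>. ?f x \<omega> \<partial>M) \<partial>lborel)"
      unfolding F_def
      by (intro nn_integral_cong nn_integral_eq_integral[symmetric] fint grid j) (auto intro!: AE_I2)
    also have "\<dots> = (\<integral>\<^sup>+\<omega>. (\<integral>\<^sup>+x. ?f x \<omega> \<partial>lborel) \<partial>M)"
    proof (rule L.Fubini'[symmetric])
      show "(\<lambda>(x, \<omega>). ?f x \<omega>) \<in> borel_measurable (lborel \<Otimes>\<^sub>M M)"
        using joint_measurable(4)[OF grid(1)[OF j], of \<gamma>] by (simp add: case_prod_beta')
    qed
    also have "\<dots> \<le> (\<integral>\<^sup>+\<omega>. ennreal (16 / 9 * (pi / \<gamma>)) \<partial>M)"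
      by (intro nn_integral_mono frobenius_average_le[OF t \<gamma> grid[OF j]])
    also have "\<dots> = ennreal (16 / 9 * (pi / \<gamma>))" by (simp add: emeasure_space_1)
    finally show ?thesis .
  qed
  have F0: "0 \<le> F i j x" for i j x
    unfolding F_def by (intro Bochner_Integration.integral_nonneg divide_nonneg_nonneg) auto
  have sum: "(\<integral>\<^sup>+x. ennreal (\<alpha> x - \<rho> i) \<partial>lborel) \<le> ennreal (deviation_const t \<gamma> / real n)" for i
  proof -
    have k0: "0 \<le> 16 / 9 * (pi / \<gamma>)" using g by simp
    have q0: "0 \<le> c * (\<epsilon> i / (real n * \<eta>\<^sup>2))" using \<epsilon>0[of i] by (simp add: c_def)
    have "(\<integral>\<^sup>+x. ennreal (\<alpha> x - \<rho> i) \<partial>lborel) \<le> (\<integral>\<^sup>+x. ennreal (\<Sum>j<N i. c * (\<epsilon> i / (real n * \<eta>\<^sup>2)) * F i j x) \<partial>lborel)"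
      by (intro nn_integral_mono ennreal_leI bound)
    also have "\<dots> = (\<integral>\<^sup>+x. (\<Sum>j<N i. ennreal (c * (\<epsilon> i / (real n * \<eta>\<^sup>2))) * ennreal (F i j x)) \<partial>lborel)"
      by (intro nn_integral_cong) (simp only: sum_ennreal[symmetric] ennreal_mult[symmetric] q0 F0 mult_nonneg_nonneg)
    also have "\<dots> = (\<Sum>j<N i. ennreal (c * (\<epsilon> i / (real n * \<eta>\<^sup>2))) * (\<integral>\<^sup>+x. ennreal (F i j x) \<partial>lborel))"
      using Fm by (subst nn_integral_sum) (auto intro!: sum.cong nn_integral_cmult)
    also have "\<dots> \<le> (\<Sum>j<N i. ennreal (c * (\<epsilon> i / (real n * \<eta>\<^sup>2))) * ennreal (16 / 9 * (pi / \<gamma>)))"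
      by (intro sum_mono mult_left_mono Fi) auto
    also have "\<dots> = (\<Sum>j<N i. ennreal (c * (\<epsilon> i / (real n * \<eta>\<^sup>2)) * (16 / 9 * (pi / \<gamma>))))"
      by (intro sum.cong refl ennreal_mult[symmetric] q0 k0)
    also have "\<dots> = ennreal (\<Sum>j<N i. c * (\<epsilon> i / (real n * \<eta>\<^sup>2)) * (16 / 9 * (pi / \<gamma>)))"
      by (intro sum_ennreal mult_nonneg_nonneg[OF q0 k0])
    also have "(\<Sum>j<N i. c * (\<epsilon> i / (real n * \<eta>\<^sup>2)) * (16 / 9 * (pi / \<gamma>))) = deviation_const t \<gamma> / real n"
      using N(1)[of i] by (simp add: deviation_const_def c_def \<epsilon>_def \<eta>_def mult_ac)
    finally show ?thesis .
  qed
  have lim: "(\<lambda>i. ennreal (\<alpha> x - \<rho> i)) \<longlonglongrightarrow> ennreal (\<alpha> x)" for x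
  proof -
    have "(\<lambda>i. \<alpha> x - \<rho> i) \<longlonglongrightarrow> \<alpha> x - 0" by (intro tendsto_intros \<rho>0)
    thus ?thesis by (intro tendsto_ennrealI) simp
  qed
  have \<alpha>m: "\<alpha> \<in> borel_measurable lborel"
  proof -
    have "(\<lambda>p. (cmod (deviation t (Complex (fst p) \<gamma>) (snd p)))\<^sup>2) \<in> borel_measurable (lborel \<Otimes>\<^sub>M M)"
      using joint_measurable(3)[OF less_imp_le[OF t], of \<gamma>] by measurable
    thus ?thesis unfolding \<alpha>_def by (intro borel_measurable_lebesgue_integral) (simp add: case_prod_beta')
  qed
  have "(\<integral>\<^sup>+x. (\<integral>\<^sup>+\<omega>. ennreal ((cmod (deviation t (Complex x \<gamma>) \<omega>))\<^sup>2) \<partial>M) \<partial>lborel) = (\<integral>\<^sup>+x. ennreal (\<alpha> x) \<partial>lborel)"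
    unfolding \<alpha>_def by (intro nn_integral_cong nn_integral_eq_integral dint) auto
  also have "\<dots> = (\<integral>\<^sup>+x. liminf (\<lambda>i. ennreal (\<alpha> x - \<rho> i)) \<partial>lborel)"
    by (intro nn_integral_cong) (simp add: lim_imp_Liminf[OF _ lim])
  also have "\<dots> \<le> liminf (\<lambda>i. \<integral>\<^sup>+x. ennreal (\<alpha> x - \<rho> i) \<partial>lborel)"
    by (rule nn_integral_liminf) (use \<alpha>m in measurable)
  also have "\<dots> \<le> liminf (\<lambda>i::nat. ennreal (deviation_const t \<gamma> / real n))"
    by (intro Liminf_mono always_eventually allI sum)
  also have "\<dots> = ennreal (deviation_const t \<gamma> / real n)" by (simp add: Liminf_const)
  finally show ?thesis .
qed

end

section \<open>Fluctuations of the sample\<close>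

lemma stieltjes_order_statistic:
  "stieltjes n (\<lambda>k. order_statistic n y k) z = stieltjes n y z"
proof -
  let ?xs = "map y [0..<n]" and ?f = "\<lambda>u. 1 / (z - complex_of_real u)"
  have "(\<Sum>k<n. ?f (sort ?xs ! k)) = sum_list (map ?f (sort ?xs))"
    by (simp add: sum_list_sum_nth atLeast0LessThan)
  also have "\<dots> = sum_mset (mset (map ?f (sort ?xs)))" by (rule sum_mset_sum_list[symmetric])
  also have "mset (map ?f (sort ?xs)) = mset (map ?f ?xs)"
    by (simp only: mset_map mset_sort)
  also have "sum_mset (mset (map ?f ?xs)) = sum_list (map ?f ?xs)" by (rule sum_mset_sum_list)
  also have "\<dots> = (\<Sum>k<n. ?f (y k))"
    by (simp add: sum_list_sum_nth atLeast0LessThan)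
  finally show ?thesis by (simp add: stieltjes_def order_statistic_def)
qed

definition cauchy_transform :: "(real \<Rightarrow> real) \<Rightarrow> complex \<Rightarrow> complex" where
  "cauchy_transform p z = (\<integral>y. complex_of_real (p y) * (1 / (z - complex_of_real y)) \<partial>lborel)"

lemma cmod_cauchy_kernel_le:
  assumes "0 < Im z"
  shows "cmod (1 / (z - complex_of_real y)) \<le> 1 / Im z"
  using assms Im_le_dist_real[of z y] by (simp add: norm_divide frac_le)

text \<open>
  The mixed terms vanish by independence and centring.
\<close>
lemma (in prob_space) independent_average_variance:
  fixes \<xi> :: "nat \<Rightarrow> 'a \<Rightarrow> complex"
  assumes ind: "indep_vars (\<lambda>_. borel) \<xi> {..<n}" and n: "1 \<le> n"
    and b: "\<And>j \<omega>. j < n \<Longrightarrow> cmod (\<xi> j \<omega>) \<le> C"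
    and mean: "\<And>j. j < n \<Longrightarrow> expectation (\<xi> j) = 0"
    and var: "\<And>j. j < n \<Longrightarrow> expectation (\<lambda>\<omega>. (cmod (\<xi> j \<omega>))\<^sup>2) \<le> V"
  shows "expectation (\<lambda>\<omega>. (cmod ((\<Sum>j<n. \<xi> j \<omega>) / of_nat n))\<^sup>2) \<le> V / real n"
proof -
  have rv: "\<xi> j \<in> borel_measurable M" if "j < n" for j
    using ind that by (auto simp: indep_vars_def)
  have int: "integrable M (\<xi> j)" if "j < n" for j
    by (rule integrable_const_bound[OF AE_I2 rv[OF that]]) (rule b[OF that])
  have cross: "expectation (\<lambda>\<omega>. \<xi> i \<omega> * cnj (\<xi> j \<omega>)) = 0" if ij: "i < n" "j < n" "i \<noteq> j" for i j
  proof -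
    define Y where "Y = (\<lambda>k \<omega>. if k = j then cnj (\<xi> k \<omega>) else \<xi> k \<omega>)"
    have sub: "indep_vars (\<lambda>_. borel) \<xi> {i, j}" by (rule indep_vars_subset[OF ind]) (use ij in auto)
    have v: "indep_vars (\<lambda>_. borel) Y {i, j}"
      unfolding Y_def
      by (rule indep_vars_compose2[OF sub, where Y = "\<lambda>k v. if k = j then cnj v else v", simplified])
         (auto intro!: cnj_measurable)
    have yi: "integrable M (Y k)" if "k \<in> {i, j}" for k
      using that int ij by (auto simp: Y_def)
    have "expectation (\<lambda>\<omega>. \<Prod>k\<in>{i, j}. Y k \<omega>) = (\<Prod>k\<in>{i, j}. expectation (Y k))"
      by (rule indep_vars_lebesgue_integral[OF _ v yi]) auto
    thus ?thesis using ij mean[OF ij(1)] by (simp add: Y_def)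
  qed
  have sq: "integrable M (\<lambda>\<omega>. \<xi> i \<omega> * cnj (\<xi> j \<omega>))" if ij: "i < n" "j < n" for i j
  proof (rule integrable_const_bound[of _ "C * C"])
    show "AE \<omega> in M. norm (\<xi> i \<omega> * cnj (\<xi> j \<omega>)) \<le> C * C"
      unfolding norm_mult complex_mod_cnj
      using b[OF ij(1)] b[OF ij(2)] by (intro AE_I2 mult_mono) (auto intro: order_trans[OF norm_ge_zero])
    show "(\<lambda>\<omega>. \<xi> i \<omega> * cnj (\<xi> j \<omega>)) \<in> borel_measurable M"
      by (intro borel_measurable_times cnj_measurable rv ij)
  qed
  have sq1: "integrable M (\<lambda>\<omega>. \<Sum>j<n. \<xi> i \<omega> * cnj (\<xi> j \<omega>))" if "i < n" for i
    by (rule Bochner_Integration.integrable_sum) (simp add: sq that)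
  have ex: "complex_of_real ((cmod (\<Sum>j<n. \<xi> j \<omega>))\<^sup>2) = (\<Sum>i<n. \<Sum>j<n. \<xi> i \<omega> * cnj (\<xi> j \<omega>))" for \<omega>
    unfolding complex_norm_square by (simp add: sum_product)
  have "expectation (\<lambda>\<omega>. complex_of_real ((cmod (\<Sum>j<n. \<xi> j \<omega>))\<^sup>2)) = (\<Sum>i<n. \<Sum>j<n. expectation (\<lambda>\<omega>. \<xi> i \<omega> * cnj (\<xi> j \<omega>)))"
    unfolding ex
    by (subst Bochner_Integration.integral_sum, simp add: sq1)
       (intro sum.cong refl Bochner_Integration.integral_sum, simp add: sq)
  also have "\<dots> = (\<Sum>i<n. \<Sum>j<n. if i = j then expectation (\<lambda>\<omega>. \<xi> i \<omega> * cnj (\<xi> i \<omega>)) else 0)"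
    using cross by (intro sum.cong refl) auto
  also have "\<dots> = (\<Sum>i<n. complex_of_real (expectation (\<lambda>\<omega>. (cmod (\<xi> i \<omega>))\<^sup>2)))"
    by (intro sum.cong refl) (simp del: of_real_power flip: complex_norm_square)
  finally have "complex_of_real (expectation (\<lambda>\<omega>. (cmod (\<Sum>j<n. \<xi> j \<omega>))\<^sup>2)) = complex_of_real (\<Sum>i<n. expectation (\<lambda>\<omega>. (cmod (\<xi> i \<omega>))\<^sup>2))"
    by (simp only: integral_complex_of_real of_real_sum)
  hence "expectation (\<lambda>\<omega>. (cmod (\<Sum>j<n. \<xi> j \<omega>))\<^sup>2) = (\<Sum>i<n. expectation (\<lambda>\<omega>. (cmod (\<xi> i \<omega>))\<^sup>2))"
    by (simp only: of_real_eq_iff)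
  also have "\<dots> \<le> (\<Sum>i<n. V)" by (intro sum_mono var) auto
  finally have le: "expectation (\<lambda>\<omega>. (cmod (\<Sum>j<n. \<xi> j \<omega>))\<^sup>2) \<le> real n * V" by simp
  have "expectation (\<lambda>\<omega>. (cmod ((\<Sum>j<n. \<xi> j \<omega>) / of_nat n))\<^sup>2) = expectation (\<lambda>\<omega>. (cmod (\<Sum>j<n. \<xi> j \<omega>))\<^sup>2) / (real n)\<^sup>2"
    by (simp add: norm_divide power_divide)
  also have "\<dots> \<le> real n * V / (real n)\<^sup>2" by (intro divide_right_mono le) simp
  finally show ?thesis using n by (simp add: power2_eq_square)
qed

lemma (in prob_space) sample_stieltjes_variance:
  fixes d :: "nat \<Rightarrow> 'a \<Rightarrow> real" and p :: "real \<Rightarrow> real"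
  assumes n: "1 \<le> n" and rv: "\<And>j. j < n \<Longrightarrow> d j \<in> borel_measurable M"
    and law: "\<And>j. j < n \<Longrightarrow> distr M borel (d j) = density lborel (\<lambda>x. ennreal (p x))"
    and ind: "indep_vars (\<lambda>_. borel) d {..<n}"
    and p: "p \<in> borel_measurable borel" "\<And>x. 0 \<le> p x" and z: "0 < Im z"
  shows "expectation (\<lambda>\<omega>. (cmod (stieltjes n (\<lambda>j. d j \<omega>) z - cauchy_transform p z))\<^sup>2)
    \<le> (\<integral>y. p y * (1 / (cmod (z - complex_of_real y))\<^sup>2) \<partial>lborel) / real n"
proof -
  note [measurable] = p(1)
  define K where "K = (\<lambda>y. 1 / (z - complex_of_real y))"
  define G where "G = cauchy_transform p z"
  have Km [measurable]: "K \<in> borel_measurable borel" unfolding K_def by measurable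
  have Kb: "cmod (K y) \<le> 1 / Im z" for y unfolding K_def by (rule cmod_cauchy_kernel_le[OF z])
  have eK: "expectation (\<lambda>\<omega>. K (d j \<omega>)) = G" if j: "j < n" for j
  proof -
    have "expectation (\<lambda>\<omega>. K (d j \<omega>)) = integral\<^sup>L (distr M borel (d j)) K"
      by (rule integral_distr[OF rv[OF j] Km, symmetric])
    also have "\<dots> = G" unfolding law[OF j] G_def cauchy_transform_def
      by (subst integral_density) (use p in \<open>auto simp: scaleR_conv_of_real K_def\<close>)
    finally show ?thesis .
  qed
  have e2: "expectation (\<lambda>\<omega>. (cmod (K (d j \<omega>)))\<^sup>2) = (\<integral>y. p y * (1 / (cmod (z - complex_of_real y))\<^sup>2) \<partial>lborel)" if j: "j < n" for j
  proof -
    have m: "(\<lambda>y. (cmod (K y))\<^sup>2) \<in> borel_measurable borel" by measurable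
    have "expectation (\<lambda>\<omega>. (cmod (K (d j \<omega>)))\<^sup>2) = integral\<^sup>L (distr M borel (d j)) (\<lambda>y. (cmod (K y))\<^sup>2)"
      by (rule integral_distr[OF rv[OF j] m, symmetric])
    also have "\<dots> = (\<integral>y. p y * (1 / (cmod (z - complex_of_real y))\<^sup>2) \<partial>lborel)"
      unfolding law[OF j]
      by (subst integral_density) (use p m in \<open>auto simp: K_def norm_divide power_divide\<close>)
    finally show ?thesis .
  qed
  have Ki: "integrable M (\<lambda>\<omega>. K (d j \<omega>))" if j: "j < n" for j
    by (rule integrable_const_bound[of _ "1 / Im z", OF AE_I2]) (use Kb measurable_compose[OF rv[OF j] Km] in auto)
  have K2i: "integrable M (\<lambda>\<omega>. (cmod (K (d j \<omega>)))\<^sup>2)" if j: "j < n" for j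
    by (rule integrable_const_bound[of _ "(1 / Im z)\<^sup>2", OF AE_I2])
       (use Kb measurable_compose[OF rv[OF j] Km] in \<open>auto intro!: power_mono\<close>)
  define \<xi> where "\<xi> = (\<lambda>j \<omega>. K (d j \<omega>) - G)"
  have "expectation (\<lambda>\<omega>. (cmod ((\<Sum>j<n. \<xi> j \<omega>) / of_nat n))\<^sup>2) \<le> (\<integral>y. p y * (1 / (cmod (z - complex_of_real y))\<^sup>2) \<partial>lborel) / real n"
  proof (rule independent_average_variance[OF _ n])
    show "indep_vars (\<lambda>_. borel) \<xi> {..<n}"
      unfolding \<xi>_def by (rule indep_vars_compose2[OF ind, where Y = "\<lambda>_ y. K y - G"]) measurable
    show "cmod (\<xi> j \<omega>) \<le> 1 / Im z + cmod G" for j \<omega>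
      unfolding \<xi>_def by (rule order_trans[OF norm_triangle_ineq4]) (simp add: Kb)
    show "expectation (\<xi> j) = 0" if "j < n" for j
      unfolding \<xi>_def using eK[OF that] Ki[OF that] by (simp add: prob_space)
    show "expectation (\<lambda>\<omega>. (cmod (\<xi> j \<omega>))\<^sup>2) \<le> (\<integral>y. p y * (1 / (cmod (z - complex_of_real y))\<^sup>2) \<partial>lborel)" if j: "j < n" for j
    proof -
      have ci: "integrable M (\<lambda>\<omega>. cnj G * K (d j \<omega>))" using Ki[OF j] by simp
      have "(cmod (\<xi> j \<omega>))\<^sup>2 = (cmod (K (d j \<omega>)))\<^sup>2 - 2 * Re (cnj G * K (d j \<omega>)) + (cmod G)\<^sup>2" for \<omega>
        unfolding \<xi>_def cmod_power2 by (simp add: algebra_simps power2_eq_square)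
      hence "expectation (\<lambda>\<omega>. (cmod (\<xi> j \<omega>))\<^sup>2) = expectation (\<lambda>\<omega>. (cmod (K (d j \<omega>)))\<^sup>2 - 2 * Re (cnj G * K (d j \<omega>)) + (cmod G)\<^sup>2)"
        by (simp only:)
      also have "\<dots> = expectation (\<lambda>\<omega>. (cmod (K (d j \<omega>)))\<^sup>2) - 2 * expectation (\<lambda>\<omega>. Re (cnj G * K (d j \<omega>))) + (cmod G)\<^sup>2"
      proof -
        have "expectation (\<lambda>\<omega>. f \<omega> - 2 * f' \<omega> + c) = expectation f - 2 * expectation f' + c"
          if "integrable M f" "integrable M f'" for f f' and c :: real
          using that by (simp add: prob_space)
        from this[OF K2i[OF j] integrable_Re[OF ci]] show ?thesis .
      qed
      also have "expectation (\<lambda>\<omega>. Re (cnj G * K (d j \<omega>))) = Re (cnj G * G)"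
        unfolding integral_Re[OF ci] Bochner_Integration.integral_mult_right_zero eK[OF j] by (rule refl)
      also have "Re (cnj G * G) = (cmod G)\<^sup>2"
        unfolding cmod_power2 by (simp add: power2_eq_square)
      finally show ?thesis using e2[OF j] by simp
    qed
  qed
  also have "(\<lambda>\<omega>. (cmod ((\<Sum>j<n. \<xi> j \<omega>) / of_nat n))\<^sup>2) = (\<lambda>\<omega>. (cmod (stieltjes n (\<lambda>j. d j \<omega>) z - cauchy_transform p z))\<^sup>2)"
    using n by (intro ext) (simp add: \<xi>_def K_def G_def stieltjes_def sum_subtractf diff_divide_distrib)
  finally show ?thesis .
qed

text \<open>
  The variance at \<open>x\<close> is at most \<open>1 / (n \<gamma>)\<close> times the Poisson smoothing of \<open>p\<close>, which has total mass \<open>\<pi>\<close>.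
\<close>
lemma (in prob_space) sample_stieltjes_mean_square_integral:
  fixes d :: "nat \<Rightarrow> 'a \<Rightarrow> real" and p :: "real \<Rightarrow> real"
  assumes n: "1 \<le> n" and rv: "\<And>j. j < n \<Longrightarrow> d j \<in> borel_measurable M"
    and law: "\<And>j. j < n \<Longrightarrow> distr M borel (d j) = density lborel (\<lambda>x. ennreal (p x))"
    and ind: "indep_vars (\<lambda>_. borel) d {..<n}"
    and p: "p \<in> borel_measurable borel" "\<And>x. 0 \<le> p x" "integrable lborel p" "(\<integral>x. p x \<partial>lborel) = 1" and \<gamma>: "0 < \<gamma>"
  shows "(\<integral>\<^sup>+x. (\<integral>\<^sup>+\<omega>. ennreal ((cmod (stieltjes n (\<lambda>j. d j \<omega>) (Complex x \<gamma>) - cauchy_transform p (Complex x \<gamma>)))\<^sup>2) \<partial>M) \<partial>lborel)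
     \<le> ennreal (pi / \<gamma> / real n)"
proof -
  note [measurable] = p(1)
  have ker: "p y * (1 / (cmod (Complex x \<gamma> - complex_of_real y))\<^sup>2) = p y * (\<gamma> / ((x - y)\<^sup>2 + \<gamma>\<^sup>2)) / \<gamma>" for x y
    unfolding cmod_Complex_diff using \<gamma> by simp
  define V where "V = (\<lambda>x. (\<integral>y. p y * (\<gamma> / ((x - y)\<^sup>2 + \<gamma>\<^sup>2)) \<partial>lborel) / \<gamma>)"
  have le: "(\<integral>\<^sup>+\<omega>. ennreal ((cmod (stieltjes n (\<lambda>j. d j \<omega>) (Complex x \<gamma>) - cauchy_transform p (Complex x \<gamma>)))\<^sup>2) \<partial>M) \<le> ennreal (V x / real n)" for x
  proof -
    let ?z = "Complex x \<gamma>"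
    have z: "0 < Im ?z" using \<gamma> by simp
    have m: "(\<lambda>\<omega>. stieltjes n (\<lambda>j. d j \<omega>) ?z) \<in> borel_measurable M"
      by (rule stieltjes_measurable[OF rv]) auto
    have i: "integrable M (\<lambda>\<omega>. (cmod (stieltjes n (\<lambda>j. d j \<omega>) ?z - cauchy_transform p ?z))\<^sup>2)"
    proof (rule integrable_const_bound[of _ "(1 / Im ?z + cmod (cauchy_transform p ?z))\<^sup>2"])
      have "cmod (stieltjes n (\<lambda>j. d j \<omega>) ?z - cauchy_transform p ?z) \<le> 1 / Im ?z + cmod (cauchy_transform p ?z)" for \<omega>
        by (rule order_trans[OF norm_triangle_ineq4 add_mono[OF cmod_stieltjes_le[OF z] order_refl]])
      thus "AE \<omega> in M. norm ((cmod (stieltjes n (\<lambda>j. d j \<omega>) ?z - cauchy_transform p ?z))\<^sup>2) \<le> (1 / Im ?z + cmod (cauchy_transform p ?z))\<^sup>2"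
        by (intro AE_I2) (simp only: real_norm_def abs_power2 power_mono norm_ge_zero)
    qed (use m in measurable)
    have "(\<integral>\<^sup>+\<omega>. ennreal ((cmod (stieltjes n (\<lambda>j. d j \<omega>) ?z - cauchy_transform p ?z))\<^sup>2) \<partial>M)
       = ennreal (expectation (\<lambda>\<omega>. (cmod (stieltjes n (\<lambda>j. d j \<omega>) ?z - cauchy_transform p ?z))\<^sup>2))"
      by (rule nn_integral_eq_integral[OF i]) simp
    also have "\<dots> \<le> ennreal ((\<integral>y. p y * (1 / (cmod (?z - complex_of_real y))\<^sup>2) \<partial>lborel) / real n)"
      by (intro ennreal_leI sample_stieltjes_variance[OF n rv law ind p(1,2) z])
    also have "(\<integral>y. p y * (1 / (cmod (?z - complex_of_real y))\<^sup>2) \<partial>lborel) = V x"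
      unfolding V_def ker by (rule Bochner_Integration.integral_divide_zero)
    finally show ?thesis .
  qed
  note P = fourier_poisson_smoothing[OF \<gamma> p(3)]
  have V0: "0 \<le> V x" for x unfolding V_def using p(2) \<gamma> by (intro divide_nonneg_nonneg Bochner_Integration.integral_nonneg mult_nonneg_nonneg) auto
  have "(\<integral>x. (\<integral>y. p y * (\<gamma> / ((x - y)\<^sup>2 + \<gamma>\<^sup>2)) \<partial>lborel) \<partial>lborel) = pi"
  proof -
    let ?k = "\<lambda>x y. p y * (\<gamma> / ((x - y)\<^sup>2 + \<gamma>\<^sup>2))"
    have intr: "integrable (lborel \<Otimes>\<^sub>M lborel) (\<lambda>(y, x). ?k x y)"
    proof (rule lborel_pair.Fubini_integrable)
      have "norm (?k x y) = p y * (\<gamma> / ((x - y)\<^sup>2 + \<gamma>\<^sup>2))" for x y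
        using p(2)[of y] \<gamma> by simp
      hence "(\<integral>x. norm (?k x y) \<partial>lborel) = p y * pi" for y
        by (simp only: Bochner_Integration.integral_mult_right_zero cauchy_kernel_integrable(2)[OF \<gamma>])
      thus "integrable lborel (\<lambda>y. \<integral>x. norm (case (y, x) of (y, x) \<Rightarrow> ?k x y) \<partial>lborel)"
        using p(3) by simp
      show "AE y in lborel. integrable lborel (\<lambda>x. case (y, x) of (y, x) \<Rightarrow> ?k x y)"
        unfolding case_prod_conv
        by (intro AE_I2 Bochner_Integration.integrable_mult_right cauchy_kernel_integrable(1)[OF \<gamma>])
    qed measurable
    have "(\<integral>x. (\<integral>y. ?k x y \<partial>lborel) \<partial>lborel) = (\<integral>y. (\<integral>x. ?k x y \<partial>lborel) \<partial>lborel)"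
      by (rule lborel_pair.Fubini_integral[OF intr])
    also have "\<dots> = (\<integral>y. p y * pi \<partial>lborel)"
      by (simp only: Bochner_Integration.integral_mult_right_zero cauchy_kernel_integrable(2)[OF \<gamma>])
    also have "\<dots> = pi" using p(4) by simp
    finally show ?thesis .
  qed
  hence Vi: "integrable lborel V" "integral\<^sup>L lborel V = pi / \<gamma>"
    unfolding V_def using P(1) by simp_all
  have "(\<integral>\<^sup>+x. (\<integral>\<^sup>+\<omega>. ennreal ((cmod (stieltjes n (\<lambda>j. d j \<omega>) (Complex x \<gamma>) - cauchy_transform p (Complex x \<gamma>)))\<^sup>2) \<partial>M) \<partial>lborel)
     \<le> (\<integral>\<^sup>+x. ennreal (V x / real n) \<partial>lborel)"
    by (rule nn_integral_mono) (rule le)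
  also have "\<dots> = ennreal (\<integral>x. V x / real n \<partial>lborel)"
    using Vi V0 by (intro nn_integral_eq_integral) auto
  also have "(\<integral>x. V x / real n \<partial>lborel) = pi / \<gamma> / real n"
    unfolding Bochner_Integration.integral_divide_zero Vi(2) by (rule refl)
  finally show ?thesis .
qed

section \<open>Risk of the estimator\<close>

lemma exp_neg_powr_le_inverse_quadratic:
  fixes a r :: real
  assumes a: "0 < a" and r: "0 < r"
  obtains C where "0 < C" "\<And>\<xi>. exp (- (2 * a * \<bar>\<xi>\<bar> powr r)) \<le> C * (1 / (\<xi>\<^sup>2 + 1))"
proof -
  have "((\<lambda>x. exp (- (2 * a * x powr r)) * (x\<^sup>2 + 1)) \<longlongrightarrow> 0) at_top"
    using a r by real_asymp
  hence "\<forall>\<^sub>F x in at_top. exp (- (2 * a * x powr r)) * (x\<^sup>2 + 1) < 1"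
    by (rule order_tendstoD) simp
  then obtain N where N: "\<And>x. N \<le> x \<Longrightarrow> exp (- (2 * a * x powr r)) * (x\<^sup>2 + 1) < 1"
    unfolding eventually_at_top_linorder by blast
  have "exp (- (2 * a * \<bar>\<xi>\<bar> powr r)) * (\<xi>\<^sup>2 + 1) \<le> N\<^sup>2 + 1" for \<xi>
  proof (cases "N \<le> \<bar>\<xi>\<bar>")
    case True
    have "exp (- (2 * a * \<bar>\<xi>\<bar> powr r)) * (\<xi>\<^sup>2 + 1) < 1" using N[OF True] by simp
    thus ?thesis using zero_le_power2[of N] by linarith
  next
    case False
    have "\<xi>\<^sup>2 \<le> N\<^sup>2" using False by (simp add: abs_le_square_iff[symmetric])
    moreover have "exp (- (2 * a * \<bar>\<xi>\<bar> powr r)) \<le> 1" using a by simp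
    ultimately have "exp (- (2 * a * \<bar>\<xi>\<bar> powr r)) * (\<xi>\<^sup>2 + 1) \<le> 1 * (N\<^sup>2 + 1)"
      by (intro mult_mono) auto
    thus ?thesis by simp
  qed
  moreover have "0 < \<xi>\<^sup>2 + (1::real)" for \<xi> using zero_le_power2[of \<xi>] by linarith
  ultimately have "exp (- (2 * a * \<bar>\<xi>\<bar> powr r)) \<le> (N\<^sup>2 + 1) * (1 / (\<xi>\<^sup>2 + 1))" for \<xi>
    by (simp add: pos_le_divide_eq)
  moreover have "0 < N\<^sup>2 + 1" using zero_le_power2[of N] by linarith
  ultimately show thesis by (rule that[rotated])
qed

lemma fourier_measurable:
  assumes "integrable lborel g"
  shows "fourier g \<in> borel_measurable borel"
proof -
  from assms have [measurable]: "g \<in> borel_measurable borel" by auto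
  show ?thesis unfolding fourier_eq_cnj_FT[abs_def] by measurable
qed

lemma fourier_bounded:
  assumes "integrable lborel g"
  shows "cmod (fourier g \<xi>) \<le> (\<integral>x. \<bar>g x\<bar> \<partial>lborel)"
  unfolding fourier_eq_cnj_FT complex_mod_cnj
  using FT_bounded[of "\<lambda>x. complex_of_real (g x)" \<xi>] assms by simp

lemma supersmooth_densitiesD:
  assumes p: "p \<in> supersmooth_densities a r L"
  shows "p \<in> borel_measurable borel" "\<And>x. 0 \<le> p x" "(\<integral>\<^sup>+x. ennreal (p x) \<partial>lborel) = 1"
    "integrable lborel p" "(\<integral>x. p x \<partial>lborel) = 1"
    "(\<integral>\<^sup>+\<xi>. ennreal ((cmod (fourier p \<xi>))\<^sup>2 * exp (2 * a * \<bar>\<xi>\<bar> powr r)) \<partial>lborel) \<le> ennreal L"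
proof -
  show *: "p \<in> borel_measurable borel" "\<And>x. 0 \<le> p x" "(\<integral>\<^sup>+x. ennreal (p x) \<partial>lborel) = 1"
    "(\<integral>\<^sup>+\<xi>. ennreal ((cmod (fourier p \<xi>))\<^sup>2 * exp (2 * a * \<bar>\<xi>\<bar> powr r)) \<partial>lborel) \<le> ennreal L"
    using p by (auto simp: supersmooth_densities_def)
  show i: "integrable lborel p" by (rule integrableI_nonneg) (use * in auto)
  show "(\<integral>x. p x \<partial>lborel) = 1"
    using nn_integral_eq_integral[OF i] *(2,3) by simp
qed

text \<open>
  By \<open>\<bar>ab\<bar> \<le> \<bar>a\<bar>\<^sup>2 + \<bar>b\<bar>\<^sup>2\<close>, split with the weight \<open>exp (a \<bar>\<xi>\<bar> powr r)\<close> on one factor and its inverse on the other.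
\<close>
lemma supersmooth_fourier_integrable:
  assumes a: "0 < a" and r: "0 < r" and p: "p \<in> supersmooth_densities a r L"
  shows "integrable lborel (fourier p)"
proof -
  note P = supersmooth_densitiesD[OF p]
  note [measurable] = fourier_measurable[OF P(4)]
  obtain C where C: "0 < C" "\<And>\<xi>. exp (- (2 * a * \<bar>\<xi>\<bar> powr r)) \<le> C * (1 / (\<xi>\<^sup>2 + 1))"
    by (rule exp_neg_powr_le_inverse_quadratic[OF a r]) blast
  define F where "F = (\<lambda>\<xi>. (cmod (fourier p \<xi>))\<^sup>2 * exp (2 * a * \<bar>\<xi>\<bar> powr r))"
  have F: "integrable lborel F"
  proof (rule integrableI_nonneg)
    show "F \<in> borel_measurable lborel" unfolding F_def by measurable
    show "(\<integral>\<^sup>+x. ennreal (F x) \<partial>lborel) < \<infinity>"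
      using P(6) unfolding F_def by (rule order_le_less_trans) simp
  qed (auto simp: F_def)
  have q: "integrable lborel (\<lambda>\<xi>::real. C * (1 / (\<xi>\<^sup>2 + 1)))"
    using cauchy_kernel_integrable(1)[of 1 0] by (intro Bochner_Integration.integrable_mult_right) simp
  show ?thesis
  proof (rule Bochner_Integration.integrable_bound[OF Bochner_Integration.integrable_add[OF F q]])
    show "fourier p \<in> borel_measurable lborel" by measurable
    show "AE \<xi> in lborel. norm (fourier p \<xi>) \<le> norm (F \<xi> + C * (1 / (\<xi>\<^sup>2 + 1)))"
    proof (rule AE_I2)
      fix \<xi> :: real
      let ?e = "a * \<bar>\<xi>\<bar> powr r" and ?c = "cmod (fourier p \<xi>)"
      have sq: "(exp y)\<^sup>2 = exp (2 * y)" for y :: real by (rule exp_double[symmetric])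
      have half: "u * v \<le> u\<^sup>2 + v\<^sup>2" if "0 \<le> u" "0 \<le> v" for u v :: real
        using sum_squares_bound[of u v] mult_nonneg_nonneg[OF that] by linarith
      have "?c = (?c * exp ?e) * exp (- ?e)" by (simp add: exp_minus)
      also have "\<dots> \<le> (?c * exp ?e)\<^sup>2 + (exp (- ?e))\<^sup>2" by (rule half) auto
      also have "(?c * exp ?e)\<^sup>2 = F \<xi>"
        unfolding F_def power_mult_distrib sq by (simp add: mult.assoc)
      also have "(exp (- ?e))\<^sup>2 = exp (- (2 * a * \<bar>\<xi>\<bar> powr r))"
        unfolding sq by (simp add: mult.assoc)
      finally show "norm (fourier p \<xi>) \<le> norm (F \<xi> + C * (1 / (\<xi>\<^sup>2 + 1)))"
        using C(2)[of \<xi>] by simp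
    qed
  qed
qed

text \<open>
  The fixed point equation gives \<open>\<gamma> - Im w = - t Im (G w)\<close>, an average of Poisson kernels at \<open>w\<close>, dominated by four times
  those at \<open>x + \<i> \<gamma>\<close>.
\<close>
lemma fixed_point_imaginary_part_integrable:
  fixes lam :: "nat \<Rightarrow> real" and n :: nat
  assumes t: "0 < t" and \<gamma>: "2 * sqrt t < \<gamma>"
  defines "G \<equiv> stieltjes n lam"
  shows "integrable lborel (\<lambda>x. \<gamma> - Im (w_fp t G (Complex x \<gamma>)))"
proof -
  have G: "stieltjes_like G" unfolding G_def by (rule stieltjes_like_stieltjes)
  note g = gamma_facts[OF t \<gamma> G]
  let ?b = "\<lambda>x. t * ((\<Sum>j<n. 4 * (\<gamma> / ((x - lam j)\<^sup>2 + \<gamma>\<^sup>2))) / real n)"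
  have b: "integrable lborel ?b"
    by (intro Bochner_Integration.integrable_mult_right Bochner_Integration.integrable_divide
        Bochner_Integration.integrable_sum cauchy_kernel_integrable(1)[OF g(1)])
  have bound: "\<bar>\<gamma> - Im (w_fp t G (Complex x \<gamma>))\<bar> \<le> ?b x" for x
  proof -
    define w where "w = w_fp t G (Complex x \<gamma>)"
    have z: "Im (Complex x \<gamma>) = \<gamma>" by simp
    have w1: "\<gamma> / 2 < Im w" and w2: "w = Complex x \<gamma> + t * G w"
      using w_fp_properties[OF t \<gamma> G z] by (simp_all add: w_def)
    have w0: "0 < Im w" using w1 g(1) by linarith
    have gn: "\<gamma> - Im w = t * ((\<Sum>j<n. Im w / (cmod (w - complex_of_real (lam j)))\<^sup>2) / real n)"
    proof -
      have "Im w = \<gamma> + t * Im (G w)" using arg_cong[OF w2, of Im] by simp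
      hence "\<gamma> - Im w = t * (- Im (G w))" by linarith
      thus ?thesis unfolding G_def Im_stieltjes .
    qed
    have nn: "0 \<le> t * ((\<Sum>j<n. Im w / (cmod (w - complex_of_real (lam j)))\<^sup>2) / real n)"
      using t w0 by (intro mult_nonneg_nonneg divide_nonneg_nonneg sum_nonneg) auto
    have wle: "Im w \<le> \<gamma>" using gn nn by linarith
    \<comment> \<open>\<open>w\<close> stays within \<open>Im w\<close> of \<open>x + \<i> \<gamma>\<close> because \<open>t < (\<gamma> / 2)\<^sup>2 < (Im w)\<^sup>2\<close>.\<close>
    have sh: "cmod (w - Complex x \<gamma>) \<le> 1 * Im w"
    proof -
      have "cmod (w - Complex x \<gamma>) = t * cmod (G w)"
        using arg_cong[OF w2, of "\<lambda>v. v - Complex x \<gamma>"] t by (simp add: norm_mult)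
      also have "\<dots> \<le> t * (1 / Im w)"
        using cmod_stieltjes_le[OF w0, of n lam] t by (intro mult_left_mono) (auto simp: G_def)
      also have "\<dots> \<le> Im w"
      proof -
        have "(\<gamma> / 2)\<^sup>2 \<le> (Im w)\<^sup>2" using w1 g(1) by (intro power_mono) auto
        hence "t \<le> Im w * Im w" using g(2) by (simp add: power2_eq_square)
        thus ?thesis using w0 by (simp add: pos_divide_le_eq)
      qed
      finally show ?thesis by simp
    qed
    have "Im w / (cmod (w - complex_of_real (lam j)))\<^sup>2 \<le> 4 * (\<gamma> / ((x - lam j)\<^sup>2 + \<gamma>\<^sup>2))" for j
    proof -
      have "1 / (cmod (w - complex_of_real (lam j)))\<^sup>2 \<le> (1 + 1)\<^sup>2 / (cmod (Complex x \<gamma> - complex_of_real (lam j)))\<^sup>2"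
        by (rule inverse_square_shift_le[OF sh w0]) (use g in simp)
      also have "(cmod (Complex x \<gamma> - complex_of_real (lam j)))\<^sup>2 = (x - lam j)\<^sup>2 + \<gamma>\<^sup>2"
        by (rule cmod_Complex_diff)
      finally have "Im w * (1 / (cmod (w - complex_of_real (lam j)))\<^sup>2) \<le> \<gamma> * (4 / ((x - lam j)\<^sup>2 + \<gamma>\<^sup>2))"
        using wle w0 g(1) by (intro mult_mono) auto
      thus ?thesis by (simp add: mult_ac)
    qed
    hence "t * ((\<Sum>j<n. Im w / (cmod (w - complex_of_real (lam j)))\<^sup>2) / real n) \<le> ?b x"
      using t by (intro mult_left_mono divide_right_mono sum_mono) auto
    thus ?thesis using nn unfolding w_def[symmetric] gn by linarith
  qed
  show ?thesis
  proof (rule Bochner_Integration.integrable_bound[OF b])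
    have "continuous_on UNIV (\<lambda>x. \<gamma> - Im (w_fp t G (Complex x \<gamma>)))"
      by (intro continuous_intros w_fp_continuous[OF t \<gamma> G])
    thus "(\<lambda>x. \<gamma> - Im (w_fp t G (Complex x \<gamma>))) \<in> borel_measurable lborel"
      by (simp add: borel_measurable_continuous_onI)
    show "AE x in lborel. norm (\<gamma> - Im (w_fp t G (Complex x \<gamma>))) \<le> norm (?b x)"
      by (rule AE_I2) (simp only: real_norm_def, rule order_trans[OF bound abs_ge_self])
  qed
qed

lemma Im_cauchy_transform:
  assumes p: "integrable lborel p" and \<gamma>: "0 < \<gamma>"
  shows "Im (cauchy_transform p (Complex x \<gamma>)) = - (\<integral>y. p y * (\<gamma> / ((x - y)\<^sup>2 + \<gamma>\<^sup>2)) \<partial>lborel)"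
proof -
  let ?f = "\<lambda>y. complex_of_real (p y) * (1 / (Complex x \<gamma> - complex_of_real y))"
  have i: "integrable lborel ?f"
  proof (rule integrable_mult_bounded)
    show "integrable lborel (\<lambda>y. complex_of_real (p y))" using p by simp
    show "(\<lambda>y. 1 / (Complex x \<gamma> - complex_of_real y)) \<in> borel_measurable lborel"
      by measurable
    show "cmod (1 / (Complex x \<gamma> - complex_of_real y)) \<le> 1 / \<gamma>" for y
      using cmod_cauchy_kernel_le[of "Complex x \<gamma>" y] \<gamma> by simp
  qed
  have f: "Im (?f y) = - (p y * (\<gamma> / ((x - y)\<^sup>2 + \<gamma>\<^sup>2)))" for y
    by (simp add: Im_divide)
  have "Im (cauchy_transform p (Complex x \<gamma>)) = (\<integral>y. Im (?f y) \<partial>lborel)"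
    unfolding cauchy_transform_def by (rule integral_Im[OF i, symmetric])
  thus ?thesis unfolding f by simp
qed

text \<open>
  Pointwise in the transform: for \<open>\<bar>\<xi>\<bar> \<le> 1 / h\<close> the error is \<open>exp (\<gamma> \<bar>\<xi>\<bar>) / (\<pi> t)\<close> times the transform of
  \<open>gn - t q\<close>, where \<open>q\<close> is the Poisson smoothing of \<open>p\<close>; for larger \<open>\<bar>\<xi>\<bar>\<close> it is, up to sign, the transform of \<open>p\<close> itself,
  which the weight controls. Plancherel's inequality is used once in each direction.
\<close>
lemma estimator_risk_bound:
  assumes t: "0 < t" and \<gamma>: "2 * sqrt t < \<gamma>" and a: "0 < a" and r: "0 < r"
    and p: "p \<in> supersmooth_densities a r L" and h: "0 < h"
    and Ks: "\<And>\<xi>. \<bar>\<xi>\<bar> \<le> 1 \<Longrightarrow> Ks \<xi> = 1" "\<And>\<xi>. 1 < \<bar>\<xi>\<bar> \<Longrightarrow> Ks \<xi> = 0"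
    and A: "empirical_stieltjes A = stieltjes n lam"
  shows "L2_dist_sq (estimator t \<gamma> Ks h A) p
    \<le> ennreal (L / (2 * pi) * exp (- (2 * a / h powr r)))
      + ennreal (exp (2 * \<gamma> / h) / (pi * t)\<^sup>2) *
        (\<integral>\<^sup>+x. ennreal ((cmod (w_fp t (stieltjes n lam) (Complex x \<gamma>)
             - (Complex x \<gamma> + complex_of_real t * cauchy_transform p (Complex x \<gamma>))))\<^sup>2) \<partial>lborel)"
proof -
  note P = supersmooth_densitiesD[OF p]
  note g = gamma_facts[OF t \<gamma> stieltjes_like_stieltjes]
  define w where "w = (\<lambda>x. w_fp t (stieltjes n lam) (Complex x \<gamma>))"
  define v where "v = (\<lambda>x. Complex x \<gamma> + complex_of_real t * cauchy_transform p (Complex x \<gamma>))"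
  define gn where "gn = (\<lambda>x. \<gamma> - Im (w x))"
  define q where "q = (\<lambda>x. \<integral>y. p y * (\<gamma> / ((x - y)\<^sup>2 + \<gamma>\<^sup>2)) \<partial>lborel)"
  define \<psi> where "\<psi> = estimator_fourier t \<gamma> Ks h A"
  have gn: "integrable lborel gn"
    unfolding gn_def w_def by (rule fixed_point_imaginary_part_integrable[OF t \<gamma>])
  note qi = fourier_poisson_smoothing[OF g(1) P(4), folded q_def]
  have tq: "integrable lborel (\<lambda>x. t * q x)" using qi(1) by simp
  have diff: "integrable lborel (\<lambda>x. gn x - t * q x)" using gn tq by simp
  have vq: "gn x - t * q x = Im (v x - w x)" for x
    by (simp add: gn_def v_def q_def Im_cauchy_transform[OF P(4) g(1)])
  have mult: "integrable lborel (\<lambda>x. complex_of_real (f x) * iexp (x * \<xi>))" if "integrable lborel f" for f :: "real \<Rightarrow> real" and \<xi>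
  proof -
    have "integrable lborel (\<lambda>x. complex_of_real (f x))" using that by simp
    thus ?thesis by (rule integrable_mult_iexp) simp
  qed
  have Fdiff: "fourier (\<lambda>x. gn x - t * q x) \<xi> = fourier gn \<xi> - complex_of_real t * fourier q \<xi>" for \<xi>
  proof -
    have "fourier (\<lambda>x. gn x - t * q x) \<xi> = (\<integral>x. complex_of_real (gn x) * iexp (x * \<xi>) - complex_of_real t * (complex_of_real (q x) * iexp (x * \<xi>)) \<partial>lborel)"
      unfolding fourier_def by (simp add: algebra_simps)
    also have "\<dots> = fourier gn \<xi> - (\<integral>x. complex_of_real t * (complex_of_real (q x) * iexp (x * \<xi>)) \<partial>lborel)"
      unfolding fourier_def
      by (rule Bochner_Integration.integral_diff[OF mult[OF gn] Bochner_Integration.integrable_mult_right[OF mult[OF qi(1)]]])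
    also have "(\<integral>x. complex_of_real t * (complex_of_real (q x) * iexp (x * \<xi>)) \<partial>lborel) = complex_of_real t * fourier q \<xi>"
      unfolding fourier_def by (rule Bochner_Integration.integral_mult_right_zero)
    finally show ?thesis .
  qed
  have \<psi>_eq: "\<psi> \<xi> = (if \<bar>\<xi>\<bar> \<le> 1 / h then complex_of_real (exp (\<gamma> * \<bar>\<xi>\<bar>) / (pi * t)) * fourier gn \<xi> else 0)" for \<xi>
  proof -
    have "\<bar>h * \<xi>\<bar> \<le> 1 \<longleftrightarrow> \<bar>\<xi>\<bar> \<le> 1 / h" using h by (simp add: abs_mult field_simps)
    thus ?thesis using Ks[of "h * \<xi>"]
      by (auto simp: \<psi>_def estimator_fourier_def A gn_def w_def not_le)
  qed
  have eb: "exp (\<gamma> * \<bar>\<xi>\<bar>) \<le> exp (\<gamma> / h)" if "\<bar>\<xi>\<bar> \<le> 1 / h" for \<xi>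
    using mult_left_mono[OF that, of \<gamma>] g(1) by simp
  have \<psi>i: "integrable lborel \<psi>"
  proof -
    define c where "c = exp (\<gamma> / h) / (pi * t) * (\<integral>x. \<bar>gn x\<bar> \<partial>lborel)"
    have b: "integrable lborel (\<lambda>\<xi>::real. c * indicator {- (1 / h)..1 / h} \<xi>)"
      by (intro Bochner_Integration.integrable_mult_right integrable_real_indicator)
         (auto simp: emeasure_lborel_Icc_eq)
    show ?thesis
    proof (rule Bochner_Integration.integrable_bound[OF b])
      note [measurable] = fourier_measurable[OF gn]
      show "\<psi> \<in> borel_measurable lborel" unfolding \<psi>_eq[abs_def] by measurable
      have "norm (\<psi> \<xi>) \<le> c * indicator {- (1 / h)..1 / h} \<xi>" for \<xi>
      proof (cases "\<bar>\<xi>\<bar> \<le> 1 / h")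
        case True
        have "norm (\<psi> \<xi>) = exp (\<gamma> * \<bar>\<xi>\<bar>) / (pi * t) * cmod (fourier gn \<xi>)"
          using True t unfolding \<psi>_eq by (simp add: norm_mult norm_divide)
        also have "\<dots> \<le> c" unfolding c_def
          using eb[OF True] t by (intro mult_mono divide_right_mono fourier_bounded[OF gn]) auto
        finally show ?thesis using True by (simp add: indicator_def abs_le_iff)
      next
        case False
        thus ?thesis unfolding \<psi>_eq by (auto simp: indicator_def)
      qed
      thus "AE \<xi> in lborel. norm (\<psi> \<xi>) \<le> norm (c * indicator {- (1 / h)..1 / h} \<xi>)"
        by (intro AE_I2) (simp only: real_norm_def, blast intro: order_trans abs_ge_self)
    qed
  qed
  define k where "k = exp (2 * \<gamma> / h) / (pi * t)\<^sup>2"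
  define F where "F = (\<lambda>\<xi>. (cmod (fourier p \<xi>))\<^sup>2 * exp (2 * a * \<bar>\<xi>\<bar> powr r))"
  define e where "e = exp (- (2 * a / h powr r))"
  have k0: "0 \<le> k" by (simp add: k_def)
  have pw: "(cmod (\<psi> \<xi> - fourier p \<xi>))\<^sup>2 \<le> k * (cmod (fourier (\<lambda>x. gn x - t * q x) \<xi>))\<^sup>2 + e * F \<xi>"
    if q\<xi>: "fourier q \<xi> = complex_of_real (pi * exp (- \<gamma> * \<bar>\<xi>\<bar>)) * fourier p \<xi>" for \<xi>
  proof (cases "\<bar>\<xi>\<bar> \<le> 1 / h")
    case True
    let ?x = "exp (\<gamma> * \<bar>\<xi>\<bar>) / (pi * t)"
    have "complex_of_real (?x * (t * (pi * exp (- \<gamma> * \<bar>\<xi>\<bar>)))) = 1"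
      using t by (simp add: exp_minus)
    hence "fourier p \<xi> = complex_of_real ?x * (complex_of_real t * fourier q \<xi>)"
      unfolding q\<xi> by (metis (no_types, lifting) mult.assoc mult_1 of_real_mult)
    hence "\<psi> \<xi> - fourier p \<xi> = complex_of_real ?x * fourier (\<lambda>x. gn x - t * q x) \<xi>"
      using True unfolding \<psi>_eq Fdiff by (simp only: if_True right_diff_distrib)
    hence "(cmod (\<psi> \<xi> - fourier p \<xi>))\<^sup>2 = ?x\<^sup>2 * (cmod (fourier (\<lambda>x. gn x - t * q x) \<xi>))\<^sup>2"
      by (simp only: norm_mult norm_of_real power_mult_distrib power2_abs)
    also have "\<dots> \<le> k * (cmod (fourier (\<lambda>x. gn x - t * q x) \<xi>))\<^sup>2"
    proof (rule mult_right_mono)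
      have "?x\<^sup>2 \<le> (exp (\<gamma> / h) / (pi * t))\<^sup>2" using eb[OF True] t by (intro power_mono divide_right_mono) auto
      also have "\<dots> = k" unfolding k_def power_divide exp_double[symmetric] by simp
      finally show "?x\<^sup>2 \<le> k" .
    qed simp
    also have "\<dots> \<le> k * (cmod (fourier (\<lambda>x. gn x - t * q x) \<xi>))\<^sup>2 + e * F \<xi>"
      by (simp add: e_def F_def)
    finally show ?thesis .
  next
    case False
    have "(1 / h) powr r \<le> \<bar>\<xi>\<bar> powr r" using False r h by (intro powr_mono2) auto
    hence "a * (1 / h powr r) \<le> a * \<bar>\<xi>\<bar> powr r" using a h by (intro mult_left_mono) (auto simp: powr_divide)
    hence "1 \<le> e * exp (2 * a * \<bar>\<xi>\<bar> powr r)" unfolding e_def exp_add[symmetric] by simp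
    hence "(cmod (fourier p \<xi>))\<^sup>2 * 1 \<le> (cmod (fourier p \<xi>))\<^sup>2 * (e * exp (2 * a * \<bar>\<xi>\<bar> powr r))"
      by (intro mult_left_mono) auto
    hence "(cmod (fourier p \<xi>))\<^sup>2 \<le> e * F \<xi>" by (simp add: F_def mult_ac)
    moreover have "0 \<le> k * (cmod (fourier (\<lambda>x. gn x - t * q x) \<xi>))\<^sup>2" using k0 by simp
    ultimately show ?thesis using False unfolding \<psi>_eq by simp
  qed
  note [measurable] = fourier_measurable[OF diff] fourier_measurable[OF P(4)]
  have Fm [measurable]: "F \<in> borel_measurable borel" unfolding F_def by measurable
  have "(\<integral>\<^sup>+\<xi>. ennreal ((cmod (\<psi> \<xi> - fourier p \<xi>))\<^sup>2) \<partial>lborel)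
     \<le> (\<integral>\<^sup>+\<xi>. ennreal k * ennreal ((cmod (fourier (\<lambda>x. gn x - t * q x) \<xi>))\<^sup>2) + ennreal e * ennreal (F \<xi>) \<partial>lborel)"
  proof (rule nn_integral_mono_AE)
    show "AE \<xi> in lborel. ennreal ((cmod (\<psi> \<xi> - fourier p \<xi>))\<^sup>2)
       \<le> ennreal k * ennreal ((cmod (fourier (\<lambda>x. gn x - t * q x) \<xi>))\<^sup>2) + ennreal e * ennreal (F \<xi>)"
      using qi(2)
    proof eventually_elim
      case (elim \<xi>)
      from ennreal_leI[OF pw[OF elim]] show ?case
        by (simp add: ennreal_plus ennreal_mult k0 F_def e_def)
    qed
  qed
  also have "\<dots> = ennreal k * (\<integral>\<^sup>+\<xi>. ennreal ((cmod (fourier (\<lambda>x. gn x - t * q x) \<xi>))\<^sup>2) \<partial>lborel)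
     + ennreal e * (\<integral>\<^sup>+\<xi>. ennreal (F \<xi>) \<partial>lborel)"
    by (simp add: nn_integral_add nn_integral_cmult)
  also have "\<dots> \<le> ennreal k * (ennreal (2 * pi) * (\<integral>\<^sup>+x. ennreal ((cmod (w x - v x))\<^sup>2) \<partial>lborel)) + ennreal e * ennreal L"
  proof (intro add_mono mult_left_mono)
    have "(\<integral>\<^sup>+\<xi>. ennreal ((cmod (fourier (\<lambda>x. gn x - t * q x) \<xi>))\<^sup>2) \<partial>lborel)
       \<le> ennreal (2 * pi) * (\<integral>\<^sup>+x. ennreal ((gn x - t * q x)\<^sup>2) \<partial>lborel)"
      by (rule fourier_plancherel_le[OF diff])
    also have "\<dots> \<le> ennreal (2 * pi) * (\<integral>\<^sup>+x. ennreal ((cmod (w x - v x))\<^sup>2) \<partial>lborel)"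
    proof (intro mult_left_mono nn_integral_mono ennreal_leI)
      fix x show "(gn x - t * q x)\<^sup>2 \<le> (cmod (w x - v x))\<^sup>2"
        unfolding vq by (subst norm_minus_commute) (simp add: cmod_power2)
    qed simp
    finally show "(\<integral>\<^sup>+\<xi>. ennreal ((cmod (fourier (\<lambda>x. gn x - t * q x) \<xi>))\<^sup>2) \<partial>lborel)
       \<le> ennreal (2 * pi) * (\<integral>\<^sup>+x. ennreal ((cmod (w x - v x))\<^sup>2) \<partial>lborel)" .
    show "(\<integral>\<^sup>+\<xi>. ennreal (F \<xi>) \<partial>lborel) \<le> ennreal L" unfolding F_def by (rule P(6))
  qed auto
  finally have main: "(\<integral>\<^sup>+\<xi>. ennreal ((cmod (\<psi> \<xi> - fourier p \<xi>))\<^sup>2) \<partial>lborel) / ennreal (2 * pi)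
    \<le> (ennreal k * (ennreal (2 * pi) * (\<integral>\<^sup>+x. ennreal ((cmod (w x - v x))\<^sup>2) \<partial>lborel)) + ennreal e * ennreal L) / ennreal (2 * pi)"
    by (rule divide_right_mono_ennreal)
  have "L2_dist_sq (estimator t \<gamma> Ks h A) p \<le> (\<integral>\<^sup>+\<xi>. ennreal ((cmod (\<psi> \<xi> - fourier p \<xi>))\<^sup>2) \<partial>lborel) / ennreal (2 * pi)"
    unfolding estimator_def \<psi>_def[symmetric]
    by (rule inverse_fourier_L2_bound[OF P(1-3) supersmooth_fourier_integrable[OF a r p] \<psi>i])
  also note main
  also have "(ennreal k * (ennreal (2 * pi) * (\<integral>\<^sup>+x. ennreal ((cmod (w x - v x))\<^sup>2) \<partial>lborel)) + ennreal e * ennreal L) / ennreal (2 * pi)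
     = ennreal k * (\<integral>\<^sup>+x. ennreal ((cmod (w x - v x))\<^sup>2) \<partial>lborel) + ennreal (L / (2 * pi) * e)"
  proof -
    have ab: "(ennreal k * (ennreal (2 * pi) * I)) / ennreal (2 * pi) = ennreal k * I" for I
    proof -
      have "ennreal k * (ennreal (2 * pi) * I) = (ennreal k * I) * ennreal (2 * pi)" by (simp add: mult_ac)
      thus ?thesis by (simp add: ennreal_mult_divide_eq)
    qed
    have L0: "ennreal e * ennreal L / ennreal (2 * pi) = ennreal (L / (2 * pi) * e)"
    proof (cases "0 \<le> L")
      case True
      thus ?thesis by (simp add: ennreal_mult[symmetric] divide_ennreal e_def mult_ac)
    next
      case False
      thus ?thesis by (simp add: ennreal_neg mult_nonpos_nonneg divide_nonpos_pos e_def)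
    qed
    show ?thesis unfolding add_divide_distrib_ennreal ab L0 by (rule refl)
  qed
  finally show ?thesis unfolding k_def e_def w_def v_def by (simp add: add.commute)
qed

lemma cauchy_transform_measurable:
  assumes [measurable]: "p \<in> borel_measurable borel"
  shows "(\<lambda>x. cauchy_transform p (Complex x \<gamma>)) \<in> borel_measurable borel"
proof -
  have [measurable]: "(\<lambda>q. Complex (fst q) \<gamma>) \<in> borel_measurable (borel \<Otimes>\<^sub>M lborel :: (real \<times> real) measure)"
    by (rule measurable_compose[OF measurable_fst Complex_measurable]) simp
  show ?thesis unfolding cauchy_transform_def
    by (intro lborel.borel_measurable_lebesgue_integral) (simp add: split_beta')
qed

context deformed_ensemble
begin

text \<open>
  Almost surely all the finitely many paths start at \<open>0\<close>.
\<close>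
lemma observed_matrix_AE:
  assumes s: "0 \<le> s"
  shows "AE \<omega> in M. mat_diag n (\<lambda>k. complex_of_real (D k \<omega>)) + hermitian_process n B B' s \<omega>
    = mat n n (\<lambda>(i, j). deformed s i j \<omega>)"
proof -
  have "AE \<omega> in M. \<forall>x\<in>entry_index n. entry_path x 0 \<omega> = 0"
    using entry_path_brownian
    by (intro AE_finite_allI finite_entry_index) (auto simp: brownian_motion_def)
  thus ?thesis
  proof eventually_elim
    case (elim \<omega>)
    have z: "k \<le> l \<Longrightarrow> l < n \<Longrightarrow> B k l 0 \<omega> = 0" "k < l \<Longrightarrow> l < n \<Longrightarrow> B' k l 0 \<omega> = 0" for k l
      using elim[rule_format, of "Inl (k, l)"] elim[rule_format, of "Inr (k, l)"]
      by (auto simp: entry_index_def entry_path_simps)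
    show ?case
      by (rule eq_matI)
         (auto simp: deformed_def herm_entry_def hermitian_process_def mat_diag_def entry_path_simps z complex_eq_iff
           Re_divide_of_real Im_divide_of_real simp del: of_real_divide)
  qed
qed

text \<open>
  The end point of the characteristic fails to solve the fixed point equation by exactly \<open>t\<close> times the deviation.
\<close>
lemma fixed_point_near_characteristic:
  assumes t: "0 < t" and \<gamma>: "2 * sqrt t < \<gamma>"
    and lam: "\<And>w. Im w \<noteq> 0 \<Longrightarrow> tr n (resolvent n (\<lambda>k l. deformed t k l \<omega>) w) / of_nat n = stieltjes n lam w"
    and z: "Im z = \<gamma>"
  shows "cmod (w_fp t (stieltjes n lam) z - characteristic t z \<omega>) \<le> t / (1 - 4 * t / \<gamma>\<^sup>2) * cmod (deviation t z \<omega>)"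
proof -
  note G = stieltjes_like_stieltjes[of n lam]
  note g = gamma_facts[OF t \<gamma> G]
  have c: "3 * \<gamma> / 4 \<le> Im (characteristic t z \<omega>)" by (rule characteristic_bounds[OF t \<gamma> z]) (use t in auto)
  hence c2: "\<gamma> / 2 \<le> Im (characteristic t z \<omega>)" and c0: "Im (characteristic t z \<omega>) \<noteq> 0" using g(1) by linarith+
  have "z + t * stieltjes n lam (characteristic t z \<omega>) - characteristic t z \<omega> = complex_of_real t * deviation t z \<omega>"
    unfolding deviation_def char_resolvent_def lam[OF c0] by (simp add: characteristic_def algebra_simps)
  hence "cmod (z + t * stieltjes n lam (characteristic t z \<omega>) - characteristic t z \<omega>) = t * cmod (deviation t z \<omega>)"
    using t by (simp add: norm_mult)
  thus ?thesis using w_fp_stability[OF t \<gamma> G z c2] by simp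
qed

lemma observed_deviation_le:
  assumes t: "0 < t" and \<gamma>: "2 * sqrt t < \<gamma>"
    and lam: "\<And>w. Im w \<noteq> 0 \<Longrightarrow> tr n (resolvent n (\<lambda>k l. deformed t k l \<omega>) w) / of_nat n = stieltjes n lam w"
    and z: "Im z = \<gamma>"
  shows "(cmod (w_fp t (stieltjes n lam) z - (z + complex_of_real t * g0)))\<^sup>2
    \<le> 2 * (t / (1 - 4 * t / \<gamma>\<^sup>2))\<^sup>2 * (cmod (deviation t z \<omega>))\<^sup>2 + 2 * t\<^sup>2 * (cmod (initial_stieltjes z \<omega> - g0))\<^sup>2"
proof -
  let ?c = "t / (1 - 4 * t / \<gamma>\<^sup>2)"
  have "w_fp t (stieltjes n lam) z - (z + complex_of_real t * g0)
     = (w_fp t (stieltjes n lam) z - characteristic t z \<omega>) + complex_of_real t * (initial_stieltjes z \<omega> - g0)"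
    by (simp add: characteristic_def algebra_simps)
  hence "cmod (w_fp t (stieltjes n lam) z - (z + complex_of_real t * g0))
     \<le> cmod (w_fp t (stieltjes n lam) z - characteristic t z \<omega>) + cmod (complex_of_real t * (initial_stieltjes z \<omega> - g0))"
    by (simp only: norm_triangle_ineq)
  also have "\<dots> \<le> ?c * cmod (deviation t z \<omega>) + t * cmod (initial_stieltjes z \<omega> - g0)"
    using fixed_point_near_characteristic[OF t \<gamma> lam z] t by (simp add: norm_mult)
  finally have "(cmod (w_fp t (stieltjes n lam) z - (z + complex_of_real t * g0)))\<^sup>2
     \<le> (?c * cmod (deviation t z \<omega>) + t * cmod (initial_stieltjes z \<omega> - g0))\<^sup>2"
    by (rule power_mono) simp
  also have "\<dots> \<le> 2 * (?c * cmod (deviation t z \<omega>))\<^sup>2 + 2 * (t * cmod (initial_stieltjes z \<omega> - g0))\<^sup>2"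
    using sum_squares_bound[of "?c * cmod (deviation t z \<omega>)" "t * cmod (initial_stieltjes z \<omega> - g0)"]
    by (simp only: power2_sum)
  finally show ?thesis by (simp only: power_mult_distrib mult.assoc)
qed

text \<open>
  The fluctuation of the sample enters as an assumption: \<open>D\<close> will be the sorted sample, whose entries are
  no longer independent, while the Stieltjes transform does not see the order.
\<close>
lemma expected_risk_bound:
  assumes t: "0 < t" and \<gamma>: "2 * sqrt t < \<gamma>" and a: "0 < a" and r: "0 < r"
    and p: "p \<in> supersmooth_densities a r L" and h: "0 < h"
    and Ks: "\<And>\<xi>. \<bar>\<xi>\<bar> \<le> 1 \<Longrightarrow> Ks \<xi> = 1" "\<And>\<xi>. 1 < \<bar>\<xi>\<bar> \<Longrightarrow> Ks \<xi> = 0"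
    and X: "\<And>\<omega>. X \<omega> = mat_diag n (\<lambda>k. complex_of_real (D k \<omega>)) + hermitian_process n B B' t \<omega>"
    and init: "(\<integral>\<^sup>+x. (\<integral>\<^sup>+\<omega>. ennreal ((cmod (initial_stieltjes (Complex x \<gamma>) \<omega> - cauchy_transform p (Complex x \<gamma>)))\<^sup>2) \<partial>M) \<partial>lborel)
       \<le> ennreal (v / real n)" and v: "0 \<le> v" and L0: "0 \<le> L"
  shows "(\<integral>\<^sup>+\<omega>. L2_dist_sq (estimator t \<gamma> Ks h (X \<omega>)) p \<partial>M)
    \<le> ennreal (L / (2 * pi) * exp (- (2 * a / h powr r))
       + (2 * (t / (1 - 4 * t / \<gamma>\<^sup>2))\<^sup>2 * deviation_const t \<gamma> + 2 * t\<^sup>2 * v) / (pi * t)\<^sup>2 * (exp (2 * \<gamma> / h) / real n))"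
proof -
  note P = supersmooth_densitiesD[OF p]
  note g = gamma_facts[OF t \<gamma> stieltjes_like_stieltjes]
  interpret L: pair_sigma_finite lborel M ..
  define b where "b = L / (2 * pi) * exp (- (2 * a / h powr r))"
  define k where "k = exp (2 * \<gamma> / h) / (pi * t)\<^sup>2"
  define c1 where "c1 = 2 * (t / (1 - 4 * t / \<gamma>\<^sup>2))\<^sup>2"
  define c2 where "c2 = 2 * t\<^sup>2"
  define f1 where "f1 = (\<lambda>q. ennreal ((cmod (deviation t (Complex (fst q) \<gamma>) (snd q)))\<^sup>2))"
  define f2 where "f2 = (\<lambda>q. ennreal ((cmod (initial_stieltjes (Complex (fst q) \<gamma>) (snd q) - cauchy_transform p (Complex (fst q) \<gamma>)))\<^sup>2))"
  have c0: "0 \<le> c1" "0 \<le> c2" "0 \<le> k" by (simp_all add: c1_def c2_def k_def)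
  have v0: "0 \<le> deviation_const t \<gamma>" unfolding deviation_const_def using t g(1) by simp
  have m1 [measurable]: "f1 \<in> borel_measurable (lborel \<Otimes>\<^sub>M M)"
    unfolding f1_def using joint_measurable(3)[OF less_imp_le[OF t], of \<gamma>] by measurable
  have m2 [measurable]: "f2 \<in> borel_measurable (lborel \<Otimes>\<^sub>M M)"
    unfolding f2_def using joint_measurable(1)[OF less_imp_le[OF t], of \<gamma>]
      measurable_compose[OF measurable_fst cauchy_transform_measurable[OF P(1), of \<gamma>, folded measurable_lborel2]]
    by measurable
  have i1: "(\<integral>\<^sup>+\<omega>. (\<integral>\<^sup>+x. f1 (x, \<omega>) \<partial>lborel) \<partial>M) \<le> ennreal (deviation_const t \<gamma> / real n)"
    using deviation_mean_square_integral[OF t \<gamma>] L.Fubini[OF m1] unfolding f1_def by simp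
  have i2: "(\<integral>\<^sup>+\<omega>. (\<integral>\<^sup>+x. f2 (x, \<omega>) \<partial>lborel) \<partial>M) \<le> ennreal (v / real n)"
    using init L.Fubini[OF m2] unfolding f2_def by simp
  have "(\<integral>\<^sup>+\<omega>. L2_dist_sq (estimator t \<gamma> Ks h (X \<omega>)) p \<partial>M)
     \<le> (\<integral>\<^sup>+\<omega>. ennreal b + ennreal k * (ennreal c1 * (\<integral>\<^sup>+x. f1 (x, \<omega>) \<partial>lborel) + ennreal c2 * (\<integral>\<^sup>+x. f2 (x, \<omega>) \<partial>lborel)) \<partial>M)"
  proof (rule nn_integral_mono_AE)
    show "AE \<omega> in M. L2_dist_sq (estimator t \<gamma> Ks h (X \<omega>)) p
       \<le> ennreal b + ennreal k * (ennreal c1 * (\<integral>\<^sup>+x. f1 (x, \<omega>) \<partial>lborel) + ennreal c2 * (\<integral>\<^sup>+x. f2 (x, \<omega>) \<partial>lborel))"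
      using observed_matrix_AE[OF less_imp_le[OF t]] AE_space
    proof eventually_elim
      case (elim \<omega>)
      obtain lam where lam: "\<And>w. empirical_stieltjes (mat n n (\<lambda>(i, j). deformed t i j \<omega>)) w = stieltjes n lam w"
        "\<And>w. Im w \<noteq> 0 \<Longrightarrow> tr n (resolvent n (\<lambda>k l. deformed t k l \<omega>) w) / of_nat n = stieltjes n lam w"
        by (rule hermitian_eigenvalues[OF hermitian_deformed[of t \<omega>]]) blast
      have A: "empirical_stieltjes (X \<omega>) = stieltjes n lam"
        unfolding X elim(1) using lam(1) by (rule ext)
      have s1: "(\<lambda>x. f1 (x, \<omega>)) \<in> borel_measurable lborel" "(\<lambda>x. f2 (x, \<omega>)) \<in> borel_measurable lborel"
        using measurable_compose[OF measurable_Pair2'[OF elim(2)] m1] measurable_compose[OF measurable_Pair2'[OF elim(2)] m2] by auto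
      have "L2_dist_sq (estimator t \<gamma> Ks h (X \<omega>)) p
        \<le> ennreal b + ennreal k * (\<integral>\<^sup>+x. ennreal ((cmod (w_fp t (stieltjes n lam) (Complex x \<gamma>)
             - (Complex x \<gamma> + complex_of_real t * cauchy_transform p (Complex x \<gamma>))))\<^sup>2) \<partial>lborel)"
        unfolding b_def k_def by (rule estimator_risk_bound[OF t \<gamma> a r p h Ks A])
      also have "\<dots> \<le> ennreal b + ennreal k * (\<integral>\<^sup>+x. ennreal c1 * f1 (x, \<omega>) + ennreal c2 * f2 (x, \<omega>) \<partial>lborel)"
      proof (intro add_left_mono mult_left_mono nn_integral_mono)
        fix x
        have "ennreal ((cmod (w_fp t (stieltjes n lam) (Complex x \<gamma>)
             - (Complex x \<gamma> + complex_of_real t * cauchy_transform p (Complex x \<gamma>))))\<^sup>2)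
          \<le> ennreal (c1 * (cmod (deviation t (Complex x \<gamma>) \<omega>))\<^sup>2 + c2 * (cmod (initial_stieltjes (Complex x \<gamma>) \<omega> - cauchy_transform p (Complex x \<gamma>)))\<^sup>2)"
          unfolding c1_def c2_def
          by (rule ennreal_leI[OF observed_deviation_le[OF t \<gamma> lam(2)]]) auto
        also have "\<dots> = ennreal c1 * f1 (x, \<omega>) + ennreal c2 * f2 (x, \<omega>)"
          by (simp add: ennreal_plus ennreal_mult c0 f1_def f2_def)
        finally show "ennreal ((cmod (w_fp t (stieltjes n lam) (Complex x \<gamma>)
             - (Complex x \<gamma> + complex_of_real t * cauchy_transform p (Complex x \<gamma>))))\<^sup>2)
          \<le> ennreal c1 * f1 (x, \<omega>) + ennreal c2 * f2 (x, \<omega>)" .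
      qed simp
      also have "(\<integral>\<^sup>+x. ennreal c1 * f1 (x, \<omega>) + ennreal c2 * f2 (x, \<omega>) \<partial>lborel)
         = ennreal c1 * (\<integral>\<^sup>+x. f1 (x, \<omega>) \<partial>lborel) + ennreal c2 * (\<integral>\<^sup>+x. f2 (x, \<omega>) \<partial>lborel)"
        using s1 by (simp add: nn_integral_add nn_integral_cmult)
      finally show ?case .
    qed
  qed
  also have "\<dots> = ennreal b + ennreal k * (ennreal c1 * (\<integral>\<^sup>+\<omega>. (\<integral>\<^sup>+x. f1 (x, \<omega>) \<partial>lborel) \<partial>M) + ennreal c2 * (\<integral>\<^sup>+\<omega>. (\<integral>\<^sup>+x. f2 (x, \<omega>) \<partial>lborel) \<partial>M))"
  proof -
    have sm: "(\<lambda>\<omega>. \<integral>\<^sup>+x. f1 (x, \<omega>) \<partial>lborel) \<in> borel_measurable M" "(\<lambda>\<omega>. \<integral>\<^sup>+x. f2 (x, \<omega>) \<partial>lborel) \<in> borel_measurable M"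
      by measurable
    thus ?thesis by (simp add: nn_integral_add nn_integral_cmult emeasure_space_1)
  qed
  also have "\<dots> \<le> ennreal b + ennreal k * (ennreal c1 * ennreal (deviation_const t \<gamma> / real n) + ennreal c2 * ennreal (v / real n))"
    by (intro add_left_mono mult_left_mono add_mono i1 i2) auto
  also have "\<dots> = ennreal (b + k * (c1 * (deviation_const t \<gamma> / real n) + c2 * (v / real n)))"
  proof -
    have b0: "0 \<le> b" using L0 by (simp add: b_def)
    have n0: "0 \<le> deviation_const t \<gamma> / real n" "0 \<le> v / real n" using v0 v by simp_all
    show ?thesis
      by (simp only: ennreal_plus ennreal_mult c0 b0 n0 mult_nonneg_nonneg add_nonneg_nonneg)
  qed
  also have "b + k * (c1 * (deviation_const t \<gamma> / real n) + c2 * (v / real n))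
     = b + (c1 * deviation_const t \<gamma> + c2 * v) / (pi * t)\<^sup>2 * (exp (2 * \<gamma> / h) / real n)"
    by (simp add: k_def add_divide_distrib ring_distribs mult_ac)
  finally show ?thesis unfolding b_def c1_def c2_def .
qed

end

section \<open>Rates of convergence\<close>

lemma bandwidth_expansion_sequence:
  fixes c \<rho> s :: real and b :: "nat \<Rightarrow> real" and k :: nat and E :: "nat \<Rightarrow> real"
  assumes \<rho>: "0 < \<rho>" "\<rho> < 1" and k: "\<rho> \<le> real (k + 1) / real (k + 2)"
    and sys: "triangular_system c \<rho> b"
    and E: "\<And>n. E n = ln (real n) + s * ln (ln (real n))
       + (\<Sum>i=0..k. b i * ln (real n) powr (\<rho> + real i * (\<rho> - 1)))"
  obtains K where "\<forall>\<^sub>F n in sequentially. 1 \<le> E n \<and> 1 \<le> n \<and>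
     \<bar>E n + c * E n powr \<rho> - s * ln (E n) - ln (real n)\<bar> \<le> K"
proof -
  define F where "F = (\<lambda>l::real. l + s * ln l + (\<Sum>i\<le>k. b i * l powr (\<rho> + real i * (\<rho> - 1))))"
  have as: "((\<lambda>l. F l / l) \<longlongrightarrow> 1) at_top"
    "(\<lambda>l. F l + c * F l powr \<rho> - s * ln (F l) - l) \<in> O[at_top](\<lambda>_. 1)"
    unfolding F_def by (rule bandwidth_expansion_asymptotics[OF \<rho> k sys])+
  have EF: "E n = F (ln (real n))" for n by (simp add: E F_def atMost_atLeast0)
  have ln: "filterlim (\<lambda>n. ln (real n)) at_top sequentially" by real_asymp
  obtain K where K: "\<forall>\<^sub>F l in at_top. norm (F l + c * F l powr \<rho> - s * ln (F l) - l) \<le> K * norm (1::real)"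
    by (rule landau_o.bigE[OF as(2)]) blast
  have "\<forall>\<^sub>F l in at_top. 1 / 2 < F l / l" using as(1) by (rule order_tendstoD) simp
  with eventually_ge_at_top[of 2] have "\<forall>\<^sub>F l in at_top. 1 \<le> F l"
  proof eventually_elim
    case (elim l)
    hence "l / 2 < F l" by (simp add: field_simps)
    thus ?case using elim by linarith
  qed
  with K have "\<forall>\<^sub>F l in at_top. 1 \<le> F l \<and> \<bar>F l + c * F l powr \<rho> - s * ln (F l) - l\<bar> \<le> K"
    by eventually_elim simp
  hence "\<forall>\<^sub>F n in sequentially. 1 \<le> E n \<and> \<bar>E n + c * E n powr \<rho> - s * ln (E n) - ln (real n)\<bar> \<le> K"
    unfolding EF using ln by (rule eventually_compose_filterlim)
  with eventually_ge_at_top[of "1::nat"] have "\<forall>\<^sub>F n in sequentially. 1 \<le> E n \<and> 1 \<le> n \<and>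
     \<bar>E n + c * E n powr \<rho> - s * ln (E n) - ln (real n)\<bar> \<le> K"
    by eventually_elim simp
  thus thesis by (rule that)
qed

text \<open>
  For this bandwidth both terms of the risk bound are equal to the rate.
\<close>
lemma rates_r_eq_1:
  fixes a \<gamma> :: real and h :: "nat \<Rightarrow> real"
  assumes a: "0 < a" and \<gamma>: "0 < \<gamma>"
    and h: "\<forall>\<^sub>F n in sequentially. h n = 2 * (a + \<gamma>) / ln (real n)"
  shows "(\<lambda>n. exp (2 * \<gamma> / h n + 2 * a / h n powr 1) * h n powr (1 - 1)) \<in> O(\<lambda>n. real n)"
    and "(\<lambda>n. exp (- (2 * a / h n powr 1))) \<in> O(\<lambda>n. real n powr (- (a / (a + \<gamma>))))"
    and "(\<lambda>n. exp (2 * \<gamma> / h n) / real n) \<in> O(\<lambda>n. real n powr (- (a / (a + \<gamma>))))"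
proof -
  have *: "\<forall>\<^sub>F n in sequentially. exp (2 * \<gamma> / h n + 2 * a / h n powr 1) * h n powr (1 - 1) = real n \<and>
     exp (- (2 * a / h n powr 1)) = real n powr (- (a / (a + \<gamma>))) \<and>
     exp (2 * \<gamma> / h n) / real n = real n powr (- (a / (a + \<gamma>)))"
    using h eventually_ge_at_top[of "2::nat"]
  proof eventually_elim
    case (elim n)
    have l: "0 < ln (real n)" using elim by simp
    have hp: "0 < h n" using elim(1) l a \<gamma> by simp
    have e1: "2 * a / h n = a / (a + \<gamma>) * ln (real n)" "2 * \<gamma> / h n = \<gamma> / (a + \<gamma>) * ln (real n)"
      unfolding elim(1) using l a \<gamma> by (simp_all add: field_simps)
    have q: "\<gamma> / (a + \<gamma>) = 1 - a / (a + \<gamma>)" using a \<gamma> by (simp add: field_simps)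
    have "exp (2 * \<gamma> / h n + 2 * a / h n) = real n"
      unfolding e1 q using elim by (simp add: algebra_simps)
    moreover have "exp (- (2 * a / h n)) = real n powr (- (a / (a + \<gamma>)))"
      unfolding e1 using elim by (simp add: powr_def)
    moreover have "exp (2 * \<gamma> / h n) / real n = real n powr (- (a / (a + \<gamma>)))"
    proof -
      have "exp (2 * \<gamma> / h n) = exp (ln (real n) - a / (a + \<gamma>) * ln (real n))"
        unfolding e1 q by (simp add: algebra_simps)
      also have "\<dots> = real n * real n powr (- (a / (a + \<gamma>)))"
        unfolding exp_diff using elim by (simp add: powr_def exp_minus field_simps)
      finally show ?thesis using elim by simp
    qed
    ultimately show ?case using hp by simp
  qed
  show "(\<lambda>n. exp (2 * \<gamma> / h n + 2 * a / h n powr 1) * h n powr (1 - 1)) \<in> O(\<lambda>n. real n)"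
    by (rule bigoI[of _ 1]) (rule eventually_mono[OF *], simp)
  show "(\<lambda>n. exp (- (2 * a / h n powr 1))) \<in> O(\<lambda>n. real n powr (- (a / (a + \<gamma>))))"
    by (rule bigoI[of _ 1]) (rule eventually_mono[OF *], simp)
  show "(\<lambda>n. exp (2 * \<gamma> / h n) / real n) \<in> O(\<lambda>n. real n powr (- (a / (a + \<gamma>))))"
    by (rule bigoI[of _ 1]) (rule eventually_mono[OF *], simp)
qed

text \<open>
  With \<open>h = 2 \<gamma> / E\<close> the tail term is the rate itself. The variance term exceeds it by the factor
  \<open>exp (E + c E powr r) / n\<close>, which is of order \<open>E powr (r - 1)\<close> and hence bounded.
\<close>
lemma rates_r_less_1:
  fixes a \<gamma> r :: real and h :: "nat \<Rightarrow> real"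
  assumes a: "0 < a" and \<gamma>: "0 < \<gamma>" and r: "0 < r" "r < 1" and k: "r \<le> real (k + 1) / real (k + 2)"
    and sys: "triangular_system (2 * a / (2 * \<gamma>) powr r) r bs"
    and h: "\<forall>\<^sub>F n in sequentially. h n = 2 * \<gamma> / expansion_lt1 r k bs n"
  defines "rate \<equiv> \<lambda>n. exp (- (2 * a / (2 * \<gamma>) powr r * expansion_lt1 r k bs n powr r))"
  shows "(\<lambda>n. exp (2 * \<gamma> / h n + 2 * a / h n powr r) * h n powr (r - 1)) \<in> O(\<lambda>n. real n)"
    and "(\<lambda>n. exp (- (2 * a / h n powr r))) \<in> O(rate)"
    and "(\<lambda>n. exp (2 * \<gamma> / h n) / real n) \<in> O(rate)"
proof -
  define E where "E = expansion_lt1 r k bs"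
  define c where "c = 2 * a / (2 * \<gamma>) powr r"
  obtain K where K: "\<forall>\<^sub>F n in sequentially. 1 \<le> E n \<and> 1 \<le> n \<and>
     \<bar>E n + c * E n powr r - (r - 1) * ln (E n) - ln (real n)\<bar> \<le> K"
    by (rule bandwidth_expansion_sequence[OF r k sys, of E "r - 1"]) (auto simp: E_def expansion_lt1_def c_def)
  have *: "\<forall>\<^sub>F n in sequentially.
      exp (2 * \<gamma> / h n + 2 * a / h n powr r) * h n powr (r - 1) \<le> exp K * (2 * \<gamma>) powr (r - 1) * real n \<and>
      exp (- (2 * a / h n powr r)) = rate n \<and>
      exp (2 * \<gamma> / h n) / real n \<le> exp K * rate n"
    using h K
  proof eventually_elim
    case (elim n)
    hence E1: "1 \<le> E n" and n: "1 \<le> n" and hE: "h n = 2 * \<gamma> / E n"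
      and d: "E n + c * E n powr r - (r - 1) * ln (E n) \<le> ln (real n) + K" by (auto simp: E_def)
    have e1: "2 * \<gamma> / h n = E n" using E1 \<gamma> by (simp add: hE)
    have e2: "2 * a / h n powr r = c * E n powr r"
      unfolding hE c_def using E1 \<gamma> by (simp add: powr_divide)
    have e3: "h n powr (r - 1) = (2 * \<gamma>) powr (r - 1) * exp (- ((r - 1) * ln (E n)))"
      unfolding hE using E1 \<gamma> by (simp add: powr_divide) (simp add: powr_def exp_minus divide_inverse)
    have rate: "rate n = exp (- (c * E n powr r))" by (simp add: rate_def c_def E_def)
    have "exp (E n + c * E n powr r) * exp (- ((r - 1) * ln (E n))) = exp (E n + c * E n powr r - (r - 1) * ln (E n))"
      by (simp add: exp_add[symmetric])
    also have "\<dots> \<le> exp (ln (real n) + K)" using d by simp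
    also have "\<dots> = real n * exp K" using n by (simp add: exp_add)
    finally have 1: "exp (E n + c * E n powr r) * exp (- ((r - 1) * ln (E n))) \<le> real n * exp K" .
    have "0 \<le> (1 - r) * ln (E n)" using r E1 by simp
    hence "E n \<le> ln (real n) + (K - c * E n powr r)" using d by (simp add: algebra_simps)
    hence "exp (E n) \<le> exp (ln (real n) + (K - c * E n powr r))" by simp
    also have "\<dots> = real n * (exp K * rate n)" using n unfolding rate by (simp add: exp_add exp_diff exp_minus divide_inverse)
    finally have 2: "exp (E n) / real n \<le> exp K * rate n" using n by (simp add: pos_divide_le_eq mult.commute)
    have "exp (E n + c * E n powr r) * h n powr (r - 1) = (2 * \<gamma>) powr (r - 1) * (exp (E n + c * E n powr r) * exp (- ((r - 1) * ln (E n))))"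
      unfolding e3 by (simp only: mult.left_commute)
    also have "\<dots> \<le> (2 * \<gamma>) powr (r - 1) * (real n * exp K)" by (rule mult_left_mono[OF 1]) simp
    finally show ?case unfolding e1 e2 rate using 2 by (simp add: mult_ac rate)
  qed
  have r0: "0 \<le> rate n" for n by (simp add: rate_def)
  show "(\<lambda>n. exp (2 * \<gamma> / h n + 2 * a / h n powr r) * h n powr (r - 1)) \<in> O(\<lambda>n. real n)"
    by (rule bigoI[of _ "exp K * (2 * \<gamma>) powr (r - 1)"]) (rule eventually_mono[OF *], simp)
  show "(\<lambda>n. exp (- (2 * a / h n powr r))) \<in> O(rate)"
    by (rule bigoI[of _ 1]) (rule eventually_mono[OF *], simp)
  show "(\<lambda>n. exp (2 * \<gamma> / h n) / real n) \<in> O(rate)"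
    by (rule bigoI[of _ "exp K"]) (rule eventually_mono[OF *], simp add: r0)
qed

text \<open>
  With \<open>h powr r = 2 a / E\<close> the roles are exchanged: the variance term is the rate itself, and the tail
  term \<open>exp (- E)\<close> is smaller by a power of \<open>E\<close>.
\<close>
lemma rates_r_greater_1:
  fixes a \<gamma> r :: real and h :: "nat \<Rightarrow> real"
  assumes a: "0 < a" and \<gamma>: "0 < \<gamma>" and r: "1 < r" and k: "1 / r \<le> real (k + 1) / real (k + 2)"
    and sys: "triangular_system (2 * \<gamma> / (2 * a) powr (1 / r)) (1 / r) ds"
    and pos: "\<forall>\<^sub>F n in sequentially. h n > 0"
    and h: "\<forall>\<^sub>F n in sequentially. h n powr r = 2 * a / expansion_gt1 r k ds n"
  defines "rate \<equiv> \<lambda>n. 1 / real n * exp (2 * \<gamma> / (2 * a) powr (1 / r) * expansion_gt1 r k ds n powr (1 / r))"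
  shows "(\<lambda>n. exp (2 * \<gamma> / h n + 2 * a / h n powr r) * h n powr (r - 1)) \<in> O(\<lambda>n. real n)"
    and "(\<lambda>n. exp (- (2 * a / h n powr r))) \<in> O(rate)"
    and "(\<lambda>n. exp (2 * \<gamma> / h n) / real n) \<in> O(rate)"
proof -
  define E where "E = expansion_gt1 r k ds"
  define c where "c = 2 * \<gamma> / (2 * a) powr (1 / r)"
  define s where "s = (r - 1) / r"
  have \<rho>: "0 < 1 / r" "1 / r < 1" using r by auto
  have ex: "1 / r - real i * ((r - 1) / r) = 1 / r + real i * (1 / r - 1)" for i
    using r by (simp add: field_simps)
  have E_eq: "E n = ln (real n) + s * ln (ln (real n))
       + (\<Sum>i=0..k. ds i * ln (real n) powr (1 / r + real i * (1 / r - 1)))" for n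
    unfolding E_def expansion_gt1_def s_def ex by (rule refl)
  obtain K where K: "\<forall>\<^sub>F n in sequentially. 1 \<le> E n \<and> 1 \<le> n \<and>
     \<bar>E n + c * E n powr (1 / r) - s * ln (E n) - ln (real n)\<bar> \<le> K"
    by (rule bandwidth_expansion_sequence[OF \<rho> k sys E_eq, folded c_def]) blast
  have *: "\<forall>\<^sub>F n in sequentially.
      exp (2 * \<gamma> / h n + 2 * a / h n powr r) * h n powr (r - 1) \<le> exp K * (2 * a) powr s * real n \<and>
      exp (- (2 * a / h n powr r)) \<le> exp K * rate n \<and>
      exp (2 * \<gamma> / h n) / real n = rate n"
    using h K pos
  proof eventually_elim
    case (elim n)
    hence E1: "1 \<le> E n" and n: "1 \<le> n" and hr: "h n powr r = 2 * a / E n" and hp: "0 < h n"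
      and d: "E n + c * E n powr (1 / r) - s * ln (E n) \<le> ln (real n) + K"
      and d': "ln (real n) - K \<le> E n + c * E n powr (1 / r) - s * ln (E n)" by (auto simp: E_def)
    \<comment> \<open>The equation determines \<open>h\<close> itself only through its positivity.\<close>
    have "h n = (h n powr r) powr (1 / r)" using hp r by (simp add: powr_powr)
    hence hE: "h n = (2 * a / E n) powr (1 / r)" unfolding hr .
    have e1: "2 * \<gamma> / h n = c * E n powr (1 / r)"
      unfolding hE c_def using E1 a by (simp add: powr_divide)
    have e2: "2 * a / h n powr r = E n" unfolding hr using E1 a by simp
    have "h n powr (r - 1) = (2 * a / E n) powr s" unfolding hE powr_powr s_def by simp
    also have "\<dots> = (2 * a) powr s * exp (- (s * ln (E n)))"
      using E1 a by (simp add: powr_divide) (simp add: powr_def exp_minus divide_inverse)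
    finally have e3: "h n powr (r - 1) = (2 * a) powr s * exp (- (s * ln (E n)))" .
    have rate: "rate n = 1 / real n * exp (c * E n powr (1 / r))" by (simp add: rate_def c_def E_def)
    have "exp (c * E n powr (1 / r) + E n) * exp (- (s * ln (E n))) = exp (E n + c * E n powr (1 / r) - s * ln (E n))"
      by (simp add: exp_add[symmetric])
    also have "\<dots> \<le> exp (ln (real n) + K)" using d by simp
    also have "\<dots> = real n * exp K" using n by (simp add: exp_add)
    finally have 1: "exp (c * E n powr (1 / r) + E n) * exp (- (s * ln (E n))) \<le> real n * exp K" .
    have "0 \<le> s * ln (E n)" using r E1 by (simp add: s_def)
    hence "- E n \<le> K + c * E n powr (1 / r) - ln (real n)" using d' by linarith
    hence "exp (- E n) \<le> exp (K + c * E n powr (1 / r) - ln (real n))" by simp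
    also have "\<dots> = exp K * rate n" using n unfolding rate by (simp add: exp_add exp_diff)
    finally have 2: "exp (- E n) \<le> exp K * rate n" .
    have "exp (c * E n powr (1 / r) + E n) * h n powr (r - 1) = (2 * a) powr s * (exp (c * E n powr (1 / r) + E n) * exp (- (s * ln (E n))))"
      unfolding e3 by (simp only: mult.left_commute)
    also have "\<dots> \<le> (2 * a) powr s * (real n * exp K)" by (rule mult_left_mono[OF 1]) simp
    finally show ?case unfolding e1 e2 using 2 by (simp add: mult_ac rate)
  qed
  have r0: "0 \<le> rate n" for n by (simp add: rate_def)
  show "(\<lambda>n. exp (2 * \<gamma> / h n + 2 * a / h n powr r) * h n powr (r - 1)) \<in> O(\<lambda>n. real n)"
    by (rule bigoI[of _ "exp K * (2 * a) powr s"]) (rule eventually_mono[OF *], simp)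
  show "(\<lambda>n. exp (- (2 * a / h n powr r))) \<in> O(rate)"
    by (rule bigoI[of _ "exp K"]) (rule eventually_mono[OF *], simp add: r0)
  show "(\<lambda>n. exp (2 * \<gamma> / h n) / real n) \<in> O(rate)"
    by (rule bigoI[of _ 1]) (rule eventually_mono[OF *], simp add: r0)
qed

lemma enn2real_bigo:
  fixes x :: "nat \<Rightarrow> ennreal" and u v rate :: "nat \<Rightarrow> real"
  assumes bound: "\<forall>\<^sub>F n in sequentially. x n \<le> ennreal (\<alpha> * u n + \<beta> * v n)"
    and nonneg: "0 \<le> \<alpha>" "0 \<le> \<beta>" "\<And>n. 0 \<le> u n" "\<And>n. 0 \<le> v n"
    and uv: "u \<in> O(rate)" "v \<in> O(rate)"
  shows "(\<lambda>n. enn2real (x n)) \<in> O(rate)"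
proof -
  have "(\<lambda>n. \<alpha> * u n + \<beta> * v n) \<in> O(rate)"
    using uv by (intro sum_in_bigo) (cases "\<alpha> = 0"; cases "\<beta> = 0"; simp)+
  moreover have "(\<lambda>n. enn2real (x n)) \<in> O(\<lambda>n. \<alpha> * u n + \<beta> * v n)"
  proof (rule bigoI[of _ 1], rule eventually_mono[OF bound])
    fix n assume "x n \<le> ennreal (\<alpha> * u n + \<beta> * v n)"
    hence "enn2real (x n) \<le> \<alpha> * u n + \<beta> * v n"
      using nonneg by (intro enn2real_leI) auto
    thus "norm (enn2real (x n)) \<le> 1 * norm (\<alpha> * u n + \<beta> * v n)" by simp
  qed
  ultimately show ?thesis using landau_o.big_trans by blast
qed

theorem corollary4p3:
  fixes M :: "'a measure"
    and \<mu>0 :: "real measure" and p0 :: "real \<Rightarrow> real"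
    and t \<gamma> a r L CK :: real
    and d :: "nat \<Rightarrow> nat \<Rightarrow> 'a \<Rightarrow> real"
    and B B' :: "nat \<Rightarrow> nat \<Rightarrow> nat \<Rightarrow> real \<Rightarrow> 'a \<Rightarrow> real"
    and H :: "nat \<Rightarrow> real \<Rightarrow> 'a \<Rightarrow> complex mat"
    and X :: "nat \<Rightarrow> 'a \<Rightarrow> complex mat"
    and K :: "real \<Rightarrow> real" and Ks :: "real \<Rightarrow> complex"
    and k :: nat and bs ds :: "nat \<Rightarrow> real"
    and h :: "nat \<Rightarrow> real"
    and risk :: "nat \<Rightarrow> ennreal"
  assumes M: "prob_space M"
    and t: "t > 0" and \<gamma>: "\<gamma> > 2 * sqrt t"
    and \<mu>0: "prob_space \<mu>0" "\<mu>0 = density lborel (\<lambda>x. ennreal (p0 x))"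
    and d_rv: "\<And>n j. n \<ge> 1 \<Longrightarrow> j < n \<Longrightarrow> d n j \<in> borel_measurable M"
    and d_law: "\<And>n j. n \<ge> 1 \<Longrightarrow> j < n \<Longrightarrow> distr M borel (d n j) = \<mu>0"
    and d_indep: "\<And>n. n \<ge> 1 \<Longrightarrow> prob_space.indep_vars M (\<lambda>_. borel) (d n) {..<n}"
    and B: "\<And>n. n \<ge> 1 \<Longrightarrow> prob_space.hermitian_bm_entries M n (B n) (B' n)"
    and H: "\<And>n. n \<ge> 1 \<Longrightarrow> H n = hermitian_process n (B n) (B' n)"
    and H_indep: "\<And>n. n \<ge> 1 \<Longrightarrow>
          prob_space.indep_matrix_process M n (initial_matrix n (d n)) (H n)"
    and X: "\<And>n \<omega>. n \<ge> 1 \<Longrightarrow> X n \<omega> = initial_matrix n (d n) \<omega> + H n t \<omega>"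
    and K: "has_L2_fourier K Ks"
    and K_bounded: "CK > 0" "\<And>\<xi>. cmod (Ks \<xi>) \<le> CK"
    and K_support: "\<And>\<xi>. \<bar>\<xi>\<bar> > 1 \<Longrightarrow> Ks \<xi> = 0"
    and K_flat: "\<And>\<xi>. \<bar>\<xi>\<bar> \<le> 1 \<Longrightarrow> Ks \<xi> = 1"
    and tail: "\<exists>C>0. \<forall>\<^sub>F \<kappa> in at_top. measure \<mu>0 {\<kappa><..} \<le> C / \<kappa>"
    and params: "a > 0" "r > 0" "L > 0"
    and smooth: "p0 \<in> supersmooth_densities a r L"
    and k: "r \<noteq> 1 \<Longrightarrow> real k / real (k + 1) < min r (1 / r) \<and>
                      min r (1 / r) \<le> real (k + 1) / real (k + 2)"
    and bs: "triangular_system (2 * a / (2 * \<gamma>) powr r) r bs"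
    and ds: "triangular_system (2 * \<gamma> / (2 * a) powr (1 / r)) (1 / r) ds"
    and h_pos: "\<forall>\<^sub>F n in sequentially. h n > 0"
    and h_eq: "r = 1 \<Longrightarrow> \<forall>\<^sub>F n in sequentially. h n = 2 * (a + \<gamma>) / ln (real n)"
    and h_lt: "r < 1 \<Longrightarrow> \<forall>\<^sub>F n in sequentially. h n = 2 * \<gamma> / expansion_lt1 r k bs n"
    and h_gt: "r > 1 \<Longrightarrow> \<forall>\<^sub>F n in sequentially. h n powr r = 2 * a / expansion_gt1 r k ds n"
    and risk: "\<And>n. risk n = (\<integral>\<^sup>+\<omega>. L2_dist_sq (estimator t \<gamma> Ks (h n) (X n \<omega>)) p0 \<partial>M)"
  shows "(\<lambda>n. exp (2 * \<gamma> / h n + 2 * a / h n powr r) * h n powr (r - 1)) \<in> O(\<lambda>n. real n) \<and>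
    (\<forall>\<^sub>F n in sequentially. risk n < \<infinity>) \<and>
    (r = 1 \<longrightarrow> (\<lambda>n. enn2real (risk n)) \<in> O(\<lambda>n. real n powr (- (a / (a + \<gamma>))))) \<and>
    (r < 1 \<longrightarrow> (\<lambda>n. enn2real (risk n)) \<in>
       O(\<lambda>n. exp (- (2 * a / (2 * \<gamma>) powr r * expansion_lt1 r k bs n powr r)))) \<and>
    (r > 1 \<longrightarrow> (\<lambda>n. enn2real (risk n)) \<in>
       O(\<lambda>n. 1 / real n * exp (2 * \<gamma> / (2 * a) powr (1 / r) * expansion_gt1 r k ds n powr (1 / r))))"
proof -
  interpret prob_space M by (rule M)
  have \<gamma>0: "0 < \<gamma>" using t \<gamma> real_sqrt_gt_zero[OF t] by linarith
  note P = supersmooth_densitiesD[OF smooth]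
  define v where "v = pi / \<gamma>"
  have v0: "0 \<le> v" using \<gamma>0 by (simp add: v_def)
  define \<beta> where "\<beta> = (2 * (t / (1 - 4 * t / \<gamma>\<^sup>2))\<^sup>2 * deviation_const t \<gamma> + 2 * t\<^sup>2 * v) / (pi * t)\<^sup>2"
  define \<alpha> where "\<alpha> = L / (2 * pi)"
  have Ks: "\<And>\<xi>. \<bar>\<xi>\<bar> \<le> 1 \<Longrightarrow> Ks \<xi> = 1" "\<And>\<xi>. 1 < \<bar>\<xi>\<bar> \<Longrightarrow> Ks \<xi> = 0"
    using K_flat K_support by auto
  have risk_le: "risk n \<le> ennreal (\<alpha> * exp (- (2 * a / h n powr r)) + \<beta> * (exp (2 * \<gamma> / h n) / real n))"
    if n: "1 \<le> n" and hn: "0 < h n" for n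
  proof -
    interpret deformed_ensemble M n "\<lambda>k \<omega>. order_statistic n (\<lambda>j. d n j \<omega>) k" "B n" "B' n"
    proof
      show "1 \<le> n" by (rule n)
      show "hermitian_bm_entries n (B n) (B' n)" by (rule B[OF n])
      show "indep_matrix_process n (\<lambda>\<omega>. mat_diag n (\<lambda>k. complex_of_real (order_statistic n (\<lambda>j. d n j \<omega>) k))) (hermitian_process n (B n) (B' n))"
        using H_indep[OF n] unfolding H[OF n] initial_matrix_def[abs_def] .
    qed
    have init: "(\<integral>\<^sup>+x. (\<integral>\<^sup>+\<omega>. ennreal ((cmod (initial_stieltjes (Complex x \<gamma>) \<omega> - cauchy_transform p0 (Complex x \<gamma>)))\<^sup>2) \<partial>M) \<partial>lborel)
       \<le> ennreal (v / real n)"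
      unfolding initial_stieltjes_def stieltjes_order_statistic v_def
      by (rule sample_stieltjes_mean_square_integral[OF n d_rv[OF n] d_law[OF n, unfolded \<mu>0(2)] d_indep[OF n] P(1,2,4,5) \<gamma>0])
    have X': "X n \<omega> = mat_diag n (\<lambda>k. complex_of_real (order_statistic n (\<lambda>j. d n j \<omega>) k)) + hermitian_process n (B n) (B' n) t \<omega>" for \<omega>
      unfolding X[OF n] H[OF n] initial_matrix_def ..
    show ?thesis unfolding risk \<alpha>_def \<beta>_def
      by (rule expected_risk_bound[where X = "X n" and Ks = Ks, OF t \<gamma> params(1,2) smooth hn Ks X' init v0 less_imp_le[OF params(3)]])
  qed
  have bound: "\<forall>\<^sub>F n in sequentially. risk n \<le> ennreal (\<alpha> * exp (- (2 * a / h n powr r)) + \<beta> * (exp (2 * \<gamma> / h n) / real n))"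
    using h_pos eventually_ge_at_top[of "1::nat"] by eventually_elim (rule risk_le)
  have \<alpha>0: "0 \<le> \<alpha>" using params by (simp add: \<alpha>_def)
  have \<beta>0: "0 \<le> \<beta>" using t \<gamma>0 v0 by (simp add: \<beta>_def deviation_const_def)
  have fin: "\<forall>\<^sub>F n in sequentially. risk n < \<infinity>"
    using bound by eventually_elim (simp add: order_le_less_trans)
  have bigo: "(\<lambda>n. enn2real (risk n)) \<in> O(rate)"
    if "(\<lambda>n. exp (- (2 * a / h n powr r))) \<in> O(rate)" "(\<lambda>n. exp (2 * \<gamma> / h n) / real n) \<in> O(rate)" for rate
    by (rule enn2real_bigo[OF bound \<alpha>0 \<beta>0 _ _ that]) auto
  consider "r = 1" | "r < 1" | "1 < r" by linarith
  thus ?thesis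
  proof cases
    case 1
    note R = rates_r_eq_1[OF params(1) \<gamma>0 h_eq[OF 1]]
    show ?thesis using R(1) fin bigo[of "\<lambda>n. real n powr (- (a / (a + \<gamma>)))"] R(2,3) unfolding 1 by simp
  next
    case 2
    have k': "r \<le> real (k + 1) / real (k + 2)"
    proof -
      have "1 \<le> 1 / r" using 2 params(2) by simp
      hence "min r (1 / r) = r" using 2 by (intro min_absorb1) linarith
      thus ?thesis using k 2 by simp
    qed
    note R = rates_r_less_1[OF params(1) \<gamma>0 params(2) 2 k' bs h_lt[OF 2]]
    show ?thesis using R(1) fin bigo[OF R(2,3)] 2 by simp
  next
    case 3
    have k': "1 / r \<le> real (k + 1) / real (k + 2)"
    proof -
      have "1 / r \<le> 1" using 3 by simp
      hence "1 / r \<le> r" using 3 by linarith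
      hence "min r (1 / r) = 1 / r" by (rule min_absorb2)
      thus ?thesis using k 3 by simp
    qed
    note R = rates_r_greater_1[OF params(1) \<gamma>0 3 k' ds h_pos h_gt[OF 3]]
    show ?thesis using R(1) fin bigo[OF R(2,3)] 3 by simp
  qed
qed

end
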